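(* Let $Y=Y_V$ be an ICCSS$(p,q)$ process with $p>q>0$ and $\Sigma_L>0$. Let $a,b\in V=\{1,\dots,k\}$ with $a\ne b$. Then the following characterisations hold: (a) $Y_a$ is Granger non-causal for $Y_b$ with respect to $Y_V$ if and only if $$e_b^\top\mathbf C\mathbf A^\alpha\Big(\mathbf E+\sum_{j=1}^{p-q}\mathbf E_{q+j}\mathsf E^\top\mathbf\Lambda^j\Big)\mathbf\Lambda^\beta\mathbf\Theta e_a=0\quad\text{and}\quad e_b^\top\mathbf C\mathbf A^\alpha\Big(\sum_{j=m+1}^{p-q}\mathbf E_{q+j}\mathsf E^\top\mathbf\Lambda^{j-1-m}\Big)\mathbf\Theta e_a=0$$ for $\alpha=0,\dots,kp-1$, $\beta=0,\dots,kq-1$, $m=0,\dots,p-q-1$. (b) $Y_a$ is locally Granger non-causal for $Y_b$ with respect to $Y_V$ if and only if $$e_b^\top\mathsf C\mathbf A\Big(\mathbf E+\sum_{j=1}^{p-q}\mathbf E_{q+j}\mathsf E^\top\mathbf\Lambda^j\Big)\mathbf\Lambda^\beta\mathbf\Theta e_a=0\quad\text{and}\quad e_b^\top\mathsf C\mathbf A\Big(\sum_{j=m+1}^{p-q}\mathbf E_{q+j}\mathsf E^\top\mathbf\Lambda^{j-1-m}\Big)\mathbf\Theta e_a=0$$ for $\beta=0,\dots,kq-1$, $m=0,\dots,p-q-1$.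
   Context: Setting. Let $k\ge1$ and let $p>q>0$ be integers. $L=(L(t))_{t\in\mathbb R}$ is a two-sided $\mathbb R^k$-valued Lévy process with $\mathbb E L(1)=0$, $\mathbb E\|L(1)\|^2<\infty$, $\Sigma_L=\mathbb E[L(1)L(1)^\top]$; $\Sigma_L>0$ means positive definite. Let $P(z)=I_kz^p+A_1z^{p-1}+\dots+A_p$ and $Q(z)=C_0+C_1z+\dots+C_qz^q$ with $A_i,C_j\in M_k(\mathbb R)$ be right coprime (the stacked $2k\times k$ matrix $\begin{pmatrix} P(z) \\ Q(z) \end{pmatrix}$ has rank $k$ for all $z\in\mathbb C$), with $\operatorname{rank}(C_q)=k$ and such that all zeros of $\det P(z)$ and of $\det Q(z)$ have strictly negative real part. Put $$\mathbf A=\begin{pmatrix} 0_k & I_k & 0_k & \cdots & 0_k \\ \vdots & & \ddots & \ddots & \vdots \\ 0_k & \cdots & \cdots & 0_k & I_k \\ -A_p & -A_{p-1} & \cdots & \cdots & -A_1 \end{pmatrix}\in M_{kp}(\mathbb R),\quad \mathbf B=\begin{pmatrix} 0_k \\ \vdots \\ 0_k \\ I_k \end{pmatrix}\in M_{kp\times k}(\mathbb R),\quad \mathbf C=(C_0,\dots,C_q,0_k,\dots,0_k)\in M_{k\times kp}(\mathbb R).$$ The stationary process $Y(t)=\mathbf CX(t)$ with $X(t)=\int_{-\infty}^te^{\mathbf A(t-u)}\mathbf B\,dL(u)$, $t\in\mathbb R$, is the ICCSS$(p,q)$ process. Matrices: $\mathsf C=(0_k,\dots,0_k,C_0,\dots,C_q)\in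 M_{k\times kp}(\mathbb R)$; $$\mathbf\Lambda=\begin{pmatrix} 0_k & I_k & 0_k & \cdots & 0_k \\ \vdots & & \ddots & \ddots & \vdots \\ 0_k & \cdots & \cdots & 0_k & I_k \\ -C_q^{-1}C_0 & -C_q^{-1}C_1 & \cdots & \cdots & -C_q^{-1}C_{q-1} \end{pmatrix}\in M_{kq}(\mathbb R),\qquad \mathbf\Theta=\begin{pmatrix} 0_k \\ \vdots \\ 0_k \\ C_q^{-1} \end{pmatrix}\in M_{kq\times k}(\mathbb R);$$ $\mathbf E_j\in M_{kp\times k}(\mathbb R)$ ($j=1,\dots,p$) is the block column whose $j$-th $k\times k$ block is $I_k$ and whose other blocks are $0_k$; $\mathbf E^\top=(I_{kq},0_{kq\times k(p-q)})\in M_{kq\times kp}(\mathbb R)$; $\mathsf E^\top=(0_{k\times k(q-1)},I_k)\in M_{k\times kq}(\mathbb R)$. $e_a\in\mathbb R^k$ is the $a$-th unit vector. For $S\subseteq V$, $\mathcal L_{Y_S}(t)$ is the closure in $L^2$ of the set of finite complex linear combinations of $Y_s(r)$, $s\in S$, $r\le t$; $P_{\mathcal L}$ is the orthogonal projection in $L^2$ onto $\mathcal L$. $Y_a$ is Granger non-causal for $Y_b$ with respect to $Y_V$ if $P_{\mathcal L_{Y_V}(t)}Y_b(t+h)=P_{\mathcal L_{Y_{V\setminus\{a\}}}(t)}Y_b(t+h)$ $\mathbb P$-a.s. for all $t\in\mathbb R$, $0\le h\le1$. With $j_b$ such that $Y_b$ is $j_b$ times but not $j_b+1$ times mean-square differentiable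 (for an ICCSS$(p,q)$ process with $\Sigma_L>0$, $j_b=p-q-1$) and $D^{(j_b)}$ the mean-square derivative of order $j_b$, $Y_a$ is locally Granger non-causal for $Y_b$ with respect to $Y_V$ if for all $t\in\mathbb R$ the mean-square limits as $h\downarrow0$ of $P_{\mathcal L_{Y_V}(t)}\big(\tfrac{D^{(j_b)}Y_b(t+h)-D^{(j_b)}Y_b(t)}h\big)$ and $P_{\mathcal L_{Y_{V\setminus\{a\}}}(t)}\big(\tfrac{D^{(j_b)}Y_b(t+h)-D^{(j_b)}Y_b(t)}h\big)$ coincide $\mathbb P$-a.s. *)

theory Defs
  imports
    "HOL-Probability.Probability"
    "Jordan_Normal_Form.Matrix"
    "Jordan_Normal_Form.Determinant"
    "Jordan_Normal_Form.Gauss_Jordan_Elimination"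
    "Jordan_Normal_Form.DL_Rank"
begin

no_notation inner (infix \<open>\<bullet>\<close> 70)
no_notation vec_nth (infixl \<open>$\<close> 90)
hide_const (open) Finite_Cartesian_Product.mat Finite_Cartesian_Product.vec Determinants.det
  Cartesian_Space.rank
hide_type (open) Finite_Cartesian_Product.vec

text \<open>
  The dimension k and the orders p, q are natural numbers, so vectors and matrices are those of
  \<^theory>\<open>Jordan_Normal_Form.Matrix\<close>. Their entries are indexed from 0; in particular the index set
  V of the component processes is \<open>{..<k}\<close>.
\<close>

text \<open>
  \<open>block_mat k m n f\<close> consists of m times n blocks of size k; its block in position (r, c), counted
  from 1 to m and from 1 to n as usual, is \<open>f r c\<close>.
\<close>

definition block_mat :: "nat \<Rightarrow> nat \<Rightarrow> nat \<Rightarrow> (nat \<Rightarrow> nat \<Rightarrow> real mat) \<Rightarrow> real mat" where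
  "block_mat k m n f =
     mat (k * m) (k * n) (\<lambda>(i, j). f (i div k + 1) (j div k + 1) $$ (i mod k, j mod k))"

definition msum :: "nat \<Rightarrow> nat \<Rightarrow> ('i \<Rightarrow> 'a::comm_monoid_add mat) \<Rightarrow> 'i set \<Rightarrow> 'a mat" where
  "msum nr nc f S = mat nr nc (\<lambda>ij. \<Sum>s\<in>S. f s $$ ij)"

definition mat_exp :: "real mat \<Rightarrow> real mat" where
  "mat_exp A = mat (dim_row A) (dim_row A) (\<lambda>ij. \<Sum>n. (A ^\<^sub>m n) $$ ij / fact n)"

text \<open>This is the inverse if the matrix is invertible and unspecified otherwise.\<close>

definition mat_inv :: "real mat \<Rightarrow> real mat" where
  "mat_inv A = the (mat_inverse A)"

definition pos_def_mat :: "nat \<Rightarrow> real mat \<Rightarrow> bool" where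
  "pos_def_mat n S \<longleftrightarrow> S \<in> carrier_mat n n \<and> S\<^sup>T = S \<and>
     (\<forall>v\<in>carrier_vec n. v \<noteq> 0\<^sub>v n \<longrightarrow> v \<bullet> (S *\<^sub>v v) > 0)"

definition AR_poly :: "nat \<Rightarrow> nat \<Rightarrow> (nat \<Rightarrow> real mat) \<Rightarrow> complex \<Rightarrow> complex mat" where
  "AR_poly k p A z = z ^ p \<cdot>\<^sub>m 1\<^sub>m k +
     msum k k (\<lambda>i. z ^ (p - i) \<cdot>\<^sub>m map_mat complex_of_real (A i)) {1..p}"

definition MA_poly :: "nat \<Rightarrow> nat \<Rightarrow> (nat \<Rightarrow> real mat) \<Rightarrow> complex \<Rightarrow> complex mat" where
  "MA_poly k q C z = msum k k (\<lambda>j. z ^ j \<cdot>\<^sub>m map_mat complex_of_real (C j)) {0..q}"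

text \<open>
  The prefixes bf and sf distinguish the bold from the sans-serif letters: \<open>bfC = (C 0, \<dots>, C q, 0, \<dots>, 0)\<close>
  but \<open>sfC = (0, \<dots>, 0, C 0, \<dots>, C q)\<close>.
\<close>

definition bfA :: "nat \<Rightarrow> nat \<Rightarrow> (nat \<Rightarrow> real mat) \<Rightarrow> real mat" where
  "bfA k p A = block_mat k p p (\<lambda>r c.
     if r = p then - A (p + 1 - c) else if c = r + 1 then 1\<^sub>m k else 0\<^sub>m k k)"

definition bfB :: "nat \<Rightarrow> nat \<Rightarrow> real mat" where
  "bfB k p = block_mat k p 1 (\<lambda>r c. if r = p then 1\<^sub>m k else 0\<^sub>m k k)"

definition bfC :: "nat \<Rightarrow> nat \<Rightarrow> nat \<Rightarrow> (nat \<Rightarrow> real mat) \<Rightarrow> real mat" where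
  "bfC k p q C = block_mat k 1 p (\<lambda>r c. if c \<le> q + 1 then C (c - 1) else 0\<^sub>m k k)"

definition sfC :: "nat \<Rightarrow> nat \<Rightarrow> nat \<Rightarrow> (nat \<Rightarrow> real mat) \<Rightarrow> real mat" where
  "sfC k p q C = block_mat k 1 p (\<lambda>r c. if c \<ge> p - q then C (c - (p - q)) else 0\<^sub>m k k)"

definition bfLambda :: "nat \<Rightarrow> nat \<Rightarrow> (nat \<Rightarrow> real mat) \<Rightarrow> real mat" where
  "bfLambda k q C = block_mat k q q (\<lambda>r c.
     if r = q then - (mat_inv (C q) * C (c - 1)) else if c = r + 1 then 1\<^sub>m k else 0\<^sub>m k k)"

definition bfTheta :: "nat \<Rightarrow> nat \<Rightarrow> (nat \<Rightarrow> real mat) \<Rightarrow> real mat" where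
  "bfTheta k q C = block_mat k q 1 (\<lambda>r c. if r = q then mat_inv (C q) else 0\<^sub>m k k)"

definition bfE_col :: "nat \<Rightarrow> nat \<Rightarrow> nat \<Rightarrow> real mat" where
  "bfE_col k p j = block_mat k p 1 (\<lambda>r c. if r = j then 1\<^sub>m k else 0\<^sub>m k k)"

definition bfE :: "nat \<Rightarrow> nat \<Rightarrow> nat \<Rightarrow> real mat" where
  "bfE k p q = (block_mat k q p (\<lambda>r c. if c = r then 1\<^sub>m k else 0\<^sub>m k k))\<^sup>T"

definition sfE_T :: "nat \<Rightarrow> nat \<Rightarrow> real mat" where
  "sfE_T k q = block_mat k 1 q (\<lambda>r c. if c = q then 1\<^sub>m k else 0\<^sub>m k k)"

definition square_integrable ::
  "'w measure \<Rightarrow> ('w \<Rightarrow> 'b::{real_normed_vector, second_countable_topology}) \<Rightarrow> bool" where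
  "square_integrable M Z \<longleftrightarrow>
     Z \<in> borel_measurable M \<and> integrable M (\<lambda>\<omega>. (norm (Z \<omega>))\<^sup>2)"

definition L2_tendsto ::
  "'w measure \<Rightarrow> ('i \<Rightarrow> 'w \<Rightarrow> 'b::{real_normed_vector, second_countable_topology}) \<Rightarrow>
     ('w \<Rightarrow> 'b) \<Rightarrow> 'i filter \<Rightarrow> bool" where
  "L2_tendsto M X Z F \<longleftrightarrow> square_integrable M Z \<and> (\<forall>\<^sub>F h in F. square_integrable M (X h)) \<and>
     ((\<lambda>h. \<integral>\<omega>. (norm (X h \<omega> - Z \<omega>))\<^sup>2 \<partial>M) \<longlongrightarrow> 0) F"

definition L2_closure :: "'w measure \<Rightarrow> ('w \<Rightarrow> complex) set \<Rightarrow> ('w \<Rightarrow> complex) set" where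
  "L2_closure M D = {Z. square_integrable M Z \<and>
     (\<forall>e>0. \<exists>W\<in>D. square_integrable M W \<and> (\<integral>\<omega>. (cmod (Z \<omega> - W \<omega>))\<^sup>2 \<partial>M) < e)}"

text \<open>
  A version of the orthogonal projection of Z onto the closed subspace S; it is determined only
  almost everywhere, and statements about it are to be read modulo null sets.
\<close>

definition L2_proj ::
  "'w measure \<Rightarrow> ('w \<Rightarrow> complex) set \<Rightarrow> ('w \<Rightarrow> complex) \<Rightarrow> 'w \<Rightarrow> complex" where
  "L2_proj M S Z = (SOME W. W \<in> S \<and> (\<forall>U\<in>S. (\<integral>\<omega>. (Z \<omega> - W \<omega>) * cnj (U \<omega>) \<partial>M) = 0))"

text \<open>The increment over (s, t], as a random element of the product space \<open>\<real>\<^sup>k\<close>.\<close>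

definition incr :: "nat \<Rightarrow> (real \<Rightarrow> 'w \<Rightarrow> real vec) \<Rightarrow> real \<Rightarrow> real \<Rightarrow> 'w \<Rightarrow> nat \<Rightarrow> real" where
  "incr k L s t \<omega> = (\<lambda>i\<in>{..<k}. L t \<omega> $ i - L s \<omega> $ i)"

definition rand_vec :: "'w measure \<Rightarrow> nat \<Rightarrow> ('w \<Rightarrow> real vec) \<Rightarrow> bool" where
  "rand_vec M n Z \<longleftrightarrow> (\<forall>\<omega>\<in>space M. Z \<omega> \<in> carrier_vec n) \<and>
     (\<forall>i<n. (\<lambda>\<omega>. Z \<omega> $ i) \<in> borel_measurable M)"

text \<open>Continuity in probability is required, but no path regularity such as right continuity.\<close>

definition two_sided_levy :: "'w measure \<Rightarrow> nat \<Rightarrow> (real \<Rightarrow> 'w \<Rightarrow> real vec) \<Rightarrow> bool" where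
  "two_sided_levy M k L \<longleftrightarrow>
     prob_space M \<and>
     (\<forall>t. rand_vec M k (L t)) \<and>
     (AE \<omega> in M. L 0 \<omega> = 0\<^sub>v k) \<and>
     (\<forall>n ts. strict_mono_on {..n} ts \<longrightarrow>
        prob_space.indep_vars M (\<lambda>_. PiM {..<k} (\<lambda>_. borel))
          (\<lambda>m. incr k L (ts m) (ts (Suc m))) {..<n}) \<and>
     (\<forall>s t h. s \<le> t \<longrightarrow>
        distr M (PiM {..<k} (\<lambda>_. borel)) (incr k L (s + h) (t + h)) =
        distr M (PiM {..<k} (\<lambda>_. borel)) (incr k L s t)) \<and>
     (\<forall>t. \<forall>e>0.
        ((\<lambda>s. measure M {\<omega>\<in>space M. sqrt ((L s \<omega> - L t \<omega>) \<bullet> (L s \<omega> - L t \<omega>)) > e}) \<longlongrightarrow> 0) (at t))"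

definition levy_cov :: "'w measure \<Rightarrow> nat \<Rightarrow> (real \<Rightarrow> 'w \<Rightarrow> real vec) \<Rightarrow> real mat" where
  "levy_cov M k L = mat k k (\<lambda>(i, j). \<integral>\<omega>. L 1 \<omega> $ i * L 1 \<omega> $ j \<partial>M)"

text \<open>
  \<open>has_levy_integral M L j f I\<close> says that I is (a version of) the integral of f over the real line
  with respect to the j-th component of L, that is, the mean-square limit of the elementary
  integrals of step functions which approximate f in \<open>L\<^sup>2(\<real>)\<close>.
\<close>

definition step_fun :: "nat \<Rightarrow> (nat \<Rightarrow> real) \<Rightarrow> (nat \<Rightarrow> real) \<Rightarrow> real \<Rightarrow> real" where
  "step_fun n c ts u = (\<Sum>m<n. c m * indicator {ts m<..ts (Suc m)} u)"

definition step_integral ::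
  "(real \<Rightarrow> 'w \<Rightarrow> real vec) \<Rightarrow> nat \<Rightarrow> nat \<Rightarrow> (nat \<Rightarrow> real) \<Rightarrow> (nat \<Rightarrow> real) \<Rightarrow> 'w \<Rightarrow> real" where
  "step_integral L j n c ts \<omega> = (\<Sum>m<n. c m * (L (ts (Suc m)) \<omega> $ j - L (ts m) \<omega> $ j))"

definition has_levy_integral ::
  "'w measure \<Rightarrow> (real \<Rightarrow> 'w \<Rightarrow> real vec) \<Rightarrow> nat \<Rightarrow> (real \<Rightarrow> real) \<Rightarrow> ('w \<Rightarrow> real) \<Rightarrow> bool" where
  "has_levy_integral M L j f I \<longleftrightarrow>
     (\<exists>n c ts. (\<forall>l. mono (ts l)) \<and>
        L2_tendsto lborel (\<lambda>l. step_fun (n l) (c l) (ts l)) f sequentially \<and>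
        L2_tendsto M (\<lambda>l. step_integral L j (n l) (c l) (ts l)) I sequentially)"

text \<open>
  \<open>X t\<close> is a version of the integral of \<open>exp ((t - u) A) B\<close> over \<open>u \<le> t\<close> with respect to L;
  the i-th entry of this vector is the sum over j of the scalar integrals of the kernel entries (i, j)
  with respect to the j-th component of L.
\<close>

definition state_process ::
  "'w measure \<Rightarrow> nat \<Rightarrow> nat \<Rightarrow> (nat \<Rightarrow> real mat) \<Rightarrow> (real \<Rightarrow> 'w \<Rightarrow> real vec) \<Rightarrow>
     (real \<Rightarrow> 'w \<Rightarrow> real vec) \<Rightarrow> bool" where
  "state_process M k p A L X \<longleftrightarrow> (\<forall>t. rand_vec M (k * p) (X t) \<and>
     (\<forall>i<k * p. \<exists>I.
        (\<forall>j<k. has_levy_integral M L j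
           (\<lambda>u. indicator {..t} u * (mat_exp ((t - u) \<cdot>\<^sub>m bfA k p A) * bfB k p) $$ (i, j)) (I j)) \<and>
        (AE \<omega> in M. X t \<omega> $ i = (\<Sum>j<k. I j \<omega>))))"

definition ICCSS ::
  "'w measure \<Rightarrow> nat \<Rightarrow> nat \<Rightarrow> nat \<Rightarrow> (nat \<Rightarrow> real mat) \<Rightarrow> (nat \<Rightarrow> real mat) \<Rightarrow>
     (real \<Rightarrow> 'w \<Rightarrow> real vec) \<Rightarrow> (real \<Rightarrow> 'w \<Rightarrow> real vec) \<Rightarrow> bool" where
  "ICCSS M k p q A C L Y \<longleftrightarrow>
     two_sided_levy M k L \<and>
     integrable M (\<lambda>\<omega>. L 1 \<omega> \<bullet> L 1 \<omega>) \<and>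
     (\<forall>i<k. (\<integral>\<omega>. L 1 \<omega> $ i \<partial>M) = 0) \<and>
     (\<forall>i\<in>{1..p}. A i \<in> carrier_mat k k) \<and>
     (\<forall>j\<in>{0..q}. C j \<in> carrier_mat k k) \<and>
     (\<forall>z. vec_space.rank (2 * k) (AR_poly k p A z @\<^sub>r MA_poly k q C z) = k) \<and>
     vec_space.rank k (C q) = k \<and>
     (\<forall>z. det (AR_poly k p A z) = 0 \<longrightarrow> Re z < 0) \<and>
     (\<forall>z. det (MA_poly k q C z) = 0 \<longrightarrow> Re z < 0) \<and>
     (\<exists>X. state_process M k p A L X \<and>
        (\<forall>t. \<forall>\<omega>\<in>space M. Y t \<omega> = bfC k p q C *\<^sub>v X t \<omega>))"

definition component :: "(real \<Rightarrow> 'w \<Rightarrow> real vec) \<Rightarrow> nat \<Rightarrow> real \<Rightarrow> 'w \<Rightarrow> complex" where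
  "component Y s t \<omega> = complex_of_real (Y t \<omega> $ s)"

definition lin_past ::
  "'w measure \<Rightarrow> (real \<Rightarrow> 'w \<Rightarrow> real vec) \<Rightarrow> nat set \<Rightarrow> real \<Rightarrow> ('w \<Rightarrow> complex) set" where
  "lin_past M Y S t = L2_closure M
     {\<lambda>\<omega>. \<Sum>(s, r)\<in>F. c (s, r) * component Y s r \<omega> | F c. finite F \<and> F \<subseteq> S \<times> {..t}}"

definition granger_noncausal ::
  "'w measure \<Rightarrow> (real \<Rightarrow> 'w \<Rightarrow> real vec) \<Rightarrow> nat set \<Rightarrow> nat \<Rightarrow> nat \<Rightarrow> bool" where
  "granger_noncausal M Y V a b \<longleftrightarrow> (\<forall>t h. 0 \<le> h \<and> h \<le> 1 \<longrightarrow>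
     (AE \<omega> in M. L2_proj M (lin_past M Y V t) (component Y b (t + h)) \<omega> =
                 L2_proj M (lin_past M Y (V - {a}) t) (component Y b (t + h)) \<omega>))"

definition diff_quot :: "(real \<Rightarrow> 'w \<Rightarrow> complex) \<Rightarrow> real \<Rightarrow> real \<Rightarrow> 'w \<Rightarrow> complex" where
  "diff_quot Z t h \<omega> = (Z (t + h) \<omega> - Z t \<omega>) / complex_of_real h"

text \<open>\<open>ms_deriv M j Z D\<close>: the process D is a j-th mean-square derivative of Z on the real line.\<close>

fun ms_deriv ::
  "'w measure \<Rightarrow> nat \<Rightarrow> (real \<Rightarrow> 'w \<Rightarrow> complex) \<Rightarrow> (real \<Rightarrow> 'w \<Rightarrow> complex) \<Rightarrow> bool" where
  "ms_deriv M 0 Z D \<longleftrightarrow> D = Z"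
| "ms_deriv M (Suc j) Z D \<longleftrightarrow>
     (\<exists>D'. ms_deriv M j Z D' \<and> (\<forall>t. L2_tendsto M (diff_quot D' t) (D t) (at 0)))"

text \<open>
  The order j with the first two properties below is unique, and the derivative D is unique up to
  modification.
\<close>

definition locally_granger_noncausal ::
  "'w measure \<Rightarrow> (real \<Rightarrow> 'w \<Rightarrow> real vec) \<Rightarrow> nat set \<Rightarrow> nat \<Rightarrow> nat \<Rightarrow> bool" where
  "locally_granger_noncausal M Y V a b \<longleftrightarrow> (\<exists>j D.
     ms_deriv M j (component Y b) D \<and>
     (\<nexists>D'. ms_deriv M (Suc j) (component Y b) D') \<and>
     (\<forall>t. \<exists>W W'.
        L2_tendsto M (\<lambda>h. L2_proj M (lin_past M Y V t) (diff_quot D t h)) W (at_right 0) \<and>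
        L2_tendsto M (\<lambda>h. L2_proj M (lin_past M Y (V - {a}) t) (diff_quot D t h)) W' (at_right 0) \<and>
        (AE \<omega> in M. W \<omega> = W' \<omega>)))"

end

theory Submission
  imports Defs "Jordan_Normal_Form.Char_Poly"
begin

text \<open>
  The forecast of \<open>Y\<^sub>b(t + h)\<close> given the full past is the linear form
  \<open>e\<^sub>b \<^bold>C exp (\<^bold>A h) X(t)\<close>, and the limit of the projected difference quotients of the last mean-square derivative
  \<open>e\<^sub>b sfC X\<close> is \<open>e\<^sub>b sfC \<^bold>A X(t)\<close>. So both notions ask when a linear form l X(t) lies in the past of the
  components other than a, and this is decided by duality, in the time domain.

  Sufficiency: if V is orthogonal to that past, then \<open>x(r) = E[X(r) V]\<close>, \<open>r \<le> t\<close>, is a bounded path whose output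
  vanishes except in the component a. Its first q blocks solve the ordinary differential equation of the inverse
  filter \<open>\<^bold>\<Lambda>\<close> driven by that component. The second family of conditions cancels the contribution of the input
  to l x; the first one makes l x together with its derivatives a homogeneous linear system with the spectrum
  of \<open>\<^bold>\<Lambda>\<close>. Since all eigenvalues have negative real part, a solution bounded towards minus infinity is zero.

  Necessity: for large real z the integral U of \<open>\<zeta> exp (z u)\<close> over \<open>u \<le> t\<close>, with \<open>\<zeta>\<close> chosen by means of the
  invertible covariance of L, has \<open>E[X(r) U] = exp (z r) (v, z v, \<dots>)\<close> with \<open>v = Q(z)\<close> inverse applied to \<open>e\<^sub>a\<close>.
  Then U is orthogonal to the past of the components other than a, and the expansion of \<open>l (v, z v, \<dots>) = 0\<close>
  at infinity in powers of z has the two families of conditions as coefficients.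

  The finite ranges of \<open>\<alpha>\<close> and \<open>\<beta>\<close> suffice by the Cayley-Hamilton theorem.
\<close>

section \<open>Mean-square calculus\<close>

text \<open>The state is not observed, so its linear forms have to be located in the past of the
  output. Every linear form of X(t) lies in the past of all components together: this is the
  sufficiency argument taken with a = k, where \<open>unit_vec k k\<close> is the zero vector and
  both families of conditions hold trivially. A reduced past therefore only has to be tested for
  containing one linear form, and the criterion does not depend on t.

  The expansion at infinity is explicit because the first q blocks of (v, z v, ...) are the
  resolvent of \<Lambda> at z applied to \<Theta> \<open>e_a\<close>, and the remaining blocks
  follow by iterating the filter equation.

  About the noise only moments of L(1) are given. That increments are centered, square integrable
  and have covariances proportional to length has to be extracted from independence, stationarity
  and continuity in probability before integrals obey an isometry. The test variables use z above a
  norm of the companion matrix, so that boundary terms vanish towards minus infinity.\<close>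

definition L2_norm :: "'w measure \<Rightarrow> ('w \<Rightarrow> 'b::{real_normed_vector, second_countable_topology}) \<Rightarrow> real" where
  "L2_norm M f = sqrt (\<integral>\<omega>. (norm (f \<omega>))\<^sup>2 \<partial>M)"

lemma L2_norm_nonneg [simp]: "0 \<le> L2_norm M f"
  by (simp add: L2_norm_def)

lemma L2_norm_power2: "(L2_norm M f)\<^sup>2 = (\<integral>\<omega>. (norm (f \<omega>))\<^sup>2 \<partial>M)"
  by (simp add: L2_norm_def)

lemma square_integrableD:
  assumes "square_integrable M f"
  shows "f \<in> borel_measurable M" "integrable M (\<lambda>\<omega>. (norm (f \<omega>))\<^sup>2)"
  using assms by (auto simp: square_integrable_def)

lemma norm_add_power2_le: "(norm (x + y :: 'b::real_normed_vector))\<^sup>2 \<le> 2 * (norm x)\<^sup>2 + 2 * (norm y)\<^sup>2"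
proof -
  have "(norm (x + y))\<^sup>2 \<le> (norm x + norm y)\<^sup>2"
    by (intro power_mono norm_triangle_ineq) auto
  moreover have "0 \<le> (norm x - norm y)\<^sup>2" by simp
  ultimately show ?thesis by (simp add: power2_eq_square algebra_simps)
qed

lemma square_integrable_add:
  assumes "square_integrable M f" "square_integrable M g"
  shows "square_integrable M (\<lambda>\<omega>. f \<omega> + g \<omega>)"
proof -
  note [measurable] = square_integrableD(1)[OF assms(1)] square_integrableD(1)[OF assms(2)]
  have "integrable M (\<lambda>\<omega>. (norm (f \<omega> + g \<omega>))\<^sup>2)"
  proof (rule Bochner_Integration.integrable_bound[where f="\<lambda>\<omega>. 2 * (norm (f \<omega>))\<^sup>2 + 2 * (norm (g \<omega>))\<^sup>2"])
    show "integrable M (\<lambda>\<omega>. 2 * (norm (f \<omega>))\<^sup>2 + 2 * (norm (g \<omega>))\<^sup>2)"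
      using square_integrableD(2)[OF assms(1)] square_integrableD(2)[OF assms(2)] by simp
    show "AE \<omega> in M. norm ((norm (f \<omega> + g \<omega>))\<^sup>2) \<le> norm (2 * (norm (f \<omega>))\<^sup>2 + 2 * (norm (g \<omega>))\<^sup>2)"
      by (intro AE_I2) (use norm_add_power2_le in auto)
  qed measurable
  then show ?thesis by (simp add: square_integrable_def)
qed

lemma square_integrable_mult:
  fixes f :: "'w \<Rightarrow> 'b::{real_normed_field, second_countable_topology}"
  assumes "square_integrable M f"
  shows "square_integrable M (\<lambda>\<omega>. c * f \<omega>)"
  using assms by (simp add: square_integrable_def norm_mult power_mult_distrib borel_measurable_times)

lemma square_integrable_minus:
  "square_integrable M f \<Longrightarrow> square_integrable M (\<lambda>\<omega>. - f \<omega>)"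
  by (simp add: square_integrable_def)

lemma square_integrable_diff:
  assumes "square_integrable M f" "square_integrable M g"
  shows "square_integrable M (\<lambda>\<omega>. f \<omega> - g \<omega>)"
  using square_integrable_add[OF assms(1) square_integrable_minus[OF assms(2)]] by simp

lemma square_integrable_zero [simp]: "square_integrable M (\<lambda>\<omega>. 0)"
  by (simp add: square_integrable_def)

lemma square_integrable_sum:
  "(\<And>i. i \<in> I \<Longrightarrow> square_integrable M (f i)) \<Longrightarrow> square_integrable M (\<lambda>\<omega>. \<Sum>i\<in>I. f i \<omega>)"
  by (induction I rule: infinite_finite_induct) (auto intro: square_integrable_add)

lemma square_integrable_cong_AE:
  assumes "square_integrable M f" "g \<in> borel_measurable M" "AE \<omega> in M. f \<omega> = g \<omega>"
  shows "square_integrable M g"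
  unfolding square_integrable_def
proof (intro conjI)
  have [measurable]: "f \<in> borel_measurable M" "g \<in> borel_measurable M"
    using assms by (auto simp: square_integrable_def)
  have "integrable M (\<lambda>\<omega>. (norm (f \<omega>))\<^sup>2) \<longleftrightarrow> integrable M (\<lambda>\<omega>. (norm (g \<omega>))\<^sup>2)"
    by (rule integrable_cong_AE) (use assms(3) in auto)
  then show "integrable M (\<lambda>\<omega>. (norm (g \<omega>))\<^sup>2)"
    using assms by (simp add: square_integrable_def)
qed (fact assms(2))

lemma square_integrable_of_real:
  "square_integrable M (\<lambda>\<omega>. complex_of_real (f \<omega>)) \<longleftrightarrow> square_integrable M f"
proof -
  have "f \<in> borel_measurable M \<longleftrightarrow> (\<lambda>\<omega>. complex_of_real (f \<omega>)) \<in> borel_measurable M"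
  proof
    assume "(\<lambda>\<omega>. complex_of_real (f \<omega>)) \<in> borel_measurable M"
    from measurable_compose[OF this borel_measurable_Re] show "f \<in> borel_measurable M" by simp
  next
    assume [measurable]: "f \<in> borel_measurable M"
    show "(\<lambda>\<omega>. complex_of_real (f \<omega>)) \<in> borel_measurable M" by measurable
  qed
  then show ?thesis unfolding square_integrable_def norm_of_real by simp
qed

lemma square_integrable_Re_Im:
  assumes "square_integrable M f"
  shows "square_integrable M (\<lambda>\<omega>. Re (f \<omega>))" "square_integrable M (\<lambda>\<omega>. Im (f \<omega>))"
proof -
  note [measurable] = square_integrableD(1)[OF assms]
  have "integrable M (\<lambda>\<omega>. (norm (Re (f \<omega>)))\<^sup>2)"
    by (rule Bochner_Integration.integrable_bound[OF square_integrableD(2)[OF assms]])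
      (measurable, simp add: cmod_power2)
  moreover have "integrable M (\<lambda>\<omega>. (norm (Im (f \<omega>)))\<^sup>2)"
    by (rule Bochner_Integration.integrable_bound[OF square_integrableD(2)[OF assms]])
      (measurable, simp add: cmod_power2)
  ultimately show "square_integrable M (\<lambda>\<omega>. Re (f \<omega>))" "square_integrable M (\<lambda>\<omega>. Im (f \<omega>))"
    unfolding square_integrable_def by simp_all
qed

lemma square_integrable_cnj:
  "square_integrable M f \<Longrightarrow> square_integrable M (\<lambda>\<omega>. cnj (f \<omega>))"
  using measurable_compose[OF _ borel_measurable_continuous_onI[OF continuous_on_cnj[OF continuous_on_id]], of f M]
  by (simp add: square_integrable_def)

lemma integrable_mult_square_integrable:
  fixes f g :: "'w \<Rightarrow> 'b::{real_normed_field, second_countable_topology, banach}"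
  assumes "square_integrable M f" "square_integrable M g"
  shows "integrable M (\<lambda>\<omega>. f \<omega> * g \<omega>)"
proof (rule Bochner_Integration.integrable_bound[where f="\<lambda>\<omega>. (norm (f \<omega>))\<^sup>2 + (norm (g \<omega>))\<^sup>2"])
  note [measurable] = square_integrableD(1)[OF assms(1)] square_integrableD(1)[OF assms(2)]
  show "integrable M (\<lambda>\<omega>. (norm (f \<omega>))\<^sup>2 + (norm (g \<omega>))\<^sup>2)"
    using square_integrableD(2)[OF assms(1)] square_integrableD(2)[OF assms(2)] by simp
  show "(\<lambda>\<omega>. f \<omega> * g \<omega>) \<in> borel_measurable M" by measurable
  have "x * y \<le> x\<^sup>2 + y\<^sup>2" if "x \<ge> 0" "y \<ge> 0" for x y :: real
    using sum_squares_bound[of x y] that mult_nonneg_nonneg[OF that] by linarith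
  then show "AE \<omega> in M. norm (f \<omega> * g \<omega>) \<le> norm ((norm (f \<omega>))\<^sup>2 + (norm (g \<omega>))\<^sup>2)"
    by (auto simp: norm_mult)
qed

lemma square_integrable_norm:
  "square_integrable M f \<Longrightarrow> square_integrable M (\<lambda>\<omega>. norm (f \<omega>))"
  by (auto simp: square_integrable_def)

text \<open>The squared norm of t |f| - |g| is a quadratic polynomial in t that is never negative;
  its discriminant gives the Cauchy-Schwarz inequality for the moduli.\<close>

lemma integral_norm_mult_le:
  fixes f g :: "'w \<Rightarrow> 'b::{real_normed_field, second_countable_topology, banach}"
  assumes "square_integrable M f" "square_integrable M g"
  shows "(\<integral>\<omega>. norm (f \<omega>) * norm (g \<omega>) \<partial>M) \<le> L2_norm M f * L2_norm M g"
proof -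
  define a b c where "a = (\<integral>\<omega>. (norm (f \<omega>))\<^sup>2 \<partial>M)" and "b = (\<integral>\<omega>. norm (f \<omega>) * norm (g \<omega>) \<partial>M)"
    and "c = (\<integral>\<omega>. (norm (g \<omega>))\<^sup>2 \<partial>M)"
  have i: "integrable M (\<lambda>\<omega>. (norm (f \<omega>))\<^sup>2)" "integrable M (\<lambda>\<omega>. (norm (g \<omega>))\<^sup>2)"
    "integrable M (\<lambda>\<omega>. norm (f \<omega>) * norm (g \<omega>))"
    using assms square_integrableD(2)
      integrable_mult_square_integrable[OF square_integrable_norm square_integrable_norm] by auto
  have q: "t\<^sup>2 * a - 2 * t * b + c \<ge> 0" for t
  proof -
    have "0 \<le> (\<integral>\<omega>. (t * norm (f \<omega>) - norm (g \<omega>))\<^sup>2 \<partial>M)" by simp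
    also have "\<dots> = (\<integral>\<omega>. t\<^sup>2 * (norm (f \<omega>))\<^sup>2 - 2 * t * (norm (f \<omega>) * norm (g \<omega>)) + (norm (g \<omega>))\<^sup>2 \<partial>M)"
      by (rule Bochner_Integration.integral_cong) (auto simp: power2_eq_square algebra_simps)
    also have "\<dots> = t\<^sup>2 * a - 2 * t * b + c"
      unfolding a_def b_def c_def using i by simp
    finally show ?thesis .
  qed
  have nn: "a \<ge> 0" "b \<ge> 0" "c \<ge> 0" unfolding a_def b_def c_def by auto
  have "b\<^sup>2 \<le> a * c"
  proof (cases "a = 0")
    case True
    have "b = 0"
    proof (rule ccontr)
      assume "b \<noteq> 0"
      \<comment> \<open>With a = 0 the polynomial is affine in t, and at this t its value is - c -
        2.\<close>
      with q[of "(c + 1) / b"] True nn show False by simp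
    qed
    with True show ?thesis by simp
  next
    case False
    have "0 \<le> a * ((b/a)\<^sup>2 * a - 2 * (b/a) * b + c)"
      using q[of "b/a"] nn by (intro mult_nonneg_nonneg) auto
    also have "\<dots> = a * c - b\<^sup>2" using False by (simp add: field_simps power2_eq_square)
    finally show ?thesis by simp
  qed
  then have "b \<le> sqrt (a * c)" by (rule real_le_rsqrt)
  then show ?thesis by (simp add: L2_norm_def real_sqrt_mult a_def b_def c_def)
qed

lemma L2_Cauchy_Schwarz:
  fixes f g :: "'w \<Rightarrow> 'b::{real_normed_field, second_countable_topology, banach}"
  assumes "square_integrable M f" "square_integrable M g"
  shows "norm (\<integral>\<omega>. f \<omega> * g \<omega> \<partial>M) \<le> L2_norm M f * L2_norm M g"
  using order_trans[OF integral_norm_bound[of M "\<lambda>\<omega>. f \<omega> * g \<omega>"]] integral_norm_mult_le[OF assms]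
  by (simp add: norm_mult)

lemma L2_norm_triangle:
  fixes f g :: "'w \<Rightarrow> 'b::{real_normed_vector, second_countable_topology}"
  assumes "square_integrable M f" "square_integrable M g"
  shows "L2_norm M (\<lambda>\<omega>. f \<omega> + g \<omega>) \<le> L2_norm M f + L2_norm M g"
proof -
  define F G where "F = (\<lambda>\<omega>. norm (f \<omega>))" and "G = (\<lambda>\<omega>. norm (g \<omega>))"
  have si: "square_integrable M F" "square_integrable M G"
    unfolding F_def G_def using assms by (auto intro: square_integrable_norm)
  note i = integrable_mult_square_integrable[OF si(1) si(1)] integrable_mult_square_integrable[OF si(2) si(2)]
    integrable_mult_square_integrable[OF si]
  have "(\<integral>\<omega>. (norm (f \<omega> + g \<omega>))\<^sup>2 \<partial>M) \<le> (\<integral>\<omega>. F \<omega> * F \<omega> + 2 * (F \<omega> * G \<omega>) + G \<omega> * G \<omega> \<partial>M)"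
  proof (rule integral_mono)
    show "integrable M (\<lambda>\<omega>. (norm (f \<omega> + g \<omega>))\<^sup>2)"
      using square_integrable_add[OF assms] by (simp add: square_integrable_def)
    fix \<omega>
    have "(norm (f \<omega> + g \<omega>))\<^sup>2 \<le> (F \<omega> + G \<omega>)\<^sup>2"
      unfolding F_def G_def by (intro power_mono norm_triangle_ineq) auto
    then show "(norm (f \<omega> + g \<omega>))\<^sup>2 \<le> F \<omega> * F \<omega> + 2 * (F \<omega> * G \<omega>) + G \<omega> * G \<omega>"
      by (simp add: power2_eq_square algebra_simps)
  qed (use i in simp)
  also have "\<dots> = (L2_norm M f)\<^sup>2 + 2 * (\<integral>\<omega>. F \<omega> * G \<omega> \<partial>M) + (L2_norm M g)\<^sup>2"
    using i by (simp add: L2_norm_power2 F_def G_def flip: power2_eq_square)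
  also have "\<dots> \<le> (L2_norm M f)\<^sup>2 + 2 * (L2_norm M f * L2_norm M g) + (L2_norm M g)\<^sup>2"
    using integral_norm_mult_le[OF si] by (simp add: F_def G_def L2_norm_def)
  also have "\<dots> = (L2_norm M f + L2_norm M g)\<^sup>2"
    by (simp add: power2_eq_square algebra_simps)
  finally show ?thesis
    unfolding L2_norm_def[of M "\<lambda>\<omega>. f \<omega> + g \<omega>"] by (intro real_le_lsqrt) simp_all
qed

lemma L2_norm_mult:
  fixes f :: "'w \<Rightarrow> 'b::{real_normed_field, second_countable_topology}"
  shows "L2_norm M (\<lambda>\<omega>. c * f \<omega>) = norm c * L2_norm M f"
  by (simp add: L2_norm_def norm_mult power_mult_distrib real_sqrt_mult)

lemma L2_norm_minus_commute: "L2_norm M (\<lambda>\<omega>. f \<omega> - g \<omega>) = L2_norm M (\<lambda>\<omega>. g \<omega> - f \<omega>)"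
  by (simp add: L2_norm_def norm_minus_commute)

lemma L2_norm_triangle_diff:
  assumes "square_integrable M f" "square_integrable M g" "square_integrable M h"
  shows "L2_norm M (\<lambda>\<omega>. f \<omega> - h \<omega>) \<le> L2_norm M (\<lambda>\<omega>. f \<omega> - g \<omega>) + L2_norm M (\<lambda>\<omega>. g \<omega> - h \<omega>)"
  using L2_norm_triangle[OF square_integrable_diff[OF assms(1,2)] square_integrable_diff[OF assms(2,3)]]
  by simp

lemma L2_norm_eq_0D:
  assumes "square_integrable M f" "L2_norm M f = 0"
  shows "AE \<omega> in M. f \<omega> = 0"
proof -
  have "(\<integral>\<omega>. (norm (f \<omega>))\<^sup>2 \<partial>M) = 0" using assms(2) by (simp add: L2_norm_def)
  then have "AE \<omega> in M. (norm (f \<omega>))\<^sup>2 = 0"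
    using integral_nonneg_eq_0_iff_AE[OF square_integrableD(2)[OF assms(1)]] by simp
  then show ?thesis by simp
qed

lemma L2_norm_cong_AE:
  assumes "f \<in> borel_measurable M" "g \<in> borel_measurable M" "AE \<omega> in M. f \<omega> = g \<omega>"
  shows "L2_norm M f = L2_norm M g"
proof -
  note [measurable] = assms(1,2)
  have "(\<integral>\<omega>. (norm (f \<omega>))\<^sup>2 \<partial>M) = (\<integral>\<omega>. (norm (g \<omega>))\<^sup>2 \<partial>M)"
    by (rule integral_cong_AE) (use assms(3) in auto)
  then show ?thesis by (simp add: L2_norm_def)
qed

lemma L2_norm_of_real: "L2_norm M (\<lambda>\<omega>. complex_of_real (f \<omega>)) = L2_norm M f"
  by (simp add: L2_norm_def)

lemma L2_tendsto_iff:
  "L2_tendsto M X Z F \<longleftrightarrow> square_integrable M Z \<and> (\<forall>\<^sub>F h in F. square_integrable M (X h)) \<and>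
     ((\<lambda>h. L2_norm M (\<lambda>\<omega>. X h \<omega> - Z \<omega>)) \<longlongrightarrow> 0) F"
proof -
  have "((\<lambda>h. \<integral>\<omega>. (norm (X h \<omega> - Z \<omega>))\<^sup>2 \<partial>M) \<longlongrightarrow> 0) F \<longleftrightarrow>
    ((\<lambda>h. L2_norm M (\<lambda>\<omega>. X h \<omega> - Z \<omega>)) \<longlongrightarrow> 0) F"
  proof
    assume "((\<lambda>h. \<integral>\<omega>. (norm (X h \<omega> - Z \<omega>))\<^sup>2 \<partial>M) \<longlongrightarrow> 0) F"
    from tendsto_real_sqrt[OF this] show "((\<lambda>h. L2_norm M (\<lambda>\<omega>. X h \<omega> - Z \<omega>)) \<longlongrightarrow> 0) F"
      by (simp add: L2_norm_def)
  next
    assume "((\<lambda>h. L2_norm M (\<lambda>\<omega>. X h \<omega> - Z \<omega>)) \<longlongrightarrow> 0) F"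
    from tendsto_power[OF this, of 2] show "((\<lambda>h. \<integral>\<omega>. (norm (X h \<omega> - Z \<omega>))\<^sup>2 \<partial>M) \<longlongrightarrow> 0) F"
      by (simp add: L2_norm_power2)
  qed
  then show ?thesis by (auto simp: L2_tendsto_def)
qed

text \<open>The approximating families may differ on null sets depending on h, because projections
  and mean-square derivatives are only fixed up to versions.\<close>

lemma L2_tendsto_unique:
  assumes "L2_tendsto M X Z F" "L2_tendsto M X' Z' F" "F \<noteq> bot"
    and "\<forall>\<^sub>F h in F. AE \<omega> in M. X h \<omega> = X' h \<omega>"
  shows "AE \<omega> in M. Z \<omega> = Z' \<omega>"
proof -
  have si: "square_integrable M Z" "square_integrable M Z'"
    using assms by (auto simp: L2_tendsto_iff)
  have "\<forall>\<^sub>F h in F. L2_norm M (\<lambda>\<omega>. Z \<omega> - Z' \<omega>) \<le>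
    L2_norm M (\<lambda>\<omega>. X h \<omega> - Z \<omega>) + L2_norm M (\<lambda>\<omega>. X' h \<omega> - Z' \<omega>)"
    using assms(4) assms(1)[unfolded L2_tendsto_iff, THEN conjunct2, THEN conjunct1]
      assms(2)[unfolded L2_tendsto_iff, THEN conjunct2, THEN conjunct1]
  proof eventually_elim
    case (elim h)
    have "L2_norm M (\<lambda>\<omega>. Z \<omega> - Z' \<omega>) \<le> L2_norm M (\<lambda>\<omega>. Z \<omega> - X h \<omega>) + L2_norm M (\<lambda>\<omega>. X h \<omega> - Z' \<omega>)"
      using L2_norm_triangle_diff[OF si(1) elim(2) si(2)] .
    also have "L2_norm M (\<lambda>\<omega>. X h \<omega> - Z' \<omega>) = L2_norm M (\<lambda>\<omega>. X' h \<omega> - Z' \<omega>)"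
      by (rule L2_norm_cong_AE)
        (use elim square_integrableD(1)[OF square_integrable_diff[OF elim(2) si(2)]]
           square_integrableD(1)[OF square_integrable_diff[OF elim(3) si(2)]] in auto)
    finally show ?case by (simp add: L2_norm_minus_commute)
  qed
  moreover have "((\<lambda>h. L2_norm M (\<lambda>\<omega>. X h \<omega> - Z \<omega>) + L2_norm M (\<lambda>\<omega>. X' h \<omega> - Z' \<omega>)) \<longlongrightarrow> 0 + 0) F"
    using assms by (intro tendsto_add) (auto simp: L2_tendsto_iff)
  ultimately have "L2_norm M (\<lambda>\<omega>. Z \<omega> - Z' \<omega>) \<le> 0 + 0"
    by (intro tendsto_le[OF assms(3) _ tendsto_const]) auto
  then have "L2_norm M (\<lambda>\<omega>. Z \<omega> - Z' \<omega>) = 0" using L2_norm_nonneg[of M "\<lambda>\<omega>. Z \<omega> - Z' \<omega>"] by linarith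
  from L2_norm_eq_0D[OF square_integrable_diff[OF si] this] show ?thesis by simp
qed

lemma tendsto_integral_mult:
  fixes Z V :: "'w \<Rightarrow> 'b::{real_normed_field, second_countable_topology, banach}"
  assumes "L2_tendsto M X Z F" "square_integrable M V"
  shows "((\<lambda>h. \<integral>\<omega>. X h \<omega> * V \<omega> \<partial>M) \<longlongrightarrow> (\<integral>\<omega>. Z \<omega> * V \<omega> \<partial>M)) F"
proof -
  have Z: "square_integrable M Z" and X: "\<forall>\<^sub>F h in F. square_integrable M (X h)"
    and l: "((\<lambda>h. L2_norm M (\<lambda>\<omega>. X h \<omega> - Z \<omega>)) \<longlongrightarrow> 0) F"
    using assms by (auto simp: L2_tendsto_iff)
  have "((\<lambda>h. (\<integral>\<omega>. X h \<omega> * V \<omega> \<partial>M) - (\<integral>\<omega>. Z \<omega> * V \<omega> \<partial>M)) \<longlongrightarrow> 0) F"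
  proof (rule Lim_null_comparison)
    show "((\<lambda>h. L2_norm M (\<lambda>\<omega>. X h \<omega> - Z \<omega>) * L2_norm M V) \<longlongrightarrow> 0) F"
      using tendsto_mult_right[OF l, of "L2_norm M V"] by simp
    show "\<forall>\<^sub>F h in F. norm ((\<integral>\<omega>. X h \<omega> * V \<omega> \<partial>M) - (\<integral>\<omega>. Z \<omega> * V \<omega> \<partial>M))
        \<le> L2_norm M (\<lambda>\<omega>. X h \<omega> - Z \<omega>) * L2_norm M V"
      using X
    proof eventually_elim
      case (elim h)
      have "(\<integral>\<omega>. X h \<omega> * V \<omega> \<partial>M) - (\<integral>\<omega>. Z \<omega> * V \<omega> \<partial>M) = (\<integral>\<omega>. (X h \<omega> - Z \<omega>) * V \<omega> \<partial>M)"
        using integrable_mult_square_integrable[OF elim assms(2)] integrable_mult_square_integrable[OF Z assms(2)]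
        by (simp add: algebra_simps)
      then show ?case
        using L2_Cauchy_Schwarz[OF square_integrable_diff[OF elim Z] assms(2)] by simp
    qed
  qed
  then show ?thesis by (simp add: LIM_zero_iff)
qed

lemma L2_tendsto_norm:
  assumes "L2_tendsto M X Z F"
  shows "((\<lambda>h. L2_norm M (X h)) \<longlongrightarrow> L2_norm M Z) F"
proof -
  have Z: "square_integrable M Z" and X: "\<forall>\<^sub>F h in F. square_integrable M (X h)"
    and l: "((\<lambda>h. L2_norm M (\<lambda>\<omega>. X h \<omega> - Z \<omega>)) \<longlongrightarrow> 0) F"
    using assms by (auto simp: L2_tendsto_iff)
  have "((\<lambda>h. L2_norm M (X h) - L2_norm M Z) \<longlongrightarrow> 0) F"
  proof (rule Lim_null_comparison[OF _ l])
    show "\<forall>\<^sub>F h in F. norm (L2_norm M (X h) - L2_norm M Z) \<le> L2_norm M (\<lambda>\<omega>. X h \<omega> - Z \<omega>)"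
      using X
    proof eventually_elim
      case (elim h)
      then show ?case
        using L2_norm_triangle_diff[OF elim Z square_integrable_zero]
          L2_norm_triangle_diff[OF Z elim square_integrable_zero]
          L2_norm_minus_commute[of M "X h" Z] by simp
    qed
  qed
  then show ?thesis by (simp add: LIM_zero_iff)
qed

lemma L2_tendsto_add:
  assumes "L2_tendsto M X Z F" "L2_tendsto M X' Z' F"
  shows "L2_tendsto M (\<lambda>h \<omega>. X h \<omega> + X' h \<omega>) (\<lambda>\<omega>. Z \<omega> + Z' \<omega>) F"
proof -
  have Z: "square_integrable M Z" "square_integrable M Z'"
    and X: "\<forall>\<^sub>F h in F. square_integrable M (X h)" "\<forall>\<^sub>F h in F. square_integrable M (X' h)"
    and l: "((\<lambda>h. L2_norm M (\<lambda>\<omega>. X h \<omega> - Z \<omega>)) \<longlongrightarrow> 0) F" "((\<lambda>h. L2_norm M (\<lambda>\<omega>. X' h \<omega> - Z' \<omega>)) \<longlongrightarrow> 0) F"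
    using assms by (auto simp: L2_tendsto_iff)
  have "((\<lambda>h. L2_norm M (\<lambda>\<omega>. X h \<omega> + X' h \<omega> - (Z \<omega> + Z' \<omega>))) \<longlongrightarrow> 0) F"
  proof (rule Lim_null_comparison)
    show "((\<lambda>h. L2_norm M (\<lambda>\<omega>. X h \<omega> - Z \<omega>) + L2_norm M (\<lambda>\<omega>. X' h \<omega> - Z' \<omega>)) \<longlongrightarrow> 0) F"
      using tendsto_add[OF l] by simp
    show "\<forall>\<^sub>F h in F. norm (L2_norm M (\<lambda>\<omega>. X h \<omega> + X' h \<omega> - (Z \<omega> + Z' \<omega>)))
        \<le> L2_norm M (\<lambda>\<omega>. X h \<omega> - Z \<omega>) + L2_norm M (\<lambda>\<omega>. X' h \<omega> - Z' \<omega>)"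
      using X
    proof eventually_elim
      case (elim h)
      then show ?case
        using L2_norm_triangle[OF square_integrable_diff[OF elim(1) Z(1)] square_integrable_diff[OF elim(2) Z(2)]]
        by (simp add: algebra_simps)
    qed
  qed
  moreover have "\<forall>\<^sub>F h in F. square_integrable M (\<lambda>\<omega>. X h \<omega> + X' h \<omega>)"
    using X by eventually_elim (auto intro: square_integrable_add)
  ultimately show ?thesis using Z by (auto simp: L2_tendsto_iff intro: square_integrable_add)
qed

lemma L2_tendsto_mult:
  fixes Z :: "'w \<Rightarrow> 'b::{real_normed_field, second_countable_topology}"
  assumes "L2_tendsto M X Z F"
  shows "L2_tendsto M (\<lambda>h \<omega>. c * X h \<omega>) (\<lambda>\<omega>. c * Z \<omega>) F"
proof -
  have "((\<lambda>h. norm c * L2_norm M (\<lambda>\<omega>. X h \<omega> - Z \<omega>)) \<longlongrightarrow> norm c * 0) F"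
    using assms by (intro tendsto_mult tendsto_const) (auto simp: L2_tendsto_iff)
  moreover have "norm c * L2_norm M (\<lambda>\<omega>. X h \<omega> - Z \<omega>) = L2_norm M (\<lambda>\<omega>. c * X h \<omega> - c * Z \<omega>)" for h
    unfolding L2_norm_mult[symmetric] by (simp add: algebra_simps)
  moreover have "\<forall>\<^sub>F h in F. square_integrable M (\<lambda>\<omega>. c * X h \<omega>)"
    using assms unfolding L2_tendsto_iff by (auto elim!: eventually_mono intro: square_integrable_mult)
  ultimately show ?thesis using assms by (auto simp: L2_tendsto_iff intro: square_integrable_mult)
qed

lemma L2_tendsto_const: "square_integrable M Z \<Longrightarrow> L2_tendsto M (\<lambda>h. Z) Z F"
  by (simp add: L2_tendsto_def)

lemma L2_tendsto_sum:
  assumes "\<And>i. i \<in> I \<Longrightarrow> L2_tendsto M (X i) (Z i) F"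
  shows "L2_tendsto M (\<lambda>h \<omega>. \<Sum>i\<in>I. X i h \<omega>) (\<lambda>\<omega>. \<Sum>i\<in>I. Z i \<omega>) F"
  using assms
proof (induction I rule: infinite_finite_induct)
  case (insert i I)
  then show ?case using L2_tendsto_add[of M "X i" "Z i" F "\<lambda>h \<omega>. \<Sum>i\<in>I. X i h \<omega>" "\<lambda>\<omega>. \<Sum>i\<in>I. Z i \<omega>"] by simp
qed (auto intro: L2_tendsto_const)

lemma L2_tendsto_of_real:
  "L2_tendsto M (\<lambda>h \<omega>. complex_of_real (X h \<omega>)) (\<lambda>\<omega>. complex_of_real (Z \<omega>)) F \<longleftrightarrow> L2_tendsto M X Z F"
  unfolding L2_tendsto_def square_integrable_of_real of_real_diff[symmetric] norm_of_real by simp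

lemma L2_tendsto_cong_AE:
  assumes "L2_tendsto M X Z F"
    and "\<And>h. X' h \<in> borel_measurable M" "\<forall>\<^sub>F h in F. AE \<omega> in M. X h \<omega> = X' h \<omega>"
    and "Z' \<in> borel_measurable M" "AE \<omega> in M. Z \<omega> = Z' \<omega>"
  shows "L2_tendsto M X' Z' F"
proof -
  have Z: "square_integrable M Z" and X: "\<forall>\<^sub>F h in F. square_integrable M (X h)"
    and l: "((\<lambda>h. L2_norm M (\<lambda>\<omega>. X h \<omega> - Z \<omega>)) \<longlongrightarrow> 0) F"
    using assms by (auto simp: L2_tendsto_iff)
  have Z': "square_integrable M Z'"
    by (rule square_integrable_cong_AE[OF Z]) fact+
  have ev: "\<forall>\<^sub>F h in F. square_integrable M (X' h) \<and>
      L2_norm M (\<lambda>\<omega>. X h \<omega> - Z \<omega>) = L2_norm M (\<lambda>\<omega>. X' h \<omega> - Z' \<omega>)"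
    using X assms(3)
  proof eventually_elim
    case (elim h)
    have X': "square_integrable M (X' h)"
      by (rule square_integrable_cong_AE[OF elim(1) assms(2) elim(2)])
    have "L2_norm M (\<lambda>\<omega>. X h \<omega> - Z \<omega>) = L2_norm M (\<lambda>\<omega>. X' h \<omega> - Z' \<omega>)"
      by (rule L2_norm_cong_AE)
        (use elim(2) assms(5) square_integrableD(1)[OF square_integrable_diff[OF elim(1) Z]]
           square_integrableD(1)[OF square_integrable_diff[OF X' Z']] in auto)
    with X' show ?case by simp
  qed
  then have "((\<lambda>h. L2_norm M (\<lambda>\<omega>. X' h \<omega> - Z' \<omega>)) \<longlongrightarrow> 0) F"
    by (intro Lim_transform_eventually[OF l] eventually_mono[OF ev]) blast
  then show ?thesis using Z' eventually_mono[OF ev, of "\<lambda>h. square_integrable M (X' h)"] by (auto simp: L2_tendsto_iff)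
qed

section \<open>Completeness of \<open>L\<^sup>2\<close> and orthogonal projections\<close>

text \<open>The hypothesis bounds \<open>d n\<close> by \<open>sqrt K\<close> times the geometric
  sequence with ratio 1 / sqrt 2.\<close>

lemma summable_of_power2_geometric:
  fixes d :: "nat \<Rightarrow> real"
  assumes "\<And>n. 0 \<le> d n" "\<And>n. 2 ^ n * (d n)\<^sup>2 \<le> K"
  shows "summable d"
proof (rule summable_comparison_test')
  show "summable (\<lambda>n. sqrt K * (1 / sqrt 2) ^ n)"
    by (intro summable_mult summable_geometric) (simp add: field_simps)
  fix n :: nat assume "n \<ge> 0"
  have "(d n)\<^sup>2 \<le> K / 2 ^ n" using assms(2)[of n] by (simp add: field_simps)
  then have "d n \<le> sqrt (K / 2 ^ n)" by (rule real_le_rsqrt)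
  also have "\<dots> = sqrt K * (1 / sqrt 2) ^ n"
    by (simp add: real_sqrt_divide real_sqrt_power power_divide)
  finally show "norm (d n) \<le> sqrt K * (1 / sqrt 2) ^ n" using assms(1)[of n] by simp
qed

text \<open>The squared increments weighted by \<open>2 ^ n\<close> still have summable
  expectations, so their sum is finite almost everywhere; at such a point the increments are
  absolutely summable and the sequence telescopes.\<close>

lemma L2_AE_convergent:
  fixes X :: "nat \<Rightarrow> 'w \<Rightarrow> 'b::{banach, second_countable_topology}"
  assumes si: "\<And>n. square_integrable M (X n)"
    and fast: "\<And>n. (\<integral>\<omega>. (norm (X (Suc n) \<omega> - X n \<omega>))\<^sup>2 \<partial>M) \<le> (1/4) ^ n"
  shows "AE \<omega> in M. convergent (\<lambda>n. X n \<omega>)"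
proof -
  note [measurable] = square_integrableD(1)[OF si]
  define g where "g n \<omega> = ennreal (2 ^ n * (norm (X (Suc n) \<omega> - X n \<omega>))\<^sup>2)" for n \<omega>
  have g[measurable]: "g n \<in> borel_measurable M" for n unfolding g_def by measurable
  have "(\<integral>\<^sup>+\<omega>. g n \<omega> \<partial>M) \<le> ennreal ((1/2) ^ n)" for n
  proof -
    have int: "integrable M (\<lambda>\<omega>. 2 ^ n * (norm (X (Suc n) \<omega> - X n \<omega>))\<^sup>2)"
      using square_integrableD(2)[OF square_integrable_diff[OF si si]] by simp
    have "(\<integral>\<^sup>+\<omega>. g n \<omega> \<partial>M) = ennreal (2 ^ n * (\<integral>\<omega>. (norm (X (Suc n) \<omega> - X n \<omega>))\<^sup>2 \<partial>M))"
      unfolding g_def by (subst nn_integral_eq_integral[OF int]) auto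
    also have "\<dots> \<le> ennreal (2 ^ n * (1/4) ^ n)"
      using fast[of n] by (intro ennreal_leI mult_left_mono) auto
    also have "2 ^ n * (1/4::real) ^ n = (1/2) ^ n"
      by (simp flip: power_mult_distrib)
    finally show ?thesis .
  qed
  then have "(\<integral>\<^sup>+\<omega>. (\<Sum>n. g n \<omega>) \<partial>M) \<le> (\<Sum>n. ennreal ((1/2) ^ n))"
    by (subst nn_integral_suminf) (auto intro!: suminf_le)
  also have "\<dots> = ennreal (\<Sum>n. (1/2) ^ n)"
    by (intro suminf_ennreal2) auto
  also have "\<dots> < \<infinity>" by simp
  finally have "AE \<omega> in M. (\<Sum>n. g n \<omega>) \<noteq> \<infinity>"
    by (intro nn_integral_PInf_AE) auto
  then show ?thesis
  proof (rule AE_mp, intro AE_I2 impI)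
    fix \<omega> assume fin: "(\<Sum>n. g n \<omega>) \<noteq> \<infinity>"
    then obtain K where K: "(\<Sum>n. g n \<omega>) = ennreal K" "K \<ge> 0"
      by (cases "\<Sum>n. g n \<omega>") auto
    have "2 ^ n * (norm (X (Suc n) \<omega> - X n \<omega>))\<^sup>2 \<le> K" for n
    proof -
      have "g n \<omega> \<le> ennreal K"
        unfolding K(1)[symmetric] using sum_le_suminf[of "\<lambda>n. g n \<omega>" "{n}"] by simp
      then show ?thesis unfolding g_def using K(2) by (subst (asm) ennreal_le_iff) auto
    qed
    then have "summable (\<lambda>n. norm (X (Suc n) \<omega> - X n \<omega>))"
      by (intro summable_of_power2_geometric) auto
    then have "summable (\<lambda>n. X (Suc n) \<omega> - X n \<omega>)" by (rule summable_norm_cancel)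
    then have "convergent (\<lambda>n. \<Sum>i<n. X (Suc i) \<omega> - X i \<omega>)"
      by (simp add: summable_iff_convergent)
    then have "convergent (\<lambda>n. X 0 \<omega> + (\<Sum>i<n. X (Suc i) \<omega> - X i \<omega>))"
      by (intro convergent_add convergent_const)
    moreover have "X 0 \<omega> + (\<Sum>i<n. X (Suc i) \<omega> - X i \<omega>) = X n \<omega>" for n
      by (induction n) (auto simp: algebra_simps)
    ultimately show "convergent (\<lambda>n. X n \<omega>)" by simp
  qed
qed

text \<open>Fatou's lemma for the squared norms; a bound from N on suffices because only the lower
  limit enters.\<close>

lemma L2_Fatou:
  fixes X :: "nat \<Rightarrow> 'w \<Rightarrow> 'b::{banach, second_countable_topology}"
  assumes "\<And>n. square_integrable M (X n)" "Z \<in> borel_measurable M"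
    and "AE \<omega> in M. (\<lambda>n. X n \<omega>) \<longlonglongrightarrow> Z \<omega>"
    and "\<And>n. n \<ge> N \<Longrightarrow> (\<integral>\<omega>. (norm (X n \<omega>))\<^sup>2 \<partial>M) \<le> e"
  shows "square_integrable M Z \<and> (\<integral>\<omega>. (norm (Z \<omega>))\<^sup>2 \<partial>M) \<le> e"
proof -
  note [measurable] = square_integrableD(1)[OF assms(1)] assms(2)
  have e: "e \<ge> 0" using order_trans[OF _ assms(4)[of N]] by simp
  have "(\<integral>\<^sup>+\<omega>. ennreal ((norm (Z \<omega>))\<^sup>2) \<partial>M) = (\<integral>\<^sup>+\<omega>. liminf (\<lambda>n. ennreal ((norm (X n \<omega>))\<^sup>2)) \<partial>M)"
  proof (rule nn_integral_cong_AE, rule AE_mp[OF assms(3)], intro AE_I2 impI)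
    fix \<omega> assume "(\<lambda>n. X n \<omega>) \<longlonglongrightarrow> Z \<omega>"
    then have "(\<lambda>n. ennreal ((norm (X n \<omega>))\<^sup>2)) \<longlonglongrightarrow> ennreal ((norm (Z \<omega>))\<^sup>2)"
      by (intro tendsto_ennrealI tendsto_power tendsto_norm)
    from lim_imp_Liminf[OF _ this] show "ennreal ((norm (Z \<omega>))\<^sup>2) = liminf (\<lambda>n. ennreal ((norm (X n \<omega>))\<^sup>2))"
      by simp
  qed
  also have "\<dots> \<le> liminf (\<lambda>n. \<integral>\<^sup>+\<omega>. ennreal ((norm (X n \<omega>))\<^sup>2) \<partial>M)"
    by (rule nn_integral_liminf) measurable
  also have "\<dots> \<le> ennreal e"
  proof (rule Liminf_le)
    show "\<forall>\<^sub>F n in sequentially. (\<integral>\<^sup>+\<omega>. ennreal ((norm (X n \<omega>))\<^sup>2) \<partial>M) \<le> ennreal e"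
      using eventually_ge_at_top[of N]
    proof eventually_elim
      case (elim n)
      then show ?case
        using assms(4)[OF elim] by (subst nn_integral_eq_integral[OF square_integrableD(2)[OF assms(1)]]) (auto intro: ennreal_leI)
    qed
  qed simp
  finally have le: "(\<integral>\<^sup>+\<omega>. ennreal ((norm (Z \<omega>))\<^sup>2) \<partial>M) \<le> ennreal e" .
  have int: "integrable M (\<lambda>\<omega>. (norm (Z \<omega>))\<^sup>2)"
    by (rule integrableI_nonneg) (use le_less_trans[OF le, of \<infinity>] in auto)
  have "ennreal (\<integral>\<omega>. (norm (Z \<omega>))\<^sup>2 \<partial>M) \<le> ennreal e"
    using le by (subst (asm) nn_integral_eq_integral[OF int]) auto
  then show ?thesis using int e by (simp add: square_integrable_def ennreal_le_iff)
qed

lemma L2_complete: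
  fixes X :: "nat \<Rightarrow> 'w \<Rightarrow> 'b::{banach, second_countable_topology}"
  assumes si: "\<And>n. square_integrable M (X n)"
    and Cauchy: "\<And>e. e > 0 \<Longrightarrow> \<exists>N. \<forall>m\<ge>N. \<forall>n\<ge>N. (\<integral>\<omega>. (norm (X m \<omega> - X n \<omega>))\<^sup>2 \<partial>M) < e"
  obtains Z where "L2_tendsto M X Z sequentially"
proof -
  note [measurable] = square_integrableD(1)[OF si]
  have "\<exists>N. \<forall>j. \<forall>m\<ge>N j. \<forall>n\<ge>N j. (\<integral>\<omega>. (norm (X m \<omega> - X n \<omega>))\<^sup>2 \<partial>M) < (1/4) ^ j"
    using Cauchy by (intro choice allI) auto
  then obtain N where N: "\<And>j m n. m \<ge> N j \<Longrightarrow> n \<ge> N j \<Longrightarrow> (\<integral>\<omega>. (norm (X m \<omega> - X n \<omega>))\<^sup>2 \<partial>M) < (1/4) ^ j"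
    by blast
  \<comment> \<open>The running maximum puts \<open>r i\<close> beyond \<open>N j\<close> for every
    j up to i, so consecutive members of the subsequence are as close as almost everywhere
    convergence requires.\<close>
  define r where "r j = Max (N ` {..j}) + j" for j
  have rN: "r i \<ge> N j" if "j \<le> i" for i j
    unfolding r_def using that by (intro trans_le_add1 Max_ge) auto
  have rj: "r j \<ge> j" for j by (simp add: r_def)
  have "AE \<omega> in M. convergent (\<lambda>n. X (r n) \<omega>)"
    by (rule L2_AE_convergent) (use si less_imp_le[OF N] rN in auto)
  then have conv: "AE \<omega> in M. (\<lambda>n. X (r n) \<omega>) \<longlonglongrightarrow> lim (\<lambda>n. X (r n) \<omega>)"
    by (simp add: convergent_LIMSEQ_iff)
  define Z where "Z \<omega> = lim (\<lambda>n. X (r n) \<omega>)" for \<omega>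
  have [measurable]: "Z \<in> borel_measurable M"
    unfolding Z_def by (rule borel_measurable_lim_metric) measurable
  \<comment> \<open>Fatou is applied to \<open>X m\<close> minus the subsequence, with m fixed. This
    yields convergence of the whole sequence, not just of the subsequence.\<close>
  have key: "square_integrable M (\<lambda>\<omega>. X m \<omega> - Z \<omega>) \<and> (\<integral>\<omega>. (norm (X m \<omega> - Z \<omega>))\<^sup>2 \<partial>M) \<le> (1/4) ^ j"
    if m: "m \<ge> N j" for m j
  proof (rule L2_Fatou[where X="\<lambda>n \<omega>. X m \<omega> - X (r n) \<omega>" and N=j])
    show "AE \<omega> in M. (\<lambda>n. X m \<omega> - X (r n) \<omega>) \<longlonglongrightarrow> X m \<omega> - Z \<omega>"
      using conv by eventually_elim (auto simp: Z_def intro!: tendsto_diff)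
    show "(\<integral>\<omega>. (norm (X m \<omega> - X (r n) \<omega>))\<^sup>2 \<partial>M) \<le> (1/4) ^ j" if "n \<ge> j" for n
      using N[OF m rN[OF that]] by simp
  qed (auto intro: si square_integrable_diff)
  have siZ: "square_integrable M Z"
    using square_integrable_diff[OF si[of "N 0"] conjunct1[OF key[of 0 "N 0"]]] by simp
  have "((\<lambda>n. \<integral>\<omega>. (norm (X n \<omega> - Z \<omega>))\<^sup>2 \<partial>M) \<longlongrightarrow> 0) sequentially"
  proof (rule LIMSEQ_I)
    fix e :: real assume "e > 0"
    then obtain j where j: "(1/4::real) ^ j < e" using real_arch_pow_inv[of e "1/4"] by auto
    then show "\<exists>no. \<forall>n\<ge>no. norm ((\<integral>\<omega>. (norm (X n \<omega> - Z \<omega>))\<^sup>2 \<partial>M) - 0) < e"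
      using key[of j] by (intro exI[of _ "N j"]) fastforce
  qed
  then have "L2_tendsto M X Z sequentially"
    using siZ si by (auto simp: L2_tendsto_def)
  then show ?thesis ..
qed

section \<open>Closed subspaces of square integrable functions and orthogonal projections\<close>

locale L2_subspace =
  fixes M :: "'w measure" and S :: "('w \<Rightarrow> complex) set"
  assumes square_integrable: "Z \<in> S \<Longrightarrow> square_integrable M Z"
    and zero: "(\<lambda>\<omega>. 0) \<in> S"
    and add: "Z \<in> S \<Longrightarrow> W \<in> S \<Longrightarrow> (\<lambda>\<omega>. Z \<omega> + W \<omega>) \<in> S"
    and mult: "Z \<in> S \<Longrightarrow> (\<lambda>\<omega>. c * Z \<omega>) \<in> S"
    and closed: "square_integrable M Z \<Longrightarrow> (\<And>e. e > 0 \<Longrightarrow> \<exists>W\<in>S. L2_norm M (\<lambda>\<omega>. Z \<omega> - W \<omega>) < e) \<Longrightarrow> Z \<in> S"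
begin

lemma diff: "Z \<in> S \<Longrightarrow> W \<in> S \<Longrightarrow> (\<lambda>\<omega>. Z \<omega> - W \<omega>) \<in> S"
  using add[of Z "\<lambda>\<omega>. (-1) * W \<omega>"] mult[of W "-1"] by simp

lemma sum: "(\<And>i. i \<in> I \<Longrightarrow> Z i \<in> S) \<Longrightarrow> (\<lambda>\<omega>. \<Sum>i\<in>I. Z i \<omega>) \<in> S"
  by (induction I rule: infinite_finite_induct) (auto intro: zero add)

text \<open>Elements are functions, not classes. A modification on a null set has distance 0 from
  the original, so \<open>closed\<close> already admits it; this makes the choice of versions
  harmless throughout.\<close>

lemma AE_eq:
  assumes "Z \<in> S" "W \<in> borel_measurable M" "AE \<omega> in M. Z \<omega> = W \<omega>"
  shows "W \<in> S"
proof (rule closed)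
  show W: "square_integrable M W"
    by (rule square_integrable_cong_AE[OF square_integrable[OF assms(1)] assms(2,3)])
  fix e :: real assume "e > 0"
  have "L2_norm M (\<lambda>\<omega>. W \<omega> - Z \<omega>) = L2_norm M (\<lambda>\<omega>. 0::complex)"
    by (rule L2_norm_cong_AE) (use assms W square_integrable[OF assms(1)] in \<open>auto simp: square_integrable_def\<close>)
  then show "\<exists>Z\<in>S. L2_norm M (\<lambda>\<omega>. W \<omega> - Z \<omega>) < e"
    using assms(1) \<open>e > 0\<close> by (intro bexI[of _ Z]) (auto simp: L2_norm_def)
qed

lemma limit:
  assumes "L2_tendsto M X Z F" "F \<noteq> bot" "\<forall>\<^sub>F h in F. X h \<in> S"
  shows "Z \<in> S"
proof (rule closed)
  show "square_integrable M Z" using assms by (simp add: L2_tendsto_iff)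
  fix e :: real assume "e > 0"
  then have "\<forall>\<^sub>F h in F. L2_norm M (\<lambda>\<omega>. X h \<omega> - Z \<omega>) < e"
    using assms(1) by (intro order_tendstoD(2)[of _ 0]) (auto simp: L2_tendsto_iff)
  from eventually_happens[OF eventually_conj[OF this assms(3)]] assms(2)
  obtain h where "X h \<in> S" "L2_norm M (\<lambda>\<omega>. X h \<omega> - Z \<omega>) < e" by blast
  then show "\<exists>W\<in>S. L2_norm M (\<lambda>\<omega>. Z \<omega> - W \<omega>) < e"
    by (auto simp: L2_norm_minus_commute)
qed

definition is_proj :: "('w \<Rightarrow> complex) \<Rightarrow> ('w \<Rightarrow> complex) \<Rightarrow> bool" where
  "is_proj Z W \<longleftrightarrow> W \<in> S \<and> (\<forall>U\<in>S. (\<integral>\<omega>. (Z \<omega> - W \<omega>) * cnj (U \<omega>) \<partial>M) = 0)"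

lemma parallelogram:
  assumes "square_integrable M f" "square_integrable M (g :: 'w \<Rightarrow> complex)"
  shows "(L2_norm M (\<lambda>\<omega>. f \<omega> - g \<omega>))\<^sup>2 = 2 * (L2_norm M f)\<^sup>2 + 2 * (L2_norm M g)\<^sup>2 - (L2_norm M (\<lambda>\<omega>. f \<omega> + g \<omega>))\<^sup>2"
proof -
  have "(\<integral>\<omega>. (norm (f \<omega> - g \<omega>))\<^sup>2 + (norm (f \<omega> + g \<omega>))\<^sup>2 \<partial>M)
     = (\<integral>\<omega>. 2 * (norm (f \<omega>))\<^sup>2 + 2 * (norm (g \<omega>))\<^sup>2 \<partial>M)"
    unfolding cmod_power2
    by (rule Bochner_Integration.integral_cong) (auto simp: power2_eq_square algebra_simps)
  then show ?thesis
    using square_integrableD(2)[OF square_integrable_diff[OF assms]] square_integrableD(2)[OF square_integrable_add[OF assms]]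
      square_integrableD(2)[OF assms(1)] square_integrableD(2)[OF assms(2)]
    by (simp add: L2_norm_power2)
qed

text \<open>A minimising sequence for the distance to S is Cauchy by the parallelogram law; its
  limit is the nearest point, and the residual at the nearest point is orthogonal to S.\<close>

lemma proj_exists:
  assumes Z: "square_integrable M Z"
  obtains W where "is_proj Z W"
proof -
  define D where "D = (\<lambda>W. (L2_norm M (\<lambda>\<omega>. Z \<omega> - W \<omega>))\<^sup>2) ` S"
  define d where "d = Inf D"
  have ne: "D \<noteq> {}" and bdd: "bdd_below D" unfolding D_def using zero by (auto intro!: bdd_belowI[of _ 0])
  have d: "d \<le> (L2_norm M (\<lambda>\<omega>. Z \<omega> - W \<omega>))\<^sup>2" if "W \<in> S" for W
    unfolding d_def using that by (intro cInf_lower bdd) (auto simp: D_def)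
  have "\<exists>W\<in>S. (L2_norm M (\<lambda>\<omega>. Z \<omega> - W \<omega>))\<^sup>2 < d + 1 / real (Suc n)" for n
  proof -
    have "d < d + 1 / real (Suc n)" by simp
    from cInf_lessD[OF ne this[unfolded d_def]] show ?thesis unfolding D_def d_def by auto
  qed
  then obtain W where WS: "\<And>n. W n \<in> S" and W: "\<And>n. (L2_norm M (\<lambda>\<omega>. Z \<omega> - W n \<omega>))\<^sup>2 < d + 1 / real (Suc n)"
    by metis
  have siW: "square_integrable M (W n)" for n using WS square_integrable by blast
  \<comment> \<open>Half the sum of the two residuals is the residual of the midpoint, which lies in
    S and so has squared norm at least d.\<close>
  have C: "(L2_norm M (\<lambda>\<omega>. W m \<omega> - W n \<omega>))\<^sup>2 \<le> 2 / real (Suc m) + 2 / real (Suc n)" for m n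
  proof -
    let ?f = "\<lambda>\<omega>. Z \<omega> - W n \<omega>" and ?g = "\<lambda>\<omega>. Z \<omega> - W m \<omega>"
    have mid: "(\<lambda>\<omega>. (1/2) * (W m \<omega> + W n \<omega>)) \<in> S" using WS by (intro mult add)
    have "4 * d \<le> 4 * (L2_norm M (\<lambda>\<omega>. Z \<omega> - (1/2) * (W m \<omega> + W n \<omega>)))\<^sup>2"
      using d[OF mid] by simp
    also have "\<dots> = (L2_norm M (\<lambda>\<omega>. 2 * (Z \<omega> - (1/2) * (W m \<omega> + W n \<omega>))))\<^sup>2"
      unfolding L2_norm_mult by (simp add: power2_eq_square)
    also have "(\<lambda>\<omega>. 2 * (Z \<omega> - (1/2) * (W m \<omega> + W n \<omega>))) = (\<lambda>\<omega>. ?f \<omega> + ?g \<omega>)"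
      by (auto simp: algebra_simps)
    finally have "4 * d \<le> (L2_norm M (\<lambda>\<omega>. ?f \<omega> + ?g \<omega>))\<^sup>2" .
    moreover have "(\<lambda>\<omega>. W m \<omega> - W n \<omega>) = (\<lambda>\<omega>. ?f \<omega> - ?g \<omega>)" by auto
    ultimately show ?thesis
      using parallelogram[OF square_integrable_diff[OF Z siW[of n]] square_integrable_diff[OF Z siW[of m]]]
        W[of m] W[of n] by simp
  qed
  have "\<exists>N. \<forall>m\<ge>N. \<forall>n\<ge>N. (\<integral>\<omega>. (norm (W m \<omega> - W n \<omega>))\<^sup>2 \<partial>M) < e" if "e > 0" for e
  proof -
    obtain N where "4 / e < real N" using reals_Archimedean2 by blast
    then have N: "4 / e < real (Suc N)" by simp
    have b: "2 / real (Suc m) < e / 2" if "m \<ge> N" for m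
    proof -
      have "4 / e < real (Suc m)" using N that by (meson less_le_trans of_nat_mono Suc_le_mono)
      then show ?thesis using \<open>e > 0\<close> by (simp add: field_simps)
    qed
    have "(\<integral>\<omega>. (norm (W m \<omega> - W n \<omega>))\<^sup>2 \<partial>M) < e" if "m \<ge> N" "n \<ge> N" for m n
      using C[of m n] b[OF that(1)] b[OF that(2)] unfolding L2_norm_power2 by linarith
    then show ?thesis by blast
  qed
  then obtain V where V: "L2_tendsto M W V sequentially" by (rule L2_complete[OF siW])
  have VS: "V \<in> S" by (rule limit[OF V]) (use WS in auto)
  have siV: "square_integrable M V" by (rule square_integrable[OF VS])
  have "L2_tendsto M (\<lambda>n \<omega>. Z \<omega> + (-1) * W n \<omega>) (\<lambda>\<omega>. Z \<omega> + (-1) * V \<omega>) sequentially"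
    by (intro L2_tendsto_add L2_tendsto_const L2_tendsto_mult Z V)
  from tendsto_power[OF L2_tendsto_norm[OF this], of 2]
  have "(\<lambda>n. (L2_norm M (\<lambda>\<omega>. Z \<omega> - W n \<omega>))\<^sup>2) \<longlonglongrightarrow> (L2_norm M (\<lambda>\<omega>. Z \<omega> - V \<omega>))\<^sup>2" by simp
  moreover have "(\<lambda>n. d + 1 / real (Suc n)) \<longlonglongrightarrow> d + 0"
    by (intro tendsto_add tendsto_const LIMSEQ_Suc lim_1_over_n[where 'a=real])
  ultimately have dV: "(L2_norm M (\<lambda>\<omega>. Z \<omega> - V \<omega>))\<^sup>2 \<le> d"
    using W by (intro LIMSEQ_le[of _ _ "\<lambda>n. d + 1 / real (Suc n)"]) (auto intro!: less_imp_le exI[of _ 0])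
  have "(\<integral>\<omega>. (Z \<omega> - V \<omega>) * cnj (U \<omega>) \<partial>M) = 0" if U: "U \<in> S" for U
  proof (rule ccontr)
    define \<beta> where "\<beta> = (\<integral>\<omega>. (Z \<omega> - V \<omega>) * cnj (U \<omega>) \<partial>M)"
    define u where "u = (L2_norm M U)\<^sup>2"
    assume "(\<integral>\<omega>. (Z \<omega> - V \<omega>) * cnj (U \<omega>) \<partial>M) \<noteq> 0"
    then have \<beta>: "(cmod \<beta>)\<^sup>2 > 0" unfolding \<beta>_def by simp
    have siU: "square_integrable M U" by (rule square_integrable[OF U])
    note siD = square_integrable_diff[OF Z siV]
    \<comment> \<open>Minimality of V against the competitor V + s \<beta> U, where \<beta> is the
      inner product that should vanish.\<close>
    have ineq: "2 * s * (cmod \<beta>)\<^sup>2 \<le> s\<^sup>2 * (cmod \<beta>)\<^sup>2 * u" for s :: real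
    proof -
      define c where "c = of_real s * \<beta>"
      have "(\<lambda>\<omega>. V \<omega> + c * U \<omega>) \<in> S" using VS U by (intro add mult)
      from order_trans[OF dV d[OF this]] have "(L2_norm M (\<lambda>\<omega>. Z \<omega> - V \<omega>))\<^sup>2 \<le> (L2_norm M (\<lambda>\<omega>. Z \<omega> - (V \<omega> + c * U \<omega>)))\<^sup>2" .
      also have "\<dots> = (\<integral>\<omega>. (norm (Z \<omega> - V \<omega>))\<^sup>2 - 2 * Re (cnj c * ((Z \<omega> - V \<omega>) * cnj (U \<omega>))) + (cmod c)\<^sup>2 * (norm (U \<omega>))\<^sup>2 \<partial>M)"
        unfolding L2_norm_power2 cmod_power2
        by (rule Bochner_Integration.integral_cong) (auto simp: power2_eq_square algebra_simps)
      also have "\<dots> = (L2_norm M (\<lambda>\<omega>. Z \<omega> - V \<omega>))\<^sup>2 - 2 * Re (cnj c * \<beta>) + (cmod c)\<^sup>2 * u"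
        unfolding \<beta>_def u_def L2_norm_power2
        using square_integrableD(2)[OF siD] square_integrableD(2)[OF siU]
          integrable_mult_square_integrable[OF siD square_integrable_cnj[OF siU]]
        by (simp del: times_complex.sel)
      finally have "2 * Re (cnj c * \<beta>) \<le> (cmod c)\<^sup>2 * u" by simp
      moreover have "cnj c * \<beta> = of_real (s * (cmod \<beta>)\<^sup>2)"
        unfolding c_def of_real_mult complex_norm_square by simp
      ultimately have "2 * (s * (cmod \<beta>)\<^sup>2) \<le> (cmod c)\<^sup>2 * u" by (simp only: Re_complex_of_real)
      then show ?thesis by (simp add: c_def norm_mult power_mult_distrib)
    qed
    have "u \<ge> 0" by (simp add: u_def)
    \<comment> \<open>Any s > 0 with s u < 2 contradicts the inequality; the added 1 avoids a case
      distinction for u = 0.\<close>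
    define s where "s = 1 / (u + 1)"
    have s: "s > 0" "s * u < 1" unfolding s_def using \<open>u \<ge> 0\<close> by (auto simp: field_simps)
    have "s * (cmod \<beta>)\<^sup>2 * (2 - s * u) \<le> 0" using ineq[of s] by (simp add: power2_eq_square algebra_simps)
    moreover have "s * (cmod \<beta>)\<^sup>2 * (2 - s * u) > 0" using s \<beta> by (intro mult_pos_pos) auto
    ultimately show False by simp
  qed
  with VS have "is_proj Z V" by (simp add: is_proj_def)
  then show ?thesis ..
qed

lemma L2_proj_is_proj:
  assumes "square_integrable M Z"
  shows "is_proj Z (L2_proj M S Z)"
proof -
  have "\<exists>W. W \<in> S \<and> (\<forall>U\<in>S. (\<integral>\<omega>. (Z \<omega> - W \<omega>) * cnj (U \<omega>) \<partial>M) = 0)"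
    using proj_exists[OF assms] unfolding is_proj_def by blast
  from someI_ex[OF this] show ?thesis unfolding L2_proj_def is_proj_def .
qed

lemma proj_unique:
  assumes "square_integrable M Z" "is_proj Z W" "is_proj Z W'"
  shows "AE \<omega> in M. W \<omega> = W' \<omega>"
proof -
  have S: "W \<in> S" "W' \<in> S" using assms by (auto simp: is_proj_def)
  define U where "U = (\<lambda>\<omega>. W \<omega> - W' \<omega>)"
  have U: "U \<in> S" unfolding U_def by (intro diff S)
  note si = assms(1) square_integrable[OF S(1)] square_integrable[OF S(2)] square_integrable[OF U]
  have "complex_of_real ((L2_norm M U)\<^sup>2) = (\<integral>\<omega>. U \<omega> * cnj (U \<omega>) \<partial>M)"
    by (simp only: L2_norm_power2 complex_norm_square[symmetric] integral_complex_of_real[symmetric])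
  also have "\<dots> = (\<integral>\<omega>. (Z \<omega> - W' \<omega>) * cnj (U \<omega>) - (Z \<omega> - W \<omega>) * cnj (U \<omega>) \<partial>M)"
    unfolding U_def by (simp add: algebra_simps)
  also have "\<dots> = 0"
    using assms(2,3) U
      integrable_mult_square_integrable[OF square_integrable_diff[OF si(1,3)] square_integrable_cnj[OF si(4)]]
      integrable_mult_square_integrable[OF square_integrable_diff[OF si(1,2)] square_integrable_cnj[OF si(4)]]
    by (simp add: is_proj_def)
  finally have "L2_norm M U = 0" by simp
  from L2_norm_eq_0D[OF si(4) this] show ?thesis by (simp add: U_def)
qed

lemma L2_proj_AE_eqI:
  assumes "square_integrable M Z" "is_proj Z W"
  shows "AE \<omega> in M. L2_proj M S Z \<omega> = W \<omega>"
  using proj_unique[OF assms(1) L2_proj_is_proj[OF assms(1)] assms(2)] .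

text \<open>The residual U of W is itself orthogonal to S, so the hypothesis applies to U and forces
  its norm to be 0. This duality criterion reduces membership in a linear past to statements about
  correlations.\<close>

lemma mem_of_orthogonal:
  assumes W: "square_integrable M W"
    and orth: "\<And>U. square_integrable M U \<Longrightarrow> (\<forall>V\<in>S. (\<integral>\<omega>. V \<omega> * cnj (U \<omega>) \<partial>M) = 0) \<Longrightarrow> (\<integral>\<omega>. W \<omega> * cnj (U \<omega>) \<partial>M) = 0"
  shows "W \<in> S"
proof -
  obtain P where P: "is_proj W P" using proj_exists[OF W] .
  then have PS: "P \<in> S" by (simp add: is_proj_def)
  define U where "U = (\<lambda>\<omega>. W \<omega> - P \<omega>)"
  have U: "square_integrable M U" unfolding U_def by (intro square_integrable_diff W square_integrable PS)
  have o: "(\<integral>\<omega>. V \<omega> * cnj (U \<omega>) \<partial>M) = 0" if "V \<in> S" for V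
  proof -
    have "(\<integral>\<omega>. V \<omega> * cnj (U \<omega>) \<partial>M) = (\<integral>\<omega>. cnj (U \<omega> * cnj (V \<omega>)) \<partial>M)" by (simp add: mult.commute)
    also have "\<dots> = cnj (\<integral>\<omega>. U \<omega> * cnj (V \<omega>) \<partial>M)" by (rule Bochner_Integration.integral_cnj)
    also have "\<dots> = 0" using P that by (simp add: is_proj_def U_def)
    finally show ?thesis .
  qed
  have "(\<integral>\<omega>. U \<omega> * cnj (U \<omega>) \<partial>M) = (\<integral>\<omega>. W \<omega> * cnj (U \<omega>) - P \<omega> * cnj (U \<omega>) \<partial>M)"
    by (simp add: U_def algebra_simps)
  also have "\<dots> = 0"
    using orth[OF U] o o[OF PS] integrable_mult_square_integrable[OF W square_integrable_cnj[OF U]]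
      integrable_mult_square_integrable[OF square_integrable[OF PS] square_integrable_cnj[OF U]] by simp
  finally have "complex_of_real ((L2_norm M U)\<^sup>2) = 0"
    by (simp only: L2_norm_power2 complex_norm_square[symmetric] integral_complex_of_real[symmetric])
  then have "L2_norm M U = 0" by simp
  from L2_norm_eq_0D[OF U this] have "AE \<omega> in M. W \<omega> = P \<omega>" by (simp add: U_def)
  then have "AE \<omega> in M. P \<omega> = W \<omega>" by eventually_elim simp
  then show ?thesis by (rule AE_eq[OF PS square_integrableD(1)[OF W]])
qed

end

lemma L2_closure_iff:
  "Z \<in> L2_closure M D \<longleftrightarrow> square_integrable M Z \<and>
     (\<forall>e>0. \<exists>W\<in>D. square_integrable M W \<and> L2_norm M (\<lambda>\<omega>. Z \<omega> - W \<omega>) < e)"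
proof -
  have *: "L2_norm M f < e \<longleftrightarrow> (\<integral>\<omega>. (cmod (f \<omega>))\<^sup>2 \<partial>M) < e\<^sup>2" if "e > 0" for f e
    using that power_strict_mono[OF _ L2_norm_nonneg[of M f], of e 2] power2_less_imp_less[of "L2_norm M f" e]
    unfolding L2_norm_power2[symmetric] by auto
  show ?thesis
  proof safe
    assume Z: "Z \<in> L2_closure M D"
    then show "square_integrable M Z" by (simp add: L2_closure_def)
    fix e :: real assume "e > 0"
    with Z have "\<exists>W\<in>D. square_integrable M W \<and> (\<integral>\<omega>. (cmod (Z \<omega> - W \<omega>))\<^sup>2 \<partial>M) < e\<^sup>2"
      unfolding L2_closure_def by auto
    then show "\<exists>W\<in>D. square_integrable M W \<and> L2_norm M (\<lambda>\<omega>. Z \<omega> - W \<omega>) < e"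
      using *[OF \<open>e > 0\<close>] by blast
  next
    assume Z: "square_integrable M Z"
      and H: "\<forall>e>0. \<exists>W\<in>D. square_integrable M W \<and> L2_norm M (\<lambda>\<omega>. Z \<omega> - W \<omega>) < e"
    have "\<exists>W\<in>D. square_integrable M W \<and> (\<integral>\<omega>. (cmod (Z \<omega> - W \<omega>))\<^sup>2 \<partial>M) < e" if "e > 0" for e
      using H[rule_format, of "sqrt e"] *[of "sqrt e"] that by simp
    with Z show "Z \<in> L2_closure M D" by (auto simp: L2_closure_def)
  qed
qed

lemma L2_closure_superset: "W \<in> D \<Longrightarrow> square_integrable M W \<Longrightarrow> W \<in> L2_closure M D"
  unfolding L2_closure_iff by (auto intro!: bexI[of _ W] simp: L2_norm_def)

lemma L2_subspace_L2_closure: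
  assumes zero: "(\<lambda>\<omega>. 0) \<in> D"
    and add: "\<And>Z W. Z \<in> D \<Longrightarrow> W \<in> D \<Longrightarrow> (\<lambda>\<omega>. Z \<omega> + W \<omega>) \<in> D"
    and mult: "\<And>Z c. Z \<in> D \<Longrightarrow> (\<lambda>\<omega>. c * Z \<omega>) \<in> D"
  shows "L2_subspace M (L2_closure M D)"
proof
  fix Z W assume Z: "Z \<in> L2_closure M D"
  then show siZ: "square_integrable M Z" by (simp add: L2_closure_iff)
  {
    assume W: "W \<in> L2_closure M D"
    then have siW: "square_integrable M W" by (simp add: L2_closure_iff)
    show "(\<lambda>\<omega>. Z \<omega> + W \<omega>) \<in> L2_closure M D"
      unfolding L2_closure_iff
    proof (intro conjI allI impI square_integrable_add siZ siW)
      fix e :: real assume "e > 0"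
      then have "e/2 > 0" by simp
      then obtain Z' W' where D: "Z' \<in> D" "W' \<in> D" and si: "square_integrable M Z'" "square_integrable M W'"
        and l: "L2_norm M (\<lambda>\<omega>. Z \<omega> - Z' \<omega>) < e/2" "L2_norm M (\<lambda>\<omega>. W \<omega> - W' \<omega>) < e/2"
        using Z[unfolded L2_closure_iff, THEN conjunct2, rule_format, of "e/2"]
          W[unfolded L2_closure_iff, THEN conjunct2, rule_format, of "e/2"] by blast
      have "L2_norm M (\<lambda>\<omega>. Z \<omega> + W \<omega> - (Z' \<omega> + W' \<omega>)) \<le> L2_norm M (\<lambda>\<omega>. Z \<omega> - Z' \<omega>) + L2_norm M (\<lambda>\<omega>. W \<omega> - W' \<omega>)"
        using L2_norm_triangle[OF square_integrable_diff[OF siZ si(1)] square_integrable_diff[OF siW si(2)]]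
        by (simp add: algebra_simps)
      with l add[OF D] square_integrable_add[OF si]
      show "\<exists>V\<in>D. square_integrable M V \<and> L2_norm M (\<lambda>\<omega>. Z \<omega> + W \<omega> - V \<omega>) < e"
        by (intro bexI[of _ "\<lambda>\<omega>. Z' \<omega> + W' \<omega>"] conjI) simp_all
    qed
  }
  fix c :: complex
  show "(\<lambda>\<omega>. c * Z \<omega>) \<in> L2_closure M D"
    unfolding L2_closure_iff
  proof (intro conjI allI impI square_integrable_mult siZ)
    fix e :: real assume e: "e > 0"
    then have "e / (norm c + 1) > 0" by (simp add: add_nonneg_pos)
    then obtain Z' where D: "Z' \<in> D" and si: "square_integrable M Z'"
      and l: "L2_norm M (\<lambda>\<omega>. Z \<omega> - Z' \<omega>) < e / (norm c + 1)"
      using Z[unfolded L2_closure_iff, THEN conjunct2, rule_format, of "e / (norm c + 1)"] by blast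
    have "L2_norm M (\<lambda>\<omega>. c * Z \<omega> - c * Z' \<omega>) = norm c * L2_norm M (\<lambda>\<omega>. Z \<omega> - Z' \<omega>)"
      unfolding L2_norm_mult[symmetric] by (simp add: algebra_simps)
    also have "\<dots> \<le> norm c * (e / (norm c + 1))" using l by (intro mult_left_mono) auto
    also have "\<dots> < e" using e by (simp add: pos_divide_less_eq add_nonneg_pos distrib_left mult.commute)
    finally show "\<exists>V\<in>D. square_integrable M V \<and> L2_norm M (\<lambda>\<omega>. c * Z \<omega> - V \<omega>) < e"
      using mult[OF D, of c] square_integrable_mult[OF si, of c]
      by (intro bexI[of _ "\<lambda>\<omega>. c * Z' \<omega>"] conjI)
  qed
next
  show "(\<lambda>\<omega>. 0) \<in> L2_closure M D" by (rule L2_closure_superset[OF zero]) simp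
next
  fix Z assume Z: "square_integrable M Z"
    and H: "\<And>e. e > 0 \<Longrightarrow> \<exists>W\<in>L2_closure M D. L2_norm M (\<lambda>\<omega>. Z \<omega> - W \<omega>) < e"
  show "Z \<in> L2_closure M D"
    unfolding L2_closure_iff
  proof (intro conjI allI impI Z)
    fix e :: real assume "e > 0"
    then obtain W where W: "W \<in> L2_closure M D" "L2_norm M (\<lambda>\<omega>. Z \<omega> - W \<omega>) < e/2" using H[of "e/2"] by auto
    then obtain V where V: "V \<in> D" "square_integrable M V" "L2_norm M (\<lambda>\<omega>. W \<omega> - V \<omega>) < e/2"
      using \<open>e > 0\<close> W(1)[unfolded L2_closure_iff, THEN conjunct2, rule_format, of "e/2"] by auto
    have "square_integrable M W" using W by (simp add: L2_closure_iff)
    from L2_norm_triangle_diff[OF Z this V(2)] W(2) V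
    show "\<exists>V\<in>D. square_integrable M V \<and> L2_norm M (\<lambda>\<omega>. Z \<omega> - V \<omega>) < e"
      by (intro bexI[of _ V] conjI) simp_all
  qed
qed

section \<open>Second moments of the increments of a Levy process\<close>

lemma (in prob_space) indep_var_of_indep_vars:
  assumes "indep_vars (\<lambda>_. N) X I" "i \<in> I" "j \<in> I" "i \<noteq> j"
  shows "indep_var N (X i) N (X j)"
proof -
  define F where "F = (\<lambda>i. sigma_sets (space M) {X i -` A \<inter> space M |A. A \<in> sets N})"
  have rv: "random_variable N (X i)" "random_variable N (X j)" and F: "indep_sets F I"
    using assms unfolding indep_vars_def F_def by auto
  have "indep_set (F i) (F j)"
    unfolding indep_sets2_eq
  proof (intro conjI ballI)
    show "F i \<subseteq> events" "F j \<subseteq> events" using F assms(2,3) by (auto simp: indep_sets_def)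
    fix a b assume "a \<in> F i" "b \<in> F j"
    then show "prob (a \<inter> b) = prob a * prob b"
      using indep_setsD[OF F, of "{i, j}" "\<lambda>l. if l = i then a else b"] assms(2-4) by (auto simp: Int_commute)
  qed
  then show ?thesis using rv unfolding indep_var_eq F_def by simp
qed

text \<open>By Fubini for the product of the two laws, (x + Y)^2 is integrable for almost every
  constant x, and a single such x is enough. It lets increments over subintervals inherit their
  second moment from L(1).\<close>

lemma (in prob_space) square_integrable_summand:
  fixes X Y :: "'a \<Rightarrow> real"
  assumes "indep_var borel X borel Y" "square_integrable M (\<lambda>\<omega>. X \<omega> + Y \<omega>)"
  shows "square_integrable M Y"
proof -
  have [measurable]: "X \<in> borel_measurable M" "Y \<in> borel_measurable M"
    and eq: "distr M borel X \<Otimes>\<^sub>M distr M borel Y = distr M (borel \<Otimes>\<^sub>M borel) (\<lambda>x. (X x, Y x))"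
    using assms(1) unfolding indep_var_distribution_eq by auto
  interpret X: prob_space "distr M borel X" by (rule prob_space_distr) measurable
  interpret Y: prob_space "distr M borel Y" by (rule prob_space_distr) measurable
  interpret pair_sigma_finite "distr M borel X" "distr M borel Y" ..
  have "integrable (distr M (borel \<Otimes>\<^sub>M borel) (\<lambda>x. (X x, Y x))) (\<lambda>z. (fst z + snd z)\<^sup>2)"
    using square_integrableD(2)[OF assms(2)] by (subst integrable_distr_eq) auto
  then have "integrable (distr M borel X \<Otimes>\<^sub>M distr M borel Y) (\<lambda>z. (fst z + snd z)\<^sup>2)"
    unfolding eq .
  from AE_integrable_fst'[OF this]
  have "AE x in distr M borel X. integrable (distr M borel Y) (\<lambda>y. (x + y)\<^sup>2)" by simp
  from eventually_happens[OF this] obtain x where "integrable (distr M borel Y) (\<lambda>y. (x + y)\<^sup>2)"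
    using X.ae_filter_bot by auto
  then have "integrable M (\<lambda>\<omega>. (x + Y \<omega>)\<^sup>2)"
    by (subst (asm) integrable_distr_eq) auto
  then have "square_integrable M (\<lambda>\<omega>. x + Y \<omega>)" by (simp add: square_integrable_def)
  moreover have "square_integrable M (\<lambda>\<omega>. x)" by (simp add: square_integrable_def)
  ultimately have "square_integrable M (\<lambda>\<omega>. (x + Y \<omega>) - x)" by (rule square_integrable_diff)
  then show ?thesis by simp
qed

text \<open>Additivity and f(1) = 0 make f vanish at positive rationals. Hence f(n t) is the value
  of f at a remainder shorter than \<delta>, so n |f t| stays below K for all n.\<close>

lemma additive_bounded_eq_0:
  fixes f :: "real \<Rightarrow> real"
  assumes add: "\<And>s t. s > 0 \<Longrightarrow> t > 0 \<Longrightarrow> f (s + t) = f s + f t"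
    and bdd: "\<And>t. 0 < t \<Longrightarrow> t < \<delta> \<Longrightarrow> \<bar>f t\<bar> \<le> K" and "\<delta> > 0" and "f 1 = 0" and t: "t > 0"
  shows "f t = 0"
proof -
  have mult: "f (real (Suc n) * s) = real (Suc n) * f s" if "s > 0" for n s
  proof (induction n)
    case (Suc n)
    have "f (real (Suc (Suc n)) * s) = f (real (Suc n) * s + s)" by (simp add: algebra_simps)
    also have "\<dots> = f (real (Suc n) * s) + f s" using that by (intro add) auto
    finally show ?case using Suc by (simp add: algebra_simps)
  qed simp
  have rat: "f q = 0" if "q \<in> \<rat>" "q > 0" for q
  proof -
    from that(1) obtain a b where "b \<noteq> 0" "\<bar>q\<bar> = real a / real b" by (rule Rats_abs_nat_div_natE)
    then have ab: "q = real a / real b" "b \<noteq> 0" using that(2) by auto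
    with that have "a \<noteq> 0" by (cases a) auto
    then obtain a' where a': "a = Suc a'" by (cases a) auto
    moreover obtain b' where "b = Suc b'" using ab by (cases b) auto
    ultimately have s: "a = Suc a'" "b = Suc b'" .
    have "real b * f q = f (real b * q)" using mult[of q b'] that s by simp
    also have "real b * q = real a" using ab by simp
    also have "f (real a) = 0" using mult[of 1 a'] assms(4) s by simp
    finally show ?thesis using ab by simp
  qed
  have le: "real (Suc n) * \<bar>f t\<bar> \<le> K" for n
  proof -
    define y where "y = real (Suc n) * t"
    have y: "y > 0" unfolding y_def using t by simp
    obtain q where q: "q \<in> \<rat>" "max 0 (y - \<delta>) < q" "q < y"
      using Rats_dense_in_real[of "max 0 (y - \<delta>)" y] y \<open>\<delta> > 0\<close> by auto
    have "f y = f (q + (y - q))" by simp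
    also have "\<dots> = f q + f (y - q)" using q by (intro add) auto
    also have "\<dots> = f (y - q)" using rat q by simp
    finally have "\<bar>f y\<bar> \<le> K" using bdd[of "y - q"] q by auto
    then show ?thesis using mult[OF t, of n] by (simp add: y_def abs_mult)
  qed
  show ?thesis
  proof (rule ccontr)
    assume "f t \<noteq> 0"
    then obtain n where "K / \<bar>f t\<bar> < real n" using reals_Archimedean2 by blast
    then have "K < real n * \<bar>f t\<bar>" using \<open>f t \<noteq> 0\<close> by (simp add: pos_divide_less_eq)
    also have "\<dots> \<le> real (Suc n) * \<bar>f t\<bar>" by (intro mult_right_mono) auto
    finally show False using le[of n] by simp
  qed
qed

locale centered_levy =
  fixes M :: "'w measure" and k :: nat and L :: "real \<Rightarrow> 'w \<Rightarrow> real vec"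
  assumes levy: "two_sided_levy M k L"
    and moment: "integrable M (\<lambda>\<omega>. L 1 \<omega> \<bullet> L 1 \<omega>)"
    and centered: "\<And>i. i < k \<Longrightarrow> (\<integral>\<omega>. L 1 \<omega> $ i \<partial>M) = 0"
begin

sublocale prob_space M
  using levy by (simp add: two_sided_levy_def)

definition cov :: "nat \<Rightarrow> nat \<Rightarrow> real" where
  "cov i j = levy_cov M k L $$ (i, j)"

definition inc :: "nat \<Rightarrow> real \<Rightarrow> real \<Rightarrow> 'w \<Rightarrow> real" where
  "inc i s t \<omega> = L t \<omega> $ i - L s \<omega> $ i"

abbreviation PB :: "(nat \<Rightarrow> real) measure" where
  "PB \<equiv> PiM {..<k} (\<lambda>_. borel)"

lemma inc_measurable [measurable]: "i < k \<Longrightarrow> inc i s t \<in> borel_measurable M"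
  using levy unfolding two_sided_levy_def rand_vec_def inc_def[abs_def] by (intro borel_measurable_diff) auto

lemma inc_add: "inc i r s \<omega> + inc i s t \<omega> = inc i r t \<omega>"
  by (simp add: inc_def)

lemma incr_measurable [measurable]: "incr k L s t \<in> measurable M PB"
proof -
  have "(\<lambda>\<omega>. \<lambda>i\<in>{..<k}. inc i s t \<omega>) \<in> measurable M PB"
    by (rule measurable_restrict) auto
  then show ?thesis unfolding incr_def[abs_def] inc_def by simp
qed

lemma stationary:
  assumes "\<phi> \<in> borel_measurable PB" "s \<le> t"
  shows "integrable M (\<lambda>\<omega>. \<phi> (incr k L (s + h) (t + h) \<omega>) :: real) \<longleftrightarrow> integrable M (\<lambda>\<omega>. \<phi> (incr k L s t \<omega>))"
    and "(\<integral>\<omega>. \<phi> (incr k L (s + h) (t + h) \<omega>) \<partial>M) = (\<integral>\<omega>. \<phi> (incr k L s t \<omega>) \<partial>M)"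
proof -
  have "distr M PB (incr k L (s + h) (t + h)) = distr M PB (incr k L s t)"
    using levy assms(2) unfolding two_sided_levy_def by blast
  note eq = this
  show "integrable M (\<lambda>\<omega>. \<phi> (incr k L (s + h) (t + h) \<omega>)) \<longleftrightarrow> integrable M (\<lambda>\<omega>. \<phi> (incr k L s t \<omega>))"
    using integrable_distr_eq[OF incr_measurable assms(1), of "s + h" "t + h"]
      integrable_distr_eq[OF incr_measurable assms(1), of s t] eq by simp
  show "(\<integral>\<omega>. \<phi> (incr k L (s + h) (t + h) \<omega>) \<partial>M) = (\<integral>\<omega>. \<phi> (incr k L s t \<omega>) \<partial>M)"
    using integral_distr[OF incr_measurable assms(1), of "s + h" "t + h"]
      integral_distr[OF incr_measurable assms(1), of s t] eq by simp
qed

lemma inc_stationary: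
  assumes "i < k" "j < k" "s \<le> t"
  shows "square_integrable M (inc i (s + h) (t + h)) \<longleftrightarrow> square_integrable M (inc i s t)"
    and "(\<integral>\<omega>. inc i (s + h) (t + h) \<omega> \<partial>M) = (\<integral>\<omega>. inc i s t \<omega> \<partial>M)"
    and "(\<integral>\<omega>. inc i (s + h) (t + h) \<omega> * inc j (s + h) (t + h) \<omega> \<partial>M) = (\<integral>\<omega>. inc i s t \<omega> * inc j s t \<omega> \<partial>M)"
proof -
  have [measurable]: "(\<lambda>x. x i) \<in> borel_measurable PB" "(\<lambda>x. x j) \<in> borel_measurable PB"
    using assms by (auto intro: measurable_component_singleton)
  have *: "incr k L s t \<omega> i = inc i s t \<omega>" "incr k L s t \<omega> j = inc j s t \<omega>" for s t \<omega>
    using assms by (auto simp: incr_def inc_def)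
  show "square_integrable M (inc i (s + h) (t + h)) \<longleftrightarrow> square_integrable M (inc i s t)"
    using stationary(1)[of "\<lambda>x. (x i)\<^sup>2" s t h] assms by (simp add: * square_integrable_def)
  show "(\<integral>\<omega>. inc i (s + h) (t + h) \<omega> \<partial>M) = (\<integral>\<omega>. inc i s t \<omega> \<partial>M)"
    using stationary(2)[of "\<lambda>x. x i" s t h] assms by (simp add: *)
  show "(\<integral>\<omega>. inc i (s + h) (t + h) \<omega> * inc j (s + h) (t + h) \<omega> \<partial>M) = (\<integral>\<omega>. inc i s t \<omega> * inc j s t \<omega> \<partial>M)"
    using stationary(2)[of "\<lambda>x. x i * x j" s t h] assms by (simp add: *)
qed

lemma inc_indep:
  assumes "i < k" "j < k" "r < s" "s < t"
  shows "indep_var borel (inc i r s) borel (inc j s t)"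
proof -
  \<comment> \<open>Monotonicity is asked for on {..2} only, so the constant tail is harmless. From
    the two vector increments the coordinates i and j are read off separately.\<close>
  define ts where "ts m = (if m = 0 then r else if m = 1 then s else t)" for m :: nat
  have "strict_mono_on {..2} ts"
    using assms unfolding strict_mono_on_def ts_def by auto
  then have "indep_vars (\<lambda>_. PB) (\<lambda>m. incr k L (ts m) (ts (Suc m))) {..<2}"
    using levy[unfolded two_sided_levy_def, THEN conjunct2, THEN conjunct2, THEN conjunct2, THEN conjunct1,
        rule_format, of 2 ts] by simp
  then have "indep_vars (\<lambda>_. borel) (\<lambda>m x. (\<lambda>y. y (if m = 0 then i else j)) (incr k L (ts m) (ts (Suc m)) x)) {..<2}"
    by (rule indep_vars_compose2) (use assms in \<open>simp add: measurable_component_singleton\<close>)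
  from indep_var_of_indep_vars[OF this, of 0 1] show ?thesis
    using assms by (simp add: ts_def incr_def inc_def[abs_def])
qed

lemma L_eq_inc: "AE \<omega> in M. inc i 0 1 \<omega> = L 1 \<omega> $ i" if "i < k"
proof -
  have "AE \<omega> in M. L 0 \<omega> = 0\<^sub>v k" using levy by (simp add: two_sided_levy_def)
  then show ?thesis by eventually_elim (use that in \<open>simp add: inc_def\<close>)
qed

lemma L_measurable: "i < k \<Longrightarrow> (\<lambda>\<omega>. L t \<omega> $ i) \<in> borel_measurable M"
  using levy by (simp add: two_sided_levy_def rand_vec_def)

text \<open>The increment over (0, 1] is the starting point. Intervals shorter than 1 are translated
  so as to be an independent summand of it, and longer ones are cut into unit pieces and a
  rest.\<close>

lemma inc_square_integrable:
  assumes "i < k"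
  shows "square_integrable M (inc i s t)"
proof -
  note [measurable] = L_measurable[of _ 1]
  have dim: "dim_vec (L 1 \<omega>) = k" if "\<omega> \<in> space M" for \<omega>
    using levy that by (auto simp: two_sided_levy_def rand_vec_def)
  have "integrable M (\<lambda>\<omega>. (L 1 \<omega> $ i)\<^sup>2)"
  proof (rule Bochner_Integration.integrable_bound[OF moment])
    show "AE \<omega> in M. norm ((L 1 \<omega> $ i)\<^sup>2) \<le> norm (L 1 \<omega> \<bullet> L 1 \<omega>)"
    proof (rule AE_I2)
      fix \<omega> assume "\<omega> \<in> space M"
      then have "L 1 \<omega> \<bullet> L 1 \<omega> = (\<Sum>j<k. (L 1 \<omega> $ j)\<^sup>2)"
        by (simp add: scalar_prod_def dim power2_eq_square lessThan_atLeast0)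
      moreover have "(L 1 \<omega> $ i)\<^sup>2 \<le> (\<Sum>j<k. (L 1 \<omega> $ j)\<^sup>2)"
        using assms by (intro member_le_sum) auto
      ultimately show "norm ((L 1 \<omega> $ i)\<^sup>2) \<le> norm (L 1 \<omega> \<bullet> L 1 \<omega>)" by simp
    qed
  qed (use assms in measurable)
  then have "square_integrable M (\<lambda>\<omega>. L 1 \<omega> $ i)"
    using L_measurable[OF assms] by (simp add: square_integrable_def)
  then have one: "square_integrable M (inc i 0 1)"
    by (rule square_integrable_cong_AE) (use L_eq_inc[OF assms] assms in auto)
  have small: "square_integrable M (inc i s t)" if "s \<le> t" "t - s < 1" for s t
  proof (cases "s = t")
    case True
    then show ?thesis by (simp add: inc_def[abs_def])
  next
    case False
    \<comment> \<open>The translate of (s, t] that ends at 1 begins at h, which is strictly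
      positive, as the independence of adjacent increments requires.\<close>
    define h where "h = 1 - (t - s)"
    have "square_integrable M (inc i h 1)"
    proof (rule square_integrable_summand[OF inc_indep[of i i 0 h 1]])
      show "square_integrable M (\<lambda>\<omega>. inc i 0 h \<omega> + inc i h 1 \<omega>)" using one by (simp add: inc_add)
    qed (use that False assms in \<open>auto simp: h_def\<close>)
    moreover have "s + (h - s) = h" "t + (h - s) = 1" by (auto simp: h_def)
    ultimately show ?thesis using inc_stationary(1)[of i i s t "h - s"] that assms by (simp only:)
  qed
  have len: "square_integrable M (inc i s t)" if "s \<le> t" "t - s < real (Suc n)" for s t n
    using that
  proof (induction n arbitrary: s)
    case 0
    then show ?case using small by simp
  next
    case (Suc n)
    show ?case
    proof (cases "t - s < 1")
      case True
      then show ?thesis using small Suc by simp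
    next
      case False
      have "square_integrable M (inc i s (s + 1))"
        using inc_stationary(1)[of i i 0 1 s] one assms by (simp add: add.commute)
      moreover have "square_integrable M (inc i (s + 1) t)"
        using Suc.prems False by (intro Suc.IH) auto
      ultimately have "square_integrable M (\<lambda>\<omega>. inc i s (s + 1) \<omega> + inc i (s + 1) t \<omega>)"
        by (rule square_integrable_add)
      then show ?thesis by (simp add: inc_add)
    qed
  qed
  have le: "square_integrable M (inc i s t)" if "s \<le> t" for s t
  proof -
    obtain n where "t - s < real n" using reals_Archimedean2 by blast
    then show ?thesis using that by (intro len[of s t n]) auto
  qed
  show ?thesis
  proof (cases "s \<le> t")
    case False
    have "inc i s t = (\<lambda>\<omega>. - inc i t s \<omega>)" by (auto simp: inc_def)
    then show ?thesis using le[of t s] False by (auto intro: square_integrable_minus)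
  qed (rule le)
qed

lemma inc_integrable: "i < k \<Longrightarrow> integrable M (inc i s t)"
  using square_integrable_imp_integrable[of "inc i s t"] inc_square_integrable[of i s t]
  by (auto simp: square_integrable_def)

lemma inc_mult_integrable: "i < k \<Longrightarrow> j < k \<Longrightarrow> integrable M (\<lambda>\<omega>. inc i s t \<omega> * inc j s' t' \<omega>)"
  by (intro integrable_mult_square_integrable inc_square_integrable)

lemma inc_mean_add:
  assumes "i < k" "s > 0" "t > 0"
  shows "expectation (inc i 0 (s + t)) = expectation (inc i 0 s) + expectation (inc i 0 t)"
proof -
  have "expectation (inc i 0 (s + t)) = expectation (\<lambda>\<omega>. inc i 0 s \<omega> + inc i s (s + t) \<omega>)"
    by (simp add: inc_add)
  also have "\<dots> = expectation (inc i 0 s) + expectation (inc i s (s + t))"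
    using assms by (simp add: inc_integrable)
  also have "expectation (inc i s (s + t)) = expectation (inc i 0 t)"
    using inc_stationary(2)[of i i 0 t s] assms by (simp add: add.commute)
  finally show ?thesis .
qed

lemma inc_mean_one: "i < k \<Longrightarrow> expectation (inc i 0 1) = 0"
proof -
  assume i: "i < k"
  have "expectation (inc i 0 1) = expectation (\<lambda>\<omega>. L 1 \<omega> $ i)"
    by (rule integral_cong_AE) (use L_eq_inc[OF i] L_measurable[OF i] i in auto)
  then show ?thesis using centered[OF i] by simp
qed

lemma inc_mean_adjacent:
  assumes "i < k" "j < k" "r < s" "s < t"
  shows "expectation (\<lambda>\<omega>. inc i r s \<omega> * inc j s t \<omega>) = expectation (inc i r s) * expectation (inc j s t)"
  using assms by (intro indep_var_lebesgue_integral inc_indep inc_integrable)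

text \<open>Only here is continuity in probability used: together with Chebyshev's inequality it shows
  that the mean, an additive function of the length of the interval, is locally bounded.\<close>

lemma inc_mean_0:
  assumes i: "i < k" and t: "t > 0"
  shows "expectation (inc i 0 t) = 0"
proof -
  define m where "m t = expectation (inc i 0 t)" for t
  define K where "K = expectation (\<lambda>\<omega>. inc i 0 1 \<omega> * inc i 0 1 \<omega>)"
  have K: "K \<ge> 0" unfolding K_def by simp
  have sq: "integrable M (\<lambda>\<omega>. (inc i s t \<omega>)\<^sup>2)" for s t
    using square_integrableD(2)[OF inc_square_integrable[OF i, of s t]] by simp
  have mean_sq: "(expectation (inc i s t))\<^sup>2 \<le> expectation (\<lambda>\<omega>. (inc i s t \<omega>)\<^sup>2)" for s t
  proof -
    have "0 \<le> variance (inc i s t)" by simp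
    then show ?thesis using variance_eq[OF inc_integrable[OF i] sq, of s t] by simp
  qed
  \<comment> \<open>Expanding the second moment over (0, 1] at h gives K as the two second moments
    minus 2 m(h)^2, since the two means are opposite. As the piece (h, 1] has second moment at least
    m(h)^2, the variance of the other piece is at most K, although m(h) is not yet under
    control.\<close>
  have var: "variance (inc i 0 h) \<le> K" if h: "0 < h" "h < 1" for h
  proof -
    have "m 1 = m h + m (1 - h)" unfolding m_def using inc_mean_add[OF i, of h "1 - h"] h by simp
    then have m: "m (1 - h) = - m h" using inc_mean_one[OF i] by (simp add: m_def)
    have m1: "expectation (inc i h 1) = m (1 - h)"
      using inc_stationary(2)[OF i i, of 0 "1 - h" h] h by (simp add: m_def)
    have "K = expectation (\<lambda>\<omega>. (inc i 0 h \<omega> + inc i h 1 \<omega>) * (inc i 0 h \<omega> + inc i h 1 \<omega>))"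
      unfolding K_def by (simp add: inc_add)
    also have "\<dots> = expectation (\<lambda>\<omega>. inc i 0 h \<omega> * inc i 0 h \<omega> + 2 * (inc i 0 h \<omega> * inc i h 1 \<omega>) + inc i h 1 \<omega> * inc i h 1 \<omega>)"
      by (simp add: algebra_simps)
    also have "\<dots> = expectation (\<lambda>\<omega>. inc i 0 h \<omega> * inc i 0 h \<omega>) + 2 * expectation (\<lambda>\<omega>. inc i 0 h \<omega> * inc i h 1 \<omega>)
        + expectation (\<lambda>\<omega>. inc i h 1 \<omega> * inc i h 1 \<omega>)"
      using i by (simp add: inc_mult_integrable)
    also have "expectation (\<lambda>\<omega>. inc i 0 h \<omega> * inc i h 1 \<omega>) = - (m h)\<^sup>2"
      using inc_mean_adjacent[OF i i, of 0 h 1] h m m1 by (simp add: m_def power2_eq_square)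
    finally have "expectation (\<lambda>\<omega>. (inc i 0 h \<omega>)\<^sup>2) = K + 2 * (m h)\<^sup>2 - expectation (\<lambda>\<omega>. (inc i h 1 \<omega>)\<^sup>2)"
      by (simp add: power2_eq_square)
    moreover have "(m h)\<^sup>2 \<le> expectation (\<lambda>\<omega>. (inc i h 1 \<omega>)\<^sup>2)"
      using mean_sq[of h 1] m1 m by simp
    ultimately show ?thesis
      using variance_eq[OF inc_integrable[OF i] sq, of 0 h] by (simp add: m_def)
  qed
  \<comment> \<open>Then K / c^2 is below 1/4, so Chebyshev leaves an exceptional event of
    probability below 1/3; the 1 keeps c positive when K = 0.\<close>
  define c where "c = 2 * sqrt (K + 1)"
  have c: "c > 0" "K / c\<^sup>2 < 1/3" unfolding c_def using K by (auto simp: power_mult_distrib field_simps)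
  define B where "B h = {\<omega>\<in>space M. 1 < sqrt ((L h \<omega> - L 0 \<omega>) \<bullet> (L h \<omega> - L 0 \<omega>))}" for h
  have "((\<lambda>h. prob (B h)) \<longlongrightarrow> 0) (at 0)"
    using levy[unfolded two_sided_levy_def, THEN conjunct2, THEN conjunct2, THEN conjunct2, THEN conjunct2,
        THEN conjunct2, rule_format, of 1 0] unfolding B_def by simp
  then have "\<forall>\<^sub>F h in at 0. prob (B h) < 1/3" by (rule order_tendstoD) simp
  then obtain d where d: "d > 0" "\<And>h. h \<noteq> 0 \<Longrightarrow> dist h 0 < d \<Longrightarrow> prob (B h) < 1/3"
    unfolding eventually_at by blast
  have Lc: "L t \<omega> \<in> carrier_vec k" if "\<omega> \<in> space M" for t \<omega>
    using levy that by (auto simp: two_sided_levy_def rand_vec_def)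
  have norm_eq: "(L h \<omega> - L 0 \<omega>) \<bullet> (L h \<omega> - L 0 \<omega>) = (\<Sum>j<k. (inc j 0 h \<omega>)\<^sup>2)" if "\<omega> \<in> space M" for h \<omega>
    using Lc[OF that, of h] Lc[OF that, of 0]
    by (simp add: scalar_prod_def power2_eq_square inc_def lessThan_atLeast0)
  have bdd: "\<bar>m h\<bar> \<le> 1 + c" if h: "0 < h" "h < min d 1" for h
  proof -
    define A where "A = {\<omega>\<in>space M. c \<le> \<bar>inc i 0 h \<omega> - m h\<bar>}"
    have "B h = {\<omega>\<in>space M. 1 < sqrt (\<Sum>j<k. (inc j 0 h \<omega>)\<^sup>2)}"
      unfolding B_def using norm_eq by auto
    also have "\<dots> \<in> sets M" by measurable
    finally have [measurable]: "B h \<in> sets M" .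
    have [measurable]: "A \<in> sets M" unfolding A_def using i by measurable
    have "prob A \<le> variance (inc i 0 h) / c\<^sup>2"
      unfolding A_def m_def using i c square_integrableD(2)[OF inc_square_integrable[OF i, of 0 h]]
      by (intro Chebyshev_inequality) auto
    also have "\<dots> \<le> K / c\<^sup>2" using var[of h] h by (intro divide_right_mono) auto
    finally have "prob A < 1/3" using c by linarith
    moreover have "prob (B h) < 1/3" using d(2)[of h] h by simp
    \<comment> \<open>Some sample point escapes both events. There the increment is at most 1 in
      size and within c of its mean, which bounds the mean by 1 + c.\<close>
    ultimately have "prob (A \<union> B h) < 1"
      using measure_Un_le[of A M "B h"] by simp
    then have "A \<union> B h \<noteq> space M" using prob_space by auto
    then obtain \<omega> where \<omega>: "\<omega> \<in> space M" "\<omega> \<notin> A" "\<omega> \<notin> B h" by (auto simp: A_def B_def)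
    have "(inc i 0 h \<omega>)\<^sup>2 \<le> (\<Sum>j<k. (inc j 0 h \<omega>)\<^sup>2)" using i by (intro member_le_sum) auto
    also have "\<dots> \<le> 1" using \<omega> norm_eq[OF \<omega>(1), of h] by (auto simp: B_def)
    finally have "\<bar>inc i 0 h \<omega>\<bar> \<le> 1" by (simp add: abs_square_le_1)
    moreover have "\<bar>inc i 0 h \<omega> - m h\<bar> < c" using \<omega> by (auto simp: A_def)
    ultimately show ?thesis by linarith
  qed
  have "m t = 0"
    by (rule additive_bounded_eq_0[where K="1 + c" and \<delta>="min d 1"])
      (use inc_mean_add[OF i] bdd d inc_mean_one[OF i] t in \<open>auto simp: m_def\<close>)
  then show ?thesis by (simp add: m_def)
qed

lemma inc_mean:
  assumes "i < k" "s < t"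
  shows "expectation (inc i s t) = 0"
  using inc_stationary(2)[of i i 0 "t - s" s] inc_mean_0[of i "t - s"] assms by simp

lemma inc_uncorrelated:
  assumes "i < k" "j < k" "r < s" "s < t"
  shows "expectation (\<lambda>\<omega>. inc i r s \<omega> * inc j s t \<omega>) = 0"
    and "expectation (\<lambda>\<omega>. inc i s t \<omega> * inc j r s \<omega>) = 0"
  using inc_mean_adjacent[of i j r s t] inc_mean_adjacent[of j i r s t] inc_mean assms
  by (auto simp: mult.commute)

lemma inc_cov_split:
  assumes "i < k" "j < k" "r < s" "s < t"
  shows "expectation (\<lambda>\<omega>. inc i r t \<omega> * inc j r t \<omega>) =
    expectation (\<lambda>\<omega>. inc i r s \<omega> * inc j r s \<omega>) + expectation (\<lambda>\<omega>. inc i s t \<omega> * inc j s t \<omega>)"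
proof -
  have "expectation (\<lambda>\<omega>. inc i r t \<omega> * inc j r t \<omega>) =
    expectation (\<lambda>\<omega>. (inc i r s \<omega> + inc i s t \<omega>) * (inc j r s \<omega> + inc j s t \<omega>))"
    by (simp add: inc_add)
  also have "\<dots> = expectation (\<lambda>\<omega>. inc i r s \<omega> * inc j r s \<omega> + inc i s t \<omega> * inc j s t \<omega>
      + inc i r s \<omega> * inc j s t \<omega> + inc i s t \<omega> * inc j r s \<omega>)"
    by (simp add: algebra_simps)
  also have "\<dots> = expectation (\<lambda>\<omega>. inc i r s \<omega> * inc j r s \<omega>) + expectation (\<lambda>\<omega>. inc i s t \<omega> * inc j s t \<omega>)"
    using assms by (simp add: inc_mult_integrable inc_uncorrelated)
  finally show ?thesis .
qed

lemma cov_eq: "i < k \<Longrightarrow> j < k \<Longrightarrow> cov i j = expectation (\<lambda>\<omega>. inc i 0 1 \<omega> * inc j 0 1 \<omega>)"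
proof -
  assume ij: "i < k" "j < k"
  have "expectation (\<lambda>\<omega>. inc i 0 1 \<omega> * inc j 0 1 \<omega>) = expectation (\<lambda>\<omega>. L 1 \<omega> $ i * L 1 \<omega> $ j)"
    by (rule integral_cong_AE)
      (use ij L_eq_inc[OF ij(1)] L_eq_inc[OF ij(2)] L_measurable[of _ 1] in auto)
  then show ?thesis using ij by (simp add: cov_def levy_cov_def)
qed

text \<open>The covariance over (0, u] is additive in u because adjacent increments are
  uncorrelated, and bounded on (0, 1) by Cauchy-Schwarz. Its deviation from u \<open>cov i j\<close>
  is additive, locally bounded and 0 at u = 1.\<close>

lemma inc_cov:
  assumes ij: "i < k" "j < k" and "s < t"
  shows "expectation (\<lambda>\<omega>. inc i s t \<omega> * inc j s t \<omega>) = (t - s) * cov i j"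
proof -
  define v where "v i j t = expectation (\<lambda>\<omega>. inc i 0 t \<omega> * inc j 0 t \<omega>)" for i j t
  have add: "v i j (s + t) = v i j s + v i j t" if "i < k" "j < k" "s > 0" "t > 0" for i j s t
    unfolding v_def using inc_cov_split[of i j 0 s "s + t"] inc_stationary(3)[of i j 0 t s] that
    by (simp add: add.commute)
  have nonneg: "v i i t \<ge> 0" for i t unfolding v_def by simp
  have mono: "v i i t \<le> v i i 1" if "i < k" "0 < t" "t < 1" for i t
    using add[of i i t "1 - t"] nonneg[of i "1 - t"] that by simp
  have bdd: "\<bar>v i j t\<bar> \<le> sqrt (v i i 1) * sqrt (v j j 1)" if "0 < t" "t < 1" for t
  proof -
    have "\<bar>v i j t\<bar> \<le> L2_norm M (inc i 0 t) * L2_norm M (inc j 0 t)"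
      using L2_Cauchy_Schwarz[OF inc_square_integrable inc_square_integrable, of i j 0 t 0 t] ij by (simp add: v_def)
    also have "\<dots> = sqrt (v i i t) * sqrt (v j j t)"
      by (simp add: L2_norm_def v_def power2_eq_square)
    also have "\<dots> \<le> sqrt (v i i 1) * sqrt (v j j 1)"
      using mono[of i t] mono[of j t] that ij nonneg by (intro mult_mono real_sqrt_le_mono) auto
    finally show ?thesis .
  qed
  have "v i j u - u * cov i j = 0" if "u > 0" for u
  proof (rule additive_bounded_eq_0[where f="\<lambda>u. v i j u - u * cov i j" and \<delta>=1
        and K="sqrt (v i i 1) * sqrt (v j j 1) + \<bar>cov i j\<bar>"])
    fix t :: real assume t: "0 < t" "t < 1"
    have "\<bar>t * cov i j\<bar> \<le> 1 * \<bar>cov i j\<bar>" unfolding abs_mult using t by (intro mult_right_mono) auto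
    then show "\<bar>v i j t - t * cov i j\<bar> \<le> sqrt (v i i 1) * sqrt (v j j 1) + \<bar>cov i j\<bar>"
      using bdd[OF t] by linarith
  qed (use that ij add cov_eq in \<open>auto simp: algebra_simps v_def\<close>)
  then show ?thesis
    using inc_stationary(3)[of i j 0 "t - s" s] assms by (simp add: v_def)
qed

lemma inc_cov_min:
  assumes ij: "i < k" "j < k" and "r < x" "r < y"
  shows "expectation (\<lambda>\<omega>. inc i r x \<omega> * inc j r y \<omega>) = (min x y - r) * cov i j"
proof -
  consider "x = y" | "x < y" | "y < x" by linarith
  then show ?thesis
  proof cases
    case 1
    then show ?thesis using inc_cov assms by simp
  next
    case 2
    have "expectation (\<lambda>\<omega>. inc i r x \<omega> * inc j r y \<omega>) = expectation (\<lambda>\<omega>. inc i r x \<omega> * (inc j r x \<omega> + inc j x y \<omega>))"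
      by (simp add: inc_add)
    also have "\<dots> = expectation (\<lambda>\<omega>. inc i r x \<omega> * inc j r x \<omega>) + expectation (\<lambda>\<omega>. inc i r x \<omega> * inc j x y \<omega>)"
      using ij by (simp add: distrib_left inc_mult_integrable)
    finally show ?thesis using inc_uncorrelated 2 assms inc_cov by simp
  next
    case 3
    have "expectation (\<lambda>\<omega>. inc i r x \<omega> * inc j r y \<omega>) = expectation (\<lambda>\<omega>. (inc i r y \<omega> + inc i y x \<omega>) * inc j r y \<omega>)"
      by (simp add: inc_add)
    also have "\<dots> = expectation (\<lambda>\<omega>. inc i r y \<omega> * inc j r y \<omega>) + expectation (\<lambda>\<omega>. inc i y x \<omega> * inc j r y \<omega>)"
      using ij by (simp add: distrib_right inc_mult_integrable)
    finally show ?thesis using inc_uncorrelated 3 assms inc_cov by simp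
  qed
qed

lemma integral_indicator_Ioc_mult:
  fixes s t s' t' :: real
  assumes "s \<le> t" "s' \<le> t'"
  shows "(\<integral>u. indicator {s<..t} u * indicator {s'<..t'} u \<partial>lborel) =
    min t t' - min t s' - min s t' + min s s'"
proof -
  have "(\<integral>u. indicator {s<..t} u * indicator {s'<..t'} u \<partial>lborel) =
      (\<integral>u. indicator {max s s'<..min t t'} u \<partial>lborel :: real)"
    by (rule Bochner_Integration.integral_cong) (auto simp: indicator_def)
  also have "\<dots> = measure lborel {max s s'<..min t t'}" by simp
  also have "\<dots> = min t t' - min t s' - min s t' + min s s'"
    using assms by (cases "max s s' \<le> min t t'") (auto simp: min_def max_def split: if_splits)
  finally show ?thesis .
qed

lemma inc_inc:
  assumes ij: "i < k" "j < k" and "s \<le> t" "s' \<le> t'"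
  shows "expectation (\<lambda>\<omega>. inc i s t \<omega> * inc j s' t' \<omega>) =
    cov i j * (\<integral>u. indicator {s<..t} u * indicator {s'<..t'} u \<partial>lborel)"
proof -
  \<comment> \<open>A common base point strictly to the left of all four endpoints, so that both
    increments become differences of increments starting at r.\<close>
  define r where "r = min s s' - 1"
  have "expectation (\<lambda>\<omega>. inc i s t \<omega> * inc j s' t' \<omega>) =
     expectation (\<lambda>\<omega>. (inc i r t \<omega> - inc i r s \<omega>) * (inc j r t' \<omega> - inc j r s' \<omega>))"
    by (simp add: inc_def)
  also have "\<dots> = expectation (\<lambda>\<omega>. inc i r t \<omega> * inc j r t' \<omega> - inc i r t \<omega> * inc j r s' \<omega>
     - inc i r s \<omega> * inc j r t' \<omega> + inc i r s \<omega> * inc j r s' \<omega>)"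
    by (simp add: algebra_simps)
  also have "\<dots> = expectation (\<lambda>\<omega>. inc i r t \<omega> * inc j r t' \<omega>) - expectation (\<lambda>\<omega>. inc i r t \<omega> * inc j r s' \<omega>)
     - expectation (\<lambda>\<omega>. inc i r s \<omega> * inc j r t' \<omega>) + expectation (\<lambda>\<omega>. inc i r s \<omega> * inc j r s' \<omega>)"
    using ij by (simp add: inc_mult_integrable)
  also have "\<dots> = cov i j * (min t t' - min t s' - min s t' + min s s')"
    using assms by (simp add: inc_cov_min r_def algebra_simps)
  finally show ?thesis using integral_indicator_Ioc_mult[OF assms(3,4)] by simp
qed

end

section \<open>Wiener integrals\<close>

lemma tendsto_integral_mult2:
  fixes Z W :: "'w \<Rightarrow> 'b::{real_normed_field, second_countable_topology, banach}"
  assumes "L2_tendsto M X Z F" "L2_tendsto M Y W F"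
  shows "((\<lambda>h. \<integral>\<omega>. X h \<omega> * Y h \<omega> \<partial>M) \<longlongrightarrow> (\<integral>\<omega>. Z \<omega> * W \<omega> \<partial>M)) F"
proof -
  have Z: "square_integrable M Z" and X: "\<forall>\<^sub>F h in F. square_integrable M (X h)"
    and l: "((\<lambda>h. L2_norm M (\<lambda>\<omega>. X h \<omega> - Z \<omega>)) \<longlongrightarrow> 0) F"
    using assms(1) by (auto simp: L2_tendsto_iff)
  have W: "square_integrable M W" and Y: "\<forall>\<^sub>F h in F. square_integrable M (Y h)"
    using assms(2) by (auto simp: L2_tendsto_iff)
  have "((\<lambda>h. (\<integral>\<omega>. X h \<omega> * Y h \<omega> \<partial>M) - (\<integral>\<omega>. Y h \<omega> * Z \<omega> \<partial>M)) \<longlongrightarrow> 0) F"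
  proof (rule Lim_null_comparison)
    show "((\<lambda>h. L2_norm M (\<lambda>\<omega>. X h \<omega> - Z \<omega>) * L2_norm M (Y h)) \<longlongrightarrow> 0) F"
      using tendsto_mult[OF l L2_tendsto_norm[OF assms(2)]] by simp
    show "\<forall>\<^sub>F h in F. norm ((\<integral>\<omega>. X h \<omega> * Y h \<omega> \<partial>M) - (\<integral>\<omega>. Y h \<omega> * Z \<omega> \<partial>M))
        \<le> L2_norm M (\<lambda>\<omega>. X h \<omega> - Z \<omega>) * L2_norm M (Y h)"
      using X Y
    proof eventually_elim
      case (elim h)
      have "(\<integral>\<omega>. X h \<omega> * Y h \<omega> \<partial>M) - (\<integral>\<omega>. Y h \<omega> * Z \<omega> \<partial>M) = (\<integral>\<omega>. (X h \<omega> - Z \<omega>) * Y h \<omega> \<partial>M)"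
        using integrable_mult_square_integrable[OF elim] integrable_mult_square_integrable[OF elim(2) Z]
        by (simp add: algebra_simps)
      then show ?case
        using L2_Cauchy_Schwarz[OF square_integrable_diff[OF elim(1) Z] elim(2)] by simp
    qed
  qed
  from tendsto_add[OF this tendsto_integral_mult[OF assms(2) Z]]
  show ?thesis by (simp add: mult.commute)
qed

context centered_levy
begin

text \<open>The list element \<open>(c, s, t, i)\<close> stands for c times the indicator of (s, t] in the i-th component.\<close>

definition skern :: "(real \<times> real \<times> real \<times> nat) list \<Rightarrow> nat \<Rightarrow> real \<Rightarrow> real" where
  "skern xs j u = (\<Sum>(c, s, t, i)\<leftarrow>xs. if i = j then c * indicator {s<..t} u else 0)"

definition svar :: "(real \<times> real \<times> real \<times> nat) list \<Rightarrow> 'w \<Rightarrow> real" where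
  "svar xs \<omega> = (\<Sum>(c, s, t, i)\<leftarrow>xs. c * inc i s t \<omega>)"

definition valid :: "(real \<times> real \<times> real \<times> nat) list \<Rightarrow> bool" where
  "valid xs \<longleftrightarrow> (\<forall>(c, s, t, i)\<in>set xs. s \<le> t \<and> i < k)"

text \<open>The bilinear form on kernels that the isometry identifies with the expectation of the
  product of two stochastic integrals; the components of the noise may be correlated, hence the
  double sum.\<close>

definition cov_form :: "(nat \<Rightarrow> real \<Rightarrow> real) \<Rightarrow> (nat \<Rightarrow> real \<Rightarrow> real) \<Rightarrow> real" where
  "cov_form f g = (\<Sum>i<k. \<Sum>j<k. cov i j * (\<integral>u. f i u * g j u \<partial>lborel))"

lemma skern_simps [simp]:
  "skern [] j u = 0"
  "skern ((c, s, t, i) # xs) j u = (if i = j then c * indicator {s<..t} u else 0) + skern xs j u"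
  "skern (xs @ ys) j u = skern xs j u + skern ys j u"
  by (simp_all add: skern_def)

lemma svar_simps [simp]:
  "svar [] \<omega> = 0" "svar ((c, s, t, i) # xs) \<omega> = c * inc i s t \<omega> + svar xs \<omega>"
  "svar (xs @ ys) \<omega> = svar xs \<omega> + svar ys \<omega>"
  by (simp_all add: svar_def)

lemma valid_simps [simp]:
  "valid []" "valid ((c, s, t, i) # xs) \<longleftrightarrow> s \<le> t \<and> i < k \<and> valid xs"
  "valid (xs @ ys) \<longleftrightarrow> valid xs \<and> valid ys"
  unfolding valid_def set_append ball_Un by simp_all

lemma square_integrable_if:
  "square_integrable N f \<Longrightarrow> square_integrable N (\<lambda>u. if P then f u else 0)"
  by (cases P) auto

lemma square_integrable_indicator_Ioc: "square_integrable lborel (indicator {s<..t} :: real \<Rightarrow> real)"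
proof -
  have "(\<lambda>u. (norm (indicator {s<..t} u :: real))\<^sup>2) = indicator {s<..t}"
    by (auto simp: indicator_def)
  moreover have "integrable lborel (indicator {s<..t} :: real \<Rightarrow> real)"
    by (rule integrable_real_indicator) (cases "s \<le> t"; simp)+
  ultimately show ?thesis by (simp add: square_integrable_def)
qed

lemma skern_square_integrable: "square_integrable lborel (skern xs j)"
proof (induction xs)
  case Nil
  then show ?case by (simp add: skern_def[abs_def])
next
  case (Cons x xs)
  obtain c s t i where x: "x = (c, s, t, i)" by (cases x) auto
  have "square_integrable lborel (\<lambda>u. if i = j then c * indicator {s<..t} u else 0 :: real)"
    using square_integrable_mult[OF square_integrable_indicator_Ioc] by (cases "i = j") auto
  from square_integrable_add[OF this Cons] show ?case by (simp add: x)
qed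

lemma svar_square_integrable: "valid xs \<Longrightarrow> square_integrable M (svar xs)"
proof (induction xs)
  case Nil
  then show ?case by (simp add: svar_def[abs_def])
next
  case (Cons x xs)
  obtain c s t i where x: "x = (c, s, t, i)" by (cases x) auto
  have "square_integrable M (\<lambda>\<omega>. c * inc i s t \<omega> + svar xs \<omega>)"
    using Cons by (intro square_integrable_add square_integrable_mult inc_square_integrable) (auto simp: x)
  then show ?case by (simp add: x)
qed

lemma cov_form_add_left:
  assumes "\<And>j. j < k \<Longrightarrow> square_integrable lborel (f j)" "\<And>j. j < k \<Longrightarrow> square_integrable lborel (f' j)"
    "\<And>j. j < k \<Longrightarrow> square_integrable lborel (g j)"
  shows "cov_form (\<lambda>j u. f j u + f' j u) g = cov_form f g + cov_form f' g"
  using assms by (simp add: cov_form_def distrib_right integrable_mult_square_integrable distrib_left sum.distrib)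

lemma cov_form_mult_left: "cov_form (\<lambda>j u. c * f j u) g = c * cov_form f g"
  by (simp add: cov_form_def mult.assoc sum_distrib_left mult.left_commute)

lemma cov_sym: "i < k \<Longrightarrow> j < k \<Longrightarrow> cov i j = cov j i"
  by (simp add: cov_eq mult.commute)

lemma cov_form_commute: "cov_form f g = cov_form g f"
proof -
  have "cov_form f g = (\<Sum>j<k. \<Sum>i<k. cov i j * (\<integral>u. f i u * g j u \<partial>lborel))"
    unfolding cov_form_def by (rule sum.swap)
  also have "\<dots> = cov_form g f"
    unfolding cov_form_def by (intro sum.cong refl) (simp add: mult.commute cov_sym)
  finally show ?thesis .
qed

lemma cov_form_single:
  assumes "i < k"
  shows "cov_form (\<lambda>l u. if i = l then f u else 0) g = (\<Sum>j<k. cov i j * (\<integral>u. f u * g j u \<partial>lborel))"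
proof -
  have "cov_form (\<lambda>l u. if i = l then f u else 0) g =
      (\<Sum>l<k. if l = i then \<Sum>j<k. cov i j * (\<integral>u. f u * g j u \<partial>lborel) else 0)"
    unfolding cov_form_def by (intro sum.cong) auto
  then show ?thesis using assms by simp
qed

text \<open>The isometry for step kernels: both sides are bilinear, so list induction in each
  argument reduces it to two single increments, where \<open>inc_inc\<close> applies.\<close>

lemma svar_inner:
  assumes "valid xs" "valid ys"
  shows "expectation (\<lambda>\<omega>. svar xs \<omega> * svar ys \<omega>) = cov_form (skern xs) (skern ys)"
proof -
  have single: "expectation (\<lambda>\<omega>. inc i s t \<omega> * svar ys \<omega>) = cov_form (\<lambda>j u. if i = j then indicator {s<..t} u else 0) (skern ys)"
    if "s \<le> t" "i < k" for s t i
    using assms(2)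
  proof (induction ys)
    case Nil
    then show ?case by (simp add: cov_form_def)
  next
    case (Cons y ys)
    obtain d s' t' j where y: "y = (d, s', t', j)" by (cases y) auto
    have "expectation (\<lambda>\<omega>. inc i s t \<omega> * svar (y # ys) \<omega>) =
        expectation (\<lambda>\<omega>. d * (inc i s t \<omega> * inc j s' t' \<omega>) + inc i s t \<omega> * svar ys \<omega>)"
      by (simp add: y algebra_simps)
    also have "\<dots> = d * expectation (\<lambda>\<omega>. inc i s t \<omega> * inc j s' t' \<omega>) + expectation (\<lambda>\<omega>. inc i s t \<omega> * svar ys \<omega>)"
      using Cons.prems that integrable_mult_square_integrable[OF inc_square_integrable[OF that(2)] svar_square_integrable, of ys s t]
      by (simp add: y inc_mult_integrable)
    also have "expectation (\<lambda>\<omega>. inc i s t \<omega> * inc j s' t' \<omega>) =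
        cov_form (\<lambda>l u. if j = l then indicator {s'<..t'} u else 0) (\<lambda>l u. if i = l then indicator {s<..t} u else 0)"
    proof -
      have z: "(\<integral>u. indicator {s'<..t'} u * (if i = l then indicator {s<..t} u else 0) \<partial>lborel) =
          (if l = i then \<integral>u. indicator {s'<..t'} u * indicator {s<..t} u \<partial>lborel else (0::real))" for l
        by (cases "i = l") auto
      have "cov_form (\<lambda>l u. if j = l then indicator {s'<..t'} u else 0) (\<lambda>l u. if i = l then indicator {s<..t} u else 0)
        = cov j i * (\<integral>u. indicator {s'<..t'} u * indicator {s<..t} u \<partial>lborel)"
      proof -
        have "(\<Sum>l<k. cov j l * (if l = i then c else 0)) = (\<Sum>l<k. if l = i then cov j i * c else 0)" for c
          by (intro sum.cong) auto
        then show ?thesis using Cons.prems that by (subst cov_form_single) (auto simp: y z)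
      qed
      then show ?thesis
        using inc_inc[of i j s t s' t'] Cons.prems that by (simp add: y cov_sym[of j i] mult.commute)
    qed
    also have "d * \<dots> + expectation (\<lambda>\<omega>. inc i s t \<omega> * svar ys \<omega>) =
        cov_form (\<lambda>l u. d * (if j = l then indicator {s'<..t'} u else 0) + skern ys l u) (\<lambda>l u. if i = l then indicator {s<..t} u else 0)"
      using Cons
      by (subst cov_form_add_left)
        (auto simp: y cov_form_mult_left cov_form_commute[of _ "skern ys"] intro!: skern_square_integrable square_integrable_mult
           square_integrable_if square_integrable_indicator_Ioc)
    also have "(\<lambda>l u. d * (if j = l then indicator {s'<..t'} u else 0) + skern ys l u) = skern (y # ys)"
      by (simp add: y fun_eq_iff)
    finally show ?case by (simp add: cov_form_commute)
  qed
  show ?thesis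
    using assms(1)
  proof (induction xs)
    case Nil
    then show ?case by (simp add: cov_form_def)
  next
    case (Cons x xs)
    obtain c s t i where x: "x = (c, s, t, i)" by (cases x) auto
    have "expectation (\<lambda>\<omega>. svar (x # xs) \<omega> * svar ys \<omega>) =
        expectation (\<lambda>\<omega>. c * (inc i s t \<omega> * svar ys \<omega>) + svar xs \<omega> * svar ys \<omega>)"
      by (simp add: x algebra_simps)
    also have "\<dots> = c * expectation (\<lambda>\<omega>. inc i s t \<omega> * svar ys \<omega>) + expectation (\<lambda>\<omega>. svar xs \<omega> * svar ys \<omega>)"
      using Cons.prems assms(2) integrable_mult_square_integrable[OF inc_square_integrable svar_square_integrable, of i ys s t]
        integrable_mult_square_integrable[OF svar_square_integrable svar_square_integrable, of xs ys]
      by (simp add: x)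
    also have "\<dots> = cov_form (\<lambda>j u. c * (if i = j then indicator {s<..t} u else 0) + skern xs j u) (skern ys)"
      using Cons single[of s t i]
      by (subst cov_form_add_left)
        (auto simp: x cov_form_mult_left intro!: skern_square_integrable square_integrable_mult square_integrable_if square_integrable_indicator_Ioc)
    also have "(\<lambda>j u. c * (if i = j then indicator {s<..t} u else 0) + skern xs j u) = skern (x # xs)"
      by (simp add: x fun_eq_iff)
    finally show ?case .
  qed
qed

text \<open>\<open>wint f Z\<close>: Z is the sum over j of the integrals of \<open>f j\<close> with respect to the j-th component.\<close>

definition wint :: "(nat \<Rightarrow> real \<Rightarrow> real) \<Rightarrow> ('w \<Rightarrow> real) \<Rightarrow> bool" where
  "wint f Z \<longleftrightarrow> (\<exists>xs. (\<forall>n. valid (xs n)) \<and>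
     (\<forall>j<k. L2_tendsto lborel (\<lambda>n. skern (xs n) j) (f j) sequentially) \<and>
     L2_tendsto M (\<lambda>n. svar (xs n)) Z sequentially)"

lemma wint_square_integrable:
  assumes "wint f Z"
  shows "square_integrable M Z" "j < k \<Longrightarrow> square_integrable lborel (f j)"
  using assms by (auto simp: wint_def L2_tendsto_iff)

lemma wint_inner:
  assumes "wint f Z" "wint g W"
  shows "expectation (\<lambda>\<omega>. Z \<omega> * W \<omega>) = cov_form f g"
proof -
  obtain xs where xs: "\<And>n. valid (xs n)" "\<And>j. j < k \<Longrightarrow> L2_tendsto lborel (\<lambda>n. skern (xs n) j) (f j) sequentially"
      "L2_tendsto M (\<lambda>n. svar (xs n)) Z sequentially"
    using assms(1) unfolding wint_def by blast
  obtain ys where ys: "\<And>n. valid (ys n)" "\<And>j. j < k \<Longrightarrow> L2_tendsto lborel (\<lambda>n. skern (ys n) j) (g j) sequentially"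
      "L2_tendsto M (\<lambda>n. svar (ys n)) W sequentially"
    using assms(2) unfolding wint_def by blast
  have "(\<lambda>n. cov_form (skern (xs n)) (skern (ys n))) \<longlonglongrightarrow> cov_form f g"
    unfolding cov_form_def using xs ys
    by (intro tendsto_sum tendsto_mult tendsto_const tendsto_integral_mult2) auto
  moreover have "(\<lambda>n. cov_form (skern (xs n)) (skern (ys n))) \<longlonglongrightarrow> expectation (\<lambda>\<omega>. Z \<omega> * W \<omega>)"
    unfolding svar_inner[OF xs(1) ys(1), symmetric] by (rule tendsto_integral_mult2[OF xs(3) ys(3)])
  ultimately show ?thesis by (rule LIMSEQ_unique[symmetric])
qed

lemma wint_add:
  assumes "wint f Z" "wint g W"
  shows "wint (\<lambda>j u. f j u + g j u) (\<lambda>\<omega>. Z \<omega> + W \<omega>)"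
proof -
  obtain xs where xs: "\<And>n. valid (xs n)" "\<And>j. j < k \<Longrightarrow> L2_tendsto lborel (\<lambda>n. skern (xs n) j) (f j) sequentially"
      "L2_tendsto M (\<lambda>n. svar (xs n)) Z sequentially"
    using assms(1) unfolding wint_def by blast
  obtain ys where ys: "\<And>n. valid (ys n)" "\<And>j. j < k \<Longrightarrow> L2_tendsto lborel (\<lambda>n. skern (ys n) j) (g j) sequentially"
      "L2_tendsto M (\<lambda>n. svar (ys n)) W sequentially"
    using assms(2) unfolding wint_def by blast
  have e: "skern (xs n @ ys n) j = (\<lambda>u. skern (xs n) j u + skern (ys n) j u)"
    "svar (xs n @ ys n) = (\<lambda>\<omega>. svar (xs n) \<omega> + svar (ys n) \<omega>)" for n j by auto
  show ?thesis
    unfolding wint_def using xs ys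
    by (intro exI[of _ "\<lambda>n. xs n @ ys n"] conjI allI impI) (simp_all only: e valid_simps L2_tendsto_add)
qed

lemma wint_mult:
  assumes "wint f Z"
  shows "wint (\<lambda>j u. c * f j u) (\<lambda>\<omega>. c * Z \<omega>)"
proof -
  obtain xs where xs: "\<And>n. valid (xs n)" "\<And>j. j < k \<Longrightarrow> L2_tendsto lborel (\<lambda>n. skern (xs n) j) (f j) sequentially"
      "L2_tendsto M (\<lambda>n. svar (xs n)) Z sequentially"
    using assms(1) unfolding wint_def by blast
  define m where "m = map (\<lambda>(d, r). (c * d, r :: real \<times> real \<times> nat))"
  have 1: "skern (m l) j u = c * skern l j u" for l j u
    by (induction l) (auto simp: m_def algebra_simps)
  have 2: "svar (m l) \<omega> = c * svar l \<omega>" for l \<omega>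
    by (induction l) (auto simp: m_def algebra_simps)
  have 3: "valid l \<Longrightarrow> valid (m l)" for l
    by (induction l) (auto simp: m_def)
  have e: "skern (m l) j = (\<lambda>u. c * skern l j u)" "svar (m l) = (\<lambda>\<omega>. c * svar l \<omega>)" for l j
    using 1 2 by auto
  show ?thesis
    unfolding wint_def using xs 3
    by (intro exI[of _ "\<lambda>n. m (xs n)"] conjI allI impI) (simp_all only: e L2_tendsto_mult)
qed

lemma wint_zero: "wint (\<lambda>j u. 0) (\<lambda>\<omega>. 0)"
proof -
  have e: "skern [] j = (\<lambda>u. 0)" "svar [] = (\<lambda>\<omega>. 0)" for j by auto
  show ?thesis unfolding wint_def
    by (intro exI[of _ "\<lambda>n. []"]) (simp add: e L2_tendsto_const)
qed

lemma wint_diff: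
  "wint f Z \<Longrightarrow> wint g W \<Longrightarrow> wint (\<lambda>j u. f j u - g j u) (\<lambda>\<omega>. Z \<omega> - W \<omega>)"
  using wint_add[of f Z "\<lambda>j u. (-1) * g j u" "\<lambda>\<omega>. (-1) * W \<omega>"] wint_mult[of g W "-1"] by simp

lemma wint_sum:
  "(\<And>i. i \<in> I \<Longrightarrow> wint (f i) (Z i)) \<Longrightarrow> wint (\<lambda>j u. \<Sum>i\<in>I. f i j u) (\<lambda>\<omega>. \<Sum>i\<in>I. Z i \<omega>)"
  by (induction I rule: infinite_finite_induct) (auto intro: wint_zero wint_add)

lemma wint_cong_AE:
  assumes "wint f Z" "Z' \<in> borel_measurable M" "AE \<omega> in M. Z \<omega> = Z' \<omega>"
  shows "wint f Z'"
proof -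
  obtain xs where xs: "\<And>n. valid (xs n)" "\<And>j. j < k \<Longrightarrow> L2_tendsto lborel (\<lambda>n. skern (xs n) j) (f j) sequentially"
      "L2_tendsto M (\<lambda>n. svar (xs n)) Z sequentially"
    using assms(1) unfolding wint_def by blast
  have "L2_tendsto M (\<lambda>n. svar (xs n)) Z' sequentially"
    by (rule L2_tendsto_cong_AE[OF xs(3)])
      (use assms svar_square_integrable[OF xs(1)] in \<open>auto simp: square_integrable_def\<close>)
  with xs show ?thesis unfolding wint_def by blast
qed

lemma wint_cong: "wint f Z \<Longrightarrow> (\<And>j u. j < k \<Longrightarrow> f j u = g j u) \<Longrightarrow> wint g Z"
proof -
  assume w: "wint f Z" and "\<And>j u. j < k \<Longrightarrow> f j u = g j u"
  then have "f j = g j" if "j < k" for j using that by auto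
  then have "(\<forall>j<k. L2_tendsto lborel (X j) (f j) sequentially) \<longleftrightarrow> (\<forall>j<k. L2_tendsto lborel (X j) (g j) sequentially)"
    for X :: "nat \<Rightarrow> nat \<Rightarrow> real \<Rightarrow> real" by auto
  with w show ?thesis unfolding wint_def by simp
qed

text \<open>An integral against one component is a vector integral whose other kernels vanish, which
  brings the entries of the state process under one isometry.\<close>

lemma wint_of_levy_integral:
  assumes "has_levy_integral M L j f I" "j < k"
  shows "wint (\<lambda>i u. if i = j then f u else 0) I"
proof -
  obtain n c ts where mono: "\<And>l. mono (ts l)"
    and f: "L2_tendsto lborel (\<lambda>l. step_fun (n l) (c l) (ts l)) f sequentially"
    and I: "L2_tendsto M (\<lambda>l. step_integral L j (n l) (c l) (ts l)) I sequentially"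
    using assms(1) unfolding has_levy_integral_def by blast
  define xs where "xs l = map (\<lambda>m. (c l m, ts l m, ts l (Suc m), j)) [0..<n l]" for l :: nat
  have "valid (xs l)" for l
    using mono[of l] assms(2) by (auto simp: valid_def xs_def mono_def)
  moreover have "svar (xs l) = step_integral L j (n l) (c l) (ts l)" for l
    by (auto simp: svar_def xs_def step_integral_def inc_def comp_def interv_sum_list_conv_sum_set_nat atLeast0LessThan)
  moreover have "skern (xs l) i = (if i = j then step_fun (n l) (c l) (ts l) else (\<lambda>u. 0))" for l i
    by (auto simp: skern_def xs_def step_fun_def comp_def interv_sum_list_conv_sum_set_nat atLeast0LessThan)
  moreover have "(\<lambda>u. if i = j then f u else 0) = (if i = j then f else (\<lambda>u. 0))" for i by auto
  ultimately show ?thesis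
    unfolding wint_def using f I by (intro exI[of _ xs]) (simp add: L2_tendsto_const)
qed

text \<open>A crude upper bound of the covariance form by kernel norms. It holds without
  definiteness and yields the continuity of the integral in its kernel.\<close>

lemma cov_form_le:
  assumes "\<And>j. j < k \<Longrightarrow> square_integrable lborel (f j)"
  shows "cov_form f f \<le> (\<Sum>i<k. \<Sum>j<k. \<bar>cov i j\<bar>) * (\<Sum>j<k. L2_norm lborel (f j))\<^sup>2"
proof -
  define s where "s = (\<Sum>j<k. L2_norm lborel (f j))"
  have s: "L2_norm lborel (f j) \<le> s" if "j < k" for j
    unfolding s_def using that by (intro member_le_sum) auto
  have "cov_form f f \<le> (\<Sum>i<k. \<Sum>j<k. \<bar>cov i j\<bar> * s\<^sup>2)"
    unfolding cov_form_def
  proof (intro sum_mono)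
    fix i j assume "i \<in> {..<k}" "j \<in> {..<k}"
    then have ij: "i < k" "j < k" by auto
    have "cov i j * (\<integral>u. f i u * f j u \<partial>lborel) \<le> \<bar>cov i j\<bar> * \<bar>\<integral>u. f i u * f j u \<partial>lborel\<bar>"
      by (metis abs_ge_self abs_mult)
    also have "\<bar>\<integral>u. f i u * f j u \<partial>lborel\<bar> \<le> L2_norm lborel (f i) * L2_norm lborel (f j)"
      using L2_Cauchy_Schwarz[OF assms(1)[OF ij(1)] assms(1)[OF ij(2)]] by simp
    also have "\<dots> \<le> s * s" using s ij by (intro mult_mono) (auto intro: order_trans[OF L2_norm_nonneg])
    finally show "cov i j * (\<integral>u. f i u * f j u \<partial>lborel) \<le> \<bar>cov i j\<bar> * s\<^sup>2"
      by (simp add: power2_eq_square mult_left_mono)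
  qed
  then show ?thesis by (simp add: sum_distrib_right s_def)
qed

lemma wint_norm: "wint f Z \<Longrightarrow> (L2_norm M Z)\<^sup>2 = cov_form f f"
  using wint_inner[of f Z f Z] by (simp add: L2_norm_power2 flip: power2_eq_square)

lemma wint_norm_le:
  assumes "wint f Z"
  shows "L2_norm M Z \<le> sqrt (\<Sum>i<k. \<Sum>j<k. \<bar>cov i j\<bar>) * (\<Sum>j<k. L2_norm lborel (f j))"
proof -
  have "(L2_norm M Z)\<^sup>2 \<le> (\<Sum>i<k. \<Sum>j<k. \<bar>cov i j\<bar>) * (\<Sum>j<k. L2_norm lborel (f j))\<^sup>2"
    using wint_norm[OF assms] cov_form_le[of f] wint_square_integrable[OF assms] by simp
  then have "L2_norm M Z \<le> sqrt ((\<Sum>i<k. \<Sum>j<k. \<bar>cov i j\<bar>) * (\<Sum>j<k. L2_norm lborel (f j))\<^sup>2)"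
    by (rule real_le_rsqrt)
  then show ?thesis by (simp add: real_sqrt_mult sum_nonneg)
qed

text \<open>Mean-square limits of integrals are reduced to limits of deterministic kernels, so all
  differentiation of the state takes place on the kernel side.\<close>

lemma wint_tendsto:
  assumes "\<And>h. wint (f h) (Z h)" "wint g W"
    and "\<And>j. j < k \<Longrightarrow> L2_tendsto lborel (\<lambda>h. f h j) (g j) F"
  shows "L2_tendsto M Z W F"
proof -
  have lim: "((\<lambda>h. sqrt (\<Sum>i<k. \<Sum>j<k. \<bar>cov i j\<bar>) * (\<Sum>j<k. L2_norm lborel (\<lambda>u. f h j u - g j u))) \<longlongrightarrow>
      sqrt (\<Sum>i<k. \<Sum>j<k. \<bar>cov i j\<bar>) * (\<Sum>j<k. 0)) F"
    using assms(3) by (intro tendsto_mult tendsto_const tendsto_sum) (auto simp: L2_tendsto_iff)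
  have "((\<lambda>h. L2_norm M (\<lambda>\<omega>. Z h \<omega> - W \<omega>)) \<longlongrightarrow> 0) F"
  proof (rule Lim_null_comparison)
    show "\<forall>\<^sub>F h in F. norm (L2_norm M (\<lambda>\<omega>. Z h \<omega> - W \<omega>)) \<le>
        sqrt (\<Sum>i<k. \<Sum>j<k. \<bar>cov i j\<bar>) * (\<Sum>j<k. L2_norm lborel (\<lambda>u. f h j u - g j u))"
      using wint_norm_le[OF wint_diff[OF assms(1,2)]] by simp
  qed (use lim in simp)
  then show ?thesis
    using wint_square_integrable(1)[OF assms(1)] wint_square_integrable(1)[OF assms(2)]
    by (simp add: L2_tendsto_iff)
qed

lemma wint_svar: "valid xs \<Longrightarrow> wint (skern xs) (svar xs)"
  unfolding wint_def
  by (intro exI[of _ "\<lambda>n. xs"]) (auto intro!: L2_tendsto_const skern_square_integrable svar_square_integrable)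

text \<open>Convergent step kernels are Cauchy; by the norm bound so are their elementary integrals,
  and completeness supplies the limit.\<close>

lemma wint_exists:
  assumes valid: "\<And>n. valid (xs n)"
    and lim: "\<And>j. j < k \<Longrightarrow> L2_tendsto lborel (\<lambda>n. skern (xs n) j) (f j) sequentially"
  obtains Z where "wint f Z"
proof -
  define C where "C = sqrt (\<Sum>i<k. \<Sum>j<k. \<bar>cov i j\<bar>)"
  have C: "C \<ge> 0" by (simp add: C_def sum_nonneg)
  define s where "s n = (\<Sum>j<k. L2_norm lborel (\<lambda>u. skern (xs n) j u - f j u))" for n
  have "s \<longlonglongrightarrow> (\<Sum>j<k. 0)"
    unfolding s_def using lim by (intro tendsto_sum) (auto simp: L2_tendsto_iff)
  then have s0: "s \<longlonglongrightarrow> 0" by simp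
  have f: "square_integrable lborel (f j)" if "j < k" for j using lim[OF that] by (simp add: L2_tendsto_iff)
  have le: "L2_norm M (\<lambda>\<omega>. svar (xs m) \<omega> - svar (xs n) \<omega>) \<le> C * (s m + s n)" for m n
  proof -
    have "L2_norm M (\<lambda>\<omega>. svar (xs m) \<omega> - svar (xs n) \<omega>) \<le> C * (\<Sum>j<k. L2_norm lborel (\<lambda>u. skern (xs m) j u - skern (xs n) j u))"
      unfolding C_def by (intro wint_norm_le wint_diff wint_svar valid)
    also have "\<dots> \<le> C * (\<Sum>j<k. L2_norm lborel (\<lambda>u. skern (xs m) j u - f j u) + L2_norm lborel (\<lambda>u. skern (xs n) j u - f j u))"
    proof (intro mult_left_mono sum_mono C)
      fix j assume "j \<in> {..<k}"
      then show "L2_norm lborel (\<lambda>u. skern (xs m) j u - skern (xs n) j u) \<le>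
          L2_norm lborel (\<lambda>u. skern (xs m) j u - f j u) + L2_norm lborel (\<lambda>u. skern (xs n) j u - f j u)"
        using L2_norm_triangle_diff[OF skern_square_integrable f skern_square_integrable, of j "xs m" j "xs n" j]
        by (simp add: L2_norm_minus_commute[of _ "f j"])
    qed
    finally show ?thesis by (simp add: s_def sum.distrib)
  qed
  have "\<exists>N. \<forall>m\<ge>N. \<forall>n\<ge>N. (\<integral>\<omega>. (norm (svar (xs m) \<omega> - svar (xs n) \<omega>))\<^sup>2 \<partial>M) < e" if e: "e > 0" for e
  proof -
    \<comment> \<open>C + 1 in place of C keeps the quotient meaningful and the estimate strict when
      C = 0.\<close>
    define d where "d = sqrt e / (2 * (C + 1))"
    have d: "d > 0" unfolding d_def using e C by simp
    from order_tendstoD(2)[OF s0 this] obtain N where N: "\<And>n. n \<ge> N \<Longrightarrow> s n < d"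
      unfolding eventually_sequentially by blast
    have "(\<integral>\<omega>. (norm (svar (xs m) \<omega> - svar (xs n) \<omega>))\<^sup>2 \<partial>M) < e" if "m \<ge> N" "n \<ge> N" for m n
    proof -
      have "L2_norm M (\<lambda>\<omega>. svar (xs m) \<omega> - svar (xs n) \<omega>) \<le> C * (s m + s n)" by (rule le)
      also have "\<dots> \<le> C * (2 * d)" using N[OF that(1)] N[OF that(2)] C by (intro mult_left_mono) auto
      also have "\<dots> < (C + 1) * (2 * d)" using d by (intro mult_strict_right_mono) auto
      also have "\<dots> = sqrt e" using C by (simp add: d_def field_simps)
      finally have "(L2_norm M (\<lambda>\<omega>. svar (xs m) \<omega> - svar (xs n) \<omega>))\<^sup>2 < (sqrt e)\<^sup>2"
        by (intro power_strict_mono) auto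
      then show ?thesis using e unfolding L2_norm_power2 by simp
    qed
    then show ?thesis by blast
  qed
  then obtain Z where "L2_tendsto M (\<lambda>n. svar (xs n)) Z sequentially"
    by (rule L2_complete[OF svar_square_integrable[OF valid]])
  then have "wint f Z" unfolding wint_def using valid lim by blast
  then show ?thesis ..
qed

end

section \<open>The matrix exponential\<close>

lemma pow_smult_mat:
  fixes A :: "'a::comm_ring_1 mat"
  assumes "A \<in> carrier_mat n n"
  shows "(c \<cdot>\<^sub>m A) ^\<^sub>m m = c ^ m \<cdot>\<^sub>m (A ^\<^sub>m m)"
proof (induction m)
  case 0
  then show ?case using assms by (intro eq_matI) auto
next
  case (Suc m)
  have P: "A ^\<^sub>m m \<in> carrier_mat n n" using assms by (rule pow_carrier_mat)
  have "(c \<cdot>\<^sub>m A) ^\<^sub>m Suc m = (c ^ m \<cdot>\<^sub>m A ^\<^sub>m m) * (c \<cdot>\<^sub>m A)" using Suc by simp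
  also have "\<dots> = c ^ m \<cdot>\<^sub>m (A ^\<^sub>m m * (c \<cdot>\<^sub>m A))"
    using P assms by (intro mult_smult_assoc_mat) auto
  also have "A ^\<^sub>m m * (c \<cdot>\<^sub>m A) = c \<cdot>\<^sub>m (A ^\<^sub>m m * A)"
    using P assms by (intro mult_smult_distrib) auto
  finally show ?case using P assms by (intro eq_matI) (auto simp: mult.assoc)
qed

lemma index_mult_mat_sum:
  assumes "A \<in> carrier_mat n m" "B \<in> carrier_mat m l" "i < n" "j < l"
  shows "(A * B) $$ (i, j) = (\<Sum>r<m. A $$ (i, r) * B $$ (r, j))"
  using assms by (simp add: scalar_prod_def lessThan_atLeast0)

lemma index_mult_mat_vec_sum:
  assumes "A \<in> carrier_mat n m" "v \<in> carrier_vec m" "i < n"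
  shows "(A *\<^sub>v v) $ i = (\<Sum>r<m. A $$ (i, r) * v $ r)"
  using assms by (simp add: scalar_prod_def lessThan_atLeast0)

locale square_mat =
  fixes A :: "real mat" and n :: nat
  assumes carrier: "A \<in> carrier_mat n n"
begin

lemma pow_carrier: "A ^\<^sub>m m \<in> carrier_mat n n"
  using carrier by (rule pow_carrier_mat)

text \<open>A crude matrix norm. The entries of \<open>A ^ m\<close> are bounded by
  \<open>cA ^ m\<close> and those of the exponential of s A by \<open>exp (cA |s|)\<close>; it later
  serves as the threshold for the exponents of the test variables.\<close>

definition cA :: real where
  "cA = (\<Sum>i<n. \<Sum>j<n. \<bar>A $$ (i, j)\<bar>)"

lemma cA_nonneg: "cA \<ge> 0"
  by (simp add: cA_def sum_nonneg)

lemma pow_Suc_left: "i < n \<Longrightarrow> j < n \<Longrightarrow> (A ^\<^sub>m Suc m) $$ (i, j) = (\<Sum>l<n. A $$ (i, l) * (A ^\<^sub>m m) $$ (l, j))"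
proof -
  have "A ^\<^sub>m Suc m = A * A ^\<^sub>m m"
  proof (induction m)
    case 0
    then show ?case using carrier by simp
  next
    case (Suc m)
    have "A ^\<^sub>m Suc (Suc m) = (A * A ^\<^sub>m m) * A" using Suc by simp
    also have "\<dots> = A * (A ^\<^sub>m m * A)" using carrier pow_carrier by (intro assoc_mult_mat) auto
    finally show ?case by simp
  qed
  then show "(A ^\<^sub>m Suc m) $$ (i, j) = (\<Sum>l<n. A $$ (i, l) * (A ^\<^sub>m m) $$ (l, j))" if "i < n" "j < n"
    using index_mult_mat_sum[OF carrier pow_carrier that, of m] by simp
qed

lemma pow_Suc_right: "i < n \<Longrightarrow> j < n \<Longrightarrow> (A ^\<^sub>m Suc m) $$ (i, j) = (\<Sum>l<n. (A ^\<^sub>m m) $$ (i, l) * A $$ (l, j))"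
  using index_mult_mat_sum[OF pow_carrier carrier, of i j m] by simp

lemma pow_entry_le: "i < n \<Longrightarrow> j < n \<Longrightarrow> \<bar>(A ^\<^sub>m m) $$ (i, j)\<bar> \<le> cA ^ m"
proof (induction m arbitrary: j)
  case 0
  then show ?case using carrier by simp
next
  case (Suc m)
  have "\<bar>(A ^\<^sub>m Suc m) $$ (i, j)\<bar> \<le> (\<Sum>l<n. \<bar>(A ^\<^sub>m m) $$ (i, l)\<bar> * \<bar>A $$ (l, j)\<bar>)"
    unfolding pow_Suc_right[OF Suc.prems] abs_mult[symmetric] by (rule sum_abs)
  also have "\<dots> \<le> (\<Sum>l<n. cA ^ m * \<bar>A $$ (l, j)\<bar>)"
    using Suc by (intro sum_mono mult_right_mono) auto
  also have "\<dots> = cA ^ m * (\<Sum>l<n. \<bar>A $$ (l, j)\<bar>)" by (simp add: sum_distrib_left)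
  also have "\<dots> \<le> cA ^ m * cA"
  proof (intro mult_left_mono)
    show "(\<Sum>l<n. \<bar>A $$ (l, j)\<bar>) \<le> cA"
      unfolding cA_def using Suc.prems by (intro sum_mono member_le_sum) auto
  qed (use cA_nonneg in simp)
  finally show ?case by (simp add: mult.commute)
qed

text \<open>The entry (i, j) of the exponential of s A, written as a scalar power series so that
  termwise differentiation in s is available.\<close>

definition ex :: "real \<Rightarrow> nat \<Rightarrow> nat \<Rightarrow> real" where
  "ex s i j = (\<Sum>m. (A ^\<^sub>m m) $$ (i, j) / fact m * s ^ m)"

lemma ex_abs_summable:
  assumes "i < n" "j < n"
  shows "summable (\<lambda>m. \<bar>(A ^\<^sub>m m) $$ (i, j) / fact m * s ^ m\<bar>)"
    and "(\<Sum>m. \<bar>(A ^\<^sub>m m) $$ (i, j) / fact m * s ^ m\<bar>) \<le> exp (cA * \<bar>s\<bar>)"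
proof -
  have sums: "(\<lambda>m. (cA * \<bar>s\<bar>) ^ m / fact m) sums exp (cA * \<bar>s\<bar>)"
    using exp_converges[of "cA * \<bar>s\<bar>"] by (simp add: field_simps)
  have le: "\<bar>(A ^\<^sub>m m) $$ (i, j) / fact m * s ^ m\<bar> \<le> (cA * \<bar>s\<bar>) ^ m / fact m" for m
    using pow_entry_le[OF assms, of m]
    by (auto simp: abs_mult power_abs power_mult_distrib intro!: divide_right_mono mult_right_mono)
  show s: "summable (\<lambda>m. \<bar>(A ^\<^sub>m m) $$ (i, j) / fact m * s ^ m\<bar>)"
    by (rule summable_comparison_test'[OF sums_summable[OF sums]]) (use le in simp)
  show "(\<Sum>m. \<bar>(A ^\<^sub>m m) $$ (i, j) / fact m * s ^ m\<bar>) \<le> exp (cA * \<bar>s\<bar>)"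
    using suminf_le[OF le s sums_summable[OF sums]] sums_unique[OF sums] by simp
qed

lemma ex_summable: "i < n \<Longrightarrow> j < n \<Longrightarrow> summable (\<lambda>m. (A ^\<^sub>m m) $$ (i, j) / fact m * s ^ m)"
  using summable_rabs_cancel[OF ex_abs_summable(1)] .

lemma ex_le: "i < n \<Longrightarrow> j < n \<Longrightarrow> \<bar>ex s i j\<bar> \<le> exp (cA * \<bar>s\<bar>)"
  unfolding ex_def using summable_rabs[OF ex_abs_summable(1)] ex_abs_summable(2) by (rule order_trans)

lemma mat_exp_entry: "i < n \<Longrightarrow> j < n \<Longrightarrow> mat_exp (s \<cdot>\<^sub>m A) $$ (i, j) = ex s i j"
  using carrier pow_carrier by (simp add: mat_exp_def pow_smult_mat[OF carrier] ex_def carrier_matD mult.commute)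

lemma ex_0: "i < n \<Longrightarrow> j < n \<Longrightarrow> ex 0 i j = (if i = j then 1 else 0)"
  unfolding ex_def using powser_zero[of "\<lambda>m. (A ^\<^sub>m m) $$ (i, j) / fact m"] carrier by simp

lemma ex_deriv_diffs:
  assumes "i < n" "j < n"
  shows "((\<lambda>s. ex s i j) has_real_derivative (\<Sum>m. (A ^\<^sub>m Suc m) $$ (i, j) / fact m * s ^ m)) (at s)"
proof -
  have "diffs (\<lambda>m. (A ^\<^sub>m m) $$ (i, j) / fact m) m = (A ^\<^sub>m Suc m) $$ (i, j) / fact m" for m
    by (simp add: diffs_def field_simps del: of_nat_Suc pow_mat.simps)
  then show ?thesis
    using termdiffs_strong_converges_everywhere[of "\<lambda>m. (A ^\<^sub>m m) $$ (i, j) / fact m" s] ex_summable[OF assms]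
    by (simp add: ex_def[abs_def] del: pow_mat.simps)
qed

lemma ex_deriv_left:
  assumes "i < n" "j < n"
  shows "((\<lambda>s. ex s i j) has_real_derivative (\<Sum>l<n. A $$ (i, l) * ex s l j)) (at s)"
proof -
  have "(\<lambda>m. \<Sum>l<n. A $$ (i, l) * ((A ^\<^sub>m m) $$ (l, j) / fact m * s ^ m)) sums (\<Sum>l<n. A $$ (i, l) * ex s l j)"
    unfolding ex_def using assms by (intro sums_sum sums_mult summable_sums ex_summable) auto
  moreover have "(\<Sum>l<n. A $$ (i, l) * ((A ^\<^sub>m m) $$ (l, j) / fact m * s ^ m)) =
      (A ^\<^sub>m Suc m) $$ (i, j) / fact m * s ^ m" for m
    by (simp add: pow_Suc_left[OF assms] sum_divide_distrib sum_distrib_right mult.assoc del: pow_mat.simps)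
  ultimately show ?thesis using ex_deriv_diffs[OF assms, of s] by (simp add: sums_iff del: pow_mat.simps)
qed

lemma ex_deriv_right:
  assumes "i < n" "j < n"
  shows "((\<lambda>s. ex s i j) has_real_derivative (\<Sum>l<n. ex s i l * A $$ (l, j))) (at s)"
proof -
  have "(\<lambda>m. \<Sum>l<n. (A ^\<^sub>m m) $$ (i, l) / fact m * s ^ m * A $$ (l, j)) sums (\<Sum>l<n. ex s i l * A $$ (l, j))"
    unfolding ex_def using assms by (intro sums_sum sums_mult2 summable_sums ex_summable) auto
  moreover have "(\<Sum>l<n. (A ^\<^sub>m m) $$ (i, l) / fact m * s ^ m * A $$ (l, j)) =
      (A ^\<^sub>m Suc m) $$ (i, j) / fact m * s ^ m" for m
    by (simp add: pow_Suc_right[OF assms] sum_divide_distrib sum_distrib_right sum_distrib_left mult_ac del: pow_mat.simps)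
  ultimately show ?thesis using ex_deriv_diffs[OF assms, of s] by (simp add: sums_iff del: pow_mat.simps)
qed

lemma ex_isCont: "i < n \<Longrightarrow> j < n \<Longrightarrow> isCont (\<lambda>s. ex s i j) s"
  using DERIV_isCont[OF ex_deriv_left] .

lemma ex_continuous_on: "i < n \<Longrightarrow> j < n \<Longrightarrow> continuous_on S (\<lambda>s. ex s i j)"
  by (simp add: continuous_at_imp_continuous_on ex_isCont)

lemma ex_measurable: "i < n \<Longrightarrow> j < n \<Longrightarrow> (\<lambda>s. ex s i j) \<in> borel_measurable borel"
  by (intro borel_measurable_continuous_onI ex_continuous_on)

text \<open>The product of the exponentials of (s + t - v) A and v A has derivative 0 in v: the left
  and the right form of the derivative cancel. Comparing v = 0 with v = t gives the claim.\<close>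

lemma ex_semigroup:
  assumes "i < n" "j < n"
  shows "ex (s + t) i j = (\<Sum>l<n. ex s i l * ex t l j)"
proof -
  define \<phi> where "\<phi> v = (\<Sum>l<n. ex (s + t - v) i l * ex v l j)" for v
  have "(\<phi> has_real_derivative 0) (at v)" for v
  proof -
    have "((\<lambda>v. ex (s + t - v) i l) has_real_derivative - (\<Sum>r<n. ex (s + t - v) i r * A $$ (r, l))) (at v)"
      if "l < n" for l
    proof -
      have "((\<lambda>v. s + t - v) has_real_derivative -1) (at v)" by (auto intro!: derivative_eq_intros)
      from DERIV_chain2[OF ex_deriv_right[OF assms(1) that] this] show ?thesis by simp
    qed
    then have "(\<phi> has_real_derivative
       (\<Sum>l<n. ex (s + t - v) i l * (\<Sum>r<n. A $$ (l, r) * ex v r j) +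
         (- (\<Sum>r<n. ex (s + t - v) i r * A $$ (r, l))) * ex v l j)) (at v)"
      unfolding \<phi>_def[abs_def] using ex_deriv_left[OF _ assms(2)]
      by (intro DERIV_sum DERIV_mult') auto
    also have "(\<Sum>l<n. ex (s + t - v) i l * (\<Sum>r<n. A $$ (l, r) * ex v r j) +
         (- (\<Sum>r<n. ex (s + t - v) i r * A $$ (r, l))) * ex v l j) =
       (\<Sum>l<n. \<Sum>r<n. ex (s + t - v) i l * A $$ (l, r) * ex v r j) -
       (\<Sum>l<n. \<Sum>r<n. ex (s + t - v) i r * A $$ (r, l) * ex v l j)"
      by (simp add: sum_subtractf sum_distrib_left sum_distrib_right mult.assoc)
    also have "\<dots> = 0" by (subst sum.swap) simp
    finally show ?thesis .
  qed
  then have "\<phi> 0 = \<phi> t" by (intro DERIV_isconst_all) auto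
  moreover have "\<phi> t = (\<Sum>l<n. ex s i l * ex t l j)" by (simp add: \<phi>_def)
  moreover have "\<phi> 0 = ex (s + t) i j"
  proof -
    have "\<phi> 0 = (\<Sum>l<n. if l = j then ex (s + t) i l else 0)"
      unfolding \<phi>_def by (intro sum.cong) (auto simp: ex_0 assms)
    then show ?thesis using assms by simp
  qed
  ultimately show ?thesis by simp
qed

text \<open>For exponent 0 continuity from the right at h = 0 suffices. Differentiating on the open
  interval replaces the row w by w A, which is the induction step; the hypothesis is therefore kept
  on an open interval.\<close>

lemma ex_form_zero_imp_pow:
  assumes "\<And>h. 0 < h \<Longrightarrow> h < 1 \<Longrightarrow> (\<Sum>i<n. \<Sum>j<n. w i * ex h i j * z j) = 0"
  shows "(\<Sum>i<n. \<Sum>j<n. w i * (A ^\<^sub>m \<alpha>) $$ (i, j) * z j) = 0"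
  using assms
proof (induction \<alpha> arbitrary: w)
  case 0
  define f where "f h = (\<Sum>i<n. \<Sum>j<n. w i * ex h i j * z j)" for h
  have "isCont f 0"
    unfolding f_def[abs_def] by (intro continuous_intros ex_isCont) auto
  then have "(f \<longlongrightarrow> f 0) (at_right 0)"
    by (simp add: isCont_def filterlim_at_split)
  moreover have "(f \<longlongrightarrow> 0) (at_right 0)"
  proof (rule Lim_transform_eventually[OF tendsto_const])
    show "\<forall>\<^sub>F h in at_right 0. 0 = f h"
      unfolding eventually_at_right_field using 0 by (intro exI[of _ 1]) (auto simp: f_def)
  qed
  ultimately have "f 0 = 0" by (intro tendsto_unique[of "at_right (0::real)"]) auto
  then show ?case using carrier by (simp add: f_def ex_0)
next
  case (Suc \<alpha>)
  define f where "f h = (\<Sum>i<n. \<Sum>j<n. w i * ex h i j * z j)" for h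
  define w' where "w' l = (\<Sum>i<n. w i * A $$ (i, l))" for l
  have "(\<Sum>i<n. \<Sum>j<n. w' i * ex h i j * z j) = 0" if h: "0 < h" "h < 1" for h
  proof -
    have "(f has_real_derivative (\<Sum>i<n. \<Sum>j<n. w i * (\<Sum>l<n. A $$ (i, l) * ex h l j) * z j)) (at h)"
      unfolding f_def[abs_def] by (intro DERIV_sum DERIV_cmult DERIV_cmult_right ex_deriv_left) auto
    moreover have "(f has_real_derivative 0) (at h)"
      by (rule has_field_derivative_transform_within_open[of "\<lambda>h. 0" _ _ "{0<..<1}"])
        (use Suc.prems h in \<open>auto simp: f_def\<close>)
    ultimately have "0 = (\<Sum>i<n. \<Sum>j<n. w i * (\<Sum>l<n. A $$ (i, l) * ex h l j) * z j)"
      using DERIV_unique by blast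
    also have "\<dots> = (\<Sum>i<n. \<Sum>j<n. \<Sum>l<n. w i * A $$ (i, l) * ex h l j * z j)"
      by (simp add: sum_distrib_left sum_distrib_right mult.assoc)
    also have "\<dots> = (\<Sum>i<n. \<Sum>l<n. \<Sum>j<n. w i * A $$ (i, l) * ex h l j * z j)"
      by (intro sum.cong refl sum.swap)
    also have "\<dots> = (\<Sum>l<n. \<Sum>i<n. \<Sum>j<n. w i * A $$ (i, l) * ex h l j * z j)"
      by (rule sum.swap)
    also have "\<dots> = (\<Sum>l<n. \<Sum>j<n. \<Sum>i<n. w i * A $$ (i, l) * ex h l j * z j)"
      by (intro sum.cong refl sum.swap)
    also have "\<dots> = (\<Sum>i<n. \<Sum>j<n. w' i * ex h i j * z j)"
      by (simp add: w'_def sum_distrib_right)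
    finally show ?thesis by simp
  qed
  from Suc.IH[OF this] have "0 = (\<Sum>l<n. \<Sum>j<n. w' l * (A ^\<^sub>m \<alpha>) $$ (l, j) * z j)" by simp
  also have "\<dots> = (\<Sum>l<n. \<Sum>j<n. \<Sum>i<n. w i * A $$ (i, l) * (A ^\<^sub>m \<alpha>) $$ (l, j) * z j)"
    by (simp add: w'_def sum_distrib_right)
  also have "\<dots> = (\<Sum>l<n. \<Sum>i<n. \<Sum>j<n. w i * A $$ (i, l) * (A ^\<^sub>m \<alpha>) $$ (l, j) * z j)"
    by (intro sum.cong refl sum.swap)
  also have "\<dots> = (\<Sum>i<n. \<Sum>l<n. \<Sum>j<n. w i * A $$ (i, l) * (A ^\<^sub>m \<alpha>) $$ (l, j) * z j)"
    by (rule sum.swap)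
  also have "\<dots> = (\<Sum>i<n. \<Sum>j<n. \<Sum>l<n. w i * A $$ (i, l) * (A ^\<^sub>m \<alpha>) $$ (l, j) * z j)"
    by (intro sum.cong refl sum.swap)
  also have "\<dots> = (\<Sum>i<n. \<Sum>j<n. w i * (A ^\<^sub>m Suc \<alpha>) $$ (i, j) * z j)"
    by (simp add: pow_Suc_left sum_distrib_left sum_distrib_right mult.assoc del: pow_mat.simps)
  finally show ?case by simp
qed

lemma pow_zero_imp_ex_form:
  assumes "\<And>\<alpha>. (\<Sum>i<n. \<Sum>j<n. w i * (A ^\<^sub>m \<alpha>) $$ (i, j) * z j) = 0"
  shows "(\<Sum>i<n. \<Sum>j<n. w i * ex h i j * z j) = 0"
proof -
  have "(\<lambda>m. \<Sum>i<n. \<Sum>j<n. w i * ((A ^\<^sub>m m) $$ (i, j) / fact m * h ^ m) * z j) sums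
      (\<Sum>i<n. \<Sum>j<n. w i * ex h i j * z j)"
    unfolding ex_def
    by (intro sums_sum sums_mult sums_mult2 summable_sums ex_summable) auto
  moreover have "(\<Sum>i<n. \<Sum>j<n. w i * ((A ^\<^sub>m m) $$ (i, j) / fact m * h ^ m) * z j) = 0" for m
  proof -
    have "(\<Sum>i<n. \<Sum>j<n. w i * ((A ^\<^sub>m m) $$ (i, j) / fact m * h ^ m) * z j) =
       (h ^ m / fact m) * (\<Sum>i<n. \<Sum>j<n. w i * (A ^\<^sub>m m) $$ (i, j) * z j)"
      by (simp add: sum_distrib_left mult_ac)
    then show ?thesis using assms[of m] by simp
  qed
  ultimately show ?thesis by (simp add: sums_iff)
qed

end

section \<open>The state process\<close>

lemma nat_eq_iff_div_mod: "(a::nat) = b \<longleftrightarrow> a div k = b div k \<and> a mod k = b mod k"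
  by (metis div_mult_mod_eq)

lemma bfA_carrier: "bfA k p A \<in> carrier_mat (k * p) (k * p)"
  by (simp add: bfA_def block_mat_def)

lemma div_lt_pred_iff: "k > 0 \<Longrightarrow> i div k < p - 1 \<longleftrightarrow> i < k * (p - 1)" for i k p :: nat
  by (simp add: div_less_iff_less_mult mult.commute)

lemma bfA_shift_row:
  assumes "k > 0" "i < k * (p - 1)" "l < k * p"
  shows "bfA k p A $$ (i, l) = (if l = i + k then 1 else 0)"
proof -
  have i: "i div k < p - 1" using div_lt_pred_iff[OF assms(1)] assms(2) by blast
  have "i < k * p" using assms(2) by (meson diff_le_self less_le_trans mult_le_mono2)
  moreover have "l = i + k \<longleftrightarrow> l div k = i div k + 1 \<and> l mod k = i mod k"
    using assms(1) nat_eq_iff_div_mod[of l "i + k" k] by simp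
  ultimately show ?thesis using assms i
    by (auto simp: bfA_def block_mat_def)
qed

lemma bfB_entry:
  assumes "k > 0" "p > 0" "l < k * p" "c < k"
  shows "bfB k p $$ (l, c) = (if l = k * (p - 1) + c then 1 else 0)"
proof -
  have "l div k < p" using assms by (simp add: div_less_iff_less_mult mult.commute)
  have "l = k * (p - 1) + c \<longleftrightarrow> l div k = p - 1 \<and> l mod k = c"
    using assms nat_eq_iff_div_mod[of l "k * (p - 1) + c" k] by simp
  then show ?thesis using assms by (auto simp: bfB_def block_mat_def)
qed

locale levy_state = centered_levy M k L
  for M :: "'w measure" and k :: nat and L :: "real \<Rightarrow> 'w \<Rightarrow> real vec" +
  fixes p :: nat and A :: "nat \<Rightarrow> real mat" and X :: "real \<Rightarrow> 'w \<Rightarrow> real vec"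
  assumes k0: "k > 0" and p0: "p > 0" and state: "state_process M k p A L X"
begin

sublocale square_mat "bfA k p A" "k * p"
  by unfold_locales (rule bfA_carrier)

text \<open>The row of the single 1 in column c of the block column B.\<close>

definition last_block :: "nat \<Rightarrow> nat" where
  "last_block c = k * (p - 1) + c"

lemma last_block_less: "c < k \<Longrightarrow> last_block c < k * p"
  unfolding last_block_def using p0 by (cases p) auto

text \<open>The causal kernel: entry (i, c) of \<open>exp (s A) B\<close> for nonnegative lag s and
  0 for negative lag. It includes s = 0, where rows of the last block may jump.\<close>

definition K :: "nat \<Rightarrow> nat \<Rightarrow> real \<Rightarrow> real" where
  "K i c s = (if s \<ge> 0 then ex s i (last_block c) else 0)"

definition Xc :: "nat \<Rightarrow> real \<Rightarrow> 'w \<Rightarrow> real" where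
  "Xc i t \<omega> = X t \<omega> $ i"

lemma kernel_entry:
  assumes "i < k * p" "c < k"
  shows "(mat_exp (s \<cdot>\<^sub>m bfA k p A) * bfB k p) $$ (i, c) = ex s i (last_block c)"
proof -
  have E: "mat_exp (s \<cdot>\<^sub>m bfA k p A) \<in> carrier_mat (k * p) (k * p)"
    using carrier by (simp add: mat_exp_def)
  have B: "bfB k p \<in> carrier_mat (k * p) k" by (simp add: bfB_def block_mat_def)
  have "(mat_exp (s \<cdot>\<^sub>m bfA k p A) * bfB k p) $$ (i, c) = (\<Sum>l<k*p. ex s i l * bfB k p $$ (l, c))"
    using assms by (simp add: index_mult_mat_sum[OF E B] mat_exp_entry)
  also have "\<dots> = (\<Sum>l<k*p. if l = last_block c then ex s i l else 0)"
    using assms k0 p0 by (intro sum.cong) (auto simp: bfB_entry last_block_def)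
  finally show ?thesis using last_block_less[OF assms(2)] by simp
qed

lemma Xc_measurable: "i < k * p \<Longrightarrow> Xc i t \<in> borel_measurable M"
  using state unfolding state_process_def rand_vec_def Xc_def[abs_def] by blast

lemma wint_X:
  assumes i: "i < k * p"
  shows "wint (\<lambda>c u. K i c (t - u)) (Xc i t)"
proof -
  define f where "f j u = indicator {..t} u * (mat_exp ((t - u) \<cdot>\<^sub>m bfA k p A) * bfB k p) $$ (i, j)" for j u
  obtain I where I: "\<And>j. j < k \<Longrightarrow> has_levy_integral M L j (f j) (I j)"
    and ae: "AE \<omega> in M. X t \<omega> $ i = (\<Sum>j<k. I j \<omega>)"
    using state i unfolding state_process_def f_def by blast
  have "wint (\<lambda>c u. \<Sum>j<k. if c = j then f j u else 0) (\<lambda>\<omega>. \<Sum>j<k. I j \<omega>)"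
    using I by (intro wint_sum wint_of_levy_integral) auto
  then have "wint (\<lambda>c u. K i c (t - u)) (\<lambda>\<omega>. \<Sum>j<k. I j \<omega>)"
    by (rule wint_cong) (use i in \<open>auto simp: f_def K_def kernel_entry\<close>)
  then show ?thesis
    by (rule wint_cong_AE) (use ae Xc_measurable[OF i] in \<open>auto simp: Xc_def\<close>)
qed

lemma Xc_square_integrable: "i < k * p \<Longrightarrow> square_integrable M (Xc i t)"
  using wint_square_integrable(1)[OF wint_X] .

text \<open>Square integrability of the kernel comes with the step approximation that defines the
  stochastic integral.\<close>

lemma K_square_integrable: "i < k * p \<Longrightarrow> c < k \<Longrightarrow> square_integrable lborel (\<lambda>u. K i c (t - u))"
  using wint_square_integrable(2)[OF wint_X] .

definition CK :: real where
  "CK = exp cA"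

lemma CK_ge_1: "CK \<ge> 1"
  using cA_nonneg by (simp add: CK_def)

lemma ex_le_CK: "i < k * p \<Longrightarrow> j < k * p \<Longrightarrow> \<bar>v\<bar> \<le> 1 \<Longrightarrow> \<bar>ex v i j\<bar> \<le> CK"
  using order_trans[OF ex_le, of i j v CK] cA_nonneg mult_left_mono[of "\<bar>v\<bar>" 1 cA] by (simp add: CK_def)

text \<open>Dominates the kernel and its difference quotients near s, and is square integrable because
  \<open>exp ((s + v) A) = exp (v A) exp (s A)\<close>.\<close>

definition dom :: "nat \<Rightarrow> real \<Rightarrow> real" where
  "dom c s = CK * ((\<Sum>l<k*p. \<bar>K l c s\<bar>) + indicator {-1..0} s)"

lemma dom_nonneg: "dom c s \<ge> 0"
  using CK_ge_1 by (simp add: dom_def sum_nonneg)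

lemma dom_square_integrable:
  assumes "c < k"
  shows "square_integrable lborel (\<lambda>u. dom c (t - u))"
proof -
  have eq: "(indicator {-1..0} (t - u) :: real) = indicator {t..t+1} u" for u
    by (auto simp: indicator_def)
  have "square_integrable lborel (indicator {t..t+1} :: real \<Rightarrow> real)"
  proof -
    have "(\<lambda>u. (norm (indicator {t..t+1} u :: real))\<^sup>2) = indicator {t..t+1}"
      by (auto simp: indicator_def)
    then show ?thesis by (simp add: square_integrable_def)
  qed
  moreover have "square_integrable lborel (\<lambda>u. \<bar>K l c (t - u)\<bar>)" if "l < k * p" for l
    using square_integrable_norm[OF K_square_integrable[OF that assms]] by simp
  ultimately show ?thesis unfolding dom_def eq
    by (intro square_integrable_mult square_integrable_add square_integrable_sum) auto
qed

lemma ex_shift_le: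
  assumes "i < k * p" "c < k" "s \<ge> -1" "\<bar>v\<bar> \<le> 1"
  shows "\<bar>ex (max s 0 + v) i (last_block c)\<bar> \<le> dom c s"
proof -
  have "\<bar>ex (max s 0 + v) i (last_block c)\<bar> = \<bar>\<Sum>l<k*p. ex v i l * ex (max s 0) l (last_block c)\<bar>"
    using ex_semigroup[of i "last_block c" v "max s 0"] assms last_block_less by (simp add: add.commute)
  also have "\<dots> \<le> (\<Sum>l<k*p. \<bar>ex v i l\<bar> * \<bar>ex (max s 0) l (last_block c)\<bar>)"
    unfolding abs_mult[symmetric] by (rule sum_abs)
  also have "\<dots> \<le> (\<Sum>l<k*p. CK * \<bar>ex (max s 0) l (last_block c)\<bar>)"
    using assms by (intro sum_mono mult_right_mono ex_le_CK) auto
  also have "\<dots> = CK * (\<Sum>l<k*p. \<bar>ex (max s 0) l (last_block c)\<bar>)" by (simp add: sum_distrib_left)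
  also have "\<dots> \<le> dom c s"
  proof (cases "s \<ge> 0")
    case True
    then show ?thesis using CK_ge_1 by (auto simp: dom_def K_def max_def intro!: mult_left_mono)
  next
    case False
    \<comment> \<open>For s between -1 and 0 the exponential is evaluated at 0, where its column is
      a unit vector with absolute sum 1. The indicator in \<open>dom\<close> accounts for exactly
      this window.\<close>
    have "(\<Sum>l<k*p. \<bar>ex 0 l (last_block c)\<bar>) = (\<Sum>l<k*p. if l = last_block c then 1 else 0)"
      using last_block_less assms by (intro sum.cong) (auto simp: ex_0)
    then have "(\<Sum>l<k*p. \<bar>ex (max s 0) l (last_block c)\<bar>) = 1"
      using False last_block_less[OF assms(2)] by (simp add: max_def)
    then show ?thesis using False assms CK_ge_1 by (simp add: dom_def K_def)
  qed
  finally show ?thesis .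
qed

lemma K_shift_le:
  assumes "i < k * p" "c < k" "\<bar>h\<bar> \<le> 1"
  shows "\<bar>K i c (s + h)\<bar> \<le> dom c s"
proof (cases "s + h \<ge> 0")
  case True
  show ?thesis
  proof (cases "s \<ge> 0")
    case True
    then show ?thesis using ex_shift_le[OF assms(1,2), of s h] assms \<open>s + h \<ge> 0\<close> by (simp add: K_def max_def)
  next
    case False
    then show ?thesis using ex_shift_le[OF assms(1,2), of s "s + h"] assms \<open>s + h \<ge> 0\<close> by (simp add: K_def max_def)
  qed
qed (simp add: K_def dom_nonneg)

lemma K_le_dom: "i < k * p \<Longrightarrow> c < k \<Longrightarrow> \<bar>K i c s\<bar> \<le> dom c s"
  using K_shift_le[of i c 0 s] by simp

lemma k_shift_less: "i < k * (p - 1) \<Longrightarrow> i < k * p \<and> i + k < k * p"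
  using p0 by (cases p) auto

lemma ex_deriv_shift:
  assumes "i < k * (p - 1)" "j < k * p"
  shows "((\<lambda>s. ex s i j) has_real_derivative ex s (i + k) j) (at s)"
proof -
  note lt = k_shift_less[OF assms(1)]
  have "(\<Sum>l<k*p. bfA k p A $$ (i, l) * ex s l j) = (\<Sum>l<k*p. if l = i + k then ex s l j else 0)"
    using assms k0 by (intro sum.cong) (auto simp: bfA_shift_row)
  then show ?thesis using ex_deriv_left[of i j s] lt assms by simp
qed

lemma K_quotient_le:
  assumes "i < k * (p - 1)" "c < k" "\<bar>h\<bar> \<le> 1" "h \<noteq> 0"
  shows "\<bar>(K i c (s + h) - K i c s) / h\<bar> \<le> dom c s"
proof -
  note lt = k_shift_less[OF assms(1)]
  \<comment> \<open>Outside the last block the kernel vanishes at lag 0, so it is the continuous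
    function s to \<open>ex (max s 0)\<close>, and the mean value estimate may be carried across the
    origin.\<close>
  have "i \<noteq> last_block c" using assms(1) by (simp add: last_block_def)
  then have K: "K i c x = ex (max x 0) i (last_block c)" for x
    using ex_0[OF conjunct1[OF lt] last_block_less[OF assms(2)]] by (cases "x \<ge> 0") (simp_all add: K_def max_def)
  have "\<bar>K i c (s + h) - K i c s\<bar> \<le> dom c s * \<bar>h\<bar>"
  proof (cases "s \<ge> -1")
    case True
    have "norm (ex (max (s + h) 0) i (last_block c) - ex (max s 0) i (last_block c)) \<le> dom c s * norm (max (s + h) 0 - max s 0)"
    proof (rule field_differentiable_bound[where S="closed_segment (max s 0) (max (s + h) 0)"
          and f="\<lambda>x. ex x i (last_block c)" and f'="\<lambda>x. ex x (i + k) (last_block c)"])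
      fix x assume x: "x \<in> closed_segment (max s 0) (max (s + h) 0)"
      show "((\<lambda>x. ex x i (last_block c)) has_real_derivative ex x (i + k) (last_block c))
          (at x within closed_segment (max s 0) (max (s + h) 0))"
        by (rule has_field_derivative_at_within[OF ex_deriv_shift[OF assms(1) last_block_less[OF assms(2)]]])
      have "\<bar>x - max s 0\<bar> \<le> \<bar>max (s + h) 0 - max s 0\<bar>"
        using x unfolding closed_segment_eq_real_ivl by (auto split: if_splits)
      also have "\<dots> \<le> 1" using assms(3) by linarith
      finally have "\<bar>x - max s 0\<bar> \<le> 1" .
      then show "norm (ex x (i + k) (last_block c)) \<le> dom c s"
        using ex_shift_le[of "i + k" c s "x - max s 0"] lt assms True by simp
    qed auto
    also have "\<dots> \<le> dom c s * \<bar>h\<bar>"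
      using dom_nonneg by (intro mult_left_mono) (simp_all add: max_def)
    finally show ?thesis by (simp add: K)
  next
    case False
    then have "\<not> s \<ge> 0" "\<not> s + h \<ge> 0" using assms(3) by linarith+
    then show ?thesis using dom_nonneg[of c s] by (simp add: K_def)
  qed
  then show ?thesis using assms by (simp add: abs_divide pos_divide_le_eq)
qed

text \<open>Dominated convergence for the squared differences along every sequence tending to 0;
  they are at most 4 d^2 because both functions are bounded by d.\<close>

lemma L2_tendsto_at_0_dominated:
  fixes f :: "real \<Rightarrow> real \<Rightarrow> real"
  assumes meas: "\<And>h. f h \<in> borel_measurable N" and g: "g \<in> borel_measurable N" and d: "square_integrable N d"
    and bound: "\<And>h u. h \<noteq> 0 \<Longrightarrow> \<bar>h\<bar> \<le> 1 \<Longrightarrow> \<bar>f h u\<bar> \<le> d u" "\<And>u. \<bar>g u\<bar> \<le> d u"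
    and lim: "AE u in N. ((\<lambda>h. f h u) \<longlongrightarrow> g u) (at 0)"
  shows "L2_tendsto N f g (at 0)"
proof -
  note [measurable] = meas g square_integrableD(1)[OF d]
  have si: "square_integrable N r" if "r \<in> borel_measurable N" "\<And>u. \<bar>r u\<bar> \<le> d u" for r :: "real \<Rightarrow> real"
    unfolding square_integrable_def
  proof (intro conjI that(1))
    note [measurable] = that(1)
    have "(norm (r u))\<^sup>2 \<le> (norm (d u))\<^sup>2" for u
      using that(2)[of u] by (intro power_mono) auto
    then show "integrable N (\<lambda>u. (norm (r u))\<^sup>2)"
      by (intro Bochner_Integration.integrable_bound[OF square_integrableD(2)[OF d]]) auto
  qed
  have near: "\<forall>\<^sub>F h in at 0. h \<noteq> 0 \<and> \<bar>h\<bar> \<le> (1::real)"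
    unfolding eventually_at by (rule exI[of _ 1]) (auto simp: dist_real_def)
  have "((\<lambda>h. \<integral>u. (norm (f h u - g u))\<^sup>2 \<partial>N) \<longlongrightarrow> 0) (at 0)"
    unfolding tendsto_at_iff_sequentially
  proof (intro allI impI)
    fix h :: "nat \<Rightarrow> real" assume "\<forall>i. h i \<in> UNIV - {0}" and h0: "h \<longlonglongrightarrow> 0"
    then have hn: "\<And>i. h i \<noteq> 0" by auto
    have "\<forall>\<^sub>F i in sequentially. \<bar>h i\<bar> < 1"
      using tendsto_rabs_zero[OF h0] by (rule order_tendstoD) simp
    then obtain i0 where i0: "\<And>i. i \<ge> i0 \<Longrightarrow> \<bar>h i\<bar> < 1" unfolding eventually_sequentially by blast
    \<comment> \<open>The index shift discards the finitely many h that may exceed 1 in size, for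
      which no domination is assumed.\<close>
    have "(\<lambda>i. \<integral>u. (norm (f (h (i + i0)) u - g u))\<^sup>2 \<partial>N) \<longlonglongrightarrow> (\<integral>u. 0 \<partial>N)"
    proof (rule integral_dominated_convergence[where w="\<lambda>u. 4 * (norm (d u))\<^sup>2"])
      show "integrable N (\<lambda>u. 4 * (norm (d u))\<^sup>2)" using square_integrableD(2)[OF d] by simp
      show "AE u in N. (\<lambda>i. (norm (f (h (i + i0)) u - g u))\<^sup>2) \<longlonglongrightarrow> 0"
        using lim
      proof eventually_elim
        case (elim u)
        have "filterlim (\<lambda>i. h (i + i0)) (at 0) sequentially"
          using LIMSEQ_ignore_initial_segment[OF h0, of i0] hn by (intro filterlim_atI) auto
        from filterlim_compose[OF elim this] have "(\<lambda>i. f (h (i + i0)) u) \<longlonglongrightarrow> g u" .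
        then have "(\<lambda>i. (norm (f (h (i + i0)) u - g u))\<^sup>2) \<longlonglongrightarrow> (norm (g u - g u))\<^sup>2"
          by (intro tendsto_intros)
        then show ?case by simp
      qed
      show "AE u in N. norm ((norm (f (h (i + i0)) u - g u))\<^sup>2) \<le> 4 * (norm (d u))\<^sup>2" for i
      proof (rule AE_I2)
        fix u
        have "\<bar>f (h (i + i0)) u - g u\<bar> \<le> 2 * \<bar>d u\<bar>"
          using bound(1)[of "h (i + i0)" u] bound(2)[of u] hn i0[of "i + i0"] by auto
        then have "\<bar>f (h (i + i0)) u - g u\<bar>\<^sup>2 \<le> (2 * \<bar>d u\<bar>)\<^sup>2" by (intro power_mono) auto
        then show "norm ((norm (f (h (i + i0)) u - g u))\<^sup>2) \<le> 4 * (norm (d u))\<^sup>2"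
          by (simp add: power_mult_distrib)
      qed
    qed measurable
    then have "(\<lambda>i. \<integral>u. (norm (f (h (i + i0)) u - g u))\<^sup>2 \<partial>N) \<longlonglongrightarrow> 0" by simp
    from LIMSEQ_offset[OF this]
    show "((\<lambda>h. \<integral>u. (norm (f h u - g u))\<^sup>2 \<partial>N) \<circ> h) \<longlonglongrightarrow> 0" by (simp add: comp_def)
  qed
  moreover have "\<forall>\<^sub>F h in at 0. square_integrable N (f h)"
    using near by eventually_elim (auto intro!: si meas bound)
  moreover have "square_integrable N g" by (intro si g bound)
  ultimately show ?thesis by (simp add: L2_tendsto_def)
qed

lemma K_measurable:
  assumes "i < k * p" "c < k"
  shows "K i c \<in> borel_measurable borel"
proof -
  note [measurable] = ex_measurable[OF assms(1) last_block_less[OF assms(2)]]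
  show ?thesis unfolding K_def[abs_def] by measurable
qed

lemma K_isCont:
  assumes "i < k * p" "c < k" "s \<noteq> 0"
  shows "isCont (K i c) s"
proof (cases "s > 0")
  case True
  have "isCont (\<lambda>s. ex s i (last_block c)) s" by (intro ex_isCont assms last_block_less)
  moreover have "\<forall>\<^sub>F x in nhds s. ex x i (last_block c) = K i c x"
    using eventually_nhds_in_open[of "{0<..}" s] True by (auto elim!: eventually_mono simp: K_def)
  ultimately show ?thesis using isCont_cong[of "\<lambda>s. ex s i (last_block c)" "K i c" s] by blast
next
  case False
  have "isCont (\<lambda>s. 0) s" for s :: real by simp
  moreover have "\<forall>\<^sub>F x in nhds s. 0 = K i c x"
    using eventually_nhds_in_open[of "{..<0}" s] assms False by (auto elim!: eventually_mono simp: K_def)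
  ultimately show ?thesis using isCont_cong[of "\<lambda>s. 0" "K i c" s] by blast
qed

lemma K_deriv:
  assumes "i < k * (p - 1)" "c < k" "s \<noteq> 0"
  shows "(K i c has_real_derivative K (i + k) c s) (at s)"
proof (cases "s > 0")
  case True
  show ?thesis
    by (rule has_field_derivative_transform_within_open[of "\<lambda>s. ex s i (last_block c)" _ _ "{0<..}"])
      (use True ex_deriv_shift[OF assms(1) last_block_less[OF assms(2)], of s] in \<open>auto simp: K_def\<close>)
next
  case False
  show ?thesis
    by (rule has_field_derivative_transform_within_open[of "\<lambda>s. 0" _ _ "{..<0}"])
      (use False assms in \<open>auto simp: K_def\<close>)
qed

lemma AE_lborel_diff_neq: "AE u in lborel. (t::real) - u \<noteq> 0"
  using AE_lborel_singleton[of t] by eventually_elim auto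

lemma Xc_continuous:
  assumes "i < k * p"
  shows "L2_tendsto M (\<lambda>h. Xc i (t + h)) (Xc i t) (at 0)"
proof (rule wint_tendsto[OF wint_X[OF assms] wint_X[OF assms]])
  fix c assume c: "c < k"
  note [measurable] = K_measurable[OF assms c]
  show "L2_tendsto lborel (\<lambda>h u. K i c (t + h - u)) (\<lambda>u. K i c (t - u)) (at 0)"
  proof (rule L2_tendsto_at_0_dominated[OF _ _ dom_square_integrable[OF c, of t]])
    show "\<bar>K i c (t + h - u)\<bar> \<le> dom c (t - u)" if "\<bar>h\<bar> \<le> 1" for h u
      using K_shift_le[OF assms c that, of "t - u"] by (simp add: algebra_simps)
    show "AE u in lborel. ((\<lambda>h. K i c (t + h - u)) \<longlongrightarrow> K i c (t - u)) (at 0)"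
      using AE_lborel_diff_neq[of t]
    proof eventually_elim
      case (elim u)
      have "((\<lambda>h. K i c (t - u + h)) \<longlongrightarrow> K i c (t - u)) (at 0)"
        using K_isCont[OF assms c elim] unfolding isCont_def by (rule LIM_offset_zero)
      then show ?case by (simp add: algebra_simps)
    qed
  qed (use K_le_dom[OF assms c] in auto)
qed

text \<open>Off lag 0 the kernel of row i has the kernel of row i + k as derivative, because the
  companion matrix shifts by one block. Lag 0 is the single point u = t, a null set, and
  \<open>K_quotient_le\<close> supplies the domination.\<close>

lemma Xc_derivative:
  assumes "i < k * (p - 1)"
  shows "L2_tendsto M (\<lambda>h \<omega>. (Xc i (t + h) \<omega> - Xc i t \<omega>) / h) (Xc (i + k) t) (at 0)"
proof (rule wint_tendsto)
  note lt = k_shift_less[OF assms]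
  show "wint (\<lambda>c u. (1 / h) * (K i c (t + h - u) - K i c (t - u))) (\<lambda>\<omega>. (Xc i (t + h) \<omega> - Xc i t \<omega>) / h)" for h
    using wint_mult[OF wint_diff[OF wint_X wint_X], of i i "1 / h" "t + h" t] lt by simp
  show "wint (\<lambda>c u. K (i + k) c (t - u)) (Xc (i + k) t)" using lt by (intro wint_X) auto
  fix c assume c: "c < k"
  have [measurable]: "K i c \<in> borel_measurable borel" "K (i + k) c \<in> borel_measurable borel"
    using lt c by (auto intro: K_measurable)
  have eq: "t - u + h = t + h - u" for u h :: real by simp
  show "L2_tendsto lborel (\<lambda>h u. (1 / h) * (K i c (t + h - u) - K i c (t - u))) (\<lambda>u. K (i + k) c (t - u)) (at 0)"
  proof (rule L2_tendsto_at_0_dominated[OF _ _ dom_square_integrable[OF c, of t]])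
    show "\<bar>1 / h * (K i c (t + h - u) - K i c (t - u))\<bar> \<le> dom c (t - u)" if "h \<noteq> 0" "\<bar>h\<bar> \<le> 1" for h u
      using K_quotient_le[OF assms c that(2,1), of "t - u"] unfolding eq by simp
    show "AE u in lborel. ((\<lambda>h. 1 / h * (K i c (t + h - u) - K i c (t - u))) \<longlongrightarrow> K (i + k) c (t - u)) (at 0)"
      using AE_lborel_diff_neq[of t]
    proof eventually_elim
      case (elim u)
      have "((\<lambda>h. (K i c (t - u + h) - K i c (t - u)) / h) \<longlongrightarrow> K (i + k) c (t - u)) (at 0)"
        using K_deriv[OF assms c elim] unfolding DERIV_def .
      then show ?case unfolding eq by simp
    qed
  qed (use K_le_dom[OF _ c] lt in auto)
qed

lemma wint_forecast_error:
  assumes "i < k * p"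
  shows "wint (\<lambda>c u. K i c (t + h - u) - (\<Sum>l<k*p. ex h i l * K l c (t - u)))
    (\<lambda>\<omega>. Xc i (t + h) \<omega> - (\<Sum>l<k*p. ex h i l * Xc l t \<omega>))"
  using assms by (intro wint_diff wint_sum wint_mult wint_X) auto

text \<open>By the semigroup law the forecast reproduces the kernel on the past of t exactly, so the
  error is driven by noise after t only.\<close>

lemma forecast_kernel:
  assumes "i < k * p" "c < k" "h \<ge> 0"
  shows "K i c (t + h - u) - (\<Sum>l<k*p. ex h i l * K l c (t - u)) = (if t < u then K i c (t + h - u) else 0)"
proof (cases "t < u")
  case False
  then show ?thesis
    using ex_semigroup[of i "last_block c" h "t - u"] assms last_block_less by (simp add: K_def algebra_simps)
qed (simp add: K_def)

text \<open>The kernel of the error lives after t and that of the state at time r before r, so every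
  product in the covariance form vanishes pointwise.\<close>

lemma forecast_orthogonal:
  assumes i: "i < k * p" and m: "m < k * p" and "h \<ge> 0" "r \<le> t"
  shows "expectation (\<lambda>\<omega>. (Xc i (t + h) \<omega> - (\<Sum>l<k*p. ex h i l * Xc l t \<omega>)) * Xc m r \<omega>) = 0"
proof -
  have z: "(K i c (t + h - u) - (\<Sum>l<k*p. ex h i l * K l c (t - u))) * K m d (r - u) = 0" if "c < k" for c d u
  proof (cases "t < u")
    case True
    then show ?thesis using assms(4) by (simp add: K_def)
  next
    case False
    then show ?thesis using forecast_kernel[OF i that assms(3), of t u] by simp
  qed
  have "cov_form (\<lambda>c u. K i c (t + h - u) - (\<Sum>l<k*p. ex h i l * K l c (t - u))) (\<lambda>c u. K m c (r - u)) = 0"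
    unfolding cov_form_def
  proof (intro sum.neutral ballI)
    fix c d assume "c \<in> {..<k}"
    then have "c < k" by simp
    then show "cov c d * (\<integral>u. (K i c (t + h - u) - (\<Sum>l<k*p. ex h i l * K l c (t - u))) * K m d (r - u) \<partial>lborel) = 0"
      by (simp only: z Bochner_Integration.integral_zero mult_zero_right)
  qed
  then show ?thesis using wint_inner[OF wint_forecast_error[OF i] wint_X[OF m]] by simp
qed

end

section \<open>A bound on mean-square smoothness\<close>

context levy_state
begin

lemma wint_inc:
  assumes "j < k" "s \<le> t"
  shows "wint (\<lambda>c u. if j = c then indicator {s<..t} u else 0) (inc j s t)"
proof -
  have "wint (skern [(1, s, t, j)]) (svar [(1, s, t, j)])" using assms by (intro wint_svar) simp
  moreover have "svar [(1, s, t, j)] = inc j s t" by auto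
  ultimately show ?thesis using wint_cong[of "skern [(1, s, t, j)]" "inc j s t"] by auto
qed

lemma cov_form_single_right:
  assumes "j < k"
  shows "cov_form f (\<lambda>c u. if j = c then g u else 0) = (\<Sum>c<k. cov c j * (\<integral>u. f c u * g u \<partial>lborel))"
  using assms by (subst cov_form_commute, subst cov_form_single) (auto simp: cov_sym mult.commute intro!: sum.cong)

text \<open>Tested against the increment of the noise over (t, t + h], the increment of the process is of
  order h, whereas differentiability would make it of order h times the square root of h.\<close>

lemma not_ms_differentiable:
  fixes w :: "nat \<Rightarrow> real"
  assumes j: "j < k" and \<gamma>: "(\<Sum>c<k. cov c j * w (last_block c)) \<noteq> 0"
    and D: "\<And>t \<omega>. D t \<omega> = (\<Sum>i<k*p. w i * Xc i t \<omega>)"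
    and lim: "((\<lambda>h. L2_norm M (\<lambda>\<omega>. (D (t + h) \<omega> - D t \<omega>) / h)) \<longlongrightarrow> B) (at 0)"
  shows False
proof -
  \<comment> \<open>The covariance kernel of the form D with the j-th noise component at lag s. The
    expectation below is the integral of g over lags in [0, h), and \<open>g 0\<close> is the
    quantity assumed to be nonzero.\<close>
  define g where "g s = (\<Sum>c<k. cov c j * (\<Sum>i<k*p. w i * ex s i (last_block c)))" for s
  have "g 0 = (\<Sum>c<k. cov c j * (\<Sum>i<k*p. if i = last_block c then w i else 0))"
    unfolding g_def using last_block_less by (intro sum.cong refl arg_cong2[where f="(*)"]) (auto simp: ex_0)
  also have "\<dots> = (\<Sum>c<k. cov c j * w (last_block c))"
    using last_block_less by (intro sum.cong) auto
  finally have g0: "g 0 \<noteq> 0" using \<gamma> by simp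
  have gc: "isCont g s" for s
    unfolding g_def[abs_def] using last_block_less by (intro continuous_intros ex_isCont) auto
  then have gm[measurable]: "g \<in> borel_measurable borel"
    by (intro borel_measurable_continuous_onI continuous_at_imp_continuous_on) auto
  have "\<exists>d>0. \<forall>s. \<bar>s\<bar> < d \<longrightarrow> \<bar>g s - g 0\<bar> < \<bar>g 0\<bar> / 2"
    using gc[of 0, unfolded continuous_at_eps_delta, rule_format, of "\<bar>g 0\<bar> / 2"] g0 by (simp add: dist_real_def)
  then obtain d where d: "d > 0" "\<And>s. \<bar>s\<bar> < d \<Longrightarrow> \<bar>g s - g 0\<bar> < \<bar>g 0\<bar> / 2" by blast
  have wD: "wint (\<lambda>c u. \<Sum>i<k*p. w i * K i c (t - u)) (D t)" for t
  proof -
    have "wint (\<lambda>c u. \<Sum>i<k*p. w i * K i c (t - u)) (\<lambda>\<omega>. \<Sum>i<k*p. w i * Xc i t \<omega>)"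
      by (intro wint_sum wint_mult wint_X) auto
    then show ?thesis using D by presburger
  qed
  have lower: "h * \<bar>g 0\<bar> / 2 \<le> \<bar>expectation (\<lambda>\<omega>. (D (t + h) \<omega> - D t \<omega>) * inc j t (t + h) \<omega>)\<bar>"
    if h: "0 < h" "h < d" for h
  proof -
    define I where "I = (indicator {t<..t+h} :: real \<Rightarrow> real)"
    have I: "integrable lborel I" unfolding I_def using h by (intro integrable_real_indicator) auto
    have Iint: "(\<integral>u. I u \<partial>lborel) = h" unfolding I_def using h by simp
    have fint: "integrable lborel (\<lambda>u. (\<Sum>i<k*p. w i * K i c (t + h - u)) * I u)" if "c < k" for c
      unfolding I_def
      by (intro integrable_mult_square_integrable square_integrable_indicator_Ioc wint_square_integrable(2)[OF wD that])
    have "expectation (\<lambda>\<omega>. (D (t + h) \<omega> - D t \<omega>) * inc j t (t + h) \<omega>) =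
        (\<Sum>c<k. cov c j * (\<integral>u. ((\<Sum>i<k*p. w i * K i c (t + h - u)) - (\<Sum>i<k*p. w i * K i c (t - u))) * I u \<partial>lborel))"
      using wint_inner[OF wint_diff[OF wD wD] wint_inc[OF j, of t "t + h"]] h
      by (simp add: cov_form_single_right[OF j] I_def)
    also have "\<dots> = (\<Sum>c<k. cov c j * (\<integral>u. (\<Sum>i<k*p. w i * K i c (t + h - u)) * I u \<partial>lborel))"
    proof -
      have "((\<Sum>i<k*p. w i * K i c (t + h - u)) - (\<Sum>i<k*p. w i * K i c (t - u))) * I u =
          (\<Sum>i<k*p. w i * K i c (t + h - u)) * I u" for c u
      proof (cases "t < u")
        case True
        then show ?thesis by (simp add: K_def)
      next
        case False
        then show ?thesis by (simp add: I_def)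
      qed
      then show ?thesis by (simp only:)
    qed
    also have "\<dots> = (\<integral>u. (\<Sum>c<k. cov c j * ((\<Sum>i<k*p. w i * K i c (t + h - u)) * I u)) \<partial>lborel)"
      using fint by (subst Bochner_Integration.integral_sum) auto
    also have "\<dots> = (\<integral>u. g (t + h - u) * I u \<partial>lborel)"
      by (intro Bochner_Integration.integral_cong)
        (auto simp: g_def I_def K_def indicator_def sum_distrib_right intro!: sum.cong)
    finally have E: "expectation (\<lambda>\<omega>. (D (t + h) \<omega> - D t \<omega>) * inc j t (t + h) \<omega>) = (\<integral>u. g (t + h - u) * I u \<partial>lborel)" .
    have bnd: "\<bar>(g (t + h - u) - g 0) * I u\<bar> \<le> (\<bar>g 0\<bar> / 2) * I u" for u
      using d(2)[of "t + h - u"] h by (auto simp: I_def indicator_def)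
    have i1: "integrable lborel (\<lambda>u. (g (t + h - u) - g 0) * I u)"
      by (rule Bochner_Integration.integrable_bound[of _ "\<lambda>u. (\<bar>g 0\<bar> / 2) * I u"])
        (use I bnd in \<open>auto simp: I_def abs_mult\<close>)
    have "(\<integral>u. g (t + h - u) * I u \<partial>lborel) = (\<integral>u. (g (t + h - u) - g 0) * I u + g 0 * I u \<partial>lborel)"
      by (simp add: algebra_simps)
    also have "\<dots> = (\<integral>u. (g (t + h - u) - g 0) * I u \<partial>lborel) + g 0 * h"
      using i1 I Iint by simp
    finally have eq: "(\<integral>u. g (t + h - u) * I u \<partial>lborel) = (\<integral>u. (g (t + h - u) - g 0) * I u \<partial>lborel) + g 0 * h" .
    have "\<bar>\<integral>u. (g (t + h - u) - g 0) * I u \<partial>lborel\<bar> \<le> (\<integral>u. \<bar>(g (t + h - u) - g 0) * I u\<bar> \<partial>lborel)"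
      by (rule integral_abs_bound)
    also have "\<dots> \<le> (\<integral>u. (\<bar>g 0\<bar> / 2) * I u \<partial>lborel)"
      using i1 I bnd by (intro integral_mono) auto
    also have "\<dots> = \<bar>g 0\<bar> / 2 * h" using Iint by simp
    finally have "\<bar>\<integral>u. (g (t + h - u) - g 0) * I u \<partial>lborel\<bar> \<le> \<bar>g 0\<bar> / 2 * h" .
    moreover have "\<bar>g 0 * h\<bar> = \<bar>g 0\<bar> * h" using h by (simp add: abs_mult)
    ultimately show ?thesis unfolding E eq mult.commute[of h] by linarith
  qed
  have norm_inc: "L2_norm M (inc j t (t + h)) = sqrt (h * cov j j)" if "h > 0" for h
    using inc_cov[OF j j, of t "t + h"] that by (simp add: L2_norm_def power2_eq_square)
  have upper: "\<bar>expectation (\<lambda>\<omega>. (D (t + h) \<omega> - D t \<omega>) * inc j t (t + h) \<omega>)\<bar> \<le>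
      h * L2_norm M (\<lambda>\<omega>. (D (t + h) \<omega> - D t \<omega>) / h) * sqrt (h * cov j j)" if "h > 0" for h
  proof -
    have "L2_norm M (\<lambda>\<omega>. D (t + h) \<omega> - D t \<omega>) = L2_norm M (\<lambda>\<omega>. h * ((D (t + h) \<omega> - D t \<omega>) / h))"
      using that by simp
    also have "\<dots> = h * L2_norm M (\<lambda>\<omega>. (D (t + h) \<omega> - D t \<omega>) / h)"
      using that by (subst L2_norm_mult) simp
    finally show ?thesis
      using L2_Cauchy_Schwarz[OF square_integrable_diff[OF wint_square_integrable(1)[OF wD] wint_square_integrable(1)[OF wD]]
          inc_square_integrable[OF j], of "t + h" t t "t + h"] norm_inc[OF that] by simp
  qed
  \<comment> \<open>After division by h the upper estimate is a convergent norm times the square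
    root of h times a constant, hence tends to 0, whereas the lower estimate stays at |g 0| /
    2.\<close>
  have "((\<lambda>h. L2_norm M (\<lambda>\<omega>. (D (t + h) \<omega> - D t \<omega>) / h) * sqrt (h * cov j j)) \<longlongrightarrow> B * sqrt (0 * cov j j)) (at_right 0)"
    by (intro tendsto_mult tendsto_real_sqrt filterlim_ident tendsto_const tendsto_within_subset[OF lim])
      (auto intro: tendsto_ident_at)
  moreover have "\<forall>\<^sub>F h in at_right 0. \<bar>g 0\<bar> / 2 \<le> L2_norm M (\<lambda>\<omega>. (D (t + h) \<omega> - D t \<omega>) / h) * sqrt (h * cov j j)"
    unfolding eventually_at_right_field
  proof (intro exI[of _ d] conjI allI impI)
    fix h :: real assume "0 < h" "h < d"
    then have "h * (\<bar>g 0\<bar> / 2) \<le> h * (L2_norm M (\<lambda>\<omega>. (D (t + h) \<omega> - D t \<omega>) / h) * sqrt (h * cov j j))"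
      using order_trans[OF lower[OF \<open>0 < h\<close> \<open>h < d\<close>] upper[OF \<open>0 < h\<close>]]
      by (simp only: mult.assoc times_divide_eq_right)
    then show "\<bar>g 0\<bar> / 2 \<le> L2_norm M (\<lambda>\<omega>. (D (t + h) \<omega> - D t \<omega>) / h) * sqrt (h * cov j j)"
      using \<open>0 < h\<close> by (simp only: mult_le_cancel_left_pos)
  qed (use d in auto)
  ultimately have "\<bar>g 0\<bar> / 2 \<le> B * sqrt (0 * cov j j)"
    by (intro tendsto_lowerbound[where F="at_right (0::real)"]) auto
  then show False using g0 by simp
qed

section \<open>Exponential test variables and their correlation with the state\<close>

definition expo :: "real \<Rightarrow> real \<Rightarrow> real \<Rightarrow> real" where
  "expo z t u = (if u < t then exp (z * u) else 0)"

lemma einterval_minus_infinity: "einterval (-\<infinity>) (ereal t) = {..<t}"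
  by (auto simp: einterval_def)

lemma exp_tendsto_minus_infinity:
  assumes "z > 0"
  shows "((\<lambda>u. exp (z * u)) \<longlongrightarrow> 0) (at_bot :: real filter)"
  by (rule filterlim_compose[OF exp_at_bot]) (use assms in \<open>simp add: filterlim_tendsto_pos_mult_at_bot[OF tendsto_const] filterlim_ident\<close>)

lemma expo_square_integrable:
  assumes "z > 0"
  shows "square_integrable lborel (expo z t)"
proof -
  have "set_integrable lborel (einterval (-\<infinity>) (ereal t)) (\<lambda>u. exp (2 * z * u))"
  proof (rule interval_integral_FTC_nonneg(1)[where F="\<lambda>u. exp (2 * z * u) / (2 * z)" and A=0 and B="exp (2 * z * t) / (2 * z)"])
    show "((\<lambda>u. exp (2 * z * u) / (2 * z)) has_real_derivative exp (2 * z * x)) (at x)" for x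
      using assms by (auto intro!: derivative_eq_intros)
    show "(((\<lambda>u. exp (2 * z * u) / (2 * z)) \<circ> real_of_ereal) \<longlongrightarrow> 0) (at_right (-\<infinity>))"
      using tendsto_divide[OF exp_tendsto_minus_infinity[of "2 * z"] tendsto_const[of "2 * z"]] assms
      unfolding ereal_tendsto_simps by simp
    show "(((\<lambda>u. exp (2 * z * u) / (2 * z)) \<circ> real_of_ereal) \<longlongrightarrow> exp (2 * z * t) / (2 * z)) (at_left (ereal t))"
      unfolding ereal_tendsto_simps using assms by (intro tendsto_intros) auto
  qed auto
  moreover have "(\<lambda>u. indicator {..<t} u *\<^sub>R exp (2 * z * u)) = (\<lambda>u. (norm (expo z t u))\<^sup>2)"
    by (auto simp: expo_def indicator_def fun_eq_iff power2_eq_square exp_add[symmetric] algebra_simps)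
  moreover have "expo z t \<in> borel_measurable lborel"
    unfolding expo_def[abs_def] by measurable
  ultimately show ?thesis
    by (simp add: square_integrable_def set_integrable_def einterval_minus_infinity)
qed

text \<open>Partition points of (t - n, t] into cells of length 1 / (n + 1): a single parameter both
  exhausts the half-line and refines the mesh.\<close>

definition grid :: "real \<Rightarrow> nat \<Rightarrow> nat \<Rightarrow> real" where
  "grid t n m = t - real n + real m / real (Suc n)"

lemma grid_step:
  fixes c :: "nat \<Rightarrow> real"
  shows "\<exists>m. (t - real n < u \<and> u \<le> t \<longrightarrow>
      (\<Sum>m<n * Suc n. c m * indicator {grid t n m<..grid t n (Suc m)} u) = c m \<and> grid t n m < u \<and> u \<le> grid t n m + 1 / real (Suc n)) \<and>
    (\<not> (t - real n < u \<and> u \<le> t) \<longrightarrow>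
      (\<Sum>m<n * Suc n. c m * indicator {grid t n m<..grid t n (Suc m)} u) = 0)"
proof -
  define y where "y = (u - t + real n) * real (Suc n)"
  \<comment> \<open>In rescaled coordinates the cells are (l, l + 1], open on the left, so the cell
    containing y has index ceiling minus 1.\<close>
  define m where "m = nat (\<lceil>y\<rceil> - 1)"
  have mem: "u \<in> {grid t n l<..grid t n (Suc l)} \<longleftrightarrow> real l < y \<and> y \<le> real l + 1" for l
  proof -
    have "grid t n l < u \<longleftrightarrow> real l < y" unfolding grid_def y_def by (simp add: field_simps)
    moreover have "u \<le> grid t n (Suc l) \<longleftrightarrow> y \<le> real l + 1" unfolding grid_def y_def by (simp add: field_simps)
    ultimately show ?thesis by simp
  qed
  have 1: "(\<Sum>m<n * Suc n. c m * indicator {grid t n m<..grid t n (Suc m)} u) = c m \<and> grid t n m < u \<and> u \<le> grid t n m + 1 / real (Suc n)"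
    if "t - real n < u" "u \<le> t"
  proof -
    have y0: "0 < y" unfolding y_def using that by simp
    have yN: "y \<le> real (n * Suc n)"
    proof -
      have "y \<le> real n * real (Suc n)" unfolding y_def using that by (intro mult_right_mono) auto
      then show ?thesis by (simp add: algebra_simps)
    qed
    have c1: "\<lceil>y\<rceil> \<ge> 1" using y0 by linarith
    then have rm: "real m = of_int \<lceil>y\<rceil> - 1" unfolding m_def by simp
    have iff: "real l < y \<and> y \<le> real l + 1 \<longleftrightarrow> l = m" for l
    proof
      assume "real l < y \<and> y \<le> real l + 1"
      then have "\<lceil>y\<rceil> = int l + 1" by (intro ceiling_unique) auto
      then show "l = m" by (simp add: m_def)
    next
      assume "l = m"
      then show "real l < y \<and> y \<le> real l + 1" using rm by linarith
    qed
    then have mm: "real m < y" "y \<le> real m + 1" by auto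
    have "m < n * Suc n" using mm(1) yN by linarith
    have "(\<Sum>l<n * Suc n. c l * indicator {grid t n l<..grid t n (Suc l)} u) = (\<Sum>l<n * Suc n. if l = m then c l else 0)"
      unfolding indicator_def mem iff by (intro sum.cong refl) simp
    also have "\<dots> = c m" using \<open>m < n * Suc n\<close> by simp
    finally have "(\<Sum>l<n * Suc n. c l * indicator {grid t n l<..grid t n (Suc l)} u) = c m" .
    moreover have "u \<in> {grid t n m<..grid t n (Suc m)}" unfolding mem using mm by simp
    ultimately show ?thesis by (auto simp: grid_def add_divide_distrib)
  qed
  have 2: "(\<Sum>m<n * Suc n. c m * indicator {grid t n m<..grid t n (Suc m)} u) = 0"
    if "\<not> (t - real n < u \<and> u \<le> t)"
  proof (intro sum.neutral ballI)
    fix l assume l: "l \<in> {..<n * Suc n}"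
    have "\<not> (real l < y \<and> y \<le> real l + 1)"
    proof
      assume a: "real l < y \<and> y \<le> real l + 1"
      then have "0 < y" by linarith
      then have "t - real n < u" unfolding y_def by (simp add: zero_less_mult_iff)
      moreover have "y \<le> real n * real (Suc n)" 
      proof -
        have "real (Suc l) \<le> real (n * Suc n)" using l by (intro of_nat_mono) auto
        then show ?thesis using a by (simp add: algebra_simps)
      qed
      then have "u \<le> t" unfolding y_def by (simp only: mult_le_cancel_right) auto
      ultimately show False using that by simp
    qed
    then show "c l * indicator {grid t n l<..grid t n (Suc l)} u = 0" using mem[of l] by simp
  qed
  show ?thesis using 1 2 by blast
qed

text \<open>Sampling at left endpoints keeps each step function below the increasing function exp (z
  u), which then dominates the approximation. At u = t the two kernels may differ, on a null
  set.\<close>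

lemma wint_expo_exists:
  assumes z: "z > 0"
  obtains U where "wint (\<lambda>c u. \<zeta> c * expo z t u) U"
proof -
  define row where "row n c = map (\<lambda>m. (\<zeta> c * exp (z * grid t n m), grid t n m, grid t n (Suc m), c)) [0..<n * Suc n]" for n c
  define xs where "xs n = concat (map (row n) [0..<k])" for n
  define e where "e n u = (\<Sum>m<n * Suc n. exp (z * grid t n m) * indicator {grid t n m<..grid t n (Suc m)} u)" for n u
  have row: "skern (row n c) j u = (if c = j then \<zeta> c * e n u else 0)" for n c j u
  proof -
    have "skern (row n c) j u = (\<Sum>m<n * Suc n. if c = j then \<zeta> c * exp (z * grid t n m) * indicator {grid t n m<..grid t n (Suc m)} u else 0)"
      by (simp only: skern_def row_def map_map comp_def prod.case interv_sum_list_conv_sum_set_nat atLeast0LessThan set_upt)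
    then show ?thesis by (cases "c = j") (simp_all only: e_def sum_distrib_left mult.assoc if_True if_False sum.neutral_const simp_thms)
  qed
  have concat: "skern (concat rs) j u = sum_list (map (\<lambda>r. skern r j u) rs)" for rs j u
    by (induction rs) (auto simp: skern_def)
  have kern: "skern (xs n) j u = \<zeta> j * e n u" if "j < k" for n j u
    using that by (simp add: xs_def concat comp_def row interv_sum_list_conv_sum_set_nat atLeast0LessThan)
  have valid: "valid (xs n)" for n
    by (auto simp: valid_def xs_def row_def grid_def divide_right_mono)
  have e_le: "\<bar>e n u\<bar> \<le> (if u \<le> t then exp (z * u) else 0)" for n u
  proof -
    obtain m where m: "t - real n < u \<and> u \<le> t \<longrightarrow> e n u = exp (z * grid t n m) \<and> grid t n m < u \<and> u \<le> grid t n m + 1 / real (Suc n)"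
      "\<not> (t - real n < u \<and> u \<le> t) \<longrightarrow> e n u = 0"
      using grid_step[of t n u "\<lambda>m. exp (z * grid t n m)"] unfolding e_def by blast
    then show ?thesis using z by (cases "t - real n < u \<and> u \<le> t") auto
  qed
  have e_lim: "(\<lambda>n. e n u) \<longlonglongrightarrow> exp (z * u)" if u: "u < t" for u
  proof (rule real_tendsto_sandwich)
    obtain N where N: "t - u < real N" using reals_Archimedean2 by blast
    show "\<forall>\<^sub>F n in sequentially. exp (z * (u - 1 / real (Suc n))) \<le> e n u"
      using eventually_ge_at_top[of N]
    proof eventually_elim
      case (elim n)
      obtain m where m: "t - real n < u \<and> u \<le> t \<longrightarrow> e n u = exp (z * grid t n m) \<and> grid t n m < u \<and> u \<le> grid t n m + 1 / real (Suc n)"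
        using grid_step[of t n u "\<lambda>m. exp (z * grid t n m)"] unfolding e_def by blast
      have "t - real n < u" using N elim by linarith
      with m u have "e n u = exp (z * grid t n m)" "u - 1 / real (Suc n) \<le> grid t n m" by auto
      then show ?case using z by simp
    qed
    show "\<forall>\<^sub>F n in sequentially. e n u \<le> exp (z * u)"
      using e_le[of _ u] u by (intro always_eventually allI) (smt (verit))
    have "(\<lambda>n. exp (z * (u - 1 / real (Suc n)))) \<longlonglongrightarrow> exp (z * (u - 0))"
      by (intro tendsto_exp tendsto_mult tendsto_const tendsto_diff LIMSEQ_Suc lim_1_over_n[where 'a=real])
    then show "(\<lambda>n. exp (z * (u - 1 / real (Suc n)))) \<longlonglongrightarrow> exp (z * u)" by simp
  qed simp
  have AEt: "AE u in lborel. u \<noteq> t" by (rule AE_lborel_singleton)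
  note si = expo_square_integrable[OF z, of t]
  have e_meas: "e n \<in> borel_measurable borel" for n unfolding e_def[abs_def] by measurable
  have e_si: "square_integrable lborel (e n)" for n
  proof -
    have "integrable lborel (\<lambda>u. (norm (e n u))\<^sup>2)"
    proof (rule Bochner_Integration.integrable_bound[OF square_integrableD(2)[OF si]])
      show "AE u in lborel. norm ((norm (e n u))\<^sup>2) \<le> norm ((norm (expo z t u))\<^sup>2)"
        using AEt
      proof eventually_elim
        case (elim u)
        then have "\<bar>e n u\<bar> \<le> \<bar>expo z t u\<bar>" using e_le[of n u] by (auto simp: expo_def split: if_splits)
        then show ?case by (simp add: abs_le_square_iff)
      qed
    qed (use e_meas in measurable)
    then show ?thesis using e_meas by (simp add: square_integrable_def)
  qed
  have "L2_tendsto lborel e (expo z t) sequentially"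
    unfolding L2_tendsto_def
  proof (intro conjI si always_eventually allI e_si)
    have "(\<lambda>n. \<integral>u. (norm (e n u - expo z t u))\<^sup>2 \<partial>lborel) \<longlonglongrightarrow> (\<integral>u. 0 \<partial>(lborel :: real measure))"
    proof (rule integral_dominated_convergence[where w="\<lambda>u. 4 * (norm (expo z t u))\<^sup>2"])
      show "integrable lborel (\<lambda>u. 4 * (norm (expo z t u))\<^sup>2)" using square_integrableD(2)[OF si] by simp
      show "AE u in lborel. (\<lambda>n. (norm (e n u - expo z t u))\<^sup>2) \<longlonglongrightarrow> 0"
        using AEt
      proof eventually_elim
        case (elim u)
        have "(\<lambda>n. e n u) \<longlonglongrightarrow> expo z t u"
        proof (cases "u < t")
          case True
          then show ?thesis using e_lim[OF True] by (simp add: expo_def)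
        next
          case False
          then have "e n u = 0" for n using e_le[of n u] elim by auto
          then show ?thesis using False by (simp add: expo_def)
        qed
        then have "(\<lambda>n. (norm (e n u - expo z t u))\<^sup>2) \<longlonglongrightarrow> (norm (expo z t u - expo z t u))\<^sup>2"
          by (intro tendsto_intros)
        then show ?case by simp
      qed
      show "AE u in lborel. norm ((norm (e n u - expo z t u))\<^sup>2) \<le> 4 * (norm (expo z t u))\<^sup>2" for n
        using AEt
      proof eventually_elim
        case (elim u)
        have "\<bar>e n u - expo z t u\<bar> \<le> 2 * \<bar>expo z t u\<bar>"
          using e_le[of n u] elim by (auto simp: expo_def split: if_splits)
        then have "\<bar>e n u - expo z t u\<bar>\<^sup>2 \<le> (2 * \<bar>expo z t u\<bar>)\<^sup>2" by (intro power_mono) auto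
        then show ?case by (simp add: power_mult_distrib)
      qed
    qed (use e_meas square_integrableD(1)[OF si] in measurable)
    then show "(\<lambda>n. \<integral>u. (norm (e n u - expo z t u))\<^sup>2 \<partial>lborel) \<longlonglongrightarrow> 0" by simp
  qed
  from L2_tendsto_mult[OF this] have lim: "L2_tendsto lborel (\<lambda>n u. \<zeta> j * e n u) (\<lambda>u. \<zeta> j * expo z t u) sequentially" for j .
  have "skern (xs n) j = (\<lambda>u. \<zeta> j * e n u)" if "j < k" for n j using kern[OF that] by auto
  then have "L2_tendsto lborel (\<lambda>n. skern (xs n) j) (\<lambda>u. \<zeta> j * expo z t u) sequentially" if "j < k" for j
    using lim[of j] that by simp
  from wint_exists[OF valid this] that show ?thesis by blast
qed

text \<open>The stochastic analogue of feeding the exponential input \<open>\<rho> exp (z u)\<close> into the linear system: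
  correlating with U turns the state at time r into the exponential solution \<open>exp (z r) x\<close>.\<close>

lemma expectation_Xc_expo:
  assumes U: "wint (\<lambda>c u. \<zeta> c * expo z t u) U"
    and z: "z > cA" and i: "i < k * p" and r: "r \<le> t"
    and \<rho>: "\<And>c. c < k \<Longrightarrow> \<rho> c = (\<Sum>d<k. cov c d * \<zeta> d)"
    and x: "\<And>l. l < k * p \<Longrightarrow> (\<Sum>m<k*p. bfA k p A $$ (l, m) * x m) + (\<Sum>c<k. if l = last_block c then \<rho> c else 0) = z * x l"
  shows "expectation (\<lambda>\<omega>. Xc i r \<omega> * U \<omega>) = exp (z * r) * x i"
proof -
  have z0: "z > 0" using z cA_nonneg by linarith
  \<comment> \<open>A primitive of the integrand g: differentiating produces the factor z x - A x,
    which by the hypothesis on x is the input \<rho> placed in the last block.\<close>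
  define G where "G u = exp (z * u) * (\<Sum>l<k*p. ex (r - u) i l * x l)" for u
  define g where "g u = (\<Sum>c<k. \<rho> c * (ex (r - u) i (last_block c) * exp (z * u)))" for u
  have int: "integrable lborel (\<lambda>u. K i c (r - u) * expo z t u)" if "c < k" for c
    by (intro integrable_mult_square_integrable K_square_integrable[OF i that] expo_square_integrable z0)
  have "expectation (\<lambda>\<omega>. Xc i r \<omega> * U \<omega>) = (\<Sum>c<k. \<Sum>d<k. cov c d * (\<integral>u. K i c (r - u) * (\<zeta> d * expo z t u) \<partial>lborel))"
    using wint_inner[OF wint_X[OF i] U] by (simp add: cov_form_def)
  also have "\<dots> = (\<Sum>c<k. \<rho> c * (\<integral>u. K i c (r - u) * expo z t u \<partial>lborel))"
  proof (intro sum.cong refl)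
    fix c assume "c \<in> {..<k}"
    have "(\<integral>u. K i c (r - u) * (\<zeta> d * expo z t u) \<partial>lborel) = \<zeta> d * (\<integral>u. K i c (r - u) * expo z t u \<partial>lborel)" for d
      by (subst integral_mult_right_zero[symmetric]) (simp add: mult_ac)
    then show "(\<Sum>d<k. cov c d * (\<integral>u. K i c (r - u) * (\<zeta> d * expo z t u) \<partial>lborel)) = \<rho> c * (\<integral>u. K i c (r - u) * expo z t u \<partial>lborel)"
      using \<open>c \<in> {..<k}\<close> by (simp add: \<rho> sum_distrib_right mult.assoc)
  qed
  also have "\<dots> = (\<integral>u. (\<Sum>c<k. \<rho> c * (K i c (r - u) * expo z t u)) \<partial>lborel)"
    using int by (subst Bochner_Integration.integral_sum) auto
  also have "\<dots> = (\<integral>u. indicator {..<r} u *\<^sub>R g u \<partial>lborel)"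
  proof (rule integral_cong_AE)
    show "AE u in lborel. (\<Sum>c<k. \<rho> c * (K i c (r - u) * expo z t u)) = indicator {..<r} u *\<^sub>R g u"
      using AE_lborel_singleton[of r]
    proof eventually_elim
      case (elim u)
      then show ?case using r by (cases "u < r") (auto simp: K_def g_def expo_def)
    qed
    have "integrable lborel (\<lambda>u. \<Sum>c<k. \<rho> c * (K i c (r - u) * expo z t u))"
      using int by (intro Bochner_Integration.integrable_sum integrable_mult_right) auto
    then show "(\<lambda>u. \<Sum>c<k. \<rho> c * (K i c (r - u) * expo z t u)) \<in> borel_measurable lborel" by simp
    have [measurable]: "(\<lambda>s. ex s i (last_block c)) \<in> borel_measurable borel" if "c < k" for c
      using ex_measurable[OF i last_block_less[OF that]] .
    show "(\<lambda>u. indicator {..<r} u *\<^sub>R g u) \<in> borel_measurable lborel"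
      unfolding g_def by measurable
  qed
  also have "\<dots> = (LBINT u=-\<infinity>..ereal r. g u)"
    by (simp add: interval_lebesgue_integral_def set_lebesgue_integral_def einterval_minus_infinity)
  also have "\<dots> = G r - 0"
  proof (rule interval_integral_FTC_integrable)
    show "set_integrable lborel (einterval (-\<infinity>) (ereal r)) g"
      unfolding set_integrable_def einterval_minus_infinity
    proof (rule integrable_cong_AE_imp)
      show "integrable lborel (\<lambda>u. \<Sum>c<k. \<rho> c * (K i c (r - u) * expo z t u))"
      using int by (intro Bochner_Integration.integrable_sum integrable_mult_right) auto
      have [measurable]: "(\<lambda>s. ex s i (last_block c)) \<in> borel_measurable borel" if "c < k" for c
        using ex_measurable[OF i last_block_less[OF that]] .
      show "(\<lambda>u. indicator {..<r} u *\<^sub>R g u) \<in> borel_measurable lborel"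
        unfolding g_def by measurable
      show "AE u in lborel. (\<Sum>c<k. \<rho> c * (K i c (r - u) * expo z t u)) = indicator {..<r} u *\<^sub>R g u"
        using AE_lborel_singleton[of r]
      proof eventually_elim
        case (elim u)
        then show ?case using r by (cases "u < r") (auto simp: K_def g_def expo_def)
      qed
    qed
    fix u :: real
    have "((\<lambda>u. ex (r - u) i l) has_real_derivative - (\<Sum>m<k*p. ex (r - u) i m * bfA k p A $$ (m, l))) (at u)"
      if "l < k * p" for l
    proof -
      have "((\<lambda>u. r - u) has_real_derivative -1) (at u)" by (auto intro!: derivative_eq_intros)
      from DERIV_chain2[OF ex_deriv_right[OF i that] this] show ?thesis by simp
    qed
    then have "((\<lambda>u. \<Sum>l<k*p. ex (r - u) i l * x l) has_real_derivative
        (\<Sum>l<k*p. - (\<Sum>m<k*p. ex (r - u) i m * bfA k p A $$ (m, l)) * x l)) (at u)"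
      by (intro DERIV_sum DERIV_cmult_right) auto
    moreover have "((\<lambda>u. exp (z * u)) has_real_derivative exp (z * u) * z) (at u)"
      by (auto intro!: derivative_eq_intros)
    ultimately have "(G has_real_derivative
        exp (z * u) * (\<Sum>l<k*p. - (\<Sum>m<k*p. ex (r - u) i m * bfA k p A $$ (m, l)) * x l)
        + exp (z * u) * z * (\<Sum>l<k*p. ex (r - u) i l * x l)) (at u)"
      unfolding G_def[abs_def] by (intro DERIV_mult')
    also have "exp (z * u) * (\<Sum>l<k*p. - (\<Sum>m<k*p. ex (r - u) i m * bfA k p A $$ (m, l)) * x l)
        + exp (z * u) * z * (\<Sum>l<k*p. ex (r - u) i l * x l) = g u"
    proof -
      have "(\<Sum>l<k*p. (\<Sum>m<k*p. ex (r - u) i m * bfA k p A $$ (m, l)) * x l) =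
          (\<Sum>m<k*p. ex (r - u) i m * (\<Sum>l<k*p. bfA k p A $$ (m, l) * x l))"
        by (simp add: sum_distrib_left sum_distrib_right mult.assoc) (rule sum.swap)
      also have "\<dots> = (\<Sum>m<k*p. ex (r - u) i m * (z * x m - (\<Sum>c<k. if m = last_block c then \<rho> c else 0)))"
      proof (intro sum.cong refl arg_cong2[where f="(*)"])
        fix m assume "m \<in> {..<k*p}"
        then show "(\<Sum>l<k*p. bfA k p A $$ (m, l) * x l) = z * x m - (\<Sum>c<k. if m = last_block c then \<rho> c else 0)"
          using x[of m] by simp
      qed
      also have "\<dots> = z * (\<Sum>m<k*p. ex (r - u) i m * x m)
          - (\<Sum>m<k*p. \<Sum>c<k. if m = last_block c then ex (r - u) i m * \<rho> c else 0)"
        by (simp add: right_diff_distrib sum_subtractf sum_distrib_left mult_ac if_distrib cong: if_cong)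
      also have "(\<Sum>m<k*p. \<Sum>c<k. if m = last_block c then ex (r - u) i m * \<rho> c else 0) =
          (\<Sum>c<k. ex (r - u) i (last_block c) * \<rho> c)"
        using last_block_less by (subst sum.swap) (auto intro!: sum.cong)
      finally have S: "(\<Sum>l<k*p. (\<Sum>m<k*p. ex (r - u) i m * bfA k p A $$ (m, l)) * x l) =
          z * (\<Sum>m<k*p. ex (r - u) i m * x m) - (\<Sum>c<k. ex (r - u) i (last_block c) * \<rho> c)" .
      have "g u = exp (z * u) * (\<Sum>c<k. ex (r - u) i (last_block c) * \<rho> c)"
        by (simp add: g_def sum_distrib_left mult_ac)
      then show ?thesis
        unfolding mult_minus_left sum_negf S by (simp add: right_diff_distrib)
    qed
    finally have "(G has_real_derivative g u) (at u)" .
    then show "(G has_vector_derivative g u) (at u)"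
      by (simp add: has_real_derivative_iff_has_vector_derivative)
    have c: "isCont (\<lambda>u. ex (r - u) i (last_block c)) u" if "c < k" for c
      using isCont_o2[of u "\<lambda>u. r - u" "\<lambda>s. ex s i (last_block c)"] ex_isCont[OF i last_block_less[OF that]] by auto
    show "isCont g u"
      unfolding g_def[abs_def] by (intro continuous_intros c) auto
  next
    have "isCont G r"
    proof -
      have "isCont (\<lambda>u. ex (r - u) i l) r" if "l < k * p" for l
        using isCont_o2[of r "\<lambda>u. r - u" "\<lambda>s. ex s i l"] ex_isCont[OF i that] by auto
      then show ?thesis unfolding G_def[abs_def] by (intro continuous_intros) auto
    qed
    then show "((G \<circ> real_of_ereal) \<longlongrightarrow> G r) (at_left (ereal r))"
      unfolding ereal_tendsto_simps isCont_def by (rule tendsto_within_subset) simp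
    \<comment> \<open>The matrix exponential grows at most like exp (cA (r - u)) towards minus
      infinity, so the boundary term vanishes because z exceeds \<open>cA\<close>.\<close>
    have "(G \<longlongrightarrow> 0) at_bot"
    proof (rule Lim_null_comparison)
      have "((\<lambda>u. exp ((z - cA) * u) * (exp (cA * r) * (\<Sum>l<k*p. \<bar>x l\<bar>))) \<longlongrightarrow> 0 * (exp (cA * r) * (\<Sum>l<k*p. \<bar>x l\<bar>))) at_bot"
        using z by (intro tendsto_mult tendsto_const exp_tendsto_minus_infinity) auto
      then show "((\<lambda>u. exp ((z - cA) * u) * (exp (cA * r) * (\<Sum>l<k*p. \<bar>x l\<bar>))) \<longlongrightarrow> 0) at_bot" by simp
      show "\<forall>\<^sub>F u in at_bot. norm (G u) \<le> exp ((z - cA) * u) * (exp (cA * r) * (\<Sum>l<k*p. \<bar>x l\<bar>))"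
        using eventually_le_at_bot[of r]
      proof eventually_elim
        case (elim u)
        have "\<bar>\<Sum>l<k*p. ex (r - u) i l * x l\<bar> \<le> (\<Sum>l<k*p. \<bar>ex (r - u) i l\<bar> * \<bar>x l\<bar>)"
          unfolding abs_mult[symmetric] by (rule sum_abs)
        also have "\<dots> \<le> (\<Sum>l<k*p. exp (cA * (r - u)) * \<bar>x l\<bar>)"
        proof (intro sum_mono mult_right_mono)
          fix l assume "l \<in> {..<k*p}"
          then show "\<bar>ex (r - u) i l\<bar> \<le> exp (cA * (r - u))" using ex_le[OF i, of l "r - u"] elim by simp
        qed auto
        also have "\<dots> = exp (cA * (r - u)) * (\<Sum>l<k*p. \<bar>x l\<bar>)" by (simp add: sum_distrib_left)
        finally have "norm (G u) \<le> exp (z * u) * (exp (cA * (r - u)) * (\<Sum>l<k*p. \<bar>x l\<bar>))"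
          unfolding G_def by (simp add: abs_mult)
        also have "\<dots> = exp (z * u + cA * (r - u)) * (\<Sum>l<k*p. \<bar>x l\<bar>)" by (simp add: exp_add)
        also have "z * u + cA * (r - u) = (z - cA) * u + cA * r" by (simp add: algebra_simps)
        finally show ?case by (simp add: exp_add)
      qed
    qed
    then show "((G \<circ> real_of_ereal) \<longlongrightarrow> 0) (at_right (-\<infinity>))"
      unfolding ereal_tendsto_simps .
  qed simp
  also have "G r - 0 = exp (z * r) * (\<Sum>l<k*p. if l = i then x l else 0)"
  proof -
    have "(\<Sum>l<k*p. ex (r - r) i l * x l) = (\<Sum>l<k*p. if l = i then x l else 0)"
      by (intro sum.cong refl) (simp add: ex_0 i)
    then show ?thesis by (simp only: G_def diff_zero)
  qed
  finally show ?thesis using i by simp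
qed

end

section \<open>The Cayley-Hamilton theorem and stable linear systems\<close>

lemma pow_mat_Suc_left:
  assumes "A \<in> carrier_mat n n"
  shows "A ^\<^sub>m Suc m = A * A ^\<^sub>m m"
proof (induction m)
  case 0
  then show ?case using assms by simp
next
  case (Suc m)
  have P: "A ^\<^sub>m m \<in> carrier_mat n n" using assms by (rule pow_carrier_mat)
  have "A ^\<^sub>m Suc (Suc m) = (A * A ^\<^sub>m m) * A" using Suc by simp
  also have "\<dots> = A * (A ^\<^sub>m m * A)" using assms P by (intro assoc_mult_mat) auto
  finally show ?case by simp
qed

text \<open>Comparing coefficients in \<open>(X I - A) adj (X I - A) = det (X I - A) I\<close> and multiplying by the powers of A
  gives a telescoping sum.\<close>

theorem Cayley_Hamilton:
  fixes A :: "'a::comm_ring_1 mat"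
  assumes A: "A \<in> carrier_mat n n" and ij: "i < n" "j < n"
  shows "(\<Sum>m\<le>n. Polynomial.coeff (char_poly A) m * (A ^\<^sub>m m) $$ (i, j)) = 0"
proof -
  define cp where "cp = char_poly A"
  define B where "B = adj_mat (char_poly_matrix A)"
  define P where "P m l = Polynomial.coeff (B $$ (l, j)) m" for m l
  have cpm: "char_poly_matrix A \<in> carrier_mat n n" using A by simp
  have B: "B \<in> carrier_mat n n" unfolding B_def by (rule adj_mat(1)[OF cpm])
  have AB: "char_poly_matrix A * B = cp \<cdot>\<^sub>m 1\<^sub>m n"
    unfolding B_def cp_def char_poly_def by (rule adj_mat(2)[OF cpm])
  \<comment> \<open>Coefficient m of entry (l, j) of the polynomial matrix identity. Multiplication
    by the indeterminate shifts coefficients by one, whence the value 0 at m = 0.\<close>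
  have eq: "(if m = 0 then 0 else P (m - 1) l) - (\<Sum>r<n. A $$ (l, r) * P m r) = (if l = j then Polynomial.coeff cp m else 0)"
    if l: "l < n" for m l
  proof -
    have "(char_poly_matrix A * B) $$ (l, j) = (\<Sum>r<n. char_poly_matrix A $$ (l, r) * B $$ (r, j))"
      by (rule index_mult_mat_sum[OF cpm B l ij(2)])
    also have "\<dots> = (\<Sum>r<n. (if l = r then pCons 0 (B $$ (r, j)) else 0) - Polynomial.smult (A $$ (l, r)) (B $$ (r, j)))"
      using A l by (intro sum.cong) (auto simp: char_poly_matrix_def algebra_simps)
    also have "\<dots> = pCons 0 (B $$ (l, j)) - (\<Sum>r<n. Polynomial.smult (A $$ (l, r)) (B $$ (r, j)))"
      using l by (simp add: sum_subtractf)
    finally have "Polynomial.coeff (pCons 0 (B $$ (l, j)) - (\<Sum>r<n. Polynomial.smult (A $$ (l, r)) (B $$ (r, j)))) m = Polynomial.coeff ((cp \<cdot>\<^sub>m 1\<^sub>m n) $$ (l, j)) m"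
      using AB by simp
    then show ?thesis
      using l ij by (cases m) (auto simp: P_def coeff_sum)
  qed
  \<comment> \<open>Large enough to exceed all degrees in column j, so that the final telescoping
    term vanishes, and at least n, so that no coefficient of the characteristic polynomial is cut
    off.\<close>
  define d where "d = n + (\<Sum>l<n. degree (B $$ (l, j)))"
  have Pd: "P d l = 0" if "l < n" for l
  proof (cases "n = 0")
    case False
    have "degree (B $$ (l, j)) \<le> (\<Sum>l<n. degree (B $$ (l, j)))" using that by (intro member_le_sum) auto
    then show ?thesis unfolding P_def d_def using False by (intro coeff_eq_0) linarith
  qed (use that in simp)
  define T where "T m = (if m = 0 then 0 else \<Sum>l<n. (A ^\<^sub>m m) $$ (i, l) * P (m - 1) l)" for m
  have step: "Polynomial.coeff cp m * (A ^\<^sub>m m) $$ (i, j) = T m - T (Suc m)" for m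
  proof -
    have Am: "A ^\<^sub>m m \<in> carrier_mat n n" using A by (rule pow_carrier_mat)
    have "Polynomial.coeff cp m * (A ^\<^sub>m m) $$ (i, j) = (\<Sum>l<n. (A ^\<^sub>m m) $$ (i, l) * (if l = j then Polynomial.coeff cp m else 0))"
    proof -
      have "(\<Sum>l<n. (A ^\<^sub>m m) $$ (i, l) * (if l = j then Polynomial.coeff cp m else 0)) =
        (\<Sum>l<n. if l = j then (A ^\<^sub>m m) $$ (i, l) * Polynomial.coeff cp m else 0)" by (intro sum.cong) auto
      then show ?thesis using ij by (simp add: mult.commute)
    qed
    also have "\<dots> = (\<Sum>l<n. (A ^\<^sub>m m) $$ (i, l) * ((if m = 0 then 0 else P (m - 1) l) - (\<Sum>r<n. A $$ (l, r) * P m r)))"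
      by (intro sum.cong refl) (simp add: eq)
    also have "\<dots> = T m - (\<Sum>l<n. \<Sum>r<n. (A ^\<^sub>m m) $$ (i, l) * A $$ (l, r) * P m r)"
      by (auto simp: T_def right_diff_distrib sum_subtractf sum_distrib_left mult.assoc)
    also have "(\<Sum>l<n. \<Sum>r<n. (A ^\<^sub>m m) $$ (i, l) * A $$ (l, r) * P m r) = (\<Sum>r<n. (\<Sum>l<n. (A ^\<^sub>m m) $$ (i, l) * A $$ (l, r)) * P m r)"
      by (subst sum.swap) (simp add: sum_distrib_right)
    also have "\<dots> = T (Suc m)"
      unfolding T_def using index_mult_mat_sum[OF Am A ij(1)] by simp
    finally show ?thesis .
  qed
  have "(\<Sum>m\<le>n. Polynomial.coeff cp m * (A ^\<^sub>m m) $$ (i, j)) = (\<Sum>m\<le>d. Polynomial.coeff cp m * (A ^\<^sub>m m) $$ (i, j))"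
  proof (rule sum.mono_neutral_left)
    have "degree cp \<le> n"
      unfolding cp_def using degree_monic_char_poly[OF A] by simp
    then show "\<forall>m\<in>{..d} - {..n}. Polynomial.coeff cp m * (A ^\<^sub>m m) $$ (i, j) = 0"
      by (auto simp: coeff_eq_0)
  qed (auto simp: d_def)
  also have "\<dots> = T 0 - T (Suc d)"
    unfolding step by (rule sum_telescope)
  also have "\<dots> = 0" using Pd by (simp add: T_def)
  finally show ?thesis by (simp add: cp_def)
qed

lemma pow_recurrence:
  fixes A :: "'a::comm_ring_1 mat"
  assumes A: "A \<in> carrier_mat n n" and "i < n" "j < n"
  shows "(\<Sum>m\<le>n. Polynomial.coeff (char_poly A) m * (A ^\<^sub>m (m + \<beta>)) $$ (i, j)) = 0"
  using assms(2)
proof (induction \<beta> arbitrary: i)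
  case 0
  then show ?case using Cayley_Hamilton[OF A 0 assms(3)] by simp
next
  case (Suc \<beta>)
  have "(A ^\<^sub>m (m + Suc \<beta>)) $$ (i, j) = (\<Sum>l<n. A $$ (i, l) * (A ^\<^sub>m (m + \<beta>)) $$ (l, j))" for m
    using pow_mat_Suc_left[OF A, of "m + \<beta>"] index_mult_mat_sum[OF A pow_carrier_mat[OF A] Suc.prems assms(3)] by simp
  then have "(\<Sum>m\<le>n. Polynomial.coeff (char_poly A) m * (A ^\<^sub>m (m + Suc \<beta>)) $$ (i, j)) =
      (\<Sum>m\<le>n. \<Sum>l<n. A $$ (i, l) * (Polynomial.coeff (char_poly A) m * (A ^\<^sub>m (m + \<beta>)) $$ (l, j)))"
    by (simp add: sum_distrib_left mult_ac)
  also have "\<dots> = (\<Sum>l<n. A $$ (i, l) * (\<Sum>m\<le>n. Polynomial.coeff (char_poly A) m * (A ^\<^sub>m (m + \<beta>)) $$ (l, j)))"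
    by (subst sum.swap) (simp add: sum_distrib_left)
  also have "\<dots> = 0" using Suc.IH by simp
  finally show ?case .
qed

lemma pow_form_recurrence:
  fixes A :: "'a::comm_ring_1 mat"
  assumes A: "A \<in> carrier_mat n n"
  shows "(\<Sum>m\<le>n. Polynomial.coeff (char_poly A) m * (\<Sum>i<n. \<Sum>j<n. w i * (A ^\<^sub>m (m + \<beta>)) $$ (i, j) * z j)) = 0"
proof -
  have "(\<Sum>m\<le>n. Polynomial.coeff (char_poly A) m * (\<Sum>i<n. \<Sum>j<n. w i * (A ^\<^sub>m (m + \<beta>)) $$ (i, j) * z j)) =
      (\<Sum>m\<le>n. \<Sum>i<n. \<Sum>j<n. w i * z j * (Polynomial.coeff (char_poly A) m * (A ^\<^sub>m (m + \<beta>)) $$ (i, j)))"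
    by (simp add: sum_distrib_left mult_ac)
  also have "\<dots> = (\<Sum>i<n. \<Sum>m\<le>n. \<Sum>j<n. w i * z j * (Polynomial.coeff (char_poly A) m * (A ^\<^sub>m (m + \<beta>)) $$ (i, j)))"
    by (rule sum.swap)
  also have "\<dots> = (\<Sum>i<n. \<Sum>j<n. \<Sum>m\<le>n. w i * z j * (Polynomial.coeff (char_poly A) m * (A ^\<^sub>m (m + \<beta>)) $$ (i, j)))"
    by (intro sum.cong refl sum.swap)
  also have "\<dots> = (\<Sum>i<n. \<Sum>j<n. w i * z j * (\<Sum>m\<le>n. Polynomial.coeff (char_poly A) m * (A ^\<^sub>m (m + \<beta>)) $$ (i, j)))"
    by (simp add: sum_distrib_left)
  also have "\<dots> = 0" using pow_recurrence[OF A] by simp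
  finally show ?thesis .
qed

text \<open>The characteristic polynomial is monic, so the recurrence expresses the form at exponent
  n + \<beta>' through the n preceding ones, and strong induction applies.\<close>

lemma pow_form_eq_0:
  fixes A :: "'a::comm_ring_1 mat"
  assumes A: "A \<in> carrier_mat n n"
    and z: "\<And>\<beta>. \<beta> < n \<Longrightarrow> (\<Sum>i<n. \<Sum>j<n. w i * (A ^\<^sub>m \<beta>) $$ (i, j) * z j) = 0"
  shows "(\<Sum>i<n. \<Sum>j<n. w i * (A ^\<^sub>m \<beta>) $$ (i, j) * z j) = 0"
proof (induction \<beta> rule: less_induct)
  case (less \<beta>)
  define F where "F \<beta> = (\<Sum>i<n. \<Sum>j<n. w i * (A ^\<^sub>m \<beta>) $$ (i, j) * z j)" for \<beta>
  show ?case
  proof (cases "\<beta> < n")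
    case False
    then obtain \<beta>' where \<beta>: "\<beta> = n + \<beta>'" using le_Suc_ex by (metis not_less)
    have "0 = (\<Sum>m\<le>n. Polynomial.coeff (char_poly A) m * F (m + \<beta>'))"
      unfolding F_def using pow_form_recurrence[OF A] by simp
    also have "\<dots> = (\<Sum>m<n. Polynomial.coeff (char_poly A) m * F (m + \<beta>')) + Polynomial.coeff (char_poly A) n * F (n + \<beta>')"
      by (simp add: lessThan_Suc_atMost[symmetric])
    also have "(\<Sum>m<n. Polynomial.coeff (char_poly A) m * F (m + \<beta>')) = 0"
      unfolding F_def using less.IH \<beta> by (intro sum.neutral ballI) simp
    also have "Polynomial.coeff (char_poly A) n = 1" using degree_monic_char_poly[OF A] by simp
    finally show ?thesis by (simp add: F_def \<beta>)
  qed (rule z)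
qed

section \<open>Solutions of stable linear systems that stay bounded towards minus infinity\<close>

lemma bounded_exponential_eq_0:
  fixes f :: "real \<Rightarrow> complex"
  assumes deriv: "\<And>r. r < t \<Longrightarrow> (f has_vector_derivative e * f r) (at r)"
    and bound: "\<And>r. r < t \<Longrightarrow> cmod (f r) \<le> K" and e: "Re e < 0" and "r < t"
  shows "f r = 0"
proof -
  \<comment> \<open>With this integrating factor f is a constant c times exp (e r). Boundedness
    gives |c| at most exp (- Re e s) K for all s < t, which tends to 0 as s decreases because Re e <
    0.\<close>
  define g where "g r = exp (of_real r * (- e)) * f r" for r
  have "(g has_vector_derivative 0) (at s within {..<t})" if "s < t" for s
  proof -
    have "((\<lambda>z. exp (z * (- e))) has_field_derivative - e * exp (of_real s * (- e))) (at (of_real s))"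
      by (auto intro!: derivative_eq_intros)
    from has_vector_derivative_real_field[OF this]
    have "((\<lambda>r. exp (of_real r * (- e))) has_vector_derivative - e * exp (of_real s * (- e))) (at s)" .
    from has_vector_derivative_mult[OF this deriv[OF that]] show ?thesis
      unfolding g_def[abs_def] by (auto intro: has_vector_derivative_at_within simp: algebra_simps)
  qed
  then obtain c where c: "\<And>s. s < t \<Longrightarrow> g s = c"
    using has_vector_derivative_zero_constant[of "{..<t}" g] by auto
  have cle: "cmod c \<le> exp (- (Re e) * s) * K" if "s < t" for s
  proof -
    have "cmod c = cmod (exp (of_real s * (- e))) * cmod (f s)"
      unfolding c[OF that, symmetric] g_def by (rule norm_mult)
    also have "\<dots> \<le> exp (- (Re e) * s) * K"
      using bound[OF that] by (simp add: mult.commute mult_left_mono)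
    finally show ?thesis .
  qed
  have "((\<lambda>s. exp (- (Re e) * s)) \<longlongrightarrow> 0) at_bot"
    by (rule filterlim_compose[OF exp_at_bot],
        rule filterlim_tendsto_pos_mult_at_bot[OF tendsto_const _ filterlim_ident]) (use e in simp)
  from tendsto_mult_right[OF this, of K] have "((\<lambda>s. exp (- (Re e) * s) * K) \<longlongrightarrow> 0) at_bot" by simp
  then have "cmod c \<le> 0"
    by (rule tendsto_lowerbound)
      (use cle in \<open>auto simp: eventually_at_bot_dense intro!: exI[of _ t]\<close>)
  then have "g r = 0" using c[OF assms(4)] by simp
  then show ?thesis by (simp add: g_def)
qed

text \<open>The product of the operators S - e over the list, with S the shift of the index \<beta>.
  On a chain of successive derivatives S is d/dr, so this is a differential operator in factored
  form.\<close>

fun annihilate :: "complex list \<Rightarrow> (nat \<Rightarrow> real \<Rightarrow> complex) \<Rightarrow> nat \<Rightarrow> real \<Rightarrow> complex" where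
  "annihilate [] f = f"
| "annihilate (e # es) f = annihilate es (\<lambda>\<beta> r. f (Suc \<beta>) r - e * f \<beta> r)"

lemma annihilate_eq:
  "annihilate es f \<beta> r = (\<Sum>m\<le>length es. Polynomial.coeff (\<Prod>e\<leftarrow>es. [:- e, 1:]) m * f (m + \<beta>) r)"
proof (induction es arbitrary: f)
  case (Cons e es)
  define Q where "Q = (\<Prod>e\<leftarrow>es. [:- e, 1:])"
  have "degree Q = length es"
    unfolding Q_def using degree_linear_factors[of uminus es] by simp
  then have Q0: "Polynomial.coeff Q (Suc (length es)) = 0" by (intro coeff_eq_0) simp
  have c: "Polynomial.coeff ([:- e, 1:] * Q) m = (if m = 0 then 0 else Polynomial.coeff Q (m - 1)) - e * Polynomial.coeff Q m" for m
    by (cases m) auto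
  have "(\<Sum>m\<le>length (e # es). Polynomial.coeff (\<Prod>e\<leftarrow>(e # es). [:- e, 1:]) m * f (m + \<beta>) r) =
      (\<Sum>m\<le>Suc (length es). (if m = 0 then 0 else Polynomial.coeff Q (m - 1) * f (m + \<beta>) r) - e * Polynomial.coeff Q m * f (m + \<beta>) r)"
    unfolding list.map prod_list.Cons Q_def[symmetric] c by (intro sum.cong) (auto simp: algebra_simps)
  also have "\<dots> = (\<Sum>m\<le>Suc (length es). if m = 0 then 0 else Polynomial.coeff Q (m - 1) * f (m + \<beta>) r)
     - (\<Sum>m\<le>Suc (length es). e * Polynomial.coeff Q m * f (m + \<beta>) r)"
    by (rule sum_subtractf)
  also have "(\<Sum>m\<le>Suc (length es). if m = 0 then 0 else Polynomial.coeff Q (m - 1) * f (m + \<beta>) r) =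
      (\<Sum>m\<le>length es. Polynomial.coeff Q m * f (Suc m + \<beta>) r)"
    by (subst sum.atMost_Suc_shift) simp
  also have "(\<Sum>m\<le>Suc (length es). e * Polynomial.coeff Q m * f (m + \<beta>) r) = (\<Sum>m\<le>length es. e * Polynomial.coeff Q m * f (m + \<beta>) r)"
    using Q0 by simp
  finally show ?case
    using Cons[of "\<lambda>\<beta> r. f (Suc \<beta>) r - e * f \<beta> r"]
    by (simp add: Q_def[symmetric] sum_subtractf right_diff_distrib mult_ac)
qed simp

text \<open>Peeling off one factor leaves the bounded chain f' - e f, annihilated by the remaining
  ones and so zero by induction. Then f' = e f with f bounded. Repeated eigenvalues need no separate
  treatment.\<close>

lemma annihilate_eq_0_imp:
  assumes "\<And>\<beta> r. r < t \<Longrightarrow> annihilate es f \<beta> r = 0"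
    and "\<And>\<beta> r. r < t \<Longrightarrow> (f \<beta> has_vector_derivative f (Suc \<beta>) r) (at r)"
    and "\<And>\<beta>. \<exists>K. \<forall>r<t. cmod (f \<beta> r) \<le> K"
    and "\<And>e. e \<in> set es \<Longrightarrow> Re e < 0" and "r < t"
  shows "f \<beta> r = 0"
  using assms
proof (induction es arbitrary: f \<beta> r)
  case (Cons e es)
  define g where "g = (\<lambda>\<beta> r. f (Suc \<beta>) r - e * f \<beta> r)"
  have "g \<beta> r = 0" if "r < t" for \<beta> r
  proof (rule Cons.IH)
    show "annihilate es g \<beta> r = 0" if "r < t" for \<beta> r
      using Cons.prems(1)[OF that, of \<beta>] by (simp add: g_def)
    show "(g \<beta> has_vector_derivative g (Suc \<beta>) r) (at r)" if "r < t" for \<beta> r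
      unfolding g_def
      by (intro has_vector_derivative_diff has_vector_derivative_mult_right Cons.prems(2) that)
    show "\<exists>K. \<forall>r<t. cmod (g \<beta> r) \<le> K" for \<beta>
    proof -
      obtain K K' where "\<forall>r<t. cmod (f \<beta> r) \<le> K" "\<forall>r<t. cmod (f (Suc \<beta>) r) \<le> K'"
        using Cons.prems(3) by blast
      then have "cmod (g \<beta> r) \<le> K' + cmod e * K" if "r < t" for r
        unfolding g_def using that
        by (intro order_trans[OF norm_triangle_ineq4] add_mono) (auto simp: norm_mult mult_left_mono)
      then show ?thesis by blast
    qed
  qed (use Cons.prems that in auto)
  then have "f (Suc \<beta>) r = e * f \<beta> r" if "r < t" for r using that by (auto simp: g_def)
  then have d: "(f \<beta> has_vector_derivative e * f \<beta> r) (at r)" if "r < t" for r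
    using Cons.prems(2)[OF that, of \<beta>] that by simp
  obtain K where "\<forall>r<t. cmod (f \<beta> r) \<le> K" using Cons.prems(3) by blast
  then show ?case
    by (intro bounded_exponential_eq_0[OF d _ Cons.prems(4) Cons.prems(5)]) auto
qed simp

text \<open>Cayley-Hamilton gives the chain a scalar differential equation with the characteristic
  polynomial of \<Lambda>, factored over the complex numbers. Only the derivatives of the form
  itself are constrained, so \<open>z r\<close> need not solve the homogeneous system.\<close>

lemma stable_chain_eq_0:
  fixes \<Lambda> :: "real mat" and f :: "nat \<Rightarrow> real \<Rightarrow> real"
  assumes \<Lambda>: "\<Lambda> \<in> carrier_mat n n"
    and stable: "\<And>e. eigenvalue (map_mat complex_of_real \<Lambda>) e \<Longrightarrow> Re e < 0"
    and form: "\<And>\<beta> r. r < t \<Longrightarrow> f \<beta> r = (\<Sum>i<n. \<Sum>j<n. w i * (\<Lambda> ^\<^sub>m \<beta>) $$ (i, j) * z r j)"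
    and deriv: "\<And>\<beta> r. r < t \<Longrightarrow> (f \<beta> has_real_derivative f (Suc \<beta>) r) (at r)"
    and bound: "\<And>\<beta>. \<exists>K. \<forall>r<t. \<bar>f \<beta> r\<bar> \<le> K" and "r < t"
  shows "f \<beta> r = 0"
proof -
  define \<Lambda>c where "\<Lambda>c = map_mat complex_of_real \<Lambda>"
  have \<Lambda>c: "\<Lambda>c \<in> carrier_mat n n" using \<Lambda> by (simp add: \<Lambda>c_def)
  obtain es where es: "char_poly \<Lambda>c = (\<Prod>e\<leftarrow>es. [:- e, 1:])" "length es = n"
    using char_poly_factorized[OF \<Lambda>c] by blast
  have Re: "Re e < 0" if "e \<in> set es" for e
  proof -
    have "poly (char_poly \<Lambda>c) e = 0"
      unfolding es(1) using that by (induction es) (auto simp: poly_mult)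
    then show ?thesis using stable eigenvalue_root_char_poly[OF \<Lambda>c] by (simp add: \<Lambda>c_def)
  qed
  have pow: "(\<Lambda>c ^\<^sub>m \<beta>) $$ (i, j) = of_real ((\<Lambda> ^\<^sub>m \<beta>) $$ (i, j))" if "i < n" "j < n" for \<beta> i j
    unfolding \<Lambda>c_def of_real_hom.mat_hom_pow[OF \<Lambda>, symmetric]
    using that carrier_matD[OF pow_carrier_mat[OF \<Lambda>, of \<beta>]] by simp
  define F where "F \<beta> r = complex_of_real (f \<beta> r)" for \<beta> r
  have "F \<beta> r = 0"
  proof (rule annihilate_eq_0_imp[where es=es])
    show "annihilate es F \<beta> r = 0" if "r < t" for \<beta> r
    proof -
      have "F \<beta> r = (\<Sum>i<n. \<Sum>j<n. of_real (w i) * (\<Lambda>c ^\<^sub>m \<beta>) $$ (i, j) * of_real (z r j))" for \<beta>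
        unfolding F_def form[OF that] of_real_sum of_real_mult by (intro sum.cong refl) (simp add: pow)
      then show ?thesis
        unfolding annihilate_eq es(1)[symmetric] es(2) by (simp only: pow_form_recurrence[OF \<Lambda>c])
    qed
    show "(F \<beta> has_vector_derivative F (Suc \<beta>) r) (at r)" if "r < t" for \<beta> r
      using deriv[OF that, of \<beta>] unfolding F_def
      by (intro has_vector_derivative_of_real) (simp add: has_real_derivative_iff_has_vector_derivative)
    show "\<exists>K. \<forall>r<t. cmod (F \<beta> r) \<le> K" for \<beta> using bound by (simp add: F_def)
  qed (use Re assms in auto)
  then show ?thesis by (simp add: F_def)
qed

section \<open>The inverse filter\<close>

lemma block_index_less: "i < k \<Longrightarrow> j < m \<Longrightarrow> k * j + i < k * m" for i j k m :: nat
proof -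
  assume "i < k" "j < m"
  then have "k * j + i < k * Suc j" by simp
  also have "\<dots> \<le> k * m" using \<open>j < m\<close> by (intro mult_le_mono2) auto
  finally show ?thesis .
qed

lemma div_less_blocks: "i < k * m \<Longrightarrow> i div k < m" for i k m :: nat
  by (metis div_less_iff_less_mult gr_zeroI mult.commute mult_is_0 not_less_zero)

lemma block_mat_carrier: "block_mat k m n f \<in> carrier_mat (k * m) (k * n)"
  by (simp add: block_mat_def)

lemma block_mat_entry:
  "i < k * m \<Longrightarrow> j < k * n \<Longrightarrow> block_mat k m n f $$ (i, j) = f (i div k + 1) (j div k + 1) $$ (i mod k, j mod k)"
  by (simp add: block_mat_def)

lemma sum_last_block:
  fixes f :: "nat \<Rightarrow> 'a::comm_monoid_add"
  shows "(\<Sum>l<k * Suc q. f l) = (\<Sum>l<k * q. f l) + (\<Sum>c<k. f (k * q + c))"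
proof -
  have "{..<k * Suc q} = {..<k * q} \<union> {k * q..<k * q + k}" by auto
  then have "(\<Sum>l<k * Suc q. f l) = (\<Sum>l<k * q. f l) + (\<Sum>l=k * q..<k * q + k. f l)"
    by (simp add: sum.union_disjoint ivl_disj_int)
  also have "(\<Sum>l=k * q..<k * q + k. f l) = (\<Sum>c<k. f (k * q + c))"
    using sum.shift_bounds_nat_ivl[of f 0 "k * q" k] by (simp add: atLeast0LessThan add.commute)
  finally show ?thesis .
qed

lemma sum_blocks:
  fixes f :: "nat \<Rightarrow> 'a::comm_monoid_add"
  shows "(\<Sum>l<k * q. f l) = (\<Sum>j<q. \<Sum>c<k. f (k * j + c))"
  by (induction q) (simp_all only: sum_last_block mult_0_right lessThan_0 sum.empty sum.lessThan_Suc)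

lemma msum_carrier: "msum nr nc f S \<in> carrier_mat nr nc"
  by (simp add: msum_def)

lemma msum_mult_vec:
  fixes f :: "'i \<Rightarrow> real mat"
  assumes "\<And>s. s \<in> S \<Longrightarrow> f s \<in> carrier_mat nr nc" "w \<in> carrier_vec nc" "i < nr"
  shows "(msum nr nc f S *\<^sub>v w) $ i = (\<Sum>s\<in>S. (f s *\<^sub>v w) $ i)"
proof -
  have "(msum nr nc f S *\<^sub>v w) $ i = (\<Sum>r<nc. (\<Sum>s\<in>S. f s $$ (i, r)) * w $ r)"
    using assms(2,3) by (subst index_mult_mat_vec_sum[OF msum_carrier]) (auto simp: msum_def)
  also have "\<dots> = (\<Sum>r<nc. \<Sum>s\<in>S. f s $$ (i, r) * w $ r)"
    by (simp add: sum_distrib_right)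
  also have "\<dots> = (\<Sum>s\<in>S. \<Sum>r<nc. f s $$ (i, r) * w $ r)" by (rule sum.swap)
  also have "\<dots> = (\<Sum>s\<in>S. (f s *\<^sub>v w) $ i)"
    using assms by (intro sum.cong refl) (simp add: index_mult_mat_vec_sum[OF assms(1) assms(2,3)])
  finally show ?thesis .
qed

lemma mat_inv_inverse:
  assumes "A \<in> carrier_mat n n" "vec_space.rank n A = n"
  shows "mat_inv A \<in> carrier_mat n n" "A * mat_inv A = 1\<^sub>m n" "mat_inv A * A = 1\<^sub>m n"
proof -
  have "det A \<noteq> 0" using vec_space.det_rank_iff[OF assms(1)] assms(2) by simp
  from det_non_zero_imp_unit[OF assms(1) this, where b="()"]
  have "mat_inverse A \<noteq> None" using mat_inverse(1)[OF assms(1), where b="()"] by blast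
  then obtain B where B: "mat_inverse A = Some B" by auto
  from mat_inverse(2)[OF assms(1) B] B
  show "mat_inv A \<in> carrier_mat n n" "A * mat_inv A = 1\<^sub>m n" "mat_inv A * A = 1\<^sub>m n"
    by (auto simp: mat_inv_def)
qed

locale ma_filter =
  fixes k p q :: nat and C :: "nat \<Rightarrow> real mat"
  assumes k0: "k > 0" and q0: "q > 0" and pq: "p > q"
    and C_carrier: "\<And>j. j \<le> q \<Longrightarrow> C j \<in> carrier_mat k k"
    and C_rank: "vec_space.rank k (C q) = k"
begin

definition Cinv :: "real mat" where "Cinv = mat_inv (C q)"

lemma Cinv: "Cinv \<in> carrier_mat k k" "C q * Cinv = 1\<^sub>m k" "Cinv * C q = 1\<^sub>m k"
  using mat_inv_inverse[OF C_carrier[OF order_refl] C_rank] by (auto simp: Cinv_def)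

abbreviation Lam :: "real mat" where "Lam \<equiv> bfLambda k q C"
abbreviation Theta :: "real mat" where "Theta \<equiv> bfTheta k q C"

text \<open>Reconstructs the state from the filter state when the input of the filter vanishes: the
  first q blocks are kept, and the others are last blocks of powers of \<Lambda> applied to
  it.\<close>

definition Mm :: "real mat" where
  "Mm = bfE k p q + msum (k * p) (k * q) (\<lambda>j. bfE_col k p (q + j) * sfE_T k q * Lam ^\<^sub>m j) {1..p - q}"

text \<open>The contribution of the m-th derivative of the filter input, already multiplied by
  \<open>Theta\<close>, to the state. The subtraction \<open>j - 1 - m\<close> is exact because the
  range starts at m + 1.\<close>

definition Nm :: "nat \<Rightarrow> real mat" where
  "Nm m = msum (k * p) (k * q) (\<lambda>j. bfE_col k p (q + j) * sfE_T k q * Lam ^\<^sub>m (j - 1 - m)) {m + 1..p - q}"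

lemma carriers:
  "Lam \<in> carrier_mat (k * q) (k * q)" "Theta \<in> carrier_mat (k * q) k"
  "bfE k p q \<in> carrier_mat (k * p) (k * q)" "bfE_col k p j \<in> carrier_mat (k * p) k"
  "sfE_T k q \<in> carrier_mat k (k * q)" "Mm \<in> carrier_mat (k * p) (k * q)" "Nm m \<in> carrier_mat (k * p) (k * q)"
  by (auto simp: bfLambda_def bfTheta_def bfE_def bfE_col_def sfE_T_def Mm_def Nm_def block_mat_def msum_def)

lemma Lam_pow: "Lam ^\<^sub>m j \<in> carrier_mat (k * q) (k * q)"
  using carriers(1) by (rule pow_carrier_mat)

text \<open>Entry (s, l) of the row of blocks (C 0, ..., C q) in flat indexing, without zero
  padding, so that it serves both placements of the coefficients.\<close>

definition Cf :: "nat \<Rightarrow> nat \<Rightarrow> real" where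
  "Cf s l = C (l div k) $$ (s, l mod k)"

definition yc :: "(nat \<Rightarrow> real) \<Rightarrow> nat \<Rightarrow> real" where
  "yc x s = (\<Sum>l<k * Suc q. Cf s l * x l)"

definition xq :: "(nat \<Rightarrow> real) \<Rightarrow> real vec" where
  "xq x = vec (k * q) x"

definition yv :: "(nat \<Rightarrow> real) \<Rightarrow> real vec" where
  "yv x = vec k (yc x)"

text \<open>A sequence x stands for a function with values in a k-dimensional space followed by its
  successive derivatives, block by block; moving by m blocks is then the m-th derivative.\<close>

definition shift :: "nat \<Rightarrow> (nat \<Rightarrow> real) \<Rightarrow> nat \<Rightarrow> real" where
  "shift m x l = x (l + m * k)"

lemma xq_carrier [simp]: "xq x \<in> carrier_vec (k * q)" and yv_carrier [simp]: "yv x \<in> carrier_vec k"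
  by (auto simp: xq_def yv_def)

lemma Lam_entry_shift:
  assumes "i < k * (q - 1)" "l < k * q"
  shows "Lam $$ (i, l) = (if l = i + k then 1 else 0)"
proof -
  have i: "i div k < q - 1" using div_less_blocks[OF assms(1)] .
  have iq: "i < k * q" using assms(1) by (meson diff_le_self less_le_trans mult_le_mono2)
  have "l = i + k \<longleftrightarrow> l div k = i div k + 1 \<and> l mod k = i mod k"
    using k0 nat_eq_iff_div_mod[of l "i + k" k] by simp
  then show ?thesis using assms i iq k0 by (auto simp: bfLambda_def block_mat_entry)
qed

lemma Lam_entry_last:
  assumes "c < k" "l < k * q"
  shows "Lam $$ (k * (q - 1) + c, l) = - (\<Sum>s<k. Cinv $$ (c, s) * Cf s l)"
proof -
  have lq: "l div k < q" using div_less_blocks[OF assms(2)] .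
  have i: "k * (q - 1) + c < k * q" using block_index_less[OF assms(1), of "q - 1" q] q0 by simp
  have "Lam $$ (k * (q - 1) + c, l) = (- (Cinv * C (l div k))) $$ (c, l mod k)"
    using assms k0 q0 i by (simp add: bfLambda_def block_mat_entry Cinv_def)
  also have "\<dots> = - (Cinv * C (l div k)) $$ (c, l mod k)"
    using Cinv(1) C_carrier[of "l div k"] lq assms k0 by (subst index_uminus_mat) auto
  also have "(Cinv * C (l div k)) $$ (c, l mod k) = (\<Sum>s<k. Cinv $$ (c, s) * Cf s l)"
    using index_mult_mat_sum[OF Cinv(1) C_carrier, of "l div k" c "l mod k"] lq assms k0 by (simp add: Cf_def)
  finally show ?thesis .
qed

lemma Theta_entry:
  assumes "i < k * q" "s < k"
  shows "Theta $$ (i, s) = (if i div k + 1 = q then Cinv $$ (i mod k, s) else 0)"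
  using assms k0 by (simp add: bfTheta_def block_mat_entry Cinv_def)

lemma Cinv_Cq_sum:
  assumes "c < k"
  shows "(\<Sum>s<k. Cinv $$ (c, s) * (\<Sum>d<k. C q $$ (s, d) * x d)) = (x c :: real)"
proof -
  have "(\<Sum>s<k. Cinv $$ (c, s) * (\<Sum>d<k. C q $$ (s, d) * x d)) = (\<Sum>s<k. \<Sum>d<k. Cinv $$ (c, s) * C q $$ (s, d) * x d)"
    by (simp add: sum_distrib_left mult.assoc)
  also have "\<dots> = (\<Sum>d<k. \<Sum>s<k. Cinv $$ (c, s) * C q $$ (s, d) * x d)" by (rule sum.swap)
  also have "\<dots> = (\<Sum>d<k. (Cinv * C q) $$ (c, d) * x d)"
    using assms by (intro sum.cong refl) (simp add: index_mult_mat_sum[OF Cinv(1) C_carrier[OF order_refl]] sum_distrib_right)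
  also have "\<dots> = (\<Sum>d<k. if d = c then x d else 0)"
    using assms by (intro sum.cong refl) (auto simp: Cinv(3))
  also have "\<dots> = x c" using assms by simp
  finally show ?thesis .
qed

lemma yc_split: "yc x s = (\<Sum>l<k * q. Cf s l * x l) + (\<Sum>d<k. C q $$ (s, d) * x (k * q + d))"
  unfolding yc_def sum_last_block using k0 by (simp add: Cf_def)

text \<open>The stacked vector of the first q blocks is the state of the filter with input y.\<close>

lemma xq_shift: "xq (shift 1 x) = Lam *\<^sub>v xq x + Theta *\<^sub>v yv x"
proof (rule eq_vecI)
  show "dim_vec (xq (shift 1 x)) = dim_vec (Lam *\<^sub>v xq x + Theta *\<^sub>v yv x)"
    using carriers by (simp add: xq_def)
  fix i assume "i < dim_vec (Lam *\<^sub>v xq x + Theta *\<^sub>v yv x)"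
  then have i: "i < k * q" using carriers by simp
  have L: "(Lam *\<^sub>v xq x) $ i = (\<Sum>l<k * q. Lam $$ (i, l) * x l)"
    by (subst index_mult_mat_vec_sum[OF carriers(1) xq_carrier i]) (simp add: xq_def)
  have T: "(Theta *\<^sub>v yv x) $ i = (\<Sum>s<k. Theta $$ (i, s) * yc x s)"
    by (subst index_mult_mat_vec_sum[OF carriers(2) yv_carrier i]) (simp add: yv_def)
  have rhs: "(Lam *\<^sub>v xq x + Theta *\<^sub>v yv x) $ i = (Lam *\<^sub>v xq x) $ i + (Theta *\<^sub>v yv x) $ i"
    using i carriers by (subst index_add_vec) auto
  show "xq (shift 1 x) $ i = (Lam *\<^sub>v xq x + Theta *\<^sub>v yv x) $ i"
  proof (cases "i < k * (q - 1)")
    case True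
    have iq: "i div k + 1 \<noteq> q" using div_less_blocks[OF True] by simp
    have ik: "i + k < k * q" using True q0 by (cases q) auto
    have "(\<Sum>l<k * q. Lam $$ (i, l) * x l) = (\<Sum>l<k * q. if l = i + k then x l else 0)"
      using True by (intro sum.cong refl) (simp add: Lam_entry_shift)
    moreover have "(\<Sum>s<k. Theta $$ (i, s) * yc x s) = 0"
      using i iq by (simp add: Theta_entry)
    moreover have "xq (shift 1 x) $ i = x (i + k)" using i by (simp add: xq_def shift_def)
    ultimately show ?thesis using ik unfolding rhs L T by simp
  next
    case False
    define c where "c = i - k * (q - 1)"
    have ic: "i = k * (q - 1) + c" using False by (simp add: c_def)
    have c: "c < k" using i False q0 by (cases q) (auto simp: c_def)
    have dm: "i div k + 1 = q" "i mod k = c" using c q0 by (auto simp: ic)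
    have "(\<Sum>l<k * q. Lam $$ (i, l) * x l) + (\<Sum>s<k. Theta $$ (i, s) * yc x s) =
       - (\<Sum>l<k * q. \<Sum>s<k. Cinv $$ (c, s) * (Cf s l * x l)) + (\<Sum>s<k. Cinv $$ (c, s) * yc x s)"
    proof -
      have "(\<Sum>l<k * q. Lam $$ (i, l) * x l) = (\<Sum>l<k * q. - (\<Sum>s<k. Cinv $$ (c, s) * (Cf s l * x l)))"
      proof (intro sum.cong refl)
        fix l assume "l \<in> {..<k * q}"
        then have "Lam $$ (i, l) = - (\<Sum>s<k. Cinv $$ (c, s) * Cf s l)"
          unfolding ic by (intro Lam_entry_last[OF c]) simp
        then show "Lam $$ (i, l) * x l = - (\<Sum>s<k. Cinv $$ (c, s) * (Cf s l * x l))"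
          by (simp add: sum_distrib_right mult.assoc)
      qed
      moreover have "(\<Sum>s<k. Theta $$ (i, s) * yc x s) = (\<Sum>s<k. Cinv $$ (c, s) * yc x s)"
        using i dm by (intro sum.cong refl) (simp add: Theta_entry)
      ultimately show ?thesis by (simp add: sum_negf)
    qed
    also have "(\<Sum>l<k * q. \<Sum>s<k. Cinv $$ (c, s) * (Cf s l * x l)) = (\<Sum>s<k. Cinv $$ (c, s) * (\<Sum>l<k * q. Cf s l * x l))"
      by (subst sum.swap) (simp add: sum_distrib_left)
    \<comment> \<open>Removing the blocks below q from the output leaves C q applied to block q, and
      \<open>Cinv\<close> recovers that block: the last row of the filter is the output equation
      solved for its highest derivative.\<close>
    also have "- \<dots> + (\<Sum>s<k. Cinv $$ (c, s) * yc x s) = (\<Sum>s<k. Cinv $$ (c, s) * (\<Sum>d<k. C q $$ (s, d) * x (k * q + d)))"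
      unfolding yc_split by (simp add: distrib_left sum.distrib)
    also have "\<dots> = x (k * q + c)" by (rule Cinv_Cq_sum[OF c])
    also have "k * q + c = i + k" using q0 by (cases q) (auto simp: ic)
    finally show ?thesis unfolding rhs L T using i by (simp add: xq_def shift_def)
  qed
qed

lemma shift_shift: "shift 1 (shift m x) = shift (Suc m) x"
  by (auto simp: shift_def fun_eq_iff algebra_simps)

text \<open>Variation of constants for the filter equation, with differentiation in the role of the
  step.\<close>

lemma xq_shift_iterate:
  "i < k * q \<Longrightarrow> xq (shift j x) $ i = (Lam ^\<^sub>m j *\<^sub>v xq x) $ i + (\<Sum>m<j. (Lam ^\<^sub>m (j - 1 - m) *\<^sub>v (Theta *\<^sub>v yv (shift m x))) $ i)"
proof (induction j arbitrary: i)
  case 0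
  have "shift 0 x = x" by (simp add: shift_def fun_eq_iff)
  then show ?case using carriers by (simp add: one_mult_mat_vec[OF xq_carrier])
next
  case (Suc j)
  have T: "Theta *\<^sub>v y \<in> carrier_vec (k * q)" for y
    by (rule carrier_vecI) (simp add: carrier_matD[OF carriers(2)])
  have step: "(Lam *\<^sub>v (Lam ^\<^sub>m n *\<^sub>v v)) = Lam ^\<^sub>m Suc n *\<^sub>v v" if "v \<in> carrier_vec (k * q)" for n v
    unfolding pow_mat_Suc_left[OF carriers(1)] by (rule assoc_mult_mat_vec[OF carriers(1) Lam_pow that, symmetric])
  have ent: "(\<Sum>l<k * q. Lam $$ (i, l) * (Lam ^\<^sub>m n *\<^sub>v v) $ l) = (Lam ^\<^sub>m Suc n *\<^sub>v v) $ i" if "v \<in> carrier_vec (k * q)" for n v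
    unfolding step[OF that, symmetric]
    by (rule index_mult_mat_vec_sum[OF carriers(1) mult_mat_vec_carrier[OF Lam_pow that] Suc.prems, symmetric])
  have "xq (shift (Suc j) x) $ i = (Lam *\<^sub>v xq (shift j x)) $ i + (Theta *\<^sub>v yv (shift j x)) $ i"
    using xq_shift[of "shift j x"] Suc.prems carriers unfolding shift_shift by simp
  also have "(Lam *\<^sub>v xq (shift j x)) $ i = (\<Sum>l<k * q. Lam $$ (i, l) * xq (shift j x) $ l)"
    by (rule index_mult_mat_vec_sum[OF carriers(1) xq_carrier Suc.prems])
  also have "\<dots> = (\<Sum>l<k * q. Lam $$ (i, l) * (Lam ^\<^sub>m j *\<^sub>v xq x) $ l +
      (\<Sum>m<j. Lam $$ (i, l) * (Lam ^\<^sub>m (j - 1 - m) *\<^sub>v (Theta *\<^sub>v yv (shift m x))) $ l))"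
    using Suc.IH by (intro sum.cong refl) (simp add: distrib_left sum_distrib_left)
  also have "\<dots> = (Lam ^\<^sub>m Suc j *\<^sub>v xq x) $ i + (\<Sum>m<j. (Lam ^\<^sub>m Suc (j - 1 - m) *\<^sub>v (Theta *\<^sub>v yv (shift m x))) $ i)"
    unfolding sum.distrib ent[OF xq_carrier] by (subst sum.swap) (simp only: ent[OF T])
  also have "(\<Sum>m<j. (Lam ^\<^sub>m Suc (j - 1 - m) *\<^sub>v (Theta *\<^sub>v yv (shift m x))) $ i) =
      (\<Sum>m<j. (Lam ^\<^sub>m (Suc j - 1 - m) *\<^sub>v (Theta *\<^sub>v yv (shift m x))) $ i)"
    by (intro sum.cong refl) (simp add: Suc_diff_Suc del: pow_mat.simps)
  also have "(Theta *\<^sub>v yv (shift j x)) $ i = (Lam ^\<^sub>m (Suc j - 1 - j) *\<^sub>v (Theta *\<^sub>v yv (shift j x))) $ i"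
    using carriers by (simp add: one_mult_mat_vec[OF T])
  finally show ?case by simp
qed

lemma E_mult_vec:
  assumes "w \<in> carrier_vec (k * q)" "i < k * p"
  shows "(bfE k p q *\<^sub>v w) $ i = (if i < k * q then w $ i else 0)"
proof -
  have e: "bfE k p q $$ (i, l) = (if l = i then 1 else 0)" if "l < k * q" for l
  proof -
    have "bfE k p q $$ (i, l) = (if i div k = l div k then 1\<^sub>m k else 0\<^sub>m k k) $$ (l mod k, i mod k)"
      using assms that by (simp add: bfE_def block_mat_def)
    also have "\<dots> = (if l div k = i div k \<and> l mod k = i mod k then 1 else 0)"
      using k0 by auto
    finally show ?thesis using nat_eq_iff_div_mod[of l i k] by simp
  qed
  have "(bfE k p q *\<^sub>v w) $ i = (\<Sum>l<k * q. bfE k p q $$ (i, l) * w $ l)"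
    by (rule index_mult_mat_vec_sum[OF carriers(3) assms])
  also have "\<dots> = (\<Sum>l<k * q. if l = i then w $ l else 0)"
    by (intro sum.cong refl) (simp add: e)
  finally show ?thesis by auto
qed

lemma E_col_sfE_mult_vec:
  assumes "w \<in> carrier_vec (k * q)" "i < k * p"
  shows "((bfE_col k p j * sfE_T k q) *\<^sub>v w) $ i = (if i div k + 1 = j then w $ (k * (q - 1) + i mod k) else 0)"
proof -
  have ik: "i mod k < k" using k0 by simp
  have s: "(sfE_T k q *\<^sub>v w) $ c = w $ (k * (q - 1) + c)" if c: "c < k" for c
  proof -
    have e: "sfE_T k q $$ (c, l) = (if l = k * (q - 1) + c then 1 else 0)" if "l < k * q" for l
    proof -
      have "sfE_T k q $$ (c, l) = (if l div k + 1 = q then 1\<^sub>m k else 0\<^sub>m k k) $$ (c, l mod k)"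
        using c that k0 by (simp add: sfE_T_def block_mat_def)
      also have "\<dots> = (if l div k = q - 1 \<and> l mod k = c then 1 else 0)"
        using c q0 k0 by auto
      also have "l div k = q - 1 \<and> l mod k = c \<longleftrightarrow> l = k * (q - 1) + c"
        using c nat_eq_iff_div_mod[of l "k * (q - 1) + c" k] by simp
      finally show ?thesis .
    qed
    have "(sfE_T k q *\<^sub>v w) $ c = (\<Sum>l<k * q. sfE_T k q $$ (c, l) * w $ l)"
      by (rule index_mult_mat_vec_sum[OF carriers(5) assms(1) c])
    also have "\<dots> = (\<Sum>l<k * q. if l = k * (q - 1) + c then w $ l else 0)"
      by (intro sum.cong refl) (simp add: e)
    finally show ?thesis using block_index_less[OF c, of "q - 1" q] q0 by simp
  qed
  have sc: "sfE_T k q *\<^sub>v w \<in> carrier_vec k" by (rule mult_mat_vec_carrier[OF carriers(5) assms(1)])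
  have e: "bfE_col k p j $$ (i, c) = (if i div k + 1 = j \<and> c = i mod k then 1 else 0)" if "c < k" for c
    using assms that k0 by (auto simp: bfE_col_def block_mat_def)
  have "((bfE_col k p j * sfE_T k q) *\<^sub>v w) $ i = (bfE_col k p j *\<^sub>v (sfE_T k q *\<^sub>v w)) $ i"
    by (simp only: assoc_mult_mat_vec[OF carriers(4,5) assms(1)])
  also have "\<dots> = (\<Sum>c<k. bfE_col k p j $$ (i, c) * (sfE_T k q *\<^sub>v w) $ c)"
    by (rule index_mult_mat_vec_sum[OF carriers(4) sc assms(2)])
  also have "\<dots> = (\<Sum>c<k. if c = i mod k then (if i div k + 1 = j then w $ (k * (q - 1) + c) else 0) else 0)"
    by (intro sum.cong refl) (simp add: e s)
  finally show ?thesis using ik by simp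
qed

lemma E_term_mult_vec:
  assumes "w \<in> carrier_vec (k * q)" "i < k * p"
  shows "((bfE_col k p j * sfE_T k q * Lam ^\<^sub>m r) *\<^sub>v w) $ i =
    (if i div k + 1 = j then (Lam ^\<^sub>m r *\<^sub>v w) $ (k * (q - 1) + i mod k) else 0)"
proof -
  have "(bfE_col k p j * sfE_T k q * Lam ^\<^sub>m r) *\<^sub>v w = (bfE_col k p j * sfE_T k q) *\<^sub>v (Lam ^\<^sub>m r *\<^sub>v w)"
    by (rule assoc_mult_mat_vec[OF mult_carrier_mat[OF carriers(4,5)] Lam_pow assms(1)])
  then show ?thesis
    using E_col_sfE_mult_vec[OF mult_mat_vec_carrier[OF Lam_pow assms(1)] assms(2)] by simp
qed

lemma E_term_carrier: "bfE_col k p j * sfE_T k q * Lam ^\<^sub>m r \<in> carrier_mat (k * p) (k * q)"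
  by (intro mult_carrier_mat[OF mult_carrier_mat[OF carriers(4,5)] Lam_pow])

lemma Mm_mult_vec:
  assumes w: "w \<in> carrier_vec (k * q)" and i: "i < k * p"
  shows "(Mm *\<^sub>v w) $ i = (if i < k * q then w $ i else (Lam ^\<^sub>m (i div k + 1 - q) *\<^sub>v w) $ (k * (q - 1) + i mod k))"
proof -
  have "(Mm *\<^sub>v w) $ i = (bfE k p q *\<^sub>v w) $ i +
      (msum (k * p) (k * q) (\<lambda>j. bfE_col k p (q + j) * sfE_T k q * Lam ^\<^sub>m j) {1..p - q} *\<^sub>v w) $ i"
    unfolding Mm_def using i carriers w by (simp add: add_mult_distrib_mat_vec[OF carriers(3) msum_carrier w] msum_carrier carrier_matD[OF msum_carrier])
  also have "(msum (k * p) (k * q) (\<lambda>j. bfE_col k p (q + j) * sfE_T k q * Lam ^\<^sub>m j) {1..p - q} *\<^sub>v w) $ i =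
      (\<Sum>j\<in>{1..p - q}. if i div k + 1 = q + j then (Lam ^\<^sub>m j *\<^sub>v w) $ (k * (q - 1) + i mod k) else 0)"
    using assms by (subst msum_mult_vec[OF E_term_carrier]) (simp_all only: E_term_mult_vec)
  also have "\<dots> = (if i < k * q then 0 else (Lam ^\<^sub>m (i div k + 1 - q) *\<^sub>v w) $ (k * (q - 1) + i mod k))"
  proof (cases "i < k * q")
    case True
    from div_less_blocks[OF this]
    have "(\<Sum>j\<in>{1..p - q}. if i div k + 1 = q + j then (Lam ^\<^sub>m j *\<^sub>v w) $ (k * (q - 1) + i mod k) else 0) = 0"
      by (intro sum.neutral) auto
    then show ?thesis using True by (simp only: if_True)
  next
    case False
    then have "q \<le> i div k" using k0 by (simp add: less_eq_div_iff_mult_less_eq mult.commute)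
    moreover have "i div k < p" by (rule div_less_blocks[OF i])
    ultimately have "i div k + 1 - q \<in> {1..p - q}" by auto
    moreover have "i div k + 1 = q + j \<longleftrightarrow> j = i div k + 1 - q" for j using \<open>q \<le> i div k\<close> by auto
    ultimately show ?thesis using False by (simp add: sum.delta)
  qed
  finally show ?thesis using E_mult_vec[OF w i] by simp
qed

lemma Nm_mult_vec:
  assumes w: "w \<in> carrier_vec (k * q)" and i: "i < k * p"
  shows "(Nm m *\<^sub>v w) $ i = (if m < i div k + 1 - q then (Lam ^\<^sub>m (i div k - q - m) *\<^sub>v w) $ (k * (q - 1) + i mod k) else 0)"
proof -
  have "(Nm m *\<^sub>v w) $ i = (\<Sum>j\<in>{m + 1..p - q}. if i div k + 1 = q + j then (Lam ^\<^sub>m (j - 1 - m) *\<^sub>v w) $ (k * (q - 1) + i mod k) else 0)"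
    unfolding Nm_def using assms by (subst msum_mult_vec[OF E_term_carrier]) (simp_all only: E_term_mult_vec)
  also have "\<dots> = (if m < i div k + 1 - q then (Lam ^\<^sub>m (i div k - q - m) *\<^sub>v w) $ (k * (q - 1) + i mod k) else 0)"
  proof (cases "m < i div k + 1 - q")
    case True
    have "i div k < p" by (rule div_less_blocks[OF i])
    then have "i div k + 1 - q \<in> {m + 1..p - q}" using True by auto
    moreover have "i div k + 1 = q + j \<longleftrightarrow> j = i div k + 1 - q" for j using True by auto
    moreover have "i div k + 1 - q - 1 - m = i div k - q - m" using True by simp
    ultimately show ?thesis using True by (simp add: sum.delta)
  next
    case False
    then show ?thesis by (intro sum.neutral[THEN trans]) auto
  qed
  finally show ?thesis .
qed

text \<open>The origin of both matrix families. Blocks beyond the q-th are last blocks of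
  derivatives of the filter state; iterating the filter equation splits them into a part from the
  state of the filter and a part from derivatives of its input.\<close>

lemma state_decomposition:
  assumes i: "i < k * p"
  shows "x i = (Mm *\<^sub>v xq x) $ i + (\<Sum>m<p - q. (Nm m *\<^sub>v (Theta *\<^sub>v yv (shift m x))) $ i)"
proof -
  have T: "Theta *\<^sub>v y \<in> carrier_vec (k * q)" for y
    by (rule carrier_vecI) (simp add: carrier_matD[OF carriers(2)])
  show ?thesis
  proof (cases "i < k * q")
    case True
    have "i div k + 1 - q = 0" using div_less_blocks[OF True] by simp
    then show ?thesis using True by (simp add: Mm_mult_vec[OF xq_carrier i] Nm_mult_vec[OF T i]) (simp add: xq_def)
  next
    case False
    have qi: "q \<le> i div k" using k0 False by (simp add: less_eq_div_iff_mult_less_eq mult.commute)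
    have ip: "i div k < p" by (rule div_less_blocks[OF i])
    \<comment> \<open>Counted from 0, the block of i is number q - 1 + j, that is, the last block of
      the filter state after j differentiations; c is its position there.\<close>
    define j where "j = i div k + 1 - q"
    define c where "c = k * (q - 1) + i mod k"
    have c: "c < k * q" unfolding c_def using block_index_less[of "i mod k" k "q - 1" q] k0 q0 by simp
    have "(\<Sum>m<p - q. (Nm m *\<^sub>v (Theta *\<^sub>v yv (shift m x))) $ i) =
        (\<Sum>m<p - q. if m < j then (Lam ^\<^sub>m (j - 1 - m) *\<^sub>v (Theta *\<^sub>v yv (shift m x))) $ c else 0)"
      by (intro sum.cong refl) (simp add: Nm_mult_vec[OF T i] j_def c_def)
    also have "\<dots> = (\<Sum>m<j. (Lam ^\<^sub>m (j - 1 - m) *\<^sub>v (Theta *\<^sub>v yv (shift m x))) $ c)"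
    proof -
      have "j \<le> p - q" unfolding j_def using ip by simp
      then have "{m \<in> {..<p - q}. m < j} = {..<j}" by auto
      then show ?thesis using sum.inter_filter[of "{..<p - q}" "\<lambda>m. (Lam ^\<^sub>m (j - 1 - m) *\<^sub>v (Theta *\<^sub>v yv (shift m x))) $ c" "\<lambda>m. m < j"] by simp
    qed
    finally have "(Mm *\<^sub>v xq x) $ i + (\<Sum>m<p - q. (Nm m *\<^sub>v (Theta *\<^sub>v yv (shift m x))) $ i) = xq (shift j x) $ c"
      using xq_shift_iterate[OF c, of j x] False by (simp add: Mm_mult_vec[OF xq_carrier i] j_def c_def)
    also have "\<dots> = x (c + j * k)" using c by (simp add: xq_def shift_def)
    also have "c + j * k = i"
    proof -
      have "c + j * k = k * ((q - 1) + j) + i mod k" by (simp add: c_def algebra_simps)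
      also have "(q - 1) + j = i div k" unfolding j_def using qi q0 by simp
      finally show ?thesis by simp
    qed
    finally show ?thesis by simp
  qed
qed

text \<open>The shift rows force an eigenvector of the companion matrix to have the form (\<xi>, e
  \<xi>, e^2 \<xi>, ...), and its last block row says that Q(e) annihilates \<xi>. Hence eigenvalues
  are zeros of det Q.\<close>

lemma Lam_stable:
  assumes stable: "\<And>z. det (MA_poly k q C z) = 0 \<Longrightarrow> Re z < 0"
    and "eigenvalue (map_mat complex_of_real Lam) e"
  shows "Re e < 0"
proof -
  have Lc: "map_mat complex_of_real Lam \<in> carrier_mat (k * q) (k * q)" using carriers by simp
  obtain v where v: "v \<in> carrier_vec (k * q)" "v \<noteq> 0\<^sub>v (k * q)" "map_mat complex_of_real Lam *\<^sub>v v = e \<cdot>\<^sub>v v"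
    using assms(2) Lc unfolding eigenvalue_def eigenvector_def by auto
  have row: "(\<Sum>l<k * q. of_real (Lam $$ (i, l)) * v $ l) = e * v $ i" if "i < k * q" for i
  proof -
    have "(map_mat complex_of_real Lam *\<^sub>v v) $ i = (\<Sum>l<k * q. of_real (Lam $$ (i, l)) * v $ l)"
      using that carriers by (subst index_mult_mat_vec_sum[OF Lc v(1) that]) simp
    then show ?thesis using v that by simp
  qed
  have shift: "v $ (i + k) = e * v $ i" if "i < k * (q - 1)" for i
  proof -
    have ik: "i + k < k * q" using that q0 by (cases q) auto
    have "(\<Sum>l<k * q. of_real (Lam $$ (i, l)) * v $ l) = (\<Sum>l<k * q. if l = i + k then v $ l else 0)"
      using that by (intro sum.cong refl) (simp add: Lam_entry_shift)
    then show ?thesis using row[of i] ik by simp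
  qed
  have pow: "v $ (k * j + c) = e ^ j * v $ c" if "j < q" "c < k" for j c
    using that
  proof (induction j)
    case (Suc j)
    have "k * j + c < k * (q - 1)" using Suc.prems by (intro block_index_less) auto
    from shift[OF this] Suc show ?case by (simp add: algebra_simps)
  qed simp
  define \<xi> where "\<xi> = vec k (\<lambda>c. v $ c)"
  have "\<xi> \<noteq> 0\<^sub>v k"
  proof
    assume z: "\<xi> = 0\<^sub>v k"
    have "v $ i = 0" if "i < k * q" for i
    proof -
      have "v $ (k * (i div k) + i mod k) = e ^ (i div k) * v $ (i mod k)"
        using div_less_blocks[OF that] k0 by (intro pow) auto
      moreover have "v $ (i mod k) = \<xi> $ (i mod k)" using k0 by (simp add: \<xi>_def)
      ultimately show ?thesis using z k0 by simp
    qed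
    then have "v = 0\<^sub>v (k * q)" using v(1) by (intro eq_vecI) auto
    then show False using v by simp
  qed
  moreover have "MA_poly k q C e *\<^sub>v \<xi> = 0\<^sub>v k"
  proof (rule eq_vecI)
    fix s assume "s < dim_vec (0\<^sub>v k)"
    then have s: "s < k" by simp
    have MAc: "MA_poly k q C e \<in> carrier_mat k k" by (simp add: MA_poly_def msum_def)
    have \<xi>c: "\<xi> \<in> carrier_vec k" by (simp add: \<xi>_def)
    \<comment> \<open>The last block row of the eigenvalue equation. Multiplied by C q, it is the
      top-degree term of Q(e) \<xi> expressed through the lower ones.\<close>
    have last: "e ^ q * v $ d = - (\<Sum>l<k * q. \<Sum>s<k. of_real (Cinv $$ (d, s) * Cf s l) * v $ l)" if d: "d < k" for d
    proof -
      have i: "k * (q - 1) + d < k * q" using block_index_less[OF d, of "q - 1" q] q0 by simp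
      have "e ^ q * v $ d = e * v $ (k * (q - 1) + d)"
        using pow[of "q - 1" d] d q0 by (cases q) auto
      also have "\<dots> = (\<Sum>l<k * q. of_real (- (\<Sum>s<k. Cinv $$ (d, s) * Cf s l)) * v $ l)"
        unfolding row[OF i, symmetric] by (intro sum.cong refl) (simp only: lessThan_iff Lam_entry_last[OF d])
      also have "\<dots> = - (\<Sum>l<k * q. \<Sum>s<k. of_real (Cinv $$ (d, s) * Cf s l) * v $ l)"
        by (simp add: sum_negf sum_distrib_right)
      finally show ?thesis .
    qed
    have CC: "(\<Sum>d<k. C q $$ (s, d) * Cinv $$ (d, r)) = (if s = r then 1 else 0)" if "r < k" for r
      using index_mult_mat_sum[OF C_carrier[OF order_refl] Cinv(1) s that] Cinv(2) s that by simp
    have t: "of_real (C q $$ (s, d)) * (e ^ q * v $ d) =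
        - (\<Sum>l<k * q. \<Sum>r<k. of_real (C q $$ (s, d) * Cinv $$ (d, r)) * (of_real (Cf r l) * v $ l))" if "d < k" for d
      unfolding last[OF that] by (simp add: sum_distrib_left mult_ac)
    have "(\<Sum>d<k. of_real (C q $$ (s, d)) * (e ^ q * v $ d)) =
        (\<Sum>d<k. - (\<Sum>l<k * q. \<Sum>r<k. of_real (C q $$ (s, d) * Cinv $$ (d, r)) * (of_real (Cf r l) * v $ l)))"
      by (intro sum.cong refl t) simp
    also have "\<dots> = - (\<Sum>d<k. \<Sum>l<k * q. \<Sum>r<k. of_real (C q $$ (s, d) * Cinv $$ (d, r)) * (of_real (Cf r l) * v $ l))"
      by (rule sum_negf)
    also have "(\<Sum>d<k. \<Sum>l<k * q. \<Sum>r<k. of_real (C q $$ (s, d) * Cinv $$ (d, r)) * (of_real (Cf r l) * v $ l)) =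
        (\<Sum>l<k * q. \<Sum>d<k. \<Sum>r<k. of_real (C q $$ (s, d) * Cinv $$ (d, r)) * (of_real (Cf r l) * v $ l))"
      by (rule sum.swap)
    also have "\<dots> = (\<Sum>l<k * q. \<Sum>r<k. \<Sum>d<k. of_real (C q $$ (s, d) * Cinv $$ (d, r)) * (of_real (Cf r l) * v $ l))"
      by (intro sum.cong refl sum.swap)
    also have "\<dots> = (\<Sum>l<k * q. \<Sum>r<k. of_real (\<Sum>d<k. C q $$ (s, d) * Cinv $$ (d, r)) * (of_real (Cf r l) * v $ l))"
      by (simp add: sum_distrib_right)
    also have "\<dots> = (\<Sum>l<k * q. \<Sum>r<k. if r = s then of_real (Cf s l) * v $ l else 0)"
      by (intro sum.cong refl) (simp add: CC)
    also have "\<dots> = (\<Sum>l<k * q. of_real (Cf s l) * v $ l)" using s by simp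
    finally have key: "(\<Sum>d<k. of_real (C q $$ (s, d)) * (e ^ q * v $ d)) = - (\<Sum>l<k * q. of_real (Cf s l) * v $ l)" .
    have lower: "(\<Sum>l<k * q. of_real (Cf s l) * v $ l) = (\<Sum>j<q. \<Sum>c<k. of_real (C j $$ (s, c)) * (e ^ j * v $ c))"
    proof -
      have "(\<Sum>l<k * q. of_real (Cf s l) * v $ l) = (\<Sum>j<q. \<Sum>c<k. of_real (Cf s (k * j + c)) * v $ (k * j + c))"
        by (rule sum_blocks)
      also have "\<dots> = (\<Sum>j<q. \<Sum>c<k. of_real (C j $$ (s, c)) * (e ^ j * v $ c))"
        by (intro sum.cong refl) (simp add: Cf_def pow)
      finally show ?thesis .
    qed
    have "(MA_poly k q C e *\<^sub>v \<xi>) $ s = (\<Sum>c<k. (\<Sum>j\<in>{0..q}. e ^ j * of_real (C j $$ (s, c))) * v $ c)"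
    proof -
      have "MA_poly k q C e $$ (s, c) = (\<Sum>j\<in>{0..q}. e ^ j * of_real (C j $$ (s, c)))" if "c < k" for c
        using s that C_carrier unfolding MA_poly_def msum_def by (simp add: carrier_matD[OF C_carrier])
      then show ?thesis
        by (subst index_mult_mat_vec_sum[OF MAc \<xi>c s]) (simp add: \<xi>_def)
    qed
    also have "\<dots> = (\<Sum>j\<in>{0..q}. \<Sum>c<k. of_real (C j $$ (s, c)) * (e ^ j * v $ c))"
      unfolding sum_distrib_right by (subst sum.swap) (simp add: mult_ac)
    also have "{0..q} = insert q {..<q}" by auto
    also have "(\<Sum>j\<in>insert q {..<q}. \<Sum>c<k. of_real (C j $$ (s, c)) * (e ^ j * v $ c)) = 0"
      using key lower by simp
    finally show "(MA_poly k q C e *\<^sub>v \<xi>) $ s = 0\<^sub>v k $ s" using s by simp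
  qed (simp add: MA_poly_def msum_def)
  moreover have "MA_poly k q C e \<in> carrier_mat k k" "\<xi> \<in> carrier_vec k"
    by (simp_all add: MA_poly_def msum_def \<xi>_def)
  ultimately have "det (MA_poly k q C e) = 0"
    using det_0_iff_vec_prod_zero[of "MA_poly k q C e" k] by blast
  then show ?thesis by (rule stable)
qed

end

text \<open>After division by the leading power only the leading coefficient survives in the limit,
  so it is 0, and the degree descends.\<close>

lemma tendsto_0_poly_coeffs:
  fixes Q :: "nat \<Rightarrow> real"
  assumes "((\<lambda>z. \<Sum>m<d. z ^ m * Q m) \<longlongrightarrow> 0) at_top" "m < d"
  shows "Q m = 0"
  using assms
proof (induction d arbitrary: m)
  case (Suc d)
  have lim0: "((\<lambda>z. (\<Sum>m<Suc d. z ^ m * Q m) * inverse (z ^ d)) \<longlongrightarrow> 0) at_top"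
  proof (rule Lim_null_comparison)
    show "\<forall>\<^sub>F z in at_top. norm ((\<Sum>m<Suc d. z ^ m * Q m) * inverse (z ^ d)) \<le> \<bar>\<Sum>m<Suc d. z ^ m * Q m\<bar>"
      using eventually_ge_at_top[of "1::real"]
    proof eventually_elim
      case (elim z)
      then have "inverse (z ^ d) \<le> 1" "0 \<le> inverse (z ^ d)"
        using one_le_power[of z d] by (simp_all add: inverse_le_1_iff)
      then have "\<bar>\<Sum>m<Suc d. z ^ m * Q m\<bar> * inverse (z ^ d) \<le> \<bar>\<Sum>m<Suc d. z ^ m * Q m\<bar> * 1"
        by (intro mult_left_mono) auto
      then show ?case using \<open>0 \<le> inverse (z ^ d)\<close> by (simp add: abs_mult)
    qed
    show "((\<lambda>z. \<bar>\<Sum>m<Suc d. z ^ m * Q m\<bar>) \<longlongrightarrow> 0) at_top"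
      using tendsto_rabs_zero[OF Suc.prems(1)] .
  qed
  have "((\<lambda>z. (\<Sum>m<Suc d. z ^ m * Q m) * inverse (z ^ d)) \<longlongrightarrow> (\<Sum>m<d. 0 * Q m) + Q d) at_top"
  proof (rule Lim_transform_eventually[where f="\<lambda>z. (\<Sum>m<d. inverse (z ^ (d - m)) * Q m) + Q d"])
    show "\<forall>\<^sub>F z in at_top. (\<Sum>m<d. inverse (z ^ (d - m)) * Q m) + Q d = (\<Sum>m<Suc d. z ^ m * Q m) * inverse (z ^ d)"
      using eventually_gt_at_top[of "0::real"]
    proof eventually_elim
      case (elim z)
      have "inverse (z ^ (d - m)) = z ^ m * inverse (z ^ d)" if "m < d" for m
      proof -
        have "z ^ d = z ^ (d - m) * z ^ m" using that by (simp flip: power_add)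
        then show ?thesis using elim by (simp add: field_simps)
      qed
      then have "(\<Sum>m<d. inverse (z ^ (d - m)) * Q m) = (\<Sum>m<d. z ^ m * Q m) * inverse (z ^ d)"
        by (simp add: sum_distrib_right sum_distrib_left mult_ac)
      then show ?case using elim by (simp add: distrib_right)
    qed
    show "((\<lambda>z. (\<Sum>m<d. inverse (z ^ (d - m)) * Q m) + Q d) \<longlongrightarrow> (\<Sum>m<d. 0 * Q m) + Q d) at_top"
    proof (intro tendsto_add tendsto_sum tendsto_mult tendsto_const)
      fix m assume "m \<in> {..<d}"
      then have "filterlim (\<lambda>z::real. z ^ (d - m)) at_top at_top"
        by (intro filterlim_pow_at_top filterlim_ident) auto
      then show "((\<lambda>z. inverse (z ^ (d - m))) \<longlongrightarrow> (0::real)) at_top"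
        by (rule tendsto_inverse_0_at_top)
    qed
  qed
  from tendsto_unique[OF trivial_limit_at_top_linorder this lim0] have Qd: "Q d = 0" by simp
  have "((\<lambda>z. \<Sum>m<d. z ^ m * Q m) \<longlongrightarrow> 0) at_top"
    using Suc.prems(1) unfolding sum.lessThan_Suc Qd by simp
  note IH = Suc.IH[OF this]
  show ?case
  proof (cases "m = d")
    case False
    then show ?thesis using IH[of m] Suc.prems(2) by simp
  qed (simp add: Qd)
qed simp

section \<open>The conditions as linear forms, their necessity and their sufficiency for
  deterministic paths\<close>

context ma_filter
begin

definition M_form :: "(nat \<Rightarrow> real) \<Rightarrow> nat \<Rightarrow> real vec \<Rightarrow> real" where
  "M_form l \<beta> w = (\<Sum>i<k * p. l i * (Mm *\<^sub>v (Lam ^\<^sub>m \<beta> *\<^sub>v w)) $ i)"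

definition N_form :: "(nat \<Rightarrow> real) \<Rightarrow> nat \<Rightarrow> real vec \<Rightarrow> real" where
  "N_form l m w = (\<Sum>i<k * p. l i * (Nm m *\<^sub>v w) $ i)"

text \<open>The row l times \<open>Mm\<close>; it puts the first family into the shape of a bilinear
  form in powers of \<Lambda>, to which the Cayley-Hamilton lemmas apply.\<close>

definition pull :: "(nat \<Rightarrow> real) \<Rightarrow> nat \<Rightarrow> real" where
  "pull l j = (\<Sum>i<k * p. l i * Mm $$ (i, j))"

lemma M_form_eq:
  assumes w: "w \<in> carrier_vec (k * q)"
  shows "M_form l \<beta> w = (\<Sum>i<k * q. \<Sum>j<k * q. pull l i * (Lam ^\<^sub>m \<beta>) $$ (i, j) * w $ j)"
proof -
  have c: "Lam ^\<^sub>m \<beta> *\<^sub>v w \<in> carrier_vec (k * q)" by (rule mult_mat_vec_carrier[OF Lam_pow w])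
  have "M_form l \<beta> w = (\<Sum>r<k * p. \<Sum>i<k * q. l r * Mm $$ (r, i) * (Lam ^\<^sub>m \<beta> *\<^sub>v w) $ i)"
    unfolding M_form_def
    by (intro sum.cong refl) (simp add: index_mult_mat_vec_sum[OF carriers(6) c] sum_distrib_left mult.assoc)
  also have "\<dots> = (\<Sum>i<k * q. pull l i * (Lam ^\<^sub>m \<beta> *\<^sub>v w) $ i)"
    by (subst sum.swap) (simp add: pull_def sum_distrib_right)
  also have "\<dots> = (\<Sum>i<k * q. \<Sum>j<k * q. pull l i * (Lam ^\<^sub>m \<beta>) $$ (i, j) * w $ j)"
    by (intro sum.cong refl) (simp add: index_mult_mat_vec_sum[OF Lam_pow w] sum_distrib_left mult.assoc)
  finally show ?thesis .
qed

lemma M_form_add: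
  assumes "v \<in> carrier_vec (k * q)" "w \<in> carrier_vec (k * q)"
  shows "M_form l \<beta> (v + w) = M_form l \<beta> v + M_form l \<beta> w"
  using assms by (simp add: M_form_eq distrib_left sum.distrib)

lemma M_form_smult:
  assumes "w \<in> carrier_vec (k * q)"
  shows "M_form l \<beta> (c \<cdot>\<^sub>v w) = c * M_form l \<beta> w"
  using assms by (simp add: M_form_eq sum_distrib_left mult_ac)

lemma M_form_Lam:
  assumes "w \<in> carrier_vec (k * q)"
  shows "M_form l \<beta> (Lam *\<^sub>v w) = M_form l (Suc \<beta>) w"
proof -
  have "Lam ^\<^sub>m Suc \<beta> *\<^sub>v w = Lam ^\<^sub>m \<beta> *\<^sub>v (Lam *\<^sub>v w)"
    by (simp add: assoc_mult_mat_vec[OF Lam_pow carriers(1) assms])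
  then show ?thesis by (simp add: M_form_def)
qed

lemma M_form_0: "w \<in> carrier_vec (k * q) \<Longrightarrow> M_form l 0 w = (\<Sum>i<k * p. l i * (Mm *\<^sub>v w) $ i)"
  using carriers(1) by (simp add: M_form_def)

lemma N_form_smult:
  assumes "w \<in> carrier_vec (k * q)"
  shows "N_form l m (c \<cdot>\<^sub>v w) = c * N_form l m w"
  using assms by (simp add: N_form_def mult_mat_vec[OF carriers(7) assms] carrier_matD[OF carriers(7)] sum_distrib_left mult_ac)

lemma Theta_smult: "w \<in> carrier_vec k \<Longrightarrow> Theta *\<^sub>v (c \<cdot>\<^sub>v w) = c \<cdot>\<^sub>v (Theta *\<^sub>v w)"
  by (rule mult_mat_vec[OF carriers(2)])

lemma Theta_carrier: "w \<in> carrier_vec k \<Longrightarrow> Theta *\<^sub>v w \<in> carrier_vec (k * q)"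
  by (rule mult_mat_vec_carrier[OF carriers(2)])

lemma sum_state_decomposition:
  "(\<Sum>i<k * p. l i * x i) = M_form l 0 (xq x) + (\<Sum>m<p - q. N_form l m (Theta *\<^sub>v yv (shift m x)))"
proof -
  have "(\<Sum>i<k * p. l i * x i) = (\<Sum>i<k * p. l i * (Mm *\<^sub>v xq x) $ i + (\<Sum>m<p - q. l i * (Nm m *\<^sub>v (Theta *\<^sub>v yv (shift m x))) $ i))"
    using state_decomposition[of _ x] by (intro sum.cong refl) (simp add: distrib_left sum_distrib_left)
  then show ?thesis
    unfolding sum.distrib M_form_0[OF xq_carrier] N_form_def by (subst (asm) sum.swap) simp
qed

lemma shift_0: "shift 0 x = x"
  by (rule ext) (simp add: shift_def)

text \<open>Formally the form equals the sum of z^m times the second family plus the sum of z^(-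
  \<beta> - 1) times the first. The coefficients are peeled off in order of decreasing power, by
  limits only: no series is summed and the resolvent of \<Lambda> is never formed.\<close>

lemma exponential_solutions_imp_conditions:
  assumes sol: "\<And>z. z > z0 \<Longrightarrow> \<exists>x. (\<forall>i. x (i + k) = z * x i) \<and> (\<forall>s<k. yc x s = (if s = a then 1 else 0)) \<and> (\<Sum>i<k * p. l i * x i) = 0"
  shows "M_form l \<beta> (Theta *\<^sub>v unit_vec k a) = 0"
    and "m < p - q \<Longrightarrow> N_form l m (Theta *\<^sub>v unit_vec k a) = 0"
proof -
  define u :: "real vec" where "u = unit_vec k a"
  have u: "u \<in> carrier_vec k" by (simp add: u_def)
  have Tu: "Theta *\<^sub>v u \<in> carrier_vec (k * q)" by (rule Theta_carrier[OF u])
  obtain x where x1: "\<And>z i. z > z0 \<Longrightarrow> x z (i + k) = z * x z i"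
    and x2: "\<And>z s. z > z0 \<Longrightarrow> s < k \<Longrightarrow> yc (x z) s = (if s = a then 1 else 0)"
    and x3: "\<And>z. z > z0 \<Longrightarrow> (\<Sum>i<k * p. l i * x z i) = 0"
    using sol by metis
  have xm: "shift m (x z) = (\<lambda>i. z ^ m * x z i)" if "z > z0" for z m
  proof
    fix i show "shift m (x z) i = z ^ m * x z i"
    proof (induction m)
      case (Suc m)
      have "x z (i + Suc m * k) = x z ((i + m * k) + k)" by (simp add: algebra_simps)
      also have "\<dots> = z * x z (i + m * k)" by (rule x1[OF that])
      finally show ?case using Suc by (simp add: shift_def)
    qed (simp add: shift_def)
  qed
  have yv: "yv (shift m (x z)) = z ^ m \<cdot>\<^sub>v u" if "z > z0" for z m
  proof (rule eq_vecI)
    fix s assume "s < dim_vec (z ^ m \<cdot>\<^sub>v u)"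
    then have s: "s < k" by (simp add: u_def)
    have "yc (\<lambda>i. z ^ m * x z i) s = z ^ m * yc (x z) s"
      by (simp add: yc_def sum_distrib_left mult_ac)
    then show "yv (shift m (x z)) $ s = (z ^ m \<cdot>\<^sub>v u) $ s"
      using s x2[OF that s] by (simp add: yv_def xm[OF that] u_def unit_vec_def)
  qed (simp add: yv_def u_def)
  define f where "f \<beta> z = M_form l \<beta> (xq (x z))" for \<beta> z
  define P where "P \<beta> = M_form l \<beta> (Theta *\<^sub>v u)" for \<beta>
  define G where "G m = N_form l m (Theta *\<^sub>v u)" for m
  have dec: "f 0 z + (\<Sum>m<p - q. z ^ m * G m) = 0" if "z > z0" for z
    using sum_state_decomposition[of l "x z"] x3[OF that]
    by (simp add: f_def G_def yv[OF that] Theta_smult[OF u] N_form_smult[OF Tu])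
  have zx: "z \<cdot>\<^sub>v xq (x z) = Lam *\<^sub>v xq (x z) + Theta *\<^sub>v u" if "z > z0" for z
  proof -
    have "xq (shift 1 (x z)) = z \<cdot>\<^sub>v xq (x z)" unfolding xm[OF that] by (auto simp: xq_def)
    moreover have "yv (x z) = u" using yv[OF that, of 0] by (simp add: shift_0 u_def)
    ultimately show ?thesis using xq_shift[of "x z"] by simp
  qed
  have rec: "z * f \<beta> z = f (Suc \<beta>) z + P \<beta>" if "z > z0" for z \<beta>
  proof -
    have "z * f \<beta> z = M_form l \<beta> (z \<cdot>\<^sub>v xq (x z))" unfolding f_def by (rule M_form_smult[OF xq_carrier, symmetric])
    also have "\<dots> = M_form l \<beta> (Lam *\<^sub>v xq (x z)) + M_form l \<beta> (Theta *\<^sub>v u)"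
      unfolding zx[OF that] by (rule M_form_add[OF mult_mat_vec_carrier[OF carriers(1) xq_carrier] Tu])
    finally show ?thesis by (simp add: f_def P_def M_form_Lam)
  qed
  define S where "S z = (\<Sum>i<k * q. \<bar>xq (x z) $ i\<bar>)" for z
  define c where "c = (\<Sum>i<k * q. \<Sum>j<k * q. \<bar>Lam $$ (i, j)\<bar>)"
  define \<theta> where "\<theta> = (\<Sum>i<k * q. \<bar>(Theta *\<^sub>v u) $ i\<bar>)"
  have S0: "S z \<ge> 0" for z by (simp add: S_def sum_nonneg)
  have c0: "c \<ge> 0" by (simp add: c_def sum_nonneg)
  \<comment> \<open>Taking absolute sums in z x = \<Lambda> x + \<Theta> u. Once z is at least 2 c,
    the matrix term is absorbed and S is at most 2 \<theta> / z, so the filter state decays.\<close>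
  have zS: "z * S z \<le> c * S z + \<theta>" if z: "z > z0" "z > 0" for z
  proof -
    have "z * S z = (\<Sum>i<k * q. \<bar>(z \<cdot>\<^sub>v xq (x z)) $ i\<bar>)"
      using z by (simp add: S_def sum_distrib_left abs_mult xq_def)
    also have "\<dots> \<le> (\<Sum>i<k * q. (\<Sum>j<k * q. \<bar>Lam $$ (i, j)\<bar> * S z) + \<bar>(Theta *\<^sub>v u) $ i\<bar>)"
    proof (rule sum_mono)
      fix i assume "i \<in> {..<k * q}"
      then have i: "i < k * q" by simp
      have "(z \<cdot>\<^sub>v xq (x z)) $ i = (\<Sum>j<k * q. Lam $$ (i, j) * xq (x z) $ j) + (Theta *\<^sub>v u) $ i"
        unfolding zx[OF z(1)] using i carriers
        by (subst index_add_vec) (auto simp: index_mult_mat_vec_sum[OF carriers(1) xq_carrier i])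
      also have "\<bar>\<dots>\<bar> \<le> (\<Sum>j<k * q. \<bar>Lam $$ (i, j)\<bar> * \<bar>xq (x z) $ j\<bar>) + \<bar>(Theta *\<^sub>v u) $ i\<bar>"
        using sum_abs[of "\<lambda>j. Lam $$ (i, j) * xq (x z) $ j" "{..<k * q}"] unfolding abs_mult by linarith
      also have "(\<Sum>j<k * q. \<bar>Lam $$ (i, j)\<bar> * \<bar>xq (x z) $ j\<bar>) \<le> (\<Sum>j<k * q. \<bar>Lam $$ (i, j)\<bar> * S z)"
        unfolding S_def by (intro sum_mono mult_left_mono member_le_sum) auto
      finally show "\<bar>(z \<cdot>\<^sub>v xq (x z)) $ i\<bar> \<le> (\<Sum>j<k * q. \<bar>Lam $$ (i, j)\<bar> * S z) + \<bar>(Theta *\<^sub>v u) $ i\<bar>" by simp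
    qed
    also have "\<dots> = c * S z + \<theta>" by (simp add: c_def \<theta>_def sum.distrib sum_distrib_right)
    finally show ?thesis .
  qed
  have S_lim: "(S \<longlongrightarrow> 0) at_top"
  proof (rule Lim_null_comparison)
    show "((\<lambda>z. 2 * \<theta> * inverse z) \<longlongrightarrow> 0) at_top"
      using tendsto_mult_right_zero[OF tendsto_inverse_0_at_top[OF filterlim_ident], of "2 * \<theta>"] by simp
    show "\<forall>\<^sub>F z in at_top. norm (S z) \<le> 2 * \<theta> * inverse z"
      using eventually_gt_at_top[of z0] eventually_gt_at_top[of 0] eventually_ge_at_top[of "2 * c"]
    proof eventually_elim
      case (elim z)
      have "2 * c * S z \<le> z * S z" using elim S0 by (intro mult_right_mono) auto
      then have "z * S z \<le> 2 * \<theta>" using zS[OF elim(1,2)] by linarith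
      then show ?case using elim S0[of z] by (simp add: field_simps)
    qed
  qed
  have f_lim: "(f \<beta> \<longlongrightarrow> 0) at_top" for \<beta>
  proof (rule Lim_null_comparison)
    define d where "d = (\<Sum>i<k * q. \<Sum>j<k * q. \<bar>pull l i * (Lam ^\<^sub>m \<beta>) $$ (i, j)\<bar>)"
    show "((\<lambda>z. d * S z) \<longlongrightarrow> 0) at_top" using tendsto_mult_right_zero[OF S_lim] .
    have "norm (f \<beta> z) \<le> d * S z" for z
    proof -
      have "\<bar>f \<beta> z\<bar> \<le> (\<Sum>i<k * q. \<Sum>j<k * q. \<bar>pull l i * (Lam ^\<^sub>m \<beta>) $$ (i, j) * xq (x z) $ j\<bar>)"
        unfolding f_def M_form_eq[OF xq_carrier]
        by (intro order_trans[OF sum_abs] sum_mono sum_abs)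
      also have "\<dots> \<le> (\<Sum>i<k * q. \<Sum>j<k * q. \<bar>pull l i * (Lam ^\<^sub>m \<beta>) $$ (i, j)\<bar> * S z)"
        unfolding S_def abs_mult[of "pull l _ * _"] by (intro sum_mono mult_left_mono member_le_sum) auto
      finally show ?thesis by (simp add: d_def sum_distrib_right)
    qed
    then show "\<forall>\<^sub>F z in at_top. norm (f \<beta> z) \<le> d * S z" by simp
  qed
  have "((\<lambda>z. \<Sum>m<p - q. z ^ m * G m) \<longlongrightarrow> 0) at_top"
  proof (rule Lim_transform_eventually)
    show "((\<lambda>z. - f 0 z) \<longlongrightarrow> 0) at_top" using tendsto_minus[OF f_lim[of 0]] by simp
    show "\<forall>\<^sub>F z in at_top. - f 0 z = (\<Sum>m<p - q. z ^ m * G m)"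
      using eventually_gt_at_top[of z0]     proof eventually_elim
      case (elim z)
      show ?case using dec[OF elim] by linarith
    qed
  qed
  note G = tendsto_0_poly_coeffs[OF this]
  then show "N_form l m (Theta *\<^sub>v unit_vec k a) = 0" if "m < p - q"
    using that by (simp add: G_def u_def)
  \<comment> \<open>Once \<open>f \<beta>\<close> vanishes, the recursion makes the next form the
    constant \<open>- P \<beta>\<close>, and its limit 0 at infinity forces that constant to be
    0.\<close>
  have "(\<forall>z>z0. f \<beta> z = 0) \<and> P \<beta> = 0" for \<beta>
  proof (induction \<beta>)
    case 0
    have f0: "f 0 z = 0" if "z > z0" for z
      using dec[OF that] G by simp
    have "P 0 = 0"
    proof -
      have "\<forall>\<^sub>F z in at_top. - P 0 = f 1 z"
        using eventually_gt_at_top[of z0]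
      proof eventually_elim
        case (elim z)
        then show ?case using rec[OF elim, of 0] f0[OF elim] by simp
      qed
      then have "(f 1 \<longlongrightarrow> - P 0) at_top" by (rule Lim_transform_eventually[OF tendsto_const])
      from tendsto_unique[OF trivial_limit_at_top_linorder this f_lim[of 1]] show ?thesis by simp
    qed
    then show ?case using f0 by blast
  next
    case (Suc \<beta>)
    have f0: "f (Suc \<beta>) z = 0" if "z > z0" for z
      using rec[OF that, of \<beta>] Suc that by simp
    have "P (Suc \<beta>) = 0"
    proof -
      have "\<forall>\<^sub>F z in at_top. - P (Suc \<beta>) = f (Suc (Suc \<beta>)) z"
        using eventually_gt_at_top[of z0]
      proof eventually_elim
        case (elim z)
        then show ?case using rec[OF elim, of "Suc \<beta>"] f0[OF elim] by simp
      qed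
      then have "(f (Suc (Suc \<beta>)) \<longlongrightarrow> - P (Suc \<beta>)) at_top" by (rule Lim_transform_eventually[OF tendsto_const])
      from tendsto_unique[OF trivial_limit_at_top_linorder this f_lim[of "Suc (Suc \<beta>)"]] show ?thesis by simp
    qed
    then show ?case using f0 by blast
  qed
  then show "M_form l \<beta> (Theta *\<^sub>v unit_vec k a) = 0" by (simp add: P_def u_def)
qed

lemma conditions_imp_state_form_0:
  fixes x :: "real \<Rightarrow> nat \<Rightarrow> real"
  assumes stable: "\<And>z. det (MA_poly k q C z) = 0 \<Longrightarrow> Re z < 0"
    and deriv: "\<And>r i. r < t \<Longrightarrow> i < k * (p - 1) \<Longrightarrow> ((\<lambda>r. x r i) has_real_derivative x r (i + k)) (at r)"
    and bound: "\<And>i. i < k * p \<Longrightarrow> \<exists>K. \<forall>r<t. \<bar>x r i\<bar> \<le> K"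
    and out: "\<And>r s. r < t \<Longrightarrow> s < k \<Longrightarrow> s \<noteq> a \<Longrightarrow> yc (x r) s = 0"
    and P: "\<And>\<beta>. M_form l \<beta> (Theta *\<^sub>v unit_vec k a) = 0"
    and G: "\<And>m. m < p - q \<Longrightarrow> N_form l m (Theta *\<^sub>v unit_vec k a) = 0"
    and r: "r < t"
  shows "(\<Sum>i<k * p. l i * x r i) = 0"
proof -
  \<comment> \<open>A vanishing output may be differentiated up to p - q - 1 times: before each
    differentiation the q + 1 blocks that are read still lie among the first p - 1.\<close>
  have out_m: "yc (shift m (x r)) s = 0" if "m < p - q" "r < t" "s < k" "s \<noteq> a" for m r s
    using that
  proof (induction m arbitrary: r)
    case 0
    then show ?case using out by (simp add: shift_def)
  next
    case (Suc m)
    have idx: "i + m * k < k * (p - 1)" if "i < k * Suc q" for i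
    proof -
      have "i + m * k < k * (Suc q + m)" using that by (simp add: algebra_simps)
      also have "\<dots> \<le> k * (p - 1)" using Suc.prems(1) by (intro mult_le_mono2) linarith
      finally show ?thesis .
    qed
    have "((\<lambda>r. yc (shift m (x r)) s) has_real_derivative (\<Sum>i<k * Suc q. Cf s i * x r (i + m * k + k))) (at r)"
      unfolding yc_def shift_def using Suc.prems idx
      by (intro DERIV_sum DERIV_cmult deriv) auto
    moreover have "((\<lambda>r. yc (shift m (x r)) s) has_real_derivative 0) (at r)"
      by (rule has_field_derivative_transform_within_open[of "\<lambda>r. 0" _ _ "{..<t}"])
        (use Suc in auto)
    ultimately have "(\<Sum>i<k * Suc q. Cf s i * x r (i + m * k + k)) = 0" using DERIV_unique by blast
    then show ?case by (simp add: yc_def shift_def algebra_simps)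
  qed
  \<comment> \<open>For a at least k the unit vector is zero, and so is the coefficient; this case
    serves the past of all components.\<close>
  define cm where "cm m r = (if a < k then yc (shift m (x r)) a else 0)" for m r
  have yv: "yv (shift m (x r)) = cm m r \<cdot>\<^sub>v unit_vec k a" if "m < p - q" "r < t" for m r
    using out_m[OF that] by (intro eq_vecI) (auto simp: yv_def cm_def)
  define f where "f \<beta> r = M_form l \<beta> (xq (x r))" for \<beta> r
  have form: "f \<beta> r = (\<Sum>i<k * q. \<Sum>j<k * q. pull l i * (Lam ^\<^sub>m \<beta>) $$ (i, j) * x r j)" for \<beta> r
    unfolding f_def M_form_eq[OF xq_carrier] by (simp add: xq_def)
  have kq: "j < k * (p - 1) \<and> j < k * p" if "j < k * q" for j
  proof -
    have "k * q \<le> k * (p - 1)" "k * q \<le> k * p" using pq by (auto intro!: mult_le_mono2)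
    then show ?thesis using that by linarith
  qed
  \<comment> \<open>The derivative of \<open>f \<beta>\<close> is \<open>f (Suc \<beta>)\<close>
    plus a multiple of the condition of the first family with exponent \<beta>, so the input drops
    out at every level of the chain.\<close>
  have "f 0 r = 0"
  proof (rule stable_chain_eq_0[OF carriers(1), where f=f and t=t and w="pull l" and z="\<lambda>r j. x r j"])
    show "Re e < 0" if "eigenvalue (map_mat complex_of_real Lam) e" for e
      using Lam_stable[OF stable that] .
    show "(f \<beta> has_real_derivative f (Suc \<beta>) r) (at r)" if "r < t" for \<beta> r
    proof -
      have "(f \<beta> has_real_derivative (\<Sum>i<k * q. \<Sum>j<k * q. pull l i * (Lam ^\<^sub>m \<beta>) $$ (i, j) * x r (j + k))) (at r)"
        unfolding form[abs_def] using kq that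
        by (intro DERIV_sum DERIV_cmult deriv) auto
      also have "(\<Sum>i<k * q. \<Sum>j<k * q. pull l i * (Lam ^\<^sub>m \<beta>) $$ (i, j) * x r (j + k)) = M_form l \<beta> (xq (shift 1 (x r)))"
        unfolding M_form_eq[OF xq_carrier] by (simp add: xq_def shift_def)
      also have "\<dots> = M_form l \<beta> (Lam *\<^sub>v xq (x r)) + M_form l \<beta> (Theta *\<^sub>v yv (x r))"
        unfolding xq_shift by (intro M_form_add mult_mat_vec_carrier[OF carriers(1)] Theta_carrier) auto
      also have "M_form l \<beta> (Theta *\<^sub>v yv (x r)) = 0"
      proof -
        have "yv (x r) = cm 0 r \<cdot>\<^sub>v unit_vec k a" using yv[of 0 r] that pq by (simp add: shift_0)
        then show ?thesis
          using M_form_smult[OF Theta_carrier[of "unit_vec k a"], of l \<beta> "cm 0 r"] P[of \<beta>] by (simp add: Theta_smult)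
      qed
      finally show ?thesis by (simp add: f_def[abs_def] M_form_Lam)
    qed
    show "\<exists>K. \<forall>r<t. \<bar>f \<beta> r\<bar> \<le> K" for \<beta>
    proof -
      obtain K where K: "\<And>i. i < k * p \<Longrightarrow> \<forall>r<t. \<bar>x r i\<bar> \<le> K i" using bound by metis
      have "\<bar>f \<beta> r\<bar> \<le> (\<Sum>i<k * q. \<Sum>j<k * q. \<bar>pull l i * (Lam ^\<^sub>m \<beta>) $$ (i, j)\<bar> * K j)" if "r < t" for r
      proof -
        have "\<bar>f \<beta> r\<bar> \<le> (\<Sum>i<k * q. \<Sum>j<k * q. \<bar>pull l i * (Lam ^\<^sub>m \<beta>) $$ (i, j) * x r j\<bar>)"
          unfolding form by (intro order_trans[OF sum_abs] sum_mono sum_abs)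
        also have "\<dots> \<le> (\<Sum>i<k * q. \<Sum>j<k * q. \<bar>pull l i * (Lam ^\<^sub>m \<beta>) $$ (i, j)\<bar> * K j)"
          unfolding abs_mult[of "pull l _ * _"] using K kq that by (intro sum_mono mult_left_mono) auto
        finally show ?thesis .
      qed
      then show ?thesis by blast
    qed
  qed (use form r in auto)
  moreover have "N_form l m (Theta *\<^sub>v yv (shift m (x r))) = 0" if "m < p - q" for m
    using N_form_smult[OF Theta_carrier[of "unit_vec k a"], of l m "cm m r"] G[OF that] yv[OF that r]
    by (simp add: Theta_smult)
  ultimately show ?thesis unfolding sum_state_decomposition f_def by simp
qed

end

section \<open>Linear pasts of the output process\<close>

lemma ms_deriv_square_integrable:
  "ms_deriv M j Z D \<Longrightarrow> (\<And>t. square_integrable M (Z t)) \<Longrightarrow> square_integrable M (D t)"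
  by (cases j) (auto simp: L2_tendsto_iff)

lemma ms_deriv_unique:
  "ms_deriv M j Z D \<Longrightarrow> ms_deriv M j Z D' \<Longrightarrow> AE \<omega> in M. D t \<omega> = D' t \<omega>"
proof (induction j arbitrary: D D' t)
  case (Suc j)
  obtain E E' where E: "ms_deriv M j Z E" "L2_tendsto M (diff_quot E t) (D t) (at 0)"
    and E': "ms_deriv M j Z E'" "L2_tendsto M (diff_quot E' t) (D' t) (at 0)"
    using Suc.prems by auto
  have "AE \<omega> in M. diff_quot E t h \<omega> = diff_quot E' t h \<omega>" for h
    using Suc.IH[OF E(1) E'(1), of "t + h"] Suc.IH[OF E(1) E'(1), of t]
    by eventually_elim (simp add: diff_quot_def)
  then show ?case by (intro L2_tendsto_unique[OF E(2) E'(2)]) auto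
qed simp

lemma ms_deriv_le: "ms_deriv M j Z D \<Longrightarrow> i \<le> j \<Longrightarrow> \<exists>D'. ms_deriv M i Z D'"
proof (induction j arbitrary: D)
  case (Suc j)
  show ?case
  proof (cases "i = Suc j")
    case True
    then show ?thesis using Suc.prems by blast
  next
    case False
    obtain E where "ms_deriv M j Z E" using Suc.prems(1) by auto
    then show ?thesis using Suc.IH Suc.prems(2) False by simp
  qed
qed auto

lemma (in L2_subspace) is_proj_sum:
  fixes Z W :: "'i \<Rightarrow> 'w \<Rightarrow> complex"
  assumes "\<And>i. i \<in> I \<Longrightarrow> is_proj (Z i) (W i)" "\<And>i. i \<in> I \<Longrightarrow> square_integrable M (Z i)"
  shows "is_proj (\<lambda>\<omega>. \<Sum>i\<in>I. c i * Z i \<omega>) (\<lambda>\<omega>. \<Sum>i\<in>I. c i * W i \<omega>)"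
  unfolding is_proj_def
proof (intro conjI ballI)
  show "(\<lambda>\<omega>. \<Sum>i\<in>I. c i * W i \<omega>) \<in> S"
    using assms(1) by (intro sum mult) (auto simp: is_proj_def)
  fix U assume U: "U \<in> S"
  have int: "integrable M (\<lambda>\<omega>. (Z i \<omega> - W i \<omega>) * cnj (U \<omega>))" if "i \<in> I" for i
  proof -
    have "W i \<in> S" using assms(1)[OF that] by (simp add: is_proj_def)
    then show ?thesis
      by (intro integrable_mult_square_integrable square_integrable_diff square_integrable_cnj assms(2)[OF that]
          square_integrable[of "W i"] square_integrable[OF U])
  qed
  have "(\<integral>\<omega>. ((\<Sum>i\<in>I. c i * Z i \<omega>) - (\<Sum>i\<in>I. c i * W i \<omega>)) * cnj (U \<omega>) \<partial>M) =
      (\<integral>\<omega>. (\<Sum>i\<in>I. c i * ((Z i \<omega> - W i \<omega>) * cnj (U \<omega>))) \<partial>M)"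
    by (simp add: sum_distrib_right right_diff_distrib left_diff_distrib sum_subtractf mult.assoc)
  also have "\<dots> = (\<Sum>i\<in>I. c i * (\<integral>\<omega>. (Z i \<omega> - W i \<omega>) * cnj (U \<omega>) \<partial>M))"
    using int by (subst Bochner_Integration.integral_sum) auto
  also have "\<dots> = 0" using assms(1) U by (simp add: is_proj_def)
  finally show "(\<integral>\<omega>. ((\<Sum>i\<in>I. c i * Z i \<omega>) - (\<Sum>i\<in>I. c i * W i \<omega>)) * cnj (U \<omega>) \<partial>M) = 0" .
qed

lemma (in L2_subspace) is_proj_self: "W \<in> S \<Longrightarrow> is_proj W W"
  by (simp add: is_proj_def)

lemma L2_subspace_lin_past: "L2_subspace M (lin_past M Y S t)"
  unfolding lin_past_def
proof (rule L2_subspace_L2_closure)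
  let ?D = "{\<lambda>\<omega>. \<Sum>(s, r)\<in>F. c (s, r) * component Y s r \<omega> | F c. finite F \<and> F \<subseteq> S \<times> {..t}}"
  show "(\<lambda>\<omega>. 0) \<in> ?D" by (intro CollectI exI[of _ "{}"]) auto
  fix Z W and c :: complex assume Z: "Z \<in> ?D"
  then obtain F f where F: "finite F" "F \<subseteq> S \<times> {..t}" "Z = (\<lambda>\<omega>. \<Sum>(s, r)\<in>F. f (s, r) * component Y s r \<omega>)" by blast
  show "(\<lambda>\<omega>. c * Z \<omega>) \<in> ?D"
    using F by (intro CollectI exI[of _ F] exI[of _ "\<lambda>x. c * f x"])
      (auto simp: sum_distrib_left mult.assoc split_beta)
  assume "W \<in> ?D"
  then obtain G g where G: "finite G" "G \<subseteq> S \<times> {..t}" "W = (\<lambda>\<omega>. \<Sum>(s, r)\<in>G. g (s, r) * component Y s r \<omega>)" by blast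
  define h where "h x = (if x \<in> F then f x else 0) + (if x \<in> G then g x else 0)" for x
  have "Z \<omega> + W \<omega> = (\<Sum>(s, r)\<in>F \<union> G. h (s, r) * component Y s r \<omega>)" for \<omega>
  proof -
    have "Z \<omega> = (\<Sum>x\<in>F \<union> G. (if x \<in> F then f x else 0) * component Y (fst x) (snd x) \<omega>)"
      unfolding F(3) using F(1) G(1) by (intro sum.mono_neutral_cong_left) (auto simp: split_beta)
    moreover have "W \<omega> = (\<Sum>x\<in>F \<union> G. (if x \<in> G then g x else 0) * component Y (fst x) (snd x) \<omega>)"
      unfolding G(3) using F(1) G(1) by (intro sum.mono_neutral_cong_left) (auto simp: split_beta)
    ultimately show ?thesis
      by (simp add: h_def split_beta distrib_right sum.distrib cong: if_cong)
  qed
  then show "(\<lambda>\<omega>. Z \<omega> + W \<omega>) \<in> ?D"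
    using F(1,2) G(1,2) by (intro CollectI exI[of _ "F \<union> G"] exI[of _ h]) auto
qed

lemma component_in_lin_past:
  assumes "s \<in> S" "r \<le> t" "square_integrable M (component Y s r)"
  shows "component Y s r \<in> lin_past M Y S t"
  unfolding lin_past_def
  by (rule L2_closure_superset) (use assms in \<open>auto intro!: exI[of _ "{(s, r)}"] exI[of _ "\<lambda>_. 1"]\<close>)

lemma L2_closure_mono:
  assumes "D \<subseteq> D'"
  shows "L2_closure M D \<subseteq> L2_closure M D'"
proof
  fix Z assume Z: "Z \<in> L2_closure M D"
  show "Z \<in> L2_closure M D'"
    unfolding L2_closure_iff
  proof (intro conjI allI impI)
    show "square_integrable M Z" using Z by (simp add: L2_closure_iff)
    fix e :: real assume "e > 0"
    then obtain W where "W \<in> D" "square_integrable M W \<and> L2_norm M (\<lambda>\<omega>. Z \<omega> - W \<omega>) < e"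
      using Z unfolding L2_closure_iff by blast
    then show "\<exists>W\<in>D'. square_integrable M W \<and> L2_norm M (\<lambda>\<omega>. Z \<omega> - W \<omega>) < e"
      using assms by blast
  qed
qed

lemma lin_past_mono:
  assumes "S \<subseteq> S'"
  shows "lin_past M Y S t \<subseteq> lin_past M Y S' t"
  unfolding lin_past_def
proof (intro L2_closure_mono subsetI)
  fix Z assume "Z \<in> {\<lambda>\<omega>. \<Sum>(s, r)\<in>F. c (s, r) * component Y s r \<omega> | F c. finite F \<and> F \<subseteq> S \<times> {..t}}"
  then obtain F c where F: "finite F" "F \<subseteq> S \<times> {..t}" and Z: "Z = (\<lambda>\<omega>. \<Sum>(s, r)\<in>F. c (s, r) * component Y s r \<omega>)"
    by blast
  have "F \<subseteq> S' \<times> {..t}" using F(2) assms by blast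
  with F(1) Z show "Z \<in> {\<lambda>\<omega>. \<Sum>(s, r)\<in>F. c (s, r) * component Y s r \<omega> | F c. finite F \<and> F \<subseteq> S' \<times> {..t}}"
    by blast
qed

text \<open>Orthogonality to the generators passes to finite combinations by linearity and to their
  closure by Cauchy-Schwarz.\<close>

lemma orthogonal_lin_past:
  assumes si: "\<And>s r. s \<in> S \<Longrightarrow> square_integrable M (component Y s r)"
    and U: "square_integrable M U"
    and orth: "\<And>s r. s \<in> S \<Longrightarrow> r \<le> t \<Longrightarrow> (\<integral>\<omega>. component Y s r \<omega> * cnj (U \<omega>) \<partial>M) = 0"
    and V: "V \<in> lin_past M Y S t"
  shows "(\<integral>\<omega>. V \<omega> * cnj (U \<omega>) \<partial>M) = 0"
proof -
  have siV: "square_integrable M V" using V by (simp add: lin_past_def L2_closure_iff)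
  note U' = square_integrable_cnj[OF U]
  have "cmod (\<integral>\<omega>. V \<omega> * cnj (U \<omega>) \<partial>M) \<le> e * L2_norm M (\<lambda>\<omega>. cnj (U \<omega>))" if e: "e > 0" for e
  proof -
    obtain F c where F: "finite F" "F \<subseteq> S \<times> {..t}"
      and d: "L2_norm M (\<lambda>\<omega>. V \<omega> - (\<Sum>(s, r)\<in>F. c (s, r) * component Y s r \<omega>)) < e"
      using V e unfolding lin_past_def L2_closure_iff by blast
    define W where "W \<omega> = (\<Sum>x\<in>F. c x * component Y (fst x) (snd x) \<omega>)" for \<omega>
    have siW: "square_integrable M W"
      unfolding W_def using F si by (intro square_integrable_sum square_integrable_mult) auto
    have "(\<integral>\<omega>. W \<omega> * cnj (U \<omega>) \<partial>M) = (\<integral>\<omega>. (\<Sum>x\<in>F. c x * (component Y (fst x) (snd x) \<omega> * cnj (U \<omega>))) \<partial>M)"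
      by (simp add: W_def sum_distrib_right mult.assoc)
    also have "\<dots> = (\<Sum>x\<in>F. c x * (\<integral>\<omega>. component Y (fst x) (snd x) \<omega> * cnj (U \<omega>) \<partial>M))"
    proof -
      have "integrable M (\<lambda>\<omega>. component Y (fst x) (snd x) \<omega> * cnj (U \<omega>))" if "x \<in> F" for x
        using that F(2) by (intro integrable_mult_square_integrable si U') auto
      then show ?thesis by (subst Bochner_Integration.integral_sum) auto
    qed
    also have "\<dots> = 0" using F(2) orth by (intro sum.neutral ballI) auto
    finally have "(\<integral>\<omega>. V \<omega> * cnj (U \<omega>) \<partial>M) = (\<integral>\<omega>. (V \<omega> - W \<omega>) * cnj (U \<omega>) \<partial>M)"
      using integrable_mult_square_integrable[OF siV U'] integrable_mult_square_integrable[OF siW U']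
      by (simp add: left_diff_distrib)
    also have "cmod \<dots> \<le> L2_norm M (\<lambda>\<omega>. V \<omega> - W \<omega>) * L2_norm M (\<lambda>\<omega>. cnj (U \<omega>))"
      by (rule L2_Cauchy_Schwarz[OF square_integrable_diff[OF siV siW] U'])
    also have "\<dots> \<le> e * L2_norm M (\<lambda>\<omega>. cnj (U \<omega>))"
      using d by (intro mult_right_mono) (simp_all add: W_def split_beta)
    finally show ?thesis .
  qed
  note le = this
  have "cmod (\<integral>\<omega>. V \<omega> * cnj (U \<omega>) \<partial>M) \<le> 0 + e" if "e > 0" for e
  proof -
    define n where "n = L2_norm M (\<lambda>\<omega>. cnj (U \<omega>))"
    have "n \<ge> 0" by (simp add: n_def)
    have "cmod (\<integral>\<omega>. V \<omega> * cnj (U \<omega>) \<partial>M) \<le> (e / (n + 1)) * n"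
      unfolding n_def by (rule le) (use that \<open>n \<ge> 0\<close> in \<open>simp add: n_def add_nonneg_pos\<close>)
    also have "\<dots> \<le> e" using that \<open>n \<ge> 0\<close> by (simp add: divide_le_eq add_nonneg_pos mult_left_mono)
    finally show ?thesis by simp
  qed
  then show ?thesis using field_le_epsilon[of _ 0] by (metis norm_le_zero_iff)
qed

section \<open>The output process and the duality criterion for linear forms of its state\<close>

locale iccss = levy_state M k L p A X + ma: ma_filter k p q C
  for M :: "'w measure" and k L p A X q C +
  fixes Y :: "real \<Rightarrow> 'w \<Rightarrow> real vec"
  assumes stable: "\<And>z. det (MA_poly k q C z) = 0 \<Longrightarrow> Re z < 0"
    and Y: "\<And>t \<omega>. \<omega> \<in> space M \<Longrightarrow> Y t \<omega> = bfC k p q C *\<^sub>v X t \<omega>"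
    and pos_def: "pos_def_mat k (levy_cov M k L)"
begin

lemma kq_le: "k * Suc q \<le> k * p"
  using ma.pq by (intro mult_le_mono2) simp

lemma bfC_carrier: "bfC k p q C \<in> carrier_mat k (k * p)"
  using block_mat_carrier[of k 1 p] by (simp add: bfC_def)

lemma sfC_carrier: "sfC k p q C \<in> carrier_mat k (k * p)"
  using block_mat_carrier[of k 1 p] by (simp add: sfC_def)

lemma div_le_iff_blocks: "i div k \<le> m \<longleftrightarrow> i < k * Suc m"
  using k0 by (metis div_less_iff_less_mult less_Suc_eq_le mult.commute)

lemma sum_bfC:
  assumes "s < k"
  shows "(\<Sum>i<k * p. bfC k p q C $$ (s, i) * x i) = ma.yc x s"
proof -
  have "(\<Sum>i<k * p. bfC k p q C $$ (s, i) * x i) = (\<Sum>i<k * p. if i < k * Suc q then ma.Cf s i * x i else 0)"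
  proof (intro sum.cong refl)
    fix i assume "i \<in> {..<k * p}"
    then show "bfC k p q C $$ (s, i) * x i = (if i < k * Suc q then ma.Cf s i * x i else 0)"
      using assms k0 div_le_iff_blocks[of i q] by (auto simp: bfC_def block_mat_def ma.Cf_def)
  qed
  also have "\<dots> = (\<Sum>i<k * Suc q. ma.Cf s i * x i)"
    using kq_le by (intro sum.mono_neutral_cong_right) auto
  finally show ?thesis by (simp add: ma.yc_def)
qed

text \<open>The p - q - 1 leading zero blocks make the sans-serif coefficient row read the output
  from a state moved by as many blocks, that is, its derivative of order p - q - 1.\<close>

lemma sum_sfC:
  assumes "s < k"
  shows "(\<Sum>i<k * p. sfC k p q C $$ (s, i) * x i) = ma.yc (ma.shift (p - q - 1) x) s"
proof -
  define d where "d = p - q - 1"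
  have p: "p = d + Suc q" unfolding d_def using ma.pq by simp
  have "(\<Sum>i<k * p. sfC k p q C $$ (s, i) * x i) = (\<Sum>i<k * p. if k * d \<le> i then ma.Cf s (i - k * d) * x i else 0)"
  proof (intro sum.cong refl)
    fix i assume i: "i \<in> {..<k * p}"
    have iff: "i div k + 1 \<ge> p - q \<longleftrightarrow> k * d \<le> i"
      using k0 ma.pq less_eq_div_iff_mult_less_eq[of k d i] by (auto simp: d_def mult.commute)
    have e: "(i - k * d) div k = i div k + 1 - (p - q) \<and> (i - k * d) mod k = i mod k" if "k * d \<le> i"
    proof -
      from le_Suc_ex[OF that] obtain e where e: "i = k * d + e" by blast
      then have "i div k = d + e div k" using k0 by simp
      then show ?thesis using e ma.pq by (simp add: d_def)
    qed
    show "sfC k p q C $$ (s, i) * x i = (if k * d \<le> i then ma.Cf s (i - k * d) * x i else 0)"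
      using assms i k0 iff e by (auto simp: sfC_def block_mat_def ma.Cf_def)
  qed
  also have "\<dots> = (\<Sum>i=k * d..<k * d + k * Suc q. ma.Cf s (i - k * d) * x i)"
    unfolding p by (intro sum.mono_neutral_cong_right) (auto simp: algebra_simps)
  also have "\<dots> = (\<Sum>i<k * Suc q. ma.Cf s i * x (i + d * k))"
    using sum.shift_bounds_nat_ivl[of "\<lambda>i. ma.Cf s (i - k * d) * x i" 0 "k * d" "k * Suc q"]
    by (simp add: atLeast0LessThan mult.commute add.commute)
  finally show ?thesis by (simp add: ma.yc_def ma.shift_def d_def)
qed

text \<open>The real output in terms of the state, at all points; the complex
  \<open>component\<close> is known to agree with it on the sample space.\<close>

definition Yr :: "nat \<Rightarrow> real \<Rightarrow> 'w \<Rightarrow> real" where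
  "Yr s t \<omega> = ma.yc (\<lambda>i. Xc i t \<omega>) s"

lemma component_eq:
  assumes "\<omega> \<in> space M" "s < k"
  shows "component Y s t \<omega> = of_real (Yr s t \<omega>)"
proof -
  have X: "X t \<omega> \<in> carrier_vec (k * p)"
    using state assms(1) by (simp add: state_process_def rand_vec_def)
  have "Y t \<omega> $ s = (\<Sum>i<k * p. bfC k p q C $$ (s, i) * Xc i t \<omega>)"
    unfolding Y[OF assms(1)] Xc_def by (rule index_mult_mat_vec_sum[OF bfC_carrier X assms(2)])
  then show ?thesis by (simp add: component_def Yr_def sum_bfC[OF assms(2)])
qed

definition lin_state :: "(nat \<Rightarrow> real) \<Rightarrow> real \<Rightarrow> 'w \<Rightarrow> real" where
  "lin_state l t \<omega> = (\<Sum>i<k * p. l i * Xc i t \<omega>)"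

lemma lin_state_square_integrable: "square_integrable M (lin_state l t)"
  unfolding lin_state_def by (intro square_integrable_sum square_integrable_mult Xc_square_integrable) auto

lemma Yr_eq_lin_state: "s < k \<Longrightarrow> Yr s t = lin_state (\<lambda>i. bfC k p q C $$ (s, i)) t"
  by (auto simp: Yr_def lin_state_def sum_bfC)

lemma Yr_square_integrable: "s < k \<Longrightarrow> square_integrable M (Yr s t)"
  by (simp add: Yr_eq_lin_state lin_state_square_integrable)

lemma square_integrable_cong_space:
  assumes "square_integrable M f" "\<And>\<omega>. \<omega> \<in> space M \<Longrightarrow> f \<omega> = g \<omega>"
  shows "square_integrable M g"
proof (rule square_integrable_cong_AE[OF assms(1)])
  show "g \<in> borel_measurable M"
    using square_integrableD(1)[OF assms(1)] measurable_cong[of M f g borel] assms(2) by simp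
qed (use assms in auto)

lemma component_square_integrable: "s < k \<Longrightarrow> square_integrable M (component Y s t)"
  by (rule square_integrable_cong_space[of "\<lambda>\<omega>. complex_of_real (Yr s t \<omega>)"])
    (simp_all add: square_integrable_of_real Yr_square_integrable component_eq)

lemma integral_component_cnj:
  assumes "s < k" "square_integrable M U"
  shows "(\<integral>\<omega>. component Y s t \<omega> * cnj (U \<omega>) \<partial>M) =
    Complex (\<integral>\<omega>. Yr s t \<omega> * Re (U \<omega>) \<partial>M) (- (\<integral>\<omega>. Yr s t \<omega> * Im (U \<omega>) \<partial>M))"
proof -
  have "(\<integral>\<omega>. component Y s t \<omega> * cnj (U \<omega>) \<partial>M) = (\<integral>\<omega>. complex_of_real (Yr s t \<omega>) * cnj (U \<omega>) \<partial>M)"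
    by (rule Bochner_Integration.integral_cong) (simp_all add: component_eq assms)
  also have "\<dots> = Complex (\<integral>\<omega>. Re (complex_of_real (Yr s t \<omega>) * cnj (U \<omega>)) \<partial>M) (\<integral>\<omega>. Im (complex_of_real (Yr s t \<omega>) * cnj (U \<omega>)) \<partial>M)"
    using integrable_mult_square_integrable[of M "\<lambda>\<omega>. complex_of_real (Yr s t \<omega>)" "\<lambda>\<omega>. cnj (U \<omega>)"]
      square_integrable_of_real[of M "Yr s t"] Yr_square_integrable[OF assms(1)] square_integrable_cnj[OF assms(2)]
    by (intro complex_eqI) (simp_all only: integral_Re integral_Im complex.sel)
  finally show ?thesis by simp
qed

lemma integral_real_cnj:
  fixes W :: "'w \<Rightarrow> real"
  assumes "square_integrable M W" "square_integrable M U"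
  shows "(\<integral>\<omega>. complex_of_real (W \<omega>) * cnj (U \<omega>) \<partial>M) =
    Complex (\<integral>\<omega>. W \<omega> * Re (U \<omega>) \<partial>M) (- (\<integral>\<omega>. W \<omega> * Im (U \<omega>) \<partial>M))"
proof -
  have "(\<integral>\<omega>. complex_of_real (W \<omega>) * cnj (U \<omega>) \<partial>M) = Complex (\<integral>\<omega>. Re (complex_of_real (W \<omega>) * cnj (U \<omega>)) \<partial>M) (\<integral>\<omega>. Im (complex_of_real (W \<omega>) * cnj (U \<omega>)) \<partial>M)"
    using integrable_mult_square_integrable[of M "\<lambda>\<omega>. complex_of_real (W \<omega>)" "\<lambda>\<omega>. cnj (U \<omega>)"]
      square_integrable_of_real[of M W] assms(1) square_integrable_cnj[OF assms(2)]
    by (intro complex_eqI) (simp_all only: integral_Re integral_Im complex.sel)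
  then show ?thesis by simp
qed

text \<open>The substitution u to t - u removes t from the covariance form. With Cauchy-Schwarz it
  bounds correlations with a fixed variable uniformly in time.\<close>

lemma Xc_norm: "i < k * p \<Longrightarrow> L2_norm M (Xc i t) = L2_norm M (Xc i 0)"
proof -
  assume i: "i < k * p"
  have "(L2_norm M (Xc i t))\<^sup>2 = (\<Sum>c<k. \<Sum>d<k. cov c d * (\<integral>v. K i c v * K i d v \<partial>lborel))" for t
    unfolding wint_norm[OF wint_X[OF i]] cov_form_def
    using lborel_integral_real_affine[of "-1" "\<lambda>v. K i _ v * K i _ v" t] by simp
  then have "(L2_norm M (Xc i t))\<^sup>2 = (L2_norm M (Xc i 0))\<^sup>2" by simp
  then show ?thesis by (simp add: power2_eq_iff_nonneg)
qed

text \<open>Testing against a fixed V turns the mean-square differentiation of the state into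
  ordinary differentiation of a real path, to which the filter argument applies.\<close>

lemma correlation_derivative:
  assumes "i < k * (p - 1)" "square_integrable M V"
  shows "((\<lambda>r. expectation (\<lambda>\<omega>. Xc i r \<omega> * V \<omega>)) has_real_derivative expectation (\<lambda>\<omega>. Xc (i + k) r \<omega> * V \<omega>)) (at r)"
proof -
  note lt = k_shift_less[OF assms(1)]
  have "(\<integral>\<omega>. (Xc i (r + h) \<omega> - Xc i r \<omega>) / h * V \<omega> \<partial>M) =
      (expectation (\<lambda>\<omega>. Xc i (r + h) \<omega> * V \<omega>) - expectation (\<lambda>\<omega>. Xc i r \<omega> * V \<omega>)) / h" for h
    using integrable_mult_square_integrable[OF Xc_square_integrable assms(2), of i] lt
    by (simp add: left_diff_distrib diff_divide_distrib)
  note eq = this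
  show ?thesis
    using tendsto_integral_mult[OF Xc_derivative[OF assms(1), of r] assms(2)] unfolding eq DERIV_def .
qed

lemma correlation_isCont:
  assumes "i < k * p" "square_integrable M V"
  shows "isCont (\<lambda>r. expectation (\<lambda>\<omega>. Xc i r \<omega> * V \<omega>)) r"
  using tendsto_integral_mult[OF Xc_continuous[OF assms(1), of r] assms(2)]
  unfolding isCont_iff .

definition cond :: "(nat \<Rightarrow> real) \<Rightarrow> nat \<Rightarrow> bool" where
  "cond l a \<longleftrightarrow> (\<forall>\<beta>. ma.M_form l \<beta> (bfTheta k q C *\<^sub>v unit_vec k a) = 0) \<and>
     (\<forall>m<p - q. ma.N_form l m (bfTheta k q C *\<^sub>v unit_vec k a) = 0)"

text \<open>With a = k no component is removed from the past.\<close>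

lemma lin_state_in_lin_past:
  assumes "cond l a"
  shows "(\<lambda>\<omega>. complex_of_real (lin_state l t \<omega>)) \<in> lin_past M Y ({..<k} - {a}) t"
proof -
  interpret S: L2_subspace M "lin_past M Y ({..<k} - {a}) t" by (rule L2_subspace_lin_past)
  show ?thesis
  proof (rule S.mem_of_orthogonal)
    show "square_integrable M (\<lambda>\<omega>. complex_of_real (lin_state l t \<omega>))"
      by (simp add: square_integrable_of_real lin_state_square_integrable)
    fix U assume U: "square_integrable M U"
      and orth: "\<forall>V\<in>lin_past M Y ({..<k} - {a}) t. (\<integral>\<omega>. V \<omega> * cnj (U \<omega>) \<partial>M) = 0"
    have o: "(\<integral>\<omega>. Yr s r \<omega> * Re (U \<omega>) \<partial>M) = 0 \<and> (\<integral>\<omega>. Yr s r \<omega> * Im (U \<omega>) \<partial>M) = 0"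
      if "s < k" "s \<noteq> a" "r \<le> t" for s r
    proof -
      have "component Y s r \<in> lin_past M Y ({..<k} - {a}) t"
        using that by (intro component_in_lin_past component_square_integrable) auto
      with orth have "(\<integral>\<omega>. component Y s r \<omega> * cnj (U \<omega>) \<partial>M) = 0" by blast
      then show ?thesis unfolding integral_component_cnj[OF that(1) U] by (simp add: complex_eq_iff)
    qed
    \<comment> \<open>Real and imaginary part of the orthogonal variable are tested separately, so
      that the correlation paths are real.\<close>
    have zero: "expectation (\<lambda>\<omega>. lin_state l t \<omega> * V \<omega>) = 0"
      if V: "square_integrable M V" and oV: "\<And>s r. s < k \<Longrightarrow> s \<noteq> a \<Longrightarrow> r \<le> t \<Longrightarrow> expectation (\<lambda>\<omega>. Yr s r \<omega> * V \<omega>) = 0"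
      for V :: "'w \<Rightarrow> real"
    proof -
      define x where "x r i = expectation (\<lambda>\<omega>. Xc i r \<omega> * V \<omega>)" for r i
      have int: "integrable M (\<lambda>\<omega>. Xc i r \<omega> * V \<omega>)" if "i < k * p" for i r
        by (intro integrable_mult_square_integrable Xc_square_integrable that V)
      have lin: "expectation (\<lambda>\<omega>. lin_state w r \<omega> * V \<omega>) = (\<Sum>i<k * p. w i * x r i)" for w r
        unfolding lin_state_def x_def sum_distrib_right mult.assoc
        using int by (subst Bochner_Integration.integral_sum) auto
      have "(\<Sum>i<k * p. l i * x r i) = 0" if "r < t" for r
      proof (rule ma.conditions_imp_state_form_0[where x=x and t=t and a=a and l=l])
        show "((\<lambda>r. x r i) has_real_derivative x r (i + k)) (at r)" if "i < k * (p - 1)" for r i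
          unfolding x_def by (rule correlation_derivative[OF that V])
        show "\<exists>B. \<forall>r<t. \<bar>x r i\<bar> \<le> B" if "i < k * p" for i
        proof (intro exI allI impI)
          fix r
          show "\<bar>x r i\<bar> \<le> L2_norm M (Xc i 0) * L2_norm M V"
            using L2_Cauchy_Schwarz[OF Xc_square_integrable[OF that] V, of r] Xc_norm[OF that, of r] by (simp add: x_def)
        qed
        show "ma.yc (x r) s = 0" if "r < t" "s < k" "s \<noteq> a" for r s
          using lin[of "\<lambda>i. bfC k p q C $$ (s, i)" r] oV[OF that(2,3), of r] that
          by (simp add: sum_bfC Yr_eq_lin_state)
      qed (use stable assms that in \<open>auto simp: cond_def\<close>)
      \<comment> \<open>The outputs are known to vanish up to t only, so the differential equations
        are used on the open half-line; continuity carries the conclusion to r = t.\<close>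
      moreover have "isCont (\<lambda>r. \<Sum>i<k * p. l i * x r i) t"
        unfolding x_def by (intro continuous_intros correlation_isCont V) auto
      then have "((\<lambda>r. \<Sum>i<k * p. l i * x r i) \<longlongrightarrow> (\<Sum>i<k * p. l i * x t i)) (at_left t)"
        unfolding isCont_def by (rule tendsto_within_subset) simp
      moreover have "\<forall>\<^sub>F r in at_left t. r < t" by (simp add: eventually_at_filter)
      ultimately have "((\<lambda>r. 0) \<longlongrightarrow> (\<Sum>i<k * p. l i * x t i)) (at_left t)"
        by (elim Lim_transform_eventually) (auto elim: eventually_mono)
      then have "(\<Sum>i<k * p. l i * x t i) = 0"
        using tendsto_unique[OF trivial_limit_at_left_real _ tendsto_const] by metis
      then show ?thesis by (simp add: lin)
    qed
    show "(\<integral>\<omega>. complex_of_real (lin_state l t \<omega>) * cnj (U \<omega>) \<partial>M) = 0"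
      unfolding integral_real_cnj[OF lin_state_square_integrable U]
      using zero[OF square_integrable_Re_Im(1)[OF U]] zero[OF square_integrable_Re_Im(2)[OF U]] o
      by (simp add: complex_eq_iff)
  qed
qed

text \<open>Positive definiteness excludes a kernel of the covariance matrix. Hence every vector
  \<rho> occurs as the correlation of the noise with a suitable kernel direction \<zeta>.\<close>

lemma cov_matrix_solve: "\<exists>\<zeta>. \<forall>c<k. (\<Sum>d<k. cov c d * \<zeta> d) = \<rho> c"
proof -
  define S where "S = levy_cov M k L"
  have S: "S \<in> carrier_mat k k" by (simp add: S_def levy_cov_def)
  have "det S \<noteq> 0"
  proof
    assume "det S = 0"
    then obtain v where v: "v \<in> carrier_vec k" "v \<noteq> 0\<^sub>v k" "S *\<^sub>v v = 0\<^sub>v k"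
      using det_0_iff_vec_prod_zero[OF S] by blast
    then have "v \<bullet> (S *\<^sub>v v) > 0" using pos_def unfolding pos_def_mat_def S_def by blast
    then show False unfolding v(3) using v(1) by simp
  qed
  then have "vec_space.rank k S = k" using vec_space.det_rank_iff[OF S] by simp
  note inv = mat_inv_inverse[OF S this]
  define z where "z = mat_inv S *\<^sub>v vec k \<rho>"
  have z: "z \<in> carrier_vec k" unfolding z_def by (rule mult_mat_vec_carrier[OF inv(1)]) simp
  have "S *\<^sub>v z = vec k \<rho>"
    unfolding z_def by (subst assoc_mult_mat_vec[OF S inv(1), symmetric]) (simp_all add: inv(2))
  then have "(\<Sum>d<k. cov c d * z $ d) = \<rho> c" if "c < k" for c
    using index_mult_mat_vec_sum[OF S z that] that by (simp add: cov_def S_def)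
  then show ?thesis by (intro exI[of _ "($) z"]) blast
qed

text \<open>All zeros of det Q lie in the left half-plane, so Q(z) is invertible and v is its
  inverse applied to the unit vector. The sequence (v, z v, ...) continues indefinitely, so the
  shift relation holds for every index.\<close>

lemma exponential_output:
  assumes z: "z > 0"
  shows "\<exists>x. (\<forall>i. x (i + k) = z * x i) \<and> (\<forall>s<k. ma.yc x s = (if s = a then 1 else 0))"
proof -
  define Q where "Q = mat k k (\<lambda>(s, c). \<Sum>j<Suc q. z ^ j * C j $$ (s, c))"
  have Q: "Q \<in> carrier_mat k k" by (simp add: Q_def)
  have "MA_poly k q C (of_real z) = map_mat complex_of_real Q"
  proof (rule eq_matI)
    fix s c assume "s < dim_row (map_mat complex_of_real Q)" "c < dim_col (map_mat complex_of_real Q)"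
    then have sc: "s < k" "c < k" by (auto simp: Q_def)
    show "MA_poly k q C (of_real z) $$ (s, c) = map_mat complex_of_real Q $$ (s, c)"
      using sc carrier_matD[OF ma.C_carrier] unfolding MA_poly_def msum_def Q_def
      by (simp add: atLeast0AtMost lessThan_Suc_atMost)
  qed (simp_all add: MA_poly_def msum_def Q_def)
  then have "det (MA_poly k q C (of_real z)) = of_real (det Q)" by simp
  then have "det Q \<noteq> 0" using stable[of "of_real z"] z by auto
  then have "vec_space.rank k Q = k" using vec_space.det_rank_iff[OF Q] by simp
  note inv = mat_inv_inverse[OF Q this]
  define v where "v = mat_inv Q *\<^sub>v unit_vec k a"
  have v: "v \<in> carrier_vec k" unfolding v_def by (rule mult_mat_vec_carrier[OF inv(1)]) simp
  have Qv: "Q *\<^sub>v v = unit_vec k a"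
    unfolding v_def by (subst assoc_mult_mat_vec[OF Q inv(1), symmetric]) (simp_all add: inv(2))
  define x where "x i = z ^ (i div k) * v $ (i mod k)" for i
  have "x (i + k) = z * x i" for i using k0 by (simp add: x_def)
  moreover have "ma.yc x s = (if s = a then 1 else 0)" if s: "s < k" for s
  proof -
    have "ma.yc x s = (\<Sum>j<Suc q. \<Sum>c<k. C j $$ (s, c) * (z ^ j * v $ c))"
      unfolding ma.yc_def sum_blocks by (intro sum.cong refl) (simp add: ma.Cf_def x_def)
    also have "\<dots> = (\<Sum>c<k. Q $$ (s, c) * v $ c)"
      unfolding Q_def using s by (subst sum.swap) (simp add: sum_distrib_right sum_distrib_left mult_ac del: sum.lessThan_Suc)
    also have "\<dots> = unit_vec k a $ s"
      using index_mult_mat_vec_sum[OF Q v s] Qv by simp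
    finally show ?thesis using s by (simp add: unit_vec_def)
  qed
  ultimately show ?thesis by blast
qed

lemma cond_of_lin_state_in_lin_past:
  assumes mem: "(\<lambda>\<omega>. complex_of_real (lin_state l t \<omega>)) \<in> lin_past M Y ({..<k} - {a}) t"
  shows "cond l a"
proof -
  have sol: "\<exists>x. (\<forall>i. x (i + k) = z * x i) \<and> (\<forall>s<k. ma.yc x s = (if s = a then 1 else 0)) \<and> (\<Sum>i<k * p. l i * x i) = 0"
    if z: "z > cA" for z
  proof -
    have z0: "z > 0" using z cA_nonneg by linarith
    obtain x where x: "\<And>i. x (i + k) = z * x i" and y: "\<And>s. s < k \<Longrightarrow> ma.yc x s = (if s = a then 1 else 0)"
      using exponential_output[OF z0, of a] by blast
    \<comment> \<open>The residual of the last block row, so that the sequence solves z x = A x + B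
      \<rho>; the remaining rows hold by the shift relation. In terms of the autoregressive
      polynomial it is P(z) v.\<close>
    define \<rho> where "\<rho> c = z * x (last_block c) - (\<Sum>m<k * p. bfA k p A $$ (last_block c, m) * x m)" for c
    obtain \<zeta> where \<zeta>: "\<And>c. c < k \<Longrightarrow> (\<Sum>d<k. cov c d * \<zeta> d) = \<rho> c" using cov_matrix_solve[of \<rho>] by blast
    obtain U where U: "wint (\<lambda>c u. \<zeta> c * expo z t u) U" by (rule wint_expo_exists[OF z0, where \<zeta>=\<zeta> and t=t])
    have siU: "square_integrable M U" by (rule wint_square_integrable(1)[OF U])
    have sys: "(\<Sum>m<k * p. bfA k p A $$ (i, m) * x m) + (\<Sum>c<k. if i = last_block c then \<rho> c else 0) = z * x i"
      if i: "i < k * p" for i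
    proof (cases "i < k * (p - 1)")
      case True
      have "(\<Sum>m<k * p. bfA k p A $$ (i, m) * x m) = (\<Sum>m<k * p. if m = i + k then x m else 0)"
        using True k0 by (intro sum.cong refl) (auto simp: bfA_shift_row)
      moreover have "(\<Sum>c<k. if i = last_block c then \<rho> c else 0) = 0"
        using True by (intro sum.neutral) (auto simp: last_block_def)
      ultimately show ?thesis using k_shift_less[OF True] x[of i] by simp
    next
      case False
      define c where "c = i - k * (p - 1)"
      have ic: "i = last_block c" using False by (simp add: c_def last_block_def)
      have "k * p = k * (p - 1) + k" using p0 by (cases p) auto
      then have "c < k" unfolding c_def using i False by linarith
      note c = this ic
      have "(\<Sum>d<k. if i = last_block d then \<rho> d else 0) = (\<Sum>d<k. if d = c then \<rho> d else 0)"
        by (intro sum.cong refl) (auto simp: c(2) last_block_def)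
      then show ?thesis using c by (simp add: \<rho>_def)
    qed
    have E: "expectation (\<lambda>\<omega>. Xc i r \<omega> * U \<omega>) = exp (z * r) * x i" if "i < k * p" "r \<le> t" for i r
      by (rule expectation_Xc_expo[OF U z that, of \<rho>]) (use \<zeta> sys in auto)
    have lin: "expectation (\<lambda>\<omega>. lin_state w r \<omega> * U \<omega>) = exp (z * r) * (\<Sum>i<k * p. w i * x i)" if r: "r \<le> t" for w r
    proof -
      have int: "integrable M (\<lambda>\<omega>. Xc i r \<omega> * U \<omega>)" if "i < k * p" for i
        by (intro integrable_mult_square_integrable Xc_square_integrable that siU)
      have "expectation (\<lambda>\<omega>. lin_state w r \<omega> * U \<omega>) = (\<Sum>i<k * p. w i * expectation (\<lambda>\<omega>. Xc i r \<omega> * U \<omega>))"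
        unfolding lin_state_def sum_distrib_right mult.assoc
        using int by (subst Bochner_Integration.integral_sum) auto
      also have "\<dots> = (\<Sum>i<k * p. w i * (exp (z * r) * x i))"
        using r by (intro sum.cong refl) (simp add: E)
      finally show ?thesis by (simp add: sum_distrib_left mult_ac)
    qed
    have siU': "square_integrable M (\<lambda>\<omega>. complex_of_real (U \<omega>))" using siU by (simp add: square_integrable_of_real)
    have "(\<integral>\<omega>. complex_of_real (lin_state l t \<omega>) * cnj (complex_of_real (U \<omega>)) \<partial>M) = 0"
    proof (rule orthogonal_lin_past[OF _ siU' _ mem])
      show "square_integrable M (component Y s r)" if "s \<in> {..<k} - {a}" for s r
        using that by (intro component_square_integrable) auto
      fix s r assume s: "s \<in> {..<k} - {a}" and r: "r \<le> t"
      have "expectation (\<lambda>\<omega>. Yr s r \<omega> * U \<omega>) = 0"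
        using s lin[OF r, of "\<lambda>i. bfC k p q C $$ (s, i)"] y[of s] by (simp add: Yr_eq_lin_state sum_bfC)
      then show "(\<integral>\<omega>. component Y s r \<omega> * cnj (complex_of_real (U \<omega>)) \<partial>M) = 0"
        using s by (subst integral_component_cnj[OF _ siU']) (auto simp: complex_eq_iff)
    qed
    then have "expectation (\<lambda>\<omega>. lin_state l t \<omega> * U \<omega>) = 0"
      unfolding integral_real_cnj[OF lin_state_square_integrable siU'] by (simp add: complex_eq_iff)
    then have "(\<Sum>i<k * p. l i * x i) = 0" by (simp add: lin)
    with x y show ?thesis by blast
  qed
  show ?thesis
    unfolding cond_def using ma.exponential_solutions_imp_conditions[OF sol] by blast
qed

lemma lin_state_in_lin_past_iff:
  "(\<lambda>\<omega>. complex_of_real (lin_state l t \<omega>)) \<in> lin_past M Y ({..<k} - {a}) t \<longleftrightarrow> cond l a"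
  using lin_state_in_lin_past cond_of_lin_state_in_lin_past by blast

text \<open>Invertibility of the process: the state is recovered from the past of the output. The
  index k names no component and its unit vector is zero, so homogeneity with scalar 0 makes all
  conditions hold.\<close>

lemma lin_state_in_full_past: "(\<lambda>\<omega>. complex_of_real (lin_state l t \<omega>)) \<in> lin_past M Y {..<k} t"
proof -
  have "bfTheta k q C *\<^sub>v unit_vec k k = 0 \<cdot>\<^sub>v (bfTheta k q C *\<^sub>v unit_vec k k)"
  proof -
    have "unit_vec k k = 0 \<cdot>\<^sub>v (unit_vec k k :: real vec)" by (intro eq_vecI) (auto simp: unit_vec_def)
    then show ?thesis using ma.Theta_smult[of "unit_vec k k" 0] by (metis unit_vec_carrier)
  qed
  then have "cond l k"
    unfolding cond_def
    using ma.M_form_smult[OF ma.Theta_carrier[of "unit_vec k k"], of l _ 0] ma.N_form_smult[OF ma.Theta_carrier[of "unit_vec k k"], of l _ 0]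
    by simp
  from lin_state_in_lin_past[OF this] show ?thesis by simp
qed

end

section \<open>Granger non-causality\<close>

text \<open>Only the scalar coefficients vary while the square integrable variables stay fixed, so
  convergence of the coefficients suffices.\<close>

lemma L2_tendsto_coefficients:
  fixes Q :: "'i \<Rightarrow> 'w \<Rightarrow> complex"
  assumes "\<And>i. i \<in> I \<Longrightarrow> square_integrable M (Q i)" "\<And>i. i \<in> I \<Longrightarrow> ((\<lambda>h. c h i) \<longlongrightarrow> d i) F"
  shows "L2_tendsto M (\<lambda>h \<omega>. \<Sum>i\<in>I. c h i * Q i \<omega>) (\<lambda>\<omega>. \<Sum>i\<in>I. d i * Q i \<omega>) F"
proof (rule L2_tendsto_sum)
  fix i assume i: "i \<in> I"
  have "((\<lambda>h. norm (c h i - d i) * L2_norm M (Q i)) \<longlongrightarrow> norm (d i - d i) * L2_norm M (Q i)) F"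
    using assms(2)[OF i] by (intro tendsto_intros)
  moreover have "L2_norm M (\<lambda>\<omega>. c h i * Q i \<omega> - d i * Q i \<omega>) = norm (c h i - d i) * L2_norm M (Q i)" for h
    unfolding L2_norm_mult[symmetric] by (simp add: left_diff_distrib)
  ultimately show "L2_tendsto M (\<lambda>h \<omega>. c h i * Q i \<omega>) (\<lambda>\<omega>. d i * Q i \<omega>) F"
    using assms(1)[OF i] by (simp add: L2_tendsto_iff square_integrable_mult)
qed

context L2_subspace
begin

lemma is_proj_cong_AE:
  assumes "is_proj Z W" "square_integrable M Z" "square_integrable M Z'" "AE \<omega> in M. Z \<omega> = Z' \<omega>"
  shows "is_proj Z' W"
  unfolding is_proj_def
proof (intro conjI ballI)
  show WS: "W \<in> S" using assms(1) by (simp add: is_proj_def)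
  fix U assume U: "U \<in> S"
  have [measurable]: "Z \<in> borel_measurable M" "Z' \<in> borel_measurable M" "W \<in> borel_measurable M"
    "(\<lambda>\<omega>. cnj (U \<omega>)) \<in> borel_measurable M"
    using assms square_integrable[OF WS] square_integrable_cnj[OF square_integrable[OF U]]
    by (auto simp: square_integrable_def)
  have "(\<integral>\<omega>. (Z' \<omega> - W \<omega>) * cnj (U \<omega>) \<partial>M) = (\<integral>\<omega>. (Z \<omega> - W \<omega>) * cnj (U \<omega>) \<partial>M)"
    by (rule integral_cong_AE) (use assms(4) in auto)
  then show "(\<integral>\<omega>. (Z' \<omega> - W \<omega>) * cnj (U \<omega>) \<partial>M) = 0" using assms(1) U by (simp add: is_proj_def)
qed

text \<open>The tower property: projecting onto a larger subspace beforehand does not change the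
  projection onto a smaller one.\<close>

lemma is_proj_trans:
  assumes S': "S \<subseteq> S'" and Z: "square_integrable M Z" and W: "square_integrable M W"
    and ZW: "L2_subspace.is_proj M S' Z W" "L2_subspace M S'" and WP: "is_proj W P"
  shows "is_proj Z P"
  unfolding is_proj_def
proof (intro conjI ballI)
  show PS: "P \<in> S" using WP by (simp add: is_proj_def)
  fix U assume U: "U \<in> S"
  note U' = square_integrable_cnj[OF square_integrable[OF U]]
  have "(\<integral>\<omega>. (Z \<omega> - P \<omega>) * cnj (U \<omega>) \<partial>M) = (\<integral>\<omega>. (Z \<omega> - W \<omega>) * cnj (U \<omega>) + (W \<omega> - P \<omega>) * cnj (U \<omega>) \<partial>M)"
    by (simp add: algebra_simps)
  also have "\<dots> = (\<integral>\<omega>. (Z \<omega> - W \<omega>) * cnj (U \<omega>) \<partial>M) + (\<integral>\<omega>. (W \<omega> - P \<omega>) * cnj (U \<omega>) \<partial>M)"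
    by (rule Bochner_Integration.integral_add[OF
          integrable_mult_square_integrable[OF square_integrable_diff[OF Z W] U']
          integrable_mult_square_integrable[OF square_integrable_diff[OF W square_integrable[OF PS]] U']])
  also have "\<dots> = 0"
    using WP U S' ZW(1) by (auto simp: is_proj_def L2_subspace.is_proj_def[OF ZW(2)])
  finally show "(\<integral>\<omega>. (Z \<omega> - P \<omega>) * cnj (U \<omega>) \<partial>M) = 0" .
qed

end

context iccss
begin

text \<open>The coefficient row w times the exponential of h A, which forecasts the form w over the
  horizon h.\<close>

definition forecast :: "(nat \<Rightarrow> real) \<Rightarrow> real \<Rightarrow> nat \<Rightarrow> real" where
  "forecast w h l = (\<Sum>i<k * p. w i * ex h i l)"

text \<open>The row w times the \<alpha>-th power of A.\<close>

definition apply_pow :: "(nat \<Rightarrow> real) \<Rightarrow> nat \<Rightarrow> nat \<Rightarrow> real" where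
  "apply_pow w \<alpha> l = (\<Sum>i<k * p. w i * (bfA k p A ^\<^sub>m \<alpha>) $$ (i, l))"

abbreviation past :: "nat set \<Rightarrow> real \<Rightarrow> ('w \<Rightarrow> complex) set" where
  "past \<equiv> lin_past M Y"

abbreviation is_projection :: "nat set \<Rightarrow> real \<Rightarrow> ('w \<Rightarrow> complex) \<Rightarrow> ('w \<Rightarrow> complex) \<Rightarrow> bool" where
  "is_projection S t \<equiv> L2_subspace.is_proj M (past S t)"

abbreviation clin_state :: "(nat \<Rightarrow> real) \<Rightarrow> real \<Rightarrow> 'w \<Rightarrow> complex" where
  "clin_state l t \<equiv> (\<lambda>\<omega>. complex_of_real (lin_state l t \<omega>))"

lemma clin_state_square_integrable: "square_integrable M (clin_state l t)"
  by (simp add: square_integrable_of_real lin_state_square_integrable)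

text \<open>The error is orthogonal to the state at all times up to t, hence to the outputs, which
  are linear in it, and therefore to the closed past that they generate.\<close>

lemma forecast_error_orthogonal:
  assumes h: "h \<ge> 0" and U: "U \<in> past {..<k} t"
  shows "(\<integral>\<omega>. (clin_state w (t + h) \<omega> - clin_state (forecast w h) t \<omega>) * cnj (U \<omega>) \<partial>M) = 0"
proof -
  define R where "R \<omega> = (\<Sum>i<k * p. w i * (Xc i (t + h) \<omega> - (\<Sum>l<k * p. ex h i l * Xc l t \<omega>)))" for \<omega>
  have R: "lin_state w (t + h) \<omega> - lin_state (forecast w h) t \<omega> = R \<omega>" for \<omega>
  proof -
    have "lin_state (forecast w h) t \<omega> = (\<Sum>l<k * p. \<Sum>i<k * p. w i * (ex h i l * Xc l t \<omega>))"
      by (simp add: lin_state_def forecast_def sum_distrib_right mult.assoc)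
    also have "\<dots> = (\<Sum>i<k * p. w i * (\<Sum>l<k * p. ex h i l * Xc l t \<omega>))"
      by (subst sum.swap) (simp add: sum_distrib_left)
    finally show ?thesis by (simp add: R_def lin_state_def right_diff_distrib sum_subtractf)
  qed
  have "R = (\<lambda>\<omega>. lin_state w (t + h) \<omega> - lin_state (forecast w h) t \<omega>)" using R by auto
  then have siR: "square_integrable M R" by (simp add: square_integrable_diff lin_state_square_integrable)
  then have siR': "square_integrable M (\<lambda>\<omega>. complex_of_real (R \<omega>))" by (simp add: square_integrable_of_real)
  have "expectation (\<lambda>\<omega>. R \<omega> * Xc m r \<omega>) = 0" if m: "m < k * p" and r: "r \<le> t" for m r
  proof -
    have "integrable M (\<lambda>\<omega>. (Xc i (t + h) \<omega> - (\<Sum>l<k * p. ex h i l * Xc l t \<omega>)) * Xc m r \<omega>)" if "i < k * p" for i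
      using that m by (intro integrable_mult_square_integrable square_integrable_diff square_integrable_sum
          square_integrable_mult Xc_square_integrable) auto
    then have "expectation (\<lambda>\<omega>. R \<omega> * Xc m r \<omega>) =
        (\<Sum>i<k * p. w i * expectation (\<lambda>\<omega>. (Xc i (t + h) \<omega> - (\<Sum>l<k * p. ex h i l * Xc l t \<omega>)) * Xc m r \<omega>))"
      unfolding R_def sum_distrib_right mult.assoc by (subst Bochner_Integration.integral_sum) auto
    then show ?thesis using forecast_orthogonal[OF _ m h r] by simp
  qed
  note RX = this
  have RY: "expectation (\<lambda>\<omega>. Yr s r \<omega> * R \<omega>) = 0" if s: "s < k" and r: "r \<le> t" for s r
  proof -
    have "integrable M (\<lambda>\<omega>. R \<omega> * Xc m r \<omega>)" if "m < k * p" for m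
      by (intro integrable_mult_square_integrable siR Xc_square_integrable that)
    then have "expectation (\<lambda>\<omega>. \<Sum>m<k * p. bfC k p q C $$ (s, m) * (R \<omega> * Xc m r \<omega>)) = 
        (\<Sum>m<k * p. bfC k p q C $$ (s, m) * expectation (\<lambda>\<omega>. R \<omega> * Xc m r \<omega>))"
      by (subst Bochner_Integration.integral_sum) auto
    moreover have "Yr s r \<omega> * R \<omega> = (\<Sum>m<k * p. bfC k p q C $$ (s, m) * (R \<omega> * Xc m r \<omega>))" for \<omega>
      by (simp add: Yr_eq_lin_state[OF s] lin_state_def sum_distrib_left sum_distrib_right mult_ac)
    ultimately show ?thesis using RX[OF _ r] by simp
  qed
  have "(\<integral>\<omega>. U \<omega> * cnj (complex_of_real (R \<omega>)) \<partial>M) = 0"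
  proof (rule orthogonal_lin_past[OF _ siR' _ U])
    fix s r assume s: "s \<in> {..<k}" and r: "r \<le> t"
    then show "(\<integral>\<omega>. component Y s r \<omega> * cnj (complex_of_real (R \<omega>)) \<partial>M) = 0"
      using RY[of s r] by (subst integral_component_cnj[OF _ siR']) (auto simp: complex_eq_iff)
  qed (simp add: component_square_integrable)
  then have "cnj (\<integral>\<omega>. U \<omega> * cnj (complex_of_real (R \<omega>)) \<partial>M) = 0" by simp
  then have "(\<integral>\<omega>. cnj (U \<omega> * cnj (complex_of_real (R \<omega>))) \<partial>M) = 0"
    by (simp only: Bochner_Integration.integral_cnj)
  then show ?thesis by (simp add: R[symmetric] mult.commute)
qed

lemma forecast_is_projection:
  assumes "h \<ge> 0"
  shows "is_projection {..<k} t (clin_state w (t + h)) (clin_state (forecast w h) t)"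
  unfolding L2_subspace.is_proj_def[OF L2_subspace_lin_past]
  using forecast_error_orthogonal[OF assms] lin_state_in_full_past by blast

text \<open>The projection onto the full past is a form of X(t). If the two projections agree, it is
  a version of an element of the smaller past; conversely, once it lies there, it is its own
  projection and the tower property applies. The resulting criterion is free of t.\<close>

lemma granger_noncausal_iff_forecast:
  assumes b: "b < k"
  shows "granger_noncausal M Y {..<k} a b \<longleftrightarrow>
    (\<forall>h. 0 \<le> h \<and> h \<le> 1 \<longrightarrow> cond (forecast (\<lambda>i. bfC k p q C $$ (b, i)) h) a)"
proof -
  define w where "w i = bfC k p q C $$ (b, i)" for i
  have comp: "component Y b t \<omega> = clin_state w t \<omega>" if "\<omega> \<in> space M" for t \<omega>
    using component_eq[OF that b] Yr_eq_lin_state[OF b] by (simp add: w_def[abs_def])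
  have "(AE \<omega> in M. L2_proj M (past {..<k} t) (component Y b (t + h)) \<omega> =
      L2_proj M (past ({..<k} - {a}) t) (component Y b (t + h)) \<omega>) \<longleftrightarrow> cond (forecast w h) a"
    if h: "0 \<le> h" for t h
  proof -
    interpret V: L2_subspace M "past {..<k} t" by (rule L2_subspace_lin_past)
    interpret S: L2_subspace M "past ({..<k} - {a}) t" by (rule L2_subspace_lin_past)
    let ?Z = "component Y b (t + h)" and ?W = "clin_state (forecast w h) t"
    have Z: "square_integrable M ?Z" by (rule component_square_integrable[OF b])
    have W: "square_integrable M ?W" by (rule clin_state_square_integrable)
    have ZW: "V.is_proj ?Z ?W"
      by (rule V.is_proj_cong_AE[OF forecast_is_projection[OF h] clin_state_square_integrable Z])
        (simp add: comp)
    have PV: "AE \<omega> in M. L2_proj M (past {..<k} t) ?Z \<omega> = ?W \<omega>"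
      by (rule V.L2_proj_AE_eqI[OF Z ZW])
    show ?thesis
    proof
      assume "AE \<omega> in M. L2_proj M (past {..<k} t) ?Z \<omega> = L2_proj M (past ({..<k} - {a}) t) ?Z \<omega>"
      with PV have "AE \<omega> in M. L2_proj M (past ({..<k} - {a}) t) ?Z \<omega> = ?W \<omega>"
        by eventually_elim simp
      moreover have "L2_proj M (past ({..<k} - {a}) t) ?Z \<in> past ({..<k} - {a}) t"
        using S.L2_proj_is_proj[OF Z] by (simp add: S.is_proj_def)
      ultimately have "?W \<in> past ({..<k} - {a}) t"
        using S.AE_eq square_integrableD(1)[OF W] by blast
      then show "cond (forecast w h) a" by (simp only: lin_state_in_lin_past_iff)
    next
      assume "cond (forecast w h) a"
      then have "?W \<in> past ({..<k} - {a}) t" by (simp only: lin_state_in_lin_past_iff)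
      then have "S.is_proj ?W ?W" by (rule S.is_proj_self)
      then have "S.is_proj ?Z ?W"
        by (rule S.is_proj_trans[OF lin_past_mono Z W ZW V.L2_subspace_axioms, rotated]) auto
      from S.L2_proj_AE_eqI[OF Z this] PV
      show "AE \<omega> in M. L2_proj M (past {..<k} t) ?Z \<omega> = L2_proj M (past ({..<k} - {a}) t) ?Z \<omega>"
        by eventually_elim simp
    qed
  qed
  then show ?thesis unfolding granger_noncausal_def w_def[symmetric] by blast
qed

lemma forecast_sum: "(\<Sum>l<k * p. forecast w h l * u l) = (\<Sum>i<k * p. \<Sum>l<k * p. w i * ex h i l * u l)"
  unfolding forecast_def sum_distrib_right by (rule sum.swap)

lemma apply_pow_sum: "(\<Sum>l<k * p. apply_pow w \<alpha> l * u l) = (\<Sum>i<k * p. \<Sum>l<k * p. w i * (bfA k p A ^\<^sub>m \<alpha>) $$ (i, l) * u l)"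
  unfolding apply_pow_def sum_distrib_right by (rule sum.swap)

text \<open>As a function of h the form is an exponential series, so its vanishing near 0 is the
  vanishing of all coefficients. Conversely the powers below the matrix size determine all others by
  Cayley-Hamilton.\<close>

lemma forecast_zero_iff:
  "(\<forall>h. 0 \<le> h \<and> h \<le> 1 \<longrightarrow> (\<Sum>l<k * p. forecast w h l * u l) = 0) \<longleftrightarrow>
   (\<forall>\<alpha><k * p. (\<Sum>l<k * p. apply_pow w \<alpha> l * u l) = 0)"
proof
  assume *: "\<forall>h. 0 \<le> h \<and> h \<le> 1 \<longrightarrow> (\<Sum>l<k * p. forecast w h l * u l) = 0"
  have "(\<Sum>i<k * p. \<Sum>l<k * p. w i * ex h i l * u l) = 0" if "0 < h" "h < 1" for h
    using *[rule_format, of h] that less_imp_le unfolding forecast_sum by blast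
  note ex_form_zero_imp_pow[of w u, OF this]
  then show "\<forall>\<alpha><k * p. (\<Sum>l<k * p. apply_pow w \<alpha> l * u l) = 0"
    unfolding apply_pow_sum by blast
next
  assume "\<forall>\<alpha><k * p. (\<Sum>l<k * p. apply_pow w \<alpha> l * u l) = 0"
  then have "(\<Sum>i<k * p. \<Sum>l<k * p. w i * (bfA k p A ^\<^sub>m \<alpha>) $$ (i, l) * u l) = 0" if "\<alpha> < k * p" for \<alpha>
    using that unfolding apply_pow_sum by blast
  note pow_form_eq_0[OF carrier, of w u, OF this]
  note pow_zero_imp_ex_form[of w u, OF this]
  then show "\<forall>h. 0 \<le> h \<and> h \<le> 1 \<longrightarrow> (\<Sum>l<k * p. forecast w h l * u l) = 0"
    unfolding forecast_sum by blast
qed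

lemma cond_forecast_iff:
  "(\<forall>h. 0 \<le> h \<and> h \<le> 1 \<longrightarrow> cond (forecast w h) a) \<longleftrightarrow> (\<forall>\<alpha><k * p. cond (apply_pow w \<alpha>) a)"
proof -
  \<comment> \<open>For fixed exponents each condition says that l annihilates a vector independent
    of l, so the passage between horizons and powers can be made equation by equation.\<close>
  define u where "u \<beta> i = (ma.Mm *\<^sub>v (bfLambda k q C ^\<^sub>m \<beta> *\<^sub>v (bfTheta k q C *\<^sub>v unit_vec k a))) $ i" for \<beta> i
  define v where "v m i = (ma.Nm m *\<^sub>v (bfTheta k q C *\<^sub>v unit_vec k a)) $ i" for m i
  have c: "cond l a \<longleftrightarrow> (\<forall>\<beta>. (\<Sum>i<k * p. l i * u \<beta> i) = 0) \<and> (\<forall>m<p - q. (\<Sum>i<k * p. l i * v m i) = 0)" for l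
    by (simp add: cond_def ma.M_form_def ma.N_form_def u_def v_def)
  have f: "(\<forall>h. 0 \<le> h \<and> h \<le> 1 \<longrightarrow> cond (forecast w h) a) \<longleftrightarrow>
      (\<forall>\<beta> h. 0 \<le> h \<and> h \<le> 1 \<longrightarrow> (\<Sum>i<k * p. forecast w h i * u \<beta> i) = 0) \<and>
      (\<forall>m<p - q. \<forall>h. 0 \<le> h \<and> h \<le> 1 \<longrightarrow> (\<Sum>i<k * p. forecast w h i * v m i) = 0)"
    unfolding c by blast
  show ?thesis unfolding f forecast_zero_iff unfolding c by blast
qed

lemma cond_iff_finite:
  "cond l a \<longleftrightarrow> (\<forall>\<beta><k * q. ma.M_form l \<beta> (bfTheta k q C *\<^sub>v unit_vec k a) = 0) \<and>
     (\<forall>m<p - q. ma.N_form l m (bfTheta k q C *\<^sub>v unit_vec k a) = 0)"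
proof -
  have T: "bfTheta k q C *\<^sub>v unit_vec k a \<in> carrier_vec (k * q)" by (rule ma.Theta_carrier) simp
  have "ma.M_form l \<beta> (bfTheta k q C *\<^sub>v unit_vec k a) = 0"
    if "\<forall>\<beta><k * q. ma.M_form l \<beta> (bfTheta k q C *\<^sub>v unit_vec k a) = 0" for \<beta>
    unfolding ma.M_form_eq[OF T]
    by (rule pow_form_eq_0[OF ma.carriers(1), OF that[rule_format, unfolded ma.M_form_eq[OF T]]])
  then show ?thesis unfolding cond_def by blast
qed

section \<open>Translation of the conditions into matrix products\<close>

lemma unit_vec_scalar_prod_mult:
  fixes R :: "real mat"
  assumes "R \<in> carrier_mat k n" "v \<in> carrier_vec n" "b < k"
  shows "unit_vec k b \<bullet> (R *\<^sub>v v) = (\<Sum>i<n. R $$ (b, i) * v $ i)"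
proof -
  have "R *\<^sub>v v \<in> carrier_vec k" by (rule mult_mat_vec_carrier[OF assms(1,2)])
  then have "unit_vec k b \<bullet> (R *\<^sub>v v) = (R *\<^sub>v v) $ b" using assms(3) by simp
  then show ?thesis using index_mult_mat_vec_sum[OF assms] by simp
qed

lemma matrix_M_form:
  assumes R: "R \<in> carrier_mat k (k * p)" and b: "b < k"
  shows "unit_vec k b \<bullet> ((R * ma.Mm * bfLambda k q C ^\<^sub>m \<beta> * bfTheta k q C) *\<^sub>v unit_vec k a) =
    ma.M_form (\<lambda>i. R $$ (b, i)) \<beta> (bfTheta k q C *\<^sub>v unit_vec k a)"
proof -
  let ?T = "bfTheta k q C *\<^sub>v unit_vec k a" and ?P = "bfLambda k q C ^\<^sub>m \<beta>"
  have T: "?T \<in> carrier_vec (k * q)" by (rule ma.Theta_carrier) simp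
  note RM = mult_carrier_mat[OF R ma.carriers(6)]
  have P: "?P *\<^sub>v ?T \<in> carrier_vec (k * q)" by (rule mult_mat_vec_carrier[OF ma.Lam_pow T])
  have "(R * ma.Mm * ?P * bfTheta k q C) *\<^sub>v unit_vec k a = (R * ma.Mm * ?P) *\<^sub>v ?T"
    by (rule assoc_mult_mat_vec[OF mult_carrier_mat[OF RM ma.Lam_pow] ma.carriers(2)]) simp
  also have "\<dots> = (R * ma.Mm) *\<^sub>v (?P *\<^sub>v ?T)" by (rule assoc_mult_mat_vec[OF RM ma.Lam_pow T])
  also have "\<dots> = R *\<^sub>v (ma.Mm *\<^sub>v (?P *\<^sub>v ?T))" by (rule assoc_mult_mat_vec[OF R ma.carriers(6) P])
  finally show ?thesis
    using unit_vec_scalar_prod_mult[OF R mult_mat_vec_carrier[OF ma.carriers(6) P] b] by (simp add: ma.M_form_def)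
qed

lemma matrix_N_form:
  assumes R: "R \<in> carrier_mat k (k * p)" and b: "b < k"
  shows "unit_vec k b \<bullet> ((R * ma.Nm m * bfTheta k q C) *\<^sub>v unit_vec k a) =
    ma.N_form (\<lambda>i. R $$ (b, i)) m (bfTheta k q C *\<^sub>v unit_vec k a)"
proof -
  let ?T = "bfTheta k q C *\<^sub>v unit_vec k a"
  have T: "?T \<in> carrier_vec (k * q)" by (rule ma.Theta_carrier) simp
  have "(R * ma.Nm m * bfTheta k q C) *\<^sub>v unit_vec k a = (R * ma.Nm m) *\<^sub>v ?T"
    by (rule assoc_mult_mat_vec[OF mult_carrier_mat[OF R ma.carriers(7)] ma.carriers(2)]) simp
  also have "\<dots> = R *\<^sub>v (ma.Nm m *\<^sub>v ?T)" by (rule assoc_mult_mat_vec[OF R ma.carriers(7) T])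
  finally show ?thesis
    using unit_vec_scalar_prod_mult[OF R mult_mat_vec_carrier[OF ma.carriers(7) T] b] by (simp add: ma.N_form_def)
qed

definition matrix_cond :: "real mat \<Rightarrow> nat \<Rightarrow> nat \<Rightarrow> bool" where
  "matrix_cond R a b \<longleftrightarrow> (\<forall>\<beta> m. \<beta> \<le> k * q - 1 \<and> m \<le> p - q - 1 \<longrightarrow>
     unit_vec k b \<bullet> ((R * ma.Mm * bfLambda k q C ^\<^sub>m \<beta> * bfTheta k q C) *\<^sub>v unit_vec k a) = 0 \<and>
     unit_vec k b \<bullet> ((R * ma.Nm m * bfTheta k q C) *\<^sub>v unit_vec k a) = 0)"

text \<open>The joint quantifier over \<beta> and m separates into the two families because both
  ranges are nonempty; positivity of k q and p - q also makes the bounds with subtracted 1 agree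
  with strict ones.\<close>

lemma cond_iff_matrix_cond:
  assumes "R \<in> carrier_mat k (k * p)" "b < k"
  shows "cond (\<lambda>i. R $$ (b, i)) a \<longleftrightarrow> matrix_cond R a b"
proof -
  have "k * q > 0" "p - q > 0" using k0 ma.q0 ma.pq by auto
  then have le: "\<beta> \<le> k * q - 1 \<longleftrightarrow> \<beta> < k * q" "m \<le> p - q - 1 \<longleftrightarrow> m < p - q" for \<beta> m by linarith+
  show ?thesis
    unfolding cond_iff_finite matrix_cond_def matrix_M_form[OF assms] matrix_N_form[OF assms] le
    using \<open>k * q > 0\<close> \<open>p - q > 0\<close> by blast
qed

theorem granger_noncausal_iff:
  assumes b: "b < k"
  shows "granger_noncausal M Y {..<k} a b \<longleftrightarrow> (\<forall>\<alpha> \<le> k * p - 1. matrix_cond (bfC k p q C * bfA k p A ^\<^sub>m \<alpha>) a b)"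
proof -
  have "apply_pow (\<lambda>i. bfC k p q C $$ (b, i)) \<alpha> i = (bfC k p q C * bfA k p A ^\<^sub>m \<alpha>) $$ (b, i)" if "i < k * p" for \<alpha> i
    unfolding apply_pow_def using index_mult_mat_sum[OF bfC_carrier pow_carrier b that] by simp
  then have "cond (apply_pow (\<lambda>i. bfC k p q C $$ (b, i)) \<alpha>) a \<longleftrightarrow> cond (\<lambda>i. (bfC k p q C * bfA k p A ^\<^sub>m \<alpha>) $$ (b, i)) a" for \<alpha>
    by (simp add: cond_def ma.M_form_def ma.N_form_def)
  also have "cond (\<lambda>i. (bfC k p q C * bfA k p A ^\<^sub>m \<alpha>) $$ (b, i)) a \<longleftrightarrow> matrix_cond (bfC k p q C * bfA k p A ^\<^sub>m \<alpha>) a b" for \<alpha>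
    by (rule cond_iff_matrix_cond[OF mult_carrier_mat[OF bfC_carrier pow_carrier] b])
  finally have c: "cond (apply_pow (\<lambda>i. bfC k p q C $$ (b, i)) \<alpha>) a \<longleftrightarrow> matrix_cond (bfC k p q C * bfA k p A ^\<^sub>m \<alpha>) a b" for \<alpha> .
  have "k * p > 0" using k0 p0 by simp
  then have le: "\<alpha> < k * p \<longleftrightarrow> \<alpha> \<le> k * p - 1" for \<alpha> by linarith
  show ?thesis unfolding granger_noncausal_iff_forecast[OF b] cond_forecast_iff c le ..
qed

section \<open>Local Granger non-causality\<close>

definition out_deriv :: "nat \<Rightarrow> nat \<Rightarrow> real \<Rightarrow> 'w \<Rightarrow> real" where
  "out_deriv b m t \<omega> = ma.yc (ma.shift m (\<lambda>i. Xc i t \<omega>)) b"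

text \<open>The predicate \<open>ms_deriv\<close> requires its 0-th derivative to be the process itself, also outside the
  sample space.\<close>

definition comp_deriv :: "nat \<Rightarrow> nat \<Rightarrow> real \<Rightarrow> 'w \<Rightarrow> complex" where
  "comp_deriv b m t = (if m = 0 then component Y b t else (\<lambda>\<omega>. complex_of_real (out_deriv b m t \<omega>)))"

lemma comp_deriv_eq:
  assumes "\<omega> \<in> space M" "b < k"
  shows "comp_deriv b m t \<omega> = of_real (out_deriv b m t \<omega>)"
  using component_eq[OF assms] by (simp add: comp_deriv_def out_deriv_def ma.shift_0 Yr_def)

lemma out_deriv_eq: "out_deriv b m t \<omega> = (\<Sum>l<k * Suc q. ma.Cf b l * Xc (l + m * k) t \<omega>)"
  by (simp add: out_deriv_def ma.yc_def ma.shift_def)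

lemma out_index_less:
  assumes "l < k * Suc q" "m < p - q"
  shows "l + m * k < k * p"
proof -
  have "l + m * k < k * (Suc q + m)" using assms by (simp add: algebra_simps)
  also have "\<dots> \<le> k * p" using assms(2) by (intro mult_le_mono2) linarith
  finally show ?thesis .
qed

lemma out_deriv_square_integrable: "m < p - q \<Longrightarrow> square_integrable M (out_deriv b m t)"
  unfolding out_deriv_eq[abs_def]
  by (intro square_integrable_sum square_integrable_mult Xc_square_integrable out_index_less) auto

lemma comp_deriv_square_integrable:
  assumes "m < p - q" "b < k"
  shows "square_integrable M (comp_deriv b m t)"
  by (rule square_integrable_cong_space[of "\<lambda>\<omega>. complex_of_real (out_deriv b m t \<omega>)"])
    (simp_all add: comp_deriv_eq assms square_integrable_of_real out_deriv_square_integrable)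

lemma diff_quot_measurable:
  assumes "\<And>t. square_integrable M (D t)"
  shows "square_integrable M (diff_quot D t h)"
proof -
  have "square_integrable M (\<lambda>\<omega>. (1 / complex_of_real h) * (D (t + h) \<omega> - D t \<omega>))"
    by (intro square_integrable_mult square_integrable_diff assms)
  then show ?thesis by (simp add: diff_quot_def[abs_def])
qed

text \<open>The output reads q + 1 consecutive blocks, and differentiation moves them on by one
  block. With p blocks in total, orders up to p - q - 1 are reached.\<close>

lemma comp_deriv_step:
  assumes m: "Suc m < p - q" and b: "b < k"
  shows "L2_tendsto M (diff_quot (comp_deriv b m) t) (comp_deriv b (Suc m) t) (at 0)"
proof -
  have "L2_tendsto M (\<lambda>h \<omega>. \<Sum>l<k * Suc q. ma.Cf b l * ((Xc (l + m * k) (t + h) \<omega> - Xc (l + m * k) t \<omega>) / h))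
      (\<lambda>\<omega>. \<Sum>l<k * Suc q. ma.Cf b l * Xc (l + m * k + k) t \<omega>) (at 0)"
  proof (intro L2_tendsto_sum L2_tendsto_mult Xc_derivative)
    fix l assume "l \<in> {..<k * Suc q}"
    then have "l + m * k < k * (Suc q + m)" by (simp add: algebra_simps)
    also have "\<dots> \<le> k * (p - 1)" using m by (intro mult_le_mono2) linarith
    finally show "l + m * k < k * (p - 1)" .
  qed
  then have "L2_tendsto M (\<lambda>h \<omega>. (out_deriv b m (t + h) \<omega> - out_deriv b m t \<omega>) / h) (out_deriv b (Suc m) t) (at 0)"
    by (simp add: out_deriv_eq[abs_def] sum_subtractf right_diff_distrib diff_divide_distrib sum_divide_distrib
        add.commute add.left_commute del: sum.lessThan_Suc)
  then have "L2_tendsto M (\<lambda>h \<omega>. complex_of_real ((out_deriv b m (t + h) \<omega> - out_deriv b m t \<omega>) / h))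
      (\<lambda>\<omega>. complex_of_real (out_deriv b (Suc m) t \<omega>)) (at 0)"
    by (simp only: L2_tendsto_of_real)
  then show ?thesis
  proof (rule L2_tendsto_cong_AE)
    show "diff_quot (comp_deriv b m) t h \<in> borel_measurable M" for h
      using m b by (intro square_integrableD(1) diff_quot_measurable comp_deriv_square_integrable) auto
    show "comp_deriv b (Suc m) t \<in> borel_measurable M"
      using m b by (intro square_integrableD(1) comp_deriv_square_integrable) auto
  qed (use b in \<open>auto simp: comp_deriv_eq diff_quot_def intro!: AE_I2\<close>)
qed

lemma ms_deriv_comp_deriv:
  assumes "m < p - q" "b < k"
  shows "ms_deriv M m (component Y b) (comp_deriv b m)"
  using assms(1)
proof (induction m)
  case 0
  then show ?case by (auto simp: comp_deriv_def)
next
  case (Suc m)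
  then show ?case using comp_deriv_step[OF Suc.prems assms(2)] by auto
qed

definition top_weights :: "nat \<Rightarrow> nat \<Rightarrow> real" where
  "top_weights b i = sfC k p q C $$ (b, i)"

lemma out_deriv_top: "b < k \<Longrightarrow> out_deriv b (p - q - 1) t = lin_state (top_weights b) t"
  by (rule ext) (simp add: out_deriv_def lin_state_def top_weights_def sum_sfC)

lemma top_weights_last_block:
  assumes "b < k" "c < k"
  shows "top_weights b (last_block c) = C q $$ (b, c)"
proof -
  have "last_block c div k = p - 1" "last_block c mod k = c" using assms by (auto simp: last_block_def)
  moreover have "last_block c < k * p" by (rule last_block_less[OF assms(2)])
  ultimately show ?thesis
    using assms p0 ma.pq k0 by (simp add: top_weights_def sfC_def block_mat_def)
qed

text \<open>Otherwise the covariance matrix would annihilate row b of C q. That row is nonzero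
  because C q is invertible, so positive definiteness is contradicted.\<close>

lemma noise_reaches_output:
  assumes b: "b < k"
  obtains j where "j < k" "(\<Sum>c<k. cov c j * top_weights b (last_block c)) \<noteq> 0"
proof -
  have "\<exists>j<k. (\<Sum>c<k. cov c j * top_weights b (last_block c)) \<noteq> 0"
  proof (rule ccontr)
    assume "\<not> ?thesis"
    then have z: "\<And>j. j < k \<Longrightarrow> (\<Sum>c<k. cov c j * C q $$ (b, c)) = 0"
      using top_weights_last_block[OF b] by simp
    define v where "v = vec k (\<lambda>c. C q $$ (b, c))"
    define S where "S = levy_cov M k L"
    have S: "S \<in> carrier_mat k k" by (simp add: S_def levy_cov_def)
    have v: "v \<in> carrier_vec k" by (simp add: v_def)
    have "v \<noteq> 0\<^sub>v k"
    proof
      assume "v = 0\<^sub>v k"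
      then have "C q $$ (b, c) = 0" if "c < k" for c
        using that index_vec[of c k "\<lambda>c. C q $$ (b, c)"] by (simp add: v_def)
      then have "(C q * ma.Cinv) $$ (b, b) = 0"
        using index_mult_mat_sum[OF ma.C_carrier[OF order_refl] ma.Cinv(1) b b] by simp
      then show False using ma.Cinv(2) b by simp
    qed
    moreover have "S *\<^sub>v v = 0\<^sub>v k"
    proof (rule eq_vecI)
      fix j assume "j < dim_vec (0\<^sub>v k)"
      then have j: "j < k" by simp
      have "(S *\<^sub>v v) $ j = (\<Sum>c<k. cov j c * C q $$ (b, c))"
        using index_mult_mat_vec_sum[OF S v j] by (simp add: cov_def S_def v_def)
      also have "\<dots> = (\<Sum>c<k. cov c j * C q $$ (b, c))"
        using j by (intro sum.cong refl) (simp add: cov_sym)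
      finally show "(S *\<^sub>v v) $ j = 0\<^sub>v k $ j" using z j by simp
    qed (use S in simp)
    ultimately have "v \<bullet> 0\<^sub>v k > 0"
      using pos_def v unfolding pos_def_mat_def S_def by metis
    then show False using v by simp
  qed
  then show ?thesis using that by blast
qed

text \<open>Local non-causality leaves the version of the derivative free; at each time every
  version is almost everywhere the same linear form of the state.\<close>

lemma ms_deriv_AE_top:
  assumes b: "b < k" and D: "ms_deriv M (p - q - 1) (component Y b) D"
  shows "square_integrable M (D t)" "AE \<omega> in M. D t \<omega> = clin_state (top_weights b) t \<omega>"
proof -
  show "square_integrable M (D t)"
    by (rule ms_deriv_square_integrable[OF D]) (rule component_square_integrable[OF b])
  have "p - q - 1 < p - q" using ma.pq by simp
  from ms_deriv_unique[OF D ms_deriv_comp_deriv[OF this b], of t] AE_space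
  show "AE \<omega> in M. D t \<omega> = clin_state (top_weights b) t \<omega>"
    by eventually_elim (simp only: comp_deriv_eq[OF _ b] out_deriv_top[OF b])
qed

text \<open>A further derivative would make the norms of the difference quotients converge already
  at time 0, which is incompatible with the correlation of the top derivative with the
  noise.\<close>

lemma no_further_ms_deriv:
  assumes b: "b < k"
  shows "\<not> ms_deriv M (Suc (p - q - 1)) (component Y b) D'"
proof
  assume "ms_deriv M (Suc (p - q - 1)) (component Y b) D'"
  then obtain D where D: "ms_deriv M (p - q - 1) (component Y b) D" and lim: "L2_tendsto M (diff_quot D 0) (D' 0) (at 0)"
    by auto
  note top = ms_deriv_AE_top[OF b D]
  define Q where "Q h \<omega> = (lin_state (top_weights b) (0 + h) \<omega> - lin_state (top_weights b) 0 \<omega>) / h" for h \<omega>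
  have "L2_norm M (diff_quot D 0 h) = L2_norm M (Q h)" for h
  proof -
    have "square_integrable M (\<lambda>\<omega>. (1 / h) * (lin_state (top_weights b) (0 + h) \<omega> - lin_state (top_weights b) 0 \<omega>))"
      by (intro square_integrable_mult square_integrable_diff lin_state_square_integrable)
    then have Q: "square_integrable M (Q h)" by (simp add: Q_def[abs_def])
    have "AE \<omega> in M. diff_quot D 0 h \<omega> = complex_of_real (Q h \<omega>)"
      using top(2)[of "0 + h"] top(2)[of 0] by eventually_elim (simp add: diff_quot_def Q_def)
    then have "L2_norm M (diff_quot D 0 h) = L2_norm M (\<lambda>\<omega>. complex_of_real (Q h \<omega>))"
      using Q by (intro L2_norm_cong_AE square_integrableD(1) diff_quot_measurable top(1)) (simp_all add: square_integrable_of_real)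
    then show ?thesis by (simp add: L2_norm_of_real)
  qed
  with L2_tendsto_norm[OF lim] have "((\<lambda>h. L2_norm M (Q h)) \<longlongrightarrow> L2_norm M (D' 0)) (at 0)" by simp
  moreover obtain j where "j < k" "(\<Sum>c<k. cov c j * top_weights b (last_block c)) \<noteq> 0"
    using noise_reaches_output[OF b] by blast
  ultimately show False
    using not_ms_differentiable[of j "top_weights b" "lin_state (top_weights b)" 0 "L2_norm M (D' 0)"]
    unfolding Q_def[abs_def] lin_state_def by blast
qed

text \<open>A version of the projection of l X(t), assembled from the projections of the
  coordinates. The dependence on l is then literally linear in fixed variables, so limits can be
  taken in the coefficients.\<close>

definition local_limit :: "nat set \<Rightarrow> (nat \<Rightarrow> real) \<Rightarrow> real \<Rightarrow> 'w \<Rightarrow> complex" where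
  "local_limit S l t \<omega> = (\<Sum>i<k * p. of_real (l i) * L2_proj M (past S t) (\<lambda>\<omega>. of_real (Xc i t \<omega>)) \<omega>)"

lemma clin_state_eq_sum: "clin_state l t = (\<lambda>\<omega>. \<Sum>i<k * p. of_real (l i) * complex_of_real (Xc i t \<omega>))"
  by (simp add: lin_state_def)

lemma local_limit_is_projection: "is_projection S t (clin_state l t) (local_limit S l t)"
proof -
  interpret S: L2_subspace M "past S t" by (rule L2_subspace_lin_past)
  show ?thesis
    unfolding clin_state_eq_sum local_limit_def[abs_def]
    by (intro S.is_proj_sum S.L2_proj_is_proj) (simp_all add: square_integrable_of_real Xc_square_integrable)
qed

lemma forecast_deriv:
  assumes "i < k * p"
  shows "((\<lambda>h. (forecast w h i - w i) / h) \<longlongrightarrow> apply_pow w 1 i) (at_right 0)"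
proof -
  have "((\<lambda>h. forecast w h i) has_real_derivative (\<Sum>j<k * p. w j * (\<Sum>l<k * p. ex 0 j l * bfA k p A $$ (l, i)))) (at 0)"
    unfolding forecast_def[abs_def] using assms by (intro DERIV_sum DERIV_cmult ex_deriv_right) auto
  also have "(\<Sum>j<k * p. w j * (\<Sum>l<k * p. ex 0 j l * bfA k p A $$ (l, i))) = apply_pow w 1 i"
  proof -
    have "(\<Sum>l<k * p. ex 0 j l * bfA k p A $$ (l, i)) = (\<Sum>l<k * p. if l = j then bfA k p A $$ (l, i) else 0)" if "j < k * p" for j
      using that by (intro sum.cong refl) (auto simp: ex_0)
    then show ?thesis using carrier by (simp add: apply_pow_def)
  qed
  finally have "((\<lambda>h. (forecast w h i - forecast w 0 i) / h) \<longlongrightarrow> apply_pow w 1 i) (at 0)"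
    by (simp add: DERIV_def)
  moreover have "forecast w 0 i = w i"
  proof -
    have "forecast w 0 i = (\<Sum>j<k * p. if j = i then w j else 0)"
      unfolding forecast_def using assms by (intro sum.cong refl) (auto simp: ex_0)
    then show ?thesis using assms by simp
  qed
  ultimately show ?thesis by (simp add: filterlim_at_split)
qed

text \<open>For every h > 0 the projected quotient is a combination of finitely many projections
  that do not depend on h, with coefficients equal to the difference quotient of w exp (h A). Their
  limit is w A, whichever subset of components is observed.\<close>

lemma local_projection_tendsto:
  assumes b: "b < k" and S: "S \<subseteq> {..<k}" and D: "ms_deriv M (p - q - 1) (component Y b) D"
  shows "L2_tendsto M (\<lambda>h. L2_proj M (past S t) (diff_quot D t h)) (local_limit S (apply_pow (top_weights b) 1) t) (at_right 0)"
proof -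
  interpret V: L2_subspace M "past {..<k} t" by (rule L2_subspace_lin_past)
  interpret S: L2_subspace M "past S t" by (rule L2_subspace_lin_past)
  define w where "w = top_weights b"
  note top = ms_deriv_AE_top[OF b D, folded w_def]
  have Dq: "square_integrable M (diff_quot D t h)" for h by (intro diff_quot_measurable top(1))
  define g where "g h i = (forecast w h i - w i) / h" for h i
  have SQ: "L2_proj M (past S t) (\<lambda>\<omega>. complex_of_real (Xc i t \<omega>)) \<in> past S t" if "i < k * p" for i
    using S.L2_proj_is_proj[of "\<lambda>\<omega>. complex_of_real (Xc i t \<omega>)"] that
    by (simp add: square_integrable_of_real Xc_square_integrable S.is_proj_def)
  have lim: "L2_tendsto M (\<lambda>h. local_limit S (g h) t) (local_limit S (apply_pow w 1) t) (at_right 0)"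
    unfolding local_limit_def g_def
    by (intro L2_tendsto_coefficients tendsto_of_real forecast_deriv S.square_integrable[OF SQ]) auto
  have proj: "AE \<omega> in M. local_limit S (g h) t \<omega> = L2_proj M (past S t) (diff_quot D t h) \<omega>" if h: "h > 0" for h
  proof -
    define Z where "Z \<omega> = (1 / complex_of_real h) * (clin_state w (t + h) \<omega> - clin_state w t \<omega>)" for \<omega>
    have Z: "square_integrable M Z"
      unfolding Z_def by (intro square_integrable_mult square_integrable_diff clin_state_square_integrable)
    \<comment> \<open>The present value of the derivative is a form of X(t) and cancels, leaving the
      forecast error divided by h, which is orthogonal to the full past.\<close>
    have "Z \<omega> - clin_state (g h) t \<omega> = (1 / complex_of_real h) * (clin_state w (t + h) \<omega> - clin_state (forecast w h) t \<omega>)" for \<omega>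
    proof -
      have "lin_state (g h) t \<omega> = (1 / h) * (lin_state (forecast w h) t \<omega> - lin_state w t \<omega>)"
        unfolding lin_state_def g_def by (simp add: sum_subtractf diff_divide_distrib left_diff_distrib right_diff_distrib sum_divide_distrib)
      then show ?thesis by (simp add: Z_def right_diff_distrib)
    qed
    then have "(\<integral>\<omega>. (Z \<omega> - clin_state (g h) t \<omega>) * cnj (U \<omega>) \<partial>M) = 0" if "U \<in> past {..<k} t" for U
      using forecast_error_orthogonal[OF less_imp_le[OF h] that, of w] by (simp add: mult.assoc)
    then have "V.is_proj Z (clin_state (g h) t)"
      unfolding V.is_proj_def using lin_state_in_full_past by blast
    then have "S.is_proj Z (local_limit S (g h) t)"
      by (rule S.is_proj_trans[OF lin_past_mono[OF S] Z clin_state_square_integrable _ V.L2_subspace_axioms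
            local_limit_is_projection])
    then have "S.is_proj (diff_quot D t h) (local_limit S (g h) t)"
    proof (rule S.is_proj_cong_AE[OF _ Z Dq])
      show "AE \<omega> in M. Z \<omega> = diff_quot D t h \<omega>"
        using top(2)[of "t + h"] top(2)[of t] by eventually_elim (simp add: Z_def diff_quot_def)
    qed
    from S.L2_proj_AE_eqI[OF Dq this] show ?thesis by eventually_elim simp
  qed
  have "L2_proj M (past S t) (diff_quot D t h) \<in> past S t" for h
    using S.L2_proj_is_proj[OF Dq] by (simp add: S.is_proj_def)
  then have meas: "L2_proj M (past S t) (diff_quot D t h) \<in> borel_measurable M" for h
    using S.square_integrable square_integrableD(1) by blast
  have siL: "square_integrable M (local_limit S (apply_pow w 1) t)" using lim by (simp add: L2_tendsto_iff)
  have "L2_tendsto M (\<lambda>h. L2_proj M (past S t) (diff_quot D t h)) (local_limit S (apply_pow w 1) t) (at_right 0)"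
  proof (rule L2_tendsto_cong_AE[OF lim meas _ square_integrableD(1)[OF siL]])
    show "\<forall>\<^sub>F h in at_right 0. AE \<omega> in M. local_limit S (g h) t \<omega> = L2_proj M (past S t) (diff_quot D t h) \<omega>"
      using eventually_at_right_less[of "0::real"] by eventually_elim (rule proj)
  qed simp
  then show ?thesis by (simp add: w_def)
qed

lemma local_limits_eq_iff:
  "(AE \<omega> in M. local_limit {..<k} l t \<omega> = local_limit ({..<k} - {a}) l t \<omega>) \<longleftrightarrow> cond l a"
proof -
  interpret V: L2_subspace M "past {..<k} t" by (rule L2_subspace_lin_past)
  interpret S: L2_subspace M "past ({..<k} - {a}) t" by (rule L2_subspace_lin_past)
  let ?W = "clin_state l t"
  note W = clin_state_square_integrable[of l t]
  have V: "AE \<omega> in M. local_limit {..<k} l t \<omega> = ?W \<omega>"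
    by (rule V.proj_unique[OF W local_limit_is_projection V.is_proj_self[OF lin_state_in_full_past]])
  show ?thesis
  proof
    assume "AE \<omega> in M. local_limit {..<k} l t \<omega> = local_limit ({..<k} - {a}) l t \<omega>"
    with V have "AE \<omega> in M. local_limit ({..<k} - {a}) l t \<omega> = ?W \<omega>" by eventually_elim simp
    moreover have "local_limit ({..<k} - {a}) l t \<in> past ({..<k} - {a}) t"
      using local_limit_is_projection[of "{..<k} - {a}" t l] by (simp add: S.is_proj_def)
    ultimately have "?W \<in> past ({..<k} - {a}) t" using S.AE_eq square_integrableD(1)[OF W] by blast
    then show "cond l a" by (simp only: lin_state_in_lin_past_iff)
  next
    assume "cond l a"
    then have "?W \<in> past ({..<k} - {a}) t" by (simp only: lin_state_in_lin_past_iff)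
    from S.proj_unique[OF W local_limit_is_projection S.is_proj_self[OF this]] V
    show "AE \<omega> in M. local_limit {..<k} l t \<omega> = local_limit ({..<k} - {a}) l t \<omega>"
      by eventually_elim simp
  qed
qed

text \<open>The order in the definition is forced: the derivative of order p - q - 1 exists and the
  next one does not. For every version of it both projected limits exist, so only their equality
  remains, and it can be tested at a single time.\<close>

theorem locally_granger_noncausal_iff:
  assumes b: "b < k"
  shows "locally_granger_noncausal M Y {..<k} a b \<longleftrightarrow> matrix_cond (sfC k p q C * bfA k p A) a b"
proof -
  define l where "l = apply_pow (top_weights b) 1"
  have "l i = (sfC k p q C * bfA k p A) $$ (b, i)" if "i < k * p" for i
    using index_mult_mat_sum[OF sfC_carrier carrier b that] carrier
    by (simp add: l_def apply_pow_def top_weights_def)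
  then have "cond l a \<longleftrightarrow> cond (\<lambda>i. (sfC k p q C * bfA k p A) $$ (b, i)) a"
    by (simp add: cond_def ma.M_form_def ma.N_form_def)
  also have "\<dots> \<longleftrightarrow> matrix_cond (sfC k p q C * bfA k p A) a b"
    by (rule cond_iff_matrix_cond[OF mult_carrier_mat[OF sfC_carrier carrier] b])
  finally have c: "cond l a \<longleftrightarrow> matrix_cond (sfC k p q C * bfA k p A) a b" .
  have J: "p - q - 1 < p - q" using ma.pq by simp
  show ?thesis
    unfolding c[symmetric]
  proof
    assume "locally_granger_noncausal M Y {..<k} a b"
    then obtain j D where D: "ms_deriv M j (component Y b) D"
      and max: "\<nexists>D'. ms_deriv M (Suc j) (component Y b) D'"
      and lim: "\<And>t. \<exists>W W'.
        L2_tendsto M (\<lambda>h. L2_proj M (past {..<k} t) (diff_quot D t h)) W (at_right 0) \<and>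
        L2_tendsto M (\<lambda>h. L2_proj M (past ({..<k} - {a}) t) (diff_quot D t h)) W' (at_right 0) \<and>
        (AE \<omega> in M. W \<omega> = W' \<omega>)"
      unfolding locally_granger_noncausal_def by blast
    have "\<not> j < p - q - 1"
      using max ms_deriv_le[OF ms_deriv_comp_deriv[OF J b], of "Suc j"] Suc_leI by blast
    moreover have "\<not> p - q - 1 < j"
      using no_further_ms_deriv[OF b] ms_deriv_le[OF D, of "Suc (p - q - 1)"] Suc_leI by blast
    ultimately have "j = p - q - 1" by simp
    note D = D[unfolded this]
    obtain W W' where W: "L2_tendsto M (\<lambda>h. L2_proj M (past {..<k} 0) (diff_quot D 0 h)) W (at_right 0)"
      and W': "L2_tendsto M (\<lambda>h. L2_proj M (past ({..<k} - {a}) 0) (diff_quot D 0 h)) W' (at_right 0)"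
      and eq: "AE \<omega> in M. W \<omega> = W' \<omega>"
      using lim by blast
    have "AE \<omega> in M. local_limit {..<k} l 0 \<omega> = W \<omega>"
      unfolding l_def by (rule L2_tendsto_unique[OF local_projection_tendsto[OF b _ D] W]) auto
    moreover have "AE \<omega> in M. local_limit ({..<k} - {a}) l 0 \<omega> = W' \<omega>"
      unfolding l_def by (rule L2_tendsto_unique[OF local_projection_tendsto[OF b _ D] W']) auto
    ultimately have "AE \<omega> in M. local_limit {..<k} l 0 \<omega> = local_limit ({..<k} - {a}) l 0 \<omega>"
      using eq by eventually_elim simp
    then show "cond l a" by (simp only: local_limits_eq_iff)
  next
    assume cond: "cond l a"
    note D = ms_deriv_comp_deriv[OF J b]
    show "locally_granger_noncausal M Y {..<k} a b"
      unfolding locally_granger_noncausal_def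
    proof (intro exI conjI allI)
      show "ms_deriv M (p - q - 1) (component Y b) (comp_deriv b (p - q - 1))" by (rule D)
      show "\<nexists>D'. ms_deriv M (Suc (p - q - 1)) (component Y b) D'" using no_further_ms_deriv[OF b] by blast
      fix t
      show "L2_tendsto M (\<lambda>h. L2_proj M (past {..<k} t) (diff_quot (comp_deriv b (p - q - 1)) t h)) (local_limit {..<k} l t) (at_right 0)"
        unfolding l_def by (rule local_projection_tendsto[OF b _ D]) auto
      show "L2_tendsto M (\<lambda>h. L2_proj M (past ({..<k} - {a}) t) (diff_quot (comp_deriv b (p - q - 1)) t h)) (local_limit ({..<k} - {a}) l t) (at_right 0)"
        unfolding l_def by (rule local_projection_tendsto[OF b _ D]) auto
      show "AE \<omega> in M. local_limit {..<k} l t \<omega> = local_limit ({..<k} - {a}) l t \<omega>"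
        using cond by (simp only: local_limits_eq_iff)
    qed
  qed
qed

end

theorem theorem4p3:
  fixes M :: "'w measure"
    and k p q a b :: nat
    and A C :: "nat \<Rightarrow> real mat"
    and L Y :: "real \<Rightarrow> 'w \<Rightarrow> real vec"
  assumes "k \<ge> 1" and "p > q" and "q > 0"
    and "ICCSS M k p q A C L Y"
    and "pos_def_mat k (levy_cov M k L)"
    and "a < k" and "b < k" and "a \<noteq> b"
  shows
    "(granger_noncausal M Y {..<k} a b \<longleftrightarrow>
       (\<forall>\<alpha> \<beta> m. \<alpha> \<le> k * p - 1 \<and> \<beta> \<le> k * q - 1 \<and> m \<le> p - q - 1 \<longrightarrow>
          unit_vec k b \<bullet> ((bfC k p q C * bfA k p A ^\<^sub>m \<alpha> *
             (bfE k p q + msum (k * p) (k * q)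
                (\<lambda>j. bfE_col k p (q + j) * sfE_T k q * bfLambda k q C ^\<^sub>m j) {1..p - q}) *
             bfLambda k q C ^\<^sub>m \<beta> * bfTheta k q C) *\<^sub>v unit_vec k a) = 0 \<and>
          unit_vec k b \<bullet> ((bfC k p q C * bfA k p A ^\<^sub>m \<alpha> *
             msum (k * p) (k * q)
                (\<lambda>j. bfE_col k p (q + j) * sfE_T k q * bfLambda k q C ^\<^sub>m (j - 1 - m)) {m + 1..p - q} *
             bfTheta k q C) *\<^sub>v unit_vec k a) = 0)) \<and>
     (locally_granger_noncausal M Y {..<k} a b \<longleftrightarrow>
       (\<forall>\<beta> m. \<beta> \<le> k * q - 1 \<and> m \<le> p - q - 1 \<longrightarrow>
          unit_vec k b \<bullet> ((sfC k p q C * bfA k p A *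
             (bfE k p q + msum (k * p) (k * q)
                (\<lambda>j. bfE_col k p (q + j) * sfE_T k q * bfLambda k q C ^\<^sub>m j) {1..p - q}) *
             bfLambda k q C ^\<^sub>m \<beta> * bfTheta k q C) *\<^sub>v unit_vec k a) = 0 \<and>
          unit_vec k b \<bullet> ((sfC k p q C * bfA k p A *
             msum (k * p) (k * q)
                (\<lambda>j. bfE_col k p (q + j) * sfE_T k q * bfLambda k q C ^\<^sub>m (j - 1 - m)) {m + 1..p - q} *
             bfTheta k q C) *\<^sub>v unit_vec k a) = 0))"
proof -
  obtain X where X: "state_process M k p A L X" "\<forall>t. \<forall>\<omega>\<in>space M. Y t \<omega> = bfC k p q C *\<^sub>v X t \<omega>"
    using assms(4) unfolding ICCSS_def by blast
  interpret iccss M k L p A X q C Y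
  proof unfold_locales
    show "two_sided_levy M k L" "integrable M (\<lambda>\<omega>. L 1 \<omega> \<bullet> L 1 \<omega>)" "vec_space.rank k (C q) = k"
      using assms(4) by (auto simp: ICCSS_def)
    show "(\<integral>\<omega>. L 1 \<omega> $ i \<partial>M) = 0" if "i < k" for i using assms(4) that by (auto simp: ICCSS_def)
    show "C j \<in> carrier_mat k k" if "j \<le> q" for j using assms(4) that by (auto simp: ICCSS_def)
    show "Re z < 0" if "det (MA_poly k q C z) = 0" for z using assms(4) that by (auto simp: ICCSS_def)
  qed (use assms X in auto)
  show ?thesis
    unfolding granger_noncausal_iff[OF assms(7)] locally_granger_noncausal_iff[OF assms(7)]
      matrix_cond_def ma.Mm_def ma.Nm_def by blast
qed

end
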